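(* Let $(M,g_M)$ and $(N,g_N)$ be compact Riemannian manifolds with $\dim M=m>n=\dim N$, and let $F:[0,\infty)\to[0,\infty)$ be a $C^2$ strictly increasing function with $F(0)=0$. Let $u:M\to N$ be an $F$-harmonic map which is a horizontally conformal submersion with dilation $\lambda$. Let $\operatorname{grad}(\lambda^2)$ be vertical, and let the zeros of $(n-2)F'(t)-2tF''(t)$ be isolated. If $H^n(M,\mathbf{R})=0$, then the horizontal distribution $\mathcal{H}$ of $u$ is not integrable. Thus the submersion is always non-trivial.
   Context: A smooth map $u:(M,g_M)\to(N,g_N)$ between compact Riemannian manifolds is $F$-harmonic if it is a critical point of the $F$-energy functional $E_F(u)=\int_M F\left(\frac{|du|^2}{2}\right)dv_g$, where $|du|$ is the Hilbert-Schmidt norm of $du$ determined by $g_M$ and $g_N$. For a submersion $u$, the horizontal space $\mathcal{H}_x$ is the orthogonal complement of $\ker du_x$ in $T_xM$, and $\mathcal{H}=\{\mathcal{H}_x:x\in M\}$ is the horizontal distribution. A vector field is vertical if it takes values in $\ker du$. A submersion $u$ is horizontally conformal with dilation $\lambda$ if $\lambda$ is a smooth positive function on $M$ with $g_N(du_x(X),du_x(Y))=\lambda^2(x)\,g_M(X,Y)$ for all $x\in M$ and $X,Y\in\mathcal{H}_x$. $H^n(M,\mathbf{R})$ is the $n$-th cohomology of $M$ with real coefficients. The term "non-trivial" is used in the source without a definition; the final sentence is asserted there as a consequence of the non-integrability of $\mathcal{H}$.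
   Formalization: N is additionally assumed orientable, and F'(t) > 0 is assumed for all t > 0 (not only F strictly increasing), since the claim fails without either; M is taken nonempty; "non-trivial" is read as: not a product projection N×P→N with the horizontal distribution tangent to N. *)

theory Defs
  imports "HOL-Analysis.Analysis" "HOL-Homology.Homology"
begin

section \<open>Smooth maps between open subsets of Euclidean spaces\<close>

text \<open>Both predicates are only meant for open sets \<^term>\<open>S\<close>. On a finite-dimensional domain,
  \<open>C\<^sup>k\<^sup>+\<^sup>1\<close> means: differentiable, and all directional derivatives are \<open>C\<^sup>k\<close>.\<close>

fun Ck_on :: "nat \<Rightarrow> 'e::euclidean_space set \<Rightarrow> ('e \<Rightarrow> 'f::real_normed_vector) \<Rightarrow> bool" where
  "Ck_on 0 S f \<longleftrightarrow> continuous_on S f"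
| "Ck_on (Suc k) S f \<longleftrightarrow>
     (\<forall>x\<in>S. f differentiable (at x)) \<and> (\<forall>v. Ck_on k S (\<lambda>x. frechet_derivative f (at x) v))"

definition smooth_on :: "'e::euclidean_space set \<Rightarrow> ('e \<Rightarrow> 'f::real_normed_vector) \<Rightarrow> bool" where
  "smooth_on S f \<longleftrightarrow> (\<forall>k. Ck_on k S f)"


section \<open>Smooth manifolds\<close>

text \<open>A chart is a pair of its domain and its coordinate map; the dimension of a manifold is
  the dimension of the model space \<^typ>\<open>'e\<close>. Manifolds have no boundary.\<close>

type_synonym ('a, 'e) chart = "'a set \<times> ('a \<Rightarrow> 'e)"

record ('a, 'e) mfd =
  mtop :: "'a topology"
  charts :: "('a, 'e) chart set"

abbreviation points :: "('a, 'e, 'z) mfd_scheme \<Rightarrow> 'a set" where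
  "points M \<equiv> topspace (mtop M)"

definition chart_inv :: "('a, 'e) chart \<Rightarrow> 'e \<Rightarrow> 'a" where
  "chart_inv c = inv_into (fst c) (snd c)"

definition transition :: "('a, 'e) chart \<Rightarrow> ('a, 'e) chart \<Rightarrow> 'e \<Rightarrow> 'e" where
  "transition c d = snd d \<circ> chart_inv c"

definition topological_chart :: "'a topology \<Rightarrow> ('a, 'e::euclidean_space) chart \<Rightarrow> bool" where
  "topological_chart T c \<longleftrightarrow>
     openin T (fst c) \<and> open (snd c ` fst c) \<and>
     homeomorphic_map (subtopology T (fst c)) (top_of_set (snd c ` fst c)) (snd c)"

definition compatible :: "('a, 'e::euclidean_space) chart \<Rightarrow> ('a, 'e) chart \<Rightarrow> bool" where
  "compatible c d \<longleftrightarrow>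
     smooth_on (snd c ` (fst c \<inter> fst d)) (transition c d) \<and>
     smooth_on (snd d ` (fst c \<inter> fst d)) (transition d c)"

definition smooth_manifold :: "('a, 'e::euclidean_space) mfd \<Rightarrow> bool" where
  "smooth_manifold M \<longleftrightarrow>
     Hausdorff_space (mtop M) \<and> second_countable (mtop M) \<and>
     (\<forall>c\<in>charts M. topological_chart (mtop M) c) \<and>
     (\<Union>c\<in>charts M. fst c) = points M \<and>
     (\<forall>c\<in>charts M. \<forall>d\<in>charts M. compatible c d)"

definition orientable :: "('a, real^'n) mfd \<Rightarrow> bool" where
  "orientable M \<longleftrightarrow>
     (\<exists>A. smooth_manifold (M\<lparr>charts := A\<rparr>) \<and>
          (\<forall>c\<in>A. \<forall>d\<in>charts M. compatible c d) \<and>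
          (\<forall>c\<in>A. \<forall>d\<in>A. \<forall>x\<in>fst c \<inter> fst d.
             det (matrix (frechet_derivative (transition c d) (at (snd c x)))) > 0))"

definition open_mfd :: "'e::euclidean_space set \<Rightarrow> ('e, 'e) mfd" where
  "open_mfd W = \<lparr>mtop = top_of_set W, charts = {(W, id)}\<rparr>"

definition prod_mfd :: "('a, 'e) mfd \<Rightarrow> ('b, 'f) mfd \<Rightarrow> ('a \<times> 'b, 'e \<times> 'f) mfd" where
  "prod_mfd M N =
     \<lparr>mtop = prod_topology (mtop M) (mtop N),
      charts = {(fst c \<times> fst d, map_prod (snd c) (snd d)) | c d. c \<in> charts M \<and> d \<in> charts N}\<rparr>"

definition smooth_map ::
  "('a, 'e::euclidean_space) mfd \<Rightarrow> ('b, 'f::euclidean_space) mfd \<Rightarrow> ('a \<Rightarrow> 'b) \<Rightarrow> bool" where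
  "smooth_map M N u \<longleftrightarrow>
     continuous_map (mtop M) (mtop N) u \<and>
     (\<forall>c\<in>charts M. \<forall>d\<in>charts N.
        smooth_on (snd c ` (fst c \<inter> u -` fst d)) (snd d \<circ> u \<circ> chart_inv c))"


section \<open>Tangent spaces and differentials\<close>

text \<open>The tangent space at \<^term>\<open>x\<close> is a copy of the model space: a tangent vector is given by
  its components in one preferred chart around \<^term>\<open>x\<close>. Components in another chart
  are converted by \<open>coord_vec\<close>.\<close>

definition chart_at :: "('a, 'e) mfd \<Rightarrow> 'a \<Rightarrow> ('a, 'e) chart" where
  "chart_at M x = (SOME c. c \<in> charts M \<and> x \<in> fst c)"

definition coord_vec ::
  "('a, 'e::euclidean_space) mfd \<Rightarrow> ('a, 'e) chart \<Rightarrow> 'a \<Rightarrow> 'e \<Rightarrow> 'e" where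
  "coord_vec M c x = frechet_derivative (transition c (chart_at M x)) (at (snd c x))"

definition mderiv ::
  "('a, 'e::euclidean_space) mfd \<Rightarrow> ('b, 'f::euclidean_space) mfd \<Rightarrow> ('a \<Rightarrow> 'b) \<Rightarrow> 'a \<Rightarrow> 'e \<Rightarrow> 'f" where
  "mderiv M N u x =
     frechet_derivative (snd (chart_at N (u x)) \<circ> u \<circ> chart_inv (chart_at M x))
       (at (snd (chart_at M x) x))"

definition submersion ::
  "('a, 'e::euclidean_space) mfd \<Rightarrow> ('b, 'f::euclidean_space) mfd \<Rightarrow> ('a \<Rightarrow> 'b) \<Rightarrow> bool" where
  "submersion M N u \<longleftrightarrow> smooth_map M N u \<and> (\<forall>x\<in>points M. surj (mderiv M N u x))"


section \<open>Riemannian metrics\<close>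

definition riemannian_metric ::
  "('a, 'e::euclidean_space) mfd \<Rightarrow> ('a \<Rightarrow> 'e \<Rightarrow> 'e \<Rightarrow> real) \<Rightarrow> bool" where
  "riemannian_metric M g \<longleftrightarrow>
     (\<forall>x\<in>points M. bilinear (g x) \<and> (\<forall>v w. g x v w = g x w v) \<and> (\<forall>v. v \<noteq> 0 \<longrightarrow> g x v v > 0)) \<and>
     (\<forall>c\<in>charts M. \<forall>v w. smooth_on (snd c ` fst c)
        (\<lambda>y. g (chart_inv c y) (coord_vec M c (chart_inv c y) v) (coord_vec M c (chart_inv c y) w)))"

definition gram ::
  "('a, real^'m) mfd \<Rightarrow> ('a \<Rightarrow> real^'m \<Rightarrow> real^'m \<Rightarrow> real) \<Rightarrow> ('a, real^'m) chart \<Rightarrow> 'a \<Rightarrow> real^'m^'m"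
  where
  "gram M g c x = (\<chi> i j. g x (coord_vec M c x (axis i 1)) (coord_vec M c x (axis j 1)))"

text \<open>The measure \<open>dv\<^sub>g\<close> is determined by \<open>dv\<^sub>g = sqrt (det g\<^sub>i\<^sub>j) dy\<close> in every chart.\<close>

definition riemannian_measure ::
  "('a, real^'m) mfd \<Rightarrow> ('a \<Rightarrow> real^'m \<Rightarrow> real^'m \<Rightarrow> real) \<Rightarrow> 'a measure" where
  "riemannian_measure M g =
     (THE \<mu>. space \<mu> = points M \<and> sets \<mu> = sigma_sets (points M) {U. openin (mtop M) U} \<and>
        (\<forall>c\<in>charts M. \<forall>A\<in>sets \<mu>. A \<subseteq> fst c \<longrightarrow>
           emeasure \<mu> A =
             (\<integral>\<^sup>+ y. ennreal (sqrt (det (gram M g c (chart_inv c y)))) * indicator (snd c ` A) y \<partial>lborel)))"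

definition gradient ::
  "('a, 'e::euclidean_space) mfd \<Rightarrow> ('a \<Rightarrow> 'e \<Rightarrow> 'e \<Rightarrow> real) \<Rightarrow> ('a \<Rightarrow> real) \<Rightarrow> 'a \<Rightarrow> 'e" where
  "gradient M g f x = (THE w. \<forall>v. g x w v = mderiv M (open_mfd UNIV) f x v)"


section \<open>F-harmonic maps\<close>

definition hs_norm_sq ::
  "('e::euclidean_space \<Rightarrow> 'e \<Rightarrow> real) \<Rightarrow> ('f \<Rightarrow> 'f \<Rightarrow> real) \<Rightarrow> ('e \<Rightarrow> 'f) \<Rightarrow> real" where
  "hs_norm_sq p q L =
     (THE r. \<exists>B. finite B \<and> card B = DIM('e) \<and> (\<forall>v\<in>B. \<forall>w\<in>B. p v w = (if v = w then 1 else 0)) \<and>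
        r = (\<Sum>v\<in>B. q (L v) (L v)))"

definition F_energy ::
  "(real \<Rightarrow> real) \<Rightarrow> ('a, real^'m) mfd \<Rightarrow> ('a \<Rightarrow> real^'m \<Rightarrow> real^'m \<Rightarrow> real) \<Rightarrow>
   ('b, 'f::euclidean_space) mfd \<Rightarrow> ('b \<Rightarrow> 'f \<Rightarrow> 'f \<Rightarrow> real) \<Rightarrow> ('a \<Rightarrow> 'b) \<Rightarrow> real" where
  "F_energy F M g N h u =
     (\<integral>x. F (hs_norm_sq (g x) (h (u x)) (mderiv M N u x) / 2) \<partial>riemannian_measure M g)"

definition F_harmonic ::
  "(real \<Rightarrow> real) \<Rightarrow> ('a, real^'m) mfd \<Rightarrow> ('a \<Rightarrow> real^'m \<Rightarrow> real^'m \<Rightarrow> real) \<Rightarrow>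
   ('b, 'f::euclidean_space) mfd \<Rightarrow> ('b \<Rightarrow> 'f \<Rightarrow> 'f \<Rightarrow> real) \<Rightarrow> ('a \<Rightarrow> 'b) \<Rightarrow> bool" where
  "F_harmonic F M g N h u \<longleftrightarrow>
     smooth_map M N u \<and>
     (\<forall>\<epsilon>>0. \<forall>U :: real \<Rightarrow> 'a \<Rightarrow> 'b.
        smooth_map (prod_mfd (open_mfd {-\<epsilon><..<\<epsilon>}) M) N (\<lambda>(t, x). U t x) \<and>
        (\<forall>x\<in>points M. U 0 x = u x) \<longrightarrow>
        ((\<lambda>t. F_energy F M g N h (U t)) has_real_derivative 0) (at 0))"


section \<open>Vertical and horizontal distributions\<close>

definition vertical_space ::
  "('a, 'e::euclidean_space) mfd \<Rightarrow> ('b, 'f::euclidean_space) mfd \<Rightarrow> ('a \<Rightarrow> 'b) \<Rightarrow> 'a \<Rightarrow> 'e set" where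
  "vertical_space M N u x = {v. mderiv M N u x v = 0}"

definition horizontal_space ::
  "('a, 'e::euclidean_space) mfd \<Rightarrow> ('a \<Rightarrow> 'e \<Rightarrow> 'e \<Rightarrow> real) \<Rightarrow> ('b, 'f::euclidean_space) mfd \<Rightarrow>
   ('a \<Rightarrow> 'b) \<Rightarrow> 'a \<Rightarrow> 'e set" where
  "horizontal_space M g N u x = {w. \<forall>v\<in>vertical_space M N u x. g x v w = 0}"

definition vertical_field ::
  "('a, 'e::euclidean_space) mfd \<Rightarrow> ('b, 'f::euclidean_space) mfd \<Rightarrow> ('a \<Rightarrow> 'b) \<Rightarrow> ('a \<Rightarrow> 'e) \<Rightarrow> bool"
  where
  "vertical_field M N u Y \<longleftrightarrow> (\<forall>x\<in>points M. Y x \<in> vertical_space M N u x)"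

definition horizontally_conformal_submersion ::
  "('a, 'e::euclidean_space) mfd \<Rightarrow> ('a \<Rightarrow> 'e \<Rightarrow> 'e \<Rightarrow> real) \<Rightarrow>
   ('b, 'f::euclidean_space) mfd \<Rightarrow> ('b \<Rightarrow> 'f \<Rightarrow> 'f \<Rightarrow> real) \<Rightarrow> ('a \<Rightarrow> 'b) \<Rightarrow> ('a \<Rightarrow> real) \<Rightarrow> bool" where
  "horizontally_conformal_submersion M g N h u dil \<longleftrightarrow>
     submersion M N u \<and>
     smooth_map M (open_mfd UNIV) dil \<and> (\<forall>x\<in>points M. dil x > 0) \<and>
     (\<forall>x\<in>points M. \<forall>v\<in>horizontal_space M g N u x. \<forall>w\<in>horizontal_space M g N u x.
        h (u x) (mderiv M N u x v) (mderiv M N u x w) = (dil x)\<^sup>2 * g x v w)"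

text \<open>A distribution \<^term>\<open>D\<close> is integrable if through every point there is an
  integral manifold, given by a local parametrisation \<^term>\<open>s\<close>. The type of the
  parameter space \<^typ>\<open>'k\<close> fixes the rank of \<^term>\<open>D\<close>; the differential of \<^term>\<open>s\<close> is required to be
  injective onto \<^term>\<open>D\<close>.\<close>

definition integrable_distribution ::
  "'k::euclidean_space itself \<Rightarrow> ('a, 'e::euclidean_space) mfd \<Rightarrow> ('a \<Rightarrow> 'e set) \<Rightarrow> bool" where
  "integrable_distribution _ M D \<longleftrightarrow>
     (\<forall>x\<in>points M. \<exists>(W :: 'k set) s.
        open W \<and> x \<in> s ` W \<and> smooth_map (open_mfd W) M s \<and> inj_on s W \<and>
        (\<forall>y\<in>W. inj (mderiv (open_mfd W) M s y) \<and> range (mderiv (open_mfd W) M s y) = D (s y)))"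

text \<open>A submersion is trivial if it is the projection of a product: there is a diffeomorphism
  \<open>(u, r)\<close> from \<^term>\<open>M\<close> onto \<^term>\<open>N\<close> times a fibre \<open>P\<close> under which the horizontal distribution
  becomes the tangent distribution of the \<^term>\<open>N\<close> factor, that is, the kernel of the differential of \<^term>\<open>r\<close>.
  As the kernels of the differentials of \<^term>\<open>u\<close> and \<^term>\<open>r\<close> are then complementary, the bijection \<open>(u, r)\<close>
  is automatically a diffeomorphism. Taking \<open>P\<close> to be a fibre of \<^term>\<open>u\<close> is no restriction.\<close>

definition trivial_submersion ::
  "('a, 'e::euclidean_space) mfd \<Rightarrow> ('a \<Rightarrow> 'e \<Rightarrow> 'e \<Rightarrow> real) \<Rightarrow> ('b, 'f::euclidean_space) mfd \<Rightarrow>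
   ('a \<Rightarrow> 'b) \<Rightarrow> bool" where
  "trivial_submersion M g N u \<longleftrightarrow>
     (\<exists>q\<in>points N. \<exists>r. smooth_map M M r \<and>
        bij_betw (\<lambda>x. (u x, r x)) (points M) (points N \<times> {x \<in> points M. u x = q}) \<and>
        (\<forall>x\<in>points M. {v. mderiv M M r x v = 0} = horizontal_space M g N u x))"


section \<open>Singular cohomology with real coefficients\<close>

text \<open>A cochain is a real function on singular simplices (0 outside of them); this is the
  same as a homomorphism from the free abelian group of singular chains to the reals, and
  \<open>coboundary\<close> is precomposition with \<^const>\<open>chain_boundary\<close>.\<close>

definition cochains :: "nat \<Rightarrow> 'a topology \<Rightarrow> (((nat \<Rightarrow> real) \<Rightarrow> 'a) \<Rightarrow> real) set" where
  "cochains p X = {f. \<forall>\<sigma>. \<sigma> \<notin> singular_simplex_set p X \<longrightarrow> f \<sigma> = 0}"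

definition coboundary ::
  "nat \<Rightarrow> 'a topology \<Rightarrow> (((nat \<Rightarrow> real) \<Rightarrow> 'a) \<Rightarrow> real) \<Rightarrow> ((nat \<Rightarrow> real) \<Rightarrow> 'a) \<Rightarrow> real" where
  "coboundary p X f =
     (\<lambda>\<sigma>. if \<sigma> \<in> singular_simplex_set (Suc p) X
           then \<Sum>k\<le>Suc p. (-1) ^ k * f (singular_face (Suc p) k \<sigma>) else 0)"

definition cocycle_group :: "nat \<Rightarrow> 'a topology \<Rightarrow> (((nat \<Rightarrow> real) \<Rightarrow> 'a) \<Rightarrow> real) monoid" where
  "cocycle_group p X =
     \<lparr>carrier = {f \<in> cochains p X. coboundary p X f = (\<lambda>\<sigma>. 0)},
      monoid.mult = (\<lambda>f f' \<sigma>. f \<sigma> + f' \<sigma>), one = (\<lambda>\<sigma>. 0)\<rparr>"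

definition coboundaries :: "nat \<Rightarrow> 'a topology \<Rightarrow> (((nat \<Rightarrow> real) \<Rightarrow> 'a) \<Rightarrow> real) set" where
  "coboundaries p X =
     (case p of 0 \<Rightarrow> {\<lambda>\<sigma>. 0} | Suc k \<Rightarrow> coboundary k X ` cochains k X)"

definition real_cohomology_group ::
  "nat \<Rightarrow> 'a topology \<Rightarrow> (((nat \<Rightarrow> real) \<Rightarrow> 'a) \<Rightarrow> real) set monoid" where
  "real_cohomology_group p X = cocycle_group p X Mod coboundaries p X"

end

theory Submission
  imports Defs
begin

text \<open>Each of the two properties to be excluded makes the horizontal lifts \<open>X\<^sub>a\<close> of the coordinate fields of \<open>N\<close>
  commute as derivations. Write \<open>w = F'(n\<lambda>\<^sup>2/2) \<lambda>\<^sup>2\<close> and let \<open>J(f\<^sub>1, \<dots>, f\<^sub>n)\<close> be \<open>det (X\<^sub>a f\<^sub>b)\<close> divided by the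
  volume density of \<open>N\<close>, with the sign of the chart. The first variation of the energy in the direction
  \<open>f\<^sub>k\<close> times the cofactors of the row \<open>k\<close> gives \<open>\<integral> w J(f\<^sub>1, \<dots>, f\<^sub>n) = 0\<close>, first for \<open>f\<^sub>k\<close> supported over a chart,
  then by a partition of unity for all smooth functions on \<open>M\<close>. So \<open>f\<^sub>0 df\<^sub>1 \<and> \<dots> \<and> df\<^sub>n \<mapsto> \<integral> w f\<^sub>0 J(f\<^sub>1, \<dots>, f\<^sub>n)\<close> is a
  current that vanishes on exact forms.

  It does not vanish on the pullback of a bump \<open>n\<close>-form on \<open>N\<close>, which is the cup product of \<open>n\<close> step functions
  of the coordinates. De Rham's theorem is avoided: the cup product is a cocycle \<open>\<Psi>\<close> on the singular simplices
  that are small with respect to an open cover, and by subdivision it extends to a singular cocycle, which is a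
  coboundary \<open>\<delta>c\<close> because the cohomology is trivial. A partition of unity \<open>\<phi>\<close> and straightened simplices \<open>A\<close>
  turn \<open>\<Psi>\<close> into the form \<open>\<Sum> \<Psi>(A\<^sub>I) \<phi>\<^sub>I\<^sub>0 d\<phi>\<^sub>I\<^sub>1 \<and> \<dots> \<and> d\<phi>\<^sub>I\<^sub>n\<close>, which is exact because \<open>\<Psi> = \<delta>c\<close>, and which differs from
  the pullback of the bump form by exact forms with support over the chart.\<close>

section \<open>Calculus of smooth maps\<close>

text \<open>Harmonicity takes the place of Stokes' theorem: criticality of the energy is the only
  source of integration by parts, and it yields divergences along the horizontal fields alone. Hence
  differential forms are never introduced; an n-form enters only through its value on the n
  horizontal lifts, a Jacobian determinant. Commutation makes the cofactors divergence free (the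
  Piola identity), which is what turns a divergence into a Jacobian. The division by the volume
  density of N is forced by the variation: the derivative of this factor cancels the derivative of
  the metric of N. A change of chart on N then leaves only a sign, and once orientability has
  removed it, partitions of unity on M are available. The obstacle on the topological side is that a
  primitive of a singular cocycle is a function on simplices without any regularity. It is evaluated
  only at finitely many simplices, spanned by the index points of a partition of unity, so that its
  values enter the integrals as constants. For this the simplices must have the prescribed vertices,
  be small, and restrict to each other on faces.\<close>

lemma Ck_on_subset: "Ck_on k S f \<Longrightarrow> T \<subseteq> S \<Longrightarrow> Ck_on k T f"
  by (induction k arbitrary: f) (auto intro: continuous_on_subset)

lemma Ck_on_cong:
  assumes "open S" "\<And>x. x \<in> S \<Longrightarrow> f x = g x"
  shows "Ck_on k S f \<Longrightarrow> Ck_on k S g"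
  using assms
proof (induction k arbitrary: f g)
  case 0
  from 0(1) have "continuous_on S f" by simp
  then have "continuous_on S g" by (rule continuous_on_eq) (rule 0(3))
  then show ?case by simp
next
  case (Suc k)
  have "(g has_derivative frechet_derivative f (at x)) (at x)" if "x \<in> S" for x
  proof (rule has_derivative_transform_within_open[OF _ \<open>open S\<close> that])
    show "(f has_derivative frechet_derivative f (at x)) (at x)"
      using Suc.prems(1) that by (simp add: frechet_derivative_works[symmetric])
  qed (rule Suc.prems(3))
  then have "g differentiable at x" "frechet_derivative g (at x) = frechet_derivative f (at x)" if "x \<in> S" for x
    using that frechet_derivative_at differentiable_def by (blast, metis)
  moreover have "Ck_on k S (\<lambda>x. frechet_derivative g (at x) v)" for v
    by (rule Suc.IH[of "\<lambda>x. frechet_derivative f (at x) v"]) (use Suc.prems calculation in auto)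
  ultimately show ?case by simp
qed

text \<open>Most inductions on \<open>k\<close> go through this rule: a derivative known in closed
  form may stand in for \<open>frechet_derivative\<close>.\<close>

lemma Ck_on_SucI:
  assumes "open S" "\<And>x. x \<in> S \<Longrightarrow> (f has_derivative D x) (at x)"
    "\<And>v. Ck_on k S (\<lambda>x. D x v)"
  shows "Ck_on (Suc k) S f"
proof -
  have "frechet_derivative f (at x) = D x" if "x \<in> S" for x
    using assms(2)[OF that] frechet_derivative_at by metis
  then have "Ck_on k S (\<lambda>x. frechet_derivative f (at x) v)" for v
    by (intro Ck_on_cong[OF \<open>open S\<close> _ assms(3)[of v]]) simp
  moreover have "f differentiable at x" if "x \<in> S" for x
    using assms(2)[OF that] by (rule differentiableI)
  ultimately show ?thesis by simp
qed

lemma Ck_on_Suc_D: "Ck_on (Suc k) S f \<Longrightarrow> Ck_on k S f"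
proof (induction k arbitrary: f)
  case 0
  then show ?case
    by (auto intro!: differentiable_imp_continuous_on simp: differentiable_on_def differentiable_at_withinI)
next
  case (Suc k)
  then show ?case by auto
qed

lemma Ck_on_has_derivative:
  "Ck_on (Suc k) S f \<Longrightarrow> x \<in> S \<Longrightarrow> (f has_derivative frechet_derivative f (at x)) (at x)"
  by (auto simp: frechet_derivative_works[symmetric])

lemma Ck_on_const [simp]: "open S \<Longrightarrow> Ck_on k S (\<lambda>x. c)"
  by (induction k arbitrary: c) auto

lemma Ck_on_compose_linear:
  assumes "bounded_linear L" "open S"
  shows "Ck_on k S f \<Longrightarrow> Ck_on k S (\<lambda>x. L (f x))"
proof (induction k arbitrary: f)
  case 0
  then show ?case by (auto intro: bounded_linear.continuous_on[OF assms(1)])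
next
  case (Suc k)
  show ?case
    by (rule Ck_on_SucI[OF \<open>open S\<close> bounded_linear.has_derivative[OF assms(1) Ck_on_has_derivative[OF Suc.prems]]])
       (use Suc in auto)
qed

lemma Ck_on_linear:
  assumes "bounded_linear L" "open S"
  shows "Ck_on k S L"
proof (cases k)
  case 0
  then show ?thesis using linear_continuous_on[OF assms(1)] by simp
next
  case (Suc k')
  have "(L has_derivative L) (at x)" for x using assms(1) by (rule bounded_linear_imp_has_derivative)
  from Ck_on_SucI[OF assms(2) this, of k'] show ?thesis using Suc Ck_on_const[OF assms(2)] by metis
qed

lemma Ck_on_add:
  assumes "open S"
  shows "Ck_on k S f \<Longrightarrow> Ck_on k S g \<Longrightarrow> Ck_on k S (\<lambda>x. f x + g x)"
proof (induction k arbitrary: f g)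
  case 0
  then show ?case by (auto intro: continuous_intros)
next
  case (Suc k)
  show ?case
    by (rule Ck_on_SucI[OF \<open>open S\<close> has_derivative_add[OF Ck_on_has_derivative[OF Suc.prems(1)] Ck_on_has_derivative[OF Suc.prems(2)]]])
       (use Suc in auto)
qed

lemma Ck_on_sum:
  assumes "open S" "\<And>i. i \<in> I \<Longrightarrow> Ck_on k S (f i)"
  shows "Ck_on k S (\<lambda>x. \<Sum>i\<in>I. f i x)"
  using assms by (induction I rule: infinite_finite_induct) (simp_all add: Ck_on_add)

lemma Ck_on_bilinear:
  assumes "bounded_bilinear pr" "open S"
  shows "Ck_on k S f \<Longrightarrow> Ck_on k S g \<Longrightarrow> Ck_on k S (\<lambda>x. pr (f x) (g x))"
proof (induction k arbitrary: f g)
  case 0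
  then show ?case by (auto intro: bounded_bilinear.continuous_on[OF assms(1)])
next
  case (Suc k)
  show ?case
  proof (rule Ck_on_SucI[OF \<open>open S\<close>])
    fix x assume x: "x \<in> S"
    show "((\<lambda>x. pr (f x) (g x)) has_derivative
        (\<lambda>v. pr (f x) (frechet_derivative g (at x) v) + pr (frechet_derivative f (at x) v) (g x))) (at x)"
      by (intro bounded_bilinear.FDERIV[OF assms(1)] Ck_on_has_derivative[OF Suc.prems(1) x]
          Ck_on_has_derivative[OF Suc.prems(2) x])
  next
    fix v
    show "Ck_on k S (\<lambda>x. pr (f x) (frechet_derivative g (at x) v) + pr (frechet_derivative f (at x) v) (g x))"
      by (rule Ck_on_add[OF \<open>open S\<close> Suc.IH[OF Ck_on_Suc_D[OF Suc.prems(1)]] Suc.IH[OF _ Ck_on_Suc_D[OF Suc.prems(2)]]])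
         (use Suc.prems in simp_all)
  qed
qed

lemma frechet_derivative_basis_sum:
  fixes f :: "'e::euclidean_space \<Rightarrow> 'f::real_normed_vector"
  assumes "f differentiable at x"
  shows "frechet_derivative f (at x) v = (\<Sum>b\<in>Basis. (v \<bullet> b) *\<^sub>R frechet_derivative f (at x) b)"
proof -
  interpret linear "frechet_derivative f (at x)" by (rule linear_frechet_derivative[OF assms])
  have "frechet_derivative f (at x) v = frechet_derivative f (at x) (\<Sum>b\<in>Basis. (v \<bullet> b) *\<^sub>R b)"
    by (simp add: euclidean_representation)
  then show ?thesis by (simp add: sum scale del: euclidean_representation)
qed

text \<open>The induction generalises over \<open>g\<close> only: the chain rule produces
  derivatives of \<open>f\<close> and partial derivatives of \<open>g\<close> composed with the same
  \<open>f\<close>.\<close>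

lemma Ck_on_compose:
  fixes f :: "'e::euclidean_space \<Rightarrow> 'f::euclidean_space" and g :: "'f \<Rightarrow> 'g::real_normed_vector"
  assumes "open S" "open T" "f ` S \<subseteq> T"
  shows "Ck_on k S f \<Longrightarrow> Ck_on k T g \<Longrightarrow> Ck_on k S (\<lambda>x. g (f x))"
proof (induction k arbitrary: g)
  case 0
  then have "continuous_on S f" "continuous_on T g" by simp_all
  then have "continuous_on S (\<lambda>x. g (f x))" using assms(3) continuous_on_compose2 by blast
  then show ?case by simp
next
  case (Suc k)
  \<comment> \<open>The chain rule with the derivative of \<open>g\<close> expanded in the basis:
    \<open>Ck_on\<close> speaks of derivatives in fixed directions, while the chain rule has a
    direction that varies with \<open>x\<close>.\<close>
  define D where "D x v = (\<Sum>b\<in>Basis. (frechet_derivative f (at x) v \<bullet> b) *\<^sub>R frechet_derivative g (at (f x)) b)" for x v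
  show ?case
  proof (rule Ck_on_SucI[OF \<open>open S\<close>])
    fix x assume x: "x \<in> S"
    then have fx: "f x \<in> T" using assms by auto
    have "frechet_derivative g (at (f x)) (frechet_derivative f (at x) v) = D x v" for v
      unfolding D_def using Suc.prems(2) fx by (subst frechet_derivative_basis_sum) auto
    then show "((\<lambda>x. g (f x)) has_derivative D x) (at x)"
      using has_derivative_compose[OF Ck_on_has_derivative[OF Suc.prems(1) x] Ck_on_has_derivative[OF Suc.prems(2) fx]]
      by presburger
  next
    fix v
    show "Ck_on k S (\<lambda>x. D x v)"
      unfolding D_def
    proof (rule Ck_on_sum[OF \<open>open S\<close> Ck_on_bilinear[OF bounded_bilinear_scaleR \<open>open S\<close>]])
      fix b :: 'f assume "b \<in> Basis"
      show "Ck_on k S (\<lambda>x. frechet_derivative f (at x) v \<bullet> b)"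
        using Suc.prems(1) by (auto intro!: Ck_on_compose_linear[OF bounded_linear_inner_left \<open>open S\<close>])
      show "Ck_on k S (\<lambda>x. frechet_derivative g (at (f x)) b)"
        by (rule Suc.IH[OF Ck_on_Suc_D[OF Suc.prems(1)]]) (use Suc.prems(2) in auto)
    qed
  qed
qed

lemma Ck_on_local:
  assumes "\<And>x. x \<in> S \<Longrightarrow> \<exists>U. open U \<and> x \<in> U \<and> Ck_on k U f"
  shows "Ck_on k S f"
  using assms
proof (induction k arbitrary: f)
  case 0
  then have "continuous (at x within S) f" if "x \<in> S" for x
    using that continuous_at_imp_continuous_within by (metis Ck_on.simps(1) continuous_on_eq_continuous_at)
  then show ?case by (simp add: continuous_on_eq_continuous_within)
next
  case (Suc k)
  show ?case unfolding Ck_on.simps(2)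
  proof (intro conjI ballI allI)
    fix x assume "x \<in> S" then show "f differentiable at x" using Suc.prems by auto
  next
    fix v show "Ck_on k S (\<lambda>x. frechet_derivative f (at x) v)"
      by (rule Suc.IH) (use Suc.prems in force)
  qed
qed

text \<open>The derivative of \<open>1 / f\<close> is a polynomial in \<open>1 / f\<close> and the
  derivative of \<open>f\<close>.\<close>

lemma Ck_on_inverse:
  fixes f :: "'e::euclidean_space \<Rightarrow> real"
  assumes "open S" "\<And>x. x \<in> S \<Longrightarrow> f x \<noteq> 0"
  shows "Ck_on k S f \<Longrightarrow> Ck_on k S (\<lambda>x. inverse (f x))"
proof (induction k)
  case 0
  then show ?case using assms by (auto intro: continuous_intros)
next
  case (Suc k)
  note IH = Suc.IH[OF Ck_on_Suc_D[OF Suc.prems]]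
  show ?case
  proof (rule Ck_on_SucI[OF \<open>open S\<close> Deriv.has_derivative_inverse[OF _ Ck_on_has_derivative[OF Suc.prems]]])
    fix v
    have "Ck_on k S (\<lambda>x. frechet_derivative f (at x) v)" using Suc.prems by auto
    note this[THEN Ck_on_bilinear[OF bounded_bilinear_mult \<open>open S\<close> IH], THEN Ck_on_bilinear[OF bounded_bilinear_mult \<open>open S\<close> _ IH]]
    from Ck_on_compose_linear[OF bounded_linear_minus[OF bounded_linear_ident] \<open>open S\<close> this]
    show "Ck_on k S (\<lambda>x. - (inverse (f x) * frechet_derivative f (at x) v * inverse (f x)))" .
  qed (use assms in auto)
qed

lemma Ck_on_imp_continuous_on: "Ck_on k S f \<Longrightarrow> continuous_on S f"
proof (induction k)
  case (Suc k)
  show ?case by (rule Suc.IH[OF Ck_on_Suc_D[OF Suc.prems]])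
qed simp

lemma smooth_on_imp_continuous_on: "smooth_on S f \<Longrightarrow> continuous_on S f"
  by (auto simp: smooth_on_def intro: Ck_on_imp_continuous_on)

lemma smooth_on_subset: "smooth_on S f \<Longrightarrow> T \<subseteq> S \<Longrightarrow> smooth_on T f"
  by (auto simp: smooth_on_def intro: Ck_on_subset)

lemma smooth_on_cong:
  "open S \<Longrightarrow> (\<And>x. x \<in> S \<Longrightarrow> f x = g x) \<Longrightarrow> smooth_on S f \<Longrightarrow> smooth_on S g"
  by (auto simp: smooth_on_def intro: Ck_on_cong)

lemma smooth_on_differentiable: "smooth_on S f \<Longrightarrow> x \<in> S \<Longrightarrow> f differentiable at x"
  unfolding smooth_on_def using Ck_on.simps(2) by blast

lemma smooth_on_has_derivative:
  "smooth_on S f \<Longrightarrow> x \<in> S \<Longrightarrow> (f has_derivative frechet_derivative f (at x)) (at x)"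
  unfolding smooth_on_def using Ck_on_has_derivative by blast

lemma smooth_on_frechet_derivative:
  "smooth_on S f \<Longrightarrow> smooth_on S (\<lambda>x. frechet_derivative f (at x) v)"
  unfolding smooth_on_def using Ck_on.simps(2) by blast

lemma smooth_on_derivI:
  assumes "open S" "\<And>x. x \<in> S \<Longrightarrow> (f has_derivative D x) (at x)" "\<And>v. smooth_on S (\<lambda>x. D x v)"
  shows "smooth_on S f"
  unfolding smooth_on_def
  by (intro allI Ck_on_Suc_D[OF Ck_on_SucI[OF assms(1,2)]]) (use assms(3) in \<open>auto simp: smooth_on_def\<close>)

lemma smooth_on_const [simp]: "open S \<Longrightarrow> smooth_on S (\<lambda>x. c)"
  by (auto simp: smooth_on_def)

lemma smooth_on_linear: "bounded_linear L \<Longrightarrow> open S \<Longrightarrow> smooth_on S L"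
  by (auto simp: smooth_on_def intro: Ck_on_linear)

lemma smooth_on_id: "open S \<Longrightarrow> smooth_on S (\<lambda>x. x)"
  by (intro smooth_on_linear bounded_linear_ident)

lemma smooth_on_compose_linear:
  "bounded_linear L \<Longrightarrow> open S \<Longrightarrow> smooth_on S f \<Longrightarrow> smooth_on S (\<lambda>x. L (f x))"
  by (auto simp: smooth_on_def intro: Ck_on_compose_linear)

lemma smooth_on_add: "open S \<Longrightarrow> smooth_on S f \<Longrightarrow> smooth_on S g \<Longrightarrow> smooth_on S (\<lambda>x. f x + g x)"
  by (auto simp: smooth_on_def intro: Ck_on_add)

lemma smooth_on_sum:
  "open S \<Longrightarrow> (\<And>i. i \<in> I \<Longrightarrow> smooth_on S (f i)) \<Longrightarrow> smooth_on S (\<lambda>x. \<Sum>i\<in>I. f i x)"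
  by (auto simp: smooth_on_def intro: Ck_on_sum)

lemma smooth_on_scaleR: "open S \<Longrightarrow> smooth_on S f \<Longrightarrow> smooth_on S g \<Longrightarrow> smooth_on S (\<lambda>x. f x *\<^sub>R g x)"
  by (auto simp: smooth_on_def intro: Ck_on_bilinear[OF bounded_bilinear_scaleR])

lemma smooth_on_mult:
  fixes f g :: "'e::euclidean_space \<Rightarrow> real"
  shows "open S \<Longrightarrow> smooth_on S f \<Longrightarrow> smooth_on S g \<Longrightarrow> smooth_on S (\<lambda>x. f x * g x)"
  by (auto simp: smooth_on_def intro: Ck_on_bilinear[OF bounded_bilinear_mult])

lemma smooth_on_inner: "open S \<Longrightarrow> smooth_on S f \<Longrightarrow> smooth_on S g \<Longrightarrow> smooth_on S (\<lambda>x. f x \<bullet> g x)"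
  by (auto simp: smooth_on_def intro: Ck_on_bilinear[OF bounded_bilinear_inner])

lemma smooth_on_minus: "open S \<Longrightarrow> smooth_on S f \<Longrightarrow> smooth_on S (\<lambda>x. - f x)"
  by (rule smooth_on_compose_linear[OF bounded_linear_minus[OF bounded_linear_ident]])

lemma smooth_on_diff: "open S \<Longrightarrow> smooth_on S f \<Longrightarrow> smooth_on S g \<Longrightarrow> smooth_on S (\<lambda>x. f x - g x)"
  using smooth_on_add[of S f "\<lambda>x. - g x"] smooth_on_minus[of S g] by simp

lemma smooth_on_prod:
  fixes f :: "'i \<Rightarrow> 'e::euclidean_space \<Rightarrow> real"
  shows "open S \<Longrightarrow> (\<And>i. i \<in> I \<Longrightarrow> smooth_on S (f i)) \<Longrightarrow> smooth_on S (\<lambda>x. \<Prod>i\<in>I. f i x)"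
  by (induction I rule: infinite_finite_induct) (simp_all add: smooth_on_mult)

lemma smooth_on_inverse:
  fixes f :: "'e::euclidean_space \<Rightarrow> real"
  shows "open S \<Longrightarrow> smooth_on S f \<Longrightarrow> (\<And>x. x \<in> S \<Longrightarrow> f x \<noteq> 0) \<Longrightarrow> smooth_on S (\<lambda>x. inverse (f x))"
  by (auto simp: smooth_on_def intro: Ck_on_inverse)

lemma smooth_on_divide:
  fixes f g :: "'e::euclidean_space \<Rightarrow> real"
  shows "open S \<Longrightarrow> smooth_on S f \<Longrightarrow> smooth_on S g \<Longrightarrow> (\<And>x. x \<in> S \<Longrightarrow> g x \<noteq> 0) \<Longrightarrow> smooth_on S (\<lambda>x. f x / g x)"
  unfolding divide_inverse by (intro smooth_on_mult smooth_on_inverse)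

lemma smooth_on_compose:
  fixes f :: "'e::euclidean_space \<Rightarrow> 'f::euclidean_space" and g :: "'f \<Rightarrow> 'g::real_normed_vector"
  shows "open S \<Longrightarrow> open T \<Longrightarrow> smooth_on S f \<Longrightarrow> smooth_on T g \<Longrightarrow> f ` S \<subseteq> T \<Longrightarrow> smooth_on S (\<lambda>x. g (f x))"
  by (auto simp: smooth_on_def intro: Ck_on_compose)

lemma smooth_on_local:
  assumes "\<And>x. x \<in> S \<Longrightarrow> \<exists>U. open U \<and> x \<in> U \<and> smooth_on U f"
  shows "smooth_on S f"
  unfolding smooth_on_def using assms by (metis Ck_on_local smooth_on_def)

lemma smooth_on_vec_iff:
  fixes f :: "'e::euclidean_space \<Rightarrow> real^'n"
  assumes "open S"
  shows "smooth_on S f \<longleftrightarrow> (\<forall>i. smooth_on S (\<lambda>x. f x $ i))"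
proof
  assume "smooth_on S f" then show "\<forall>i. smooth_on S (\<lambda>x. f x $ i)"
    using smooth_on_compose_linear[OF bounded_linear_vec_nth assms] by blast
next
  assume "\<forall>i. smooth_on S (\<lambda>x. f x $ i)"
  then have "smooth_on S (\<lambda>x. \<Sum>i\<in>UNIV. f x $ i *\<^sub>R axis i (1::real))"
    using assms by (auto intro!: smooth_on_sum smooth_on_scaleR)
  moreover have "(\<Sum>i\<in>UNIV. f x $ i *\<^sub>R axis i (1::real)) = f x" for x
    using basis_expansion[of "f x"] by (simp add: scalar_mult_eq_scaleR)
  ultimately show "smooth_on S f" by simp
qed

lemma smooth_on_fst: "open S \<Longrightarrow> smooth_on S f \<Longrightarrow> smooth_on S (\<lambda>x. fst (f x))"
  by (rule smooth_on_compose_linear[OF bounded_linear_fst])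

lemma smooth_on_snd: "open S \<Longrightarrow> smooth_on S f \<Longrightarrow> smooth_on S (\<lambda>x. snd (f x))"
  by (rule smooth_on_compose_linear[OF bounded_linear_snd])

lemma smooth_on_real_derivI:
  fixes f :: "real \<Rightarrow> real"
  assumes "open S" "\<And>x. x \<in> S \<Longrightarrow> (f has_real_derivative f' x) (at x)" "smooth_on S f'"
  shows "smooth_on S f"
  by (rule smooth_on_derivI[OF assms(1) assms(2)[unfolded has_field_derivative_def]])
     (use assms in \<open>auto intro!: smooth_on_mult\<close>)

text \<open>The derivative of this function is -1/2 times its own cube, so the induction stays among
  products of the function with itself.\<close>

lemma smooth_on_inverse_sqrt: "smooth_on {0<..} (\<lambda>x. inverse (sqrt x))"
proof -
  have "Ck_on k {0<..} (\<lambda>x. inverse (sqrt x))" for k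
  proof (induction k)
    case 0
    then show ?case by (auto intro!: continuous_intros)
  next
    case (Suc k)
    show ?case
    proof (rule Ck_on_SucI)
      fix x :: real assume "x \<in> {0<..}"
      then have "((\<lambda>x. inverse (sqrt x)) has_real_derivative (- (inverse (sqrt x) * inverse (sqrt x) * inverse (sqrt x)) / 2)) (at x)"
        by (auto intro!: derivative_eq_intros simp: field_simps)
      then show "((\<lambda>x. inverse (sqrt x)) has_derivative (\<lambda>v. (- (inverse (sqrt x) * inverse (sqrt x) * inverse (sqrt x)) / 2) * v)) (at x)"
        unfolding has_field_derivative_def .
    next
      fix v :: real
      have L: "bounded_linear (\<lambda>t::real. - t / 2 * v)"
        by (intro bounded_linear_mult_const bounded_linear_divide bounded_linear_minus bounded_linear_ident
            bounded_linear_compose[OF bounded_linear_divide bounded_linear_minus[OF bounded_linear_ident]])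
      show "Ck_on k {0<..} (\<lambda>x::real. - (inverse (sqrt x) * inverse (sqrt x) * inverse (sqrt x)) / 2 * v)"
        by (intro Ck_on_compose_linear[OF L] Ck_on_bilinear[OF bounded_bilinear_mult] Suc.IH) auto
    qed auto
  qed
  then show ?thesis by (simp add: smooth_on_def)
qed

text \<open>The family is closed under differentiation, which gives smoothness at 0.\<close>

definition flat_exp :: "nat \<Rightarrow> real \<Rightarrow> real" where
  "flat_exp k t = (if t > 0 then exp (- inverse t) * inverse t ^ k else 0)"

lemma has_real_derivative_flat_exp:
  "(flat_exp k has_real_derivative flat_exp (k + 2) t - real k * flat_exp (k + 1) t) (at t)"
proof (cases t "0::real" rule: linorder_cases)
  case less
  have "((\<lambda>_. 0) has_real_derivative 0) (at t)" by simp
  then have "(flat_exp k has_real_derivative 0) (at t)"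
    by (rule has_field_derivative_transform_within_open[of _ _ _ "{..<0}"]) (use less in \<open>auto simp: flat_exp_def\<close>)
  then show ?thesis using less by (simp add: flat_exp_def)
next
  case equal
  have "((\<lambda>h. flat_exp k h / h) \<longlongrightarrow> 0) (at 0)"
  proof (rule filterlim_split_at)
    show "((\<lambda>h. flat_exp k h / h) \<longlongrightarrow> 0) (at_left 0)"
      by (rule tendsto_eventually) (auto simp: flat_exp_def eventually_at_left_field intro!: exI[of _ "-1"])
    have "((\<lambda>h::real. exp (- inverse h) * inverse h ^ k / h) \<longlongrightarrow> 0) (at_right 0)"
    proof -
      have "((\<lambda>x::real. x ^ Suc k / exp x) \<longlongrightarrow> 0) at_top" by (rule tendsto_power_div_exp_0)
      then have "((\<lambda>h::real. inverse h ^ Suc k / exp (inverse h)) \<longlongrightarrow> 0) (at_right 0)"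
        by (rule filterlim_compose) (rule filterlim_inverse_at_top_right)
      then show ?thesis by (simp add: exp_minus field_simps)
    qed
    then show "((\<lambda>h. flat_exp k h / h) \<longlongrightarrow> 0) (at_right 0)"
      by (rule Lim_transform_eventually) (auto simp: flat_exp_def eventually_at_right_field intro!: exI[of _ 1])
  qed
  then show ?thesis using equal by (simp add: has_field_derivative_iff flat_exp_def)
next
  case greater
  have "((\<lambda>t. exp (- inverse t) * inverse t ^ k) has_real_derivative
      exp (- inverse t) * inverse t ^ (k + 2) - real k * (exp (- inverse t) * inverse t ^ (k + 1))) (at t)"
  proof -
    have i: "(inverse has_real_derivative - (inverse t * inverse t)) (at t)"
      using DERIV_inverse[of t] greater by (simp add: power2_eq_square)
    have "((\<lambda>t. exp (- inverse t) * inverse t ^ k) has_real_derivative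
        exp (- inverse t) * (inverse t * inverse t) * inverse t ^ k +
        real k * inverse t ^ (k - 1) * (- (inverse t * inverse t)) * exp (- inverse t)) (at t)"
      by (rule derivative_eq_intros i refl | simp)+
    then show ?thesis by (rule DERIV_cong) (cases k; simp add: algebra_simps)
  qed
  then show ?thesis
    by (rule DERIV_cong[OF has_field_derivative_transform_within_open[of _ _ _ "{0<..}"]])
       (use greater in \<open>auto simp: flat_exp_def\<close>)
qed

lemma smooth_on_flat_exp: "smooth_on UNIV (flat_exp k)"
proof -
  have "Ck_on j UNIV (flat_exp k)" for j
  proof (induction j arbitrary: k)
    case 0
    then show ?case
      by (simp add: continuous_on_eq_continuous_at DERIV_isCont[OF has_real_derivative_flat_exp])
  next
    case (Suc j)
    show ?case
    proof (rule Ck_on_SucI[OF open_UNIV has_real_derivative_flat_exp[of k, unfolded has_field_derivative_def]])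
      fix v
      have *: "bounded_linear (\<lambda>t::real. t * v)" "bounded_linear (\<lambda>t::real. (- real k) * t * v)"
        by (auto intro!: bounded_linear_intros bounded_linear_minus)
      show "Ck_on j UNIV (\<lambda>x. (flat_exp (k + 2) x - real k * flat_exp (k + 1) x) * v)"
        using Ck_on_add[OF open_UNIV Ck_on_compose_linear[OF *(1) open_UNIV Suc.IH[of "k+2"]]
            Ck_on_compose_linear[OF *(2) open_UNIV Suc.IH[of "k+1"]]]
        by (simp add: algebra_simps)
    qed
  qed
  then show ?thesis by (simp add: smooth_on_def)
qed

lemma flat_exp_pos: "flat_exp 0 t \<ge> 0" "flat_exp 0 t > 0 \<longleftrightarrow> t > 0" "t \<le> 0 \<Longrightarrow> flat_exp 0 t = 0"
  by (auto simp: flat_exp_def)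

text \<open>\<open>flat_exp 0\<close> is composed with a polynomial in the squared distance, since
  the distance itself is not smooth at \<open>z\<close>.\<close>

lemma smooth_bump_exists:
  fixes z :: "'e::euclidean_space"
  assumes "r > 0"
  obtains f :: "'e \<Rightarrow> real" where "smooth_on UNIV f" "\<And>y. f y \<ge> 0" "\<And>y. f y > 0 \<longleftrightarrow> dist z y < r"
proof
  define f where "f y = flat_exp 0 (r\<^sup>2 - (y - z) \<bullet> (y - z))" for y
  have "smooth_on UNIV (\<lambda>y. r\<^sup>2 - (y - z) \<bullet> (y - z))"
    by (intro smooth_on_diff smooth_on_inner smooth_on_id) auto
  from smooth_on_compose[OF open_UNIV open_UNIV this smooth_on_flat_exp]
  show "smooth_on UNIV f" unfolding f_def by simp
  show "f y \<ge> 0" for y by (simp add: f_def flat_exp_pos)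
  show "f y > 0 \<longleftrightarrow> dist z y < r" for y
  proof -
    have "f y > 0 \<longleftrightarrow> (dist z y)\<^sup>2 < r\<^sup>2"
      by (simp add: f_def flat_exp_pos(2) dist_norm norm_minus_commute flip: power2_norm_eq_inner)
    also have "\<dots> \<longleftrightarrow> dist z y < r" using assms by (metis less_eq_real_def power2_less_imp_less power_strict_mono pos2 zero_le_dist)
    finally show ?thesis .
  qed
qed

lemma smooth_step_exists:
  obtains S :: "real \<Rightarrow> real" and S' where "smooth_on UNIV S" "\<And>t. (S has_real_derivative S' t) (at t)"
    "\<And>t. S' t \<ge> 0" "S' 0 > 0" "\<And>t. \<bar>t\<bar> \<ge> 1 \<Longrightarrow> S' t = 0"
    "\<And>t. t \<le> -1 \<Longrightarrow> S t = S (-1)" "\<And>t. t \<ge> 1 \<Longrightarrow> S t = S 1" "smooth_on UNIV S'"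
proof -
  obtain b :: "real \<Rightarrow> real" where b: "smooth_on UNIV b" "\<And>y. b y \<ge> 0" "\<And>y. b y > 0 \<longleftrightarrow> dist 0 y < 1"
    using smooth_bump_exists[of 1 "0::real"] by (metis zero_less_one)
  have cb: "continuous_on A b" for A using b(1) smooth_on_imp_continuous_on continuous_on_subset by blast
  have b0: "b t = 0" if "\<bar>t\<bar> \<ge> 1" for t
    using b(2,3)[of t] that by (auto simp: dist_real_def)
  define S where "S t = integral {-2..t} b" for t
  have S: "(S has_real_derivative b t) (at t)" for t
  proof (cases "t < -1")
    case True
    have "((\<lambda>_. 0) has_real_derivative 0) (at t)" by simp
    then have "(S has_real_derivative 0) (at t)"
    proof (rule has_field_derivative_transform_within_open)
      fix x :: real assume "x \<in> {..<-1}"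
      then have "integral {-2..x} b = integral {-2..x} (\<lambda>_. 0)"
        by (intro integral_cong b0) auto
      then show "0 = S x" by (simp add: S_def)
    qed (use True in auto)
    then show ?thesis using b0 True by simp
  next
    case False
    have "((\<lambda>x. integral {-2..x} b) has_real_derivative b t) (at t within {-2..t+1})"
      by (rule integral_has_real_derivative[OF cb]) (use False in auto)
    then have "(S has_real_derivative b t) (at t within {-2..t+1})" by (simp add: S_def[abs_def])
    moreover have "at t within {-2..t+1} = at t"
      by (rule at_within_interior) (use False in auto)
    ultimately show ?thesis by simp
  qed
  have const: "S s = S t" if st: "s < t" "\<And>x. s < x \<Longrightarrow> x < t \<Longrightarrow> b x = 0" for s t
  proof -
    obtain x where "s < x" "x < t" "S t - S s = (t - s) * b x"
      using MVT2[OF st(1), of S b] S by metis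
    then show ?thesis using st(2) by simp
  qed
  have "S t = S (-1)" if "t \<le> -1" for t
    using const[of t "-1"] b0 that by (cases "t = -1") auto
  moreover have "S t = S 1" if "t \<ge> 1" for t
    using const[of 1 t] b0 that by (cases "t = 1") auto
  moreover have "smooth_on UNIV S" by (rule smooth_on_real_derivI[OF open_UNIV S b(1)])
  moreover have "b 0 > 0" using b(3)[of 0] by simp
  ultimately show ?thesis using that[of S b] S b(1,2) b0 by blast
qed

text \<open>The mean value theorem is applied twice: in the direction \<open>v\<close> to the
  increment of \<open>f\<close> along \<open>w\<close>, then in the direction \<open>w\<close> to
  the derivative of \<open>f\<close> along \<open>v\<close>.\<close>

lemma second_difference_mvt:
  fixes f :: "'e::euclidean_space \<Rightarrow> real"
  assumes "open U" "smooth_on U f" "h > 0"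
    and seg: "\<And>a b. \<lbrakk>0 \<le> a; a \<le> h; 0 \<le> b; b \<le> h\<rbrakk> \<Longrightarrow> x + a *\<^sub>R v + b *\<^sub>R w \<in> U"
  obtains a b where "0 \<le> a" "a \<le> h" "0 \<le> b" "b \<le> h"
    "f (x + h *\<^sub>R v + h *\<^sub>R w) - f (x + h *\<^sub>R v) - f (x + h *\<^sub>R w) + f x
      = h\<^sup>2 * frechet_derivative (\<lambda>y. frechet_derivative f (at y) v) (at (x + a *\<^sub>R v + b *\<^sub>R w)) w"
proof -
  define f1 where "f1 y = frechet_derivative f (at y) v" for y
  have f1s: "smooth_on U f1" unfolding f1_def by (rule smooth_on_frechet_derivative[OF assms(2)])
  have line: "((\<lambda>t. g (p + t *\<^sub>R d)) has_real_derivative frechet_derivative g (at (p + t *\<^sub>R d)) d) (at t)"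
    if "smooth_on U g" "p + t *\<^sub>R d \<in> U" for g :: "'e \<Rightarrow> real" and p d t
  proof -
    have lin: "linear (frechet_derivative g (at (p + t *\<^sub>R d)))"
      by (rule linear_frechet_derivative[OF smooth_on_differentiable[OF that]])
    have "((\<lambda>t. p + t *\<^sub>R d) has_derivative (\<lambda>s. s *\<^sub>R d)) (at t)"
      by (auto intro!: derivative_eq_intros)
    from has_derivative_compose[OF this smooth_on_has_derivative[OF that]]
    show ?thesis by (simp add: has_field_derivative_def linear_scale[OF lin] mult.commute[of _ "frechet_derivative g _ d"])
  qed
  define \<phi> where "\<phi> t = f ((x + h *\<^sub>R w) + t *\<^sub>R v) - f (x + t *\<^sub>R v)" for t
  have "(\<phi> has_real_derivative (f1 ((x + h *\<^sub>R w) + t *\<^sub>R v) - f1 (x + t *\<^sub>R v))) (at t)"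
    if "0 \<le> t" "t \<le> h" for t
    unfolding \<phi>_def f1_def
    using seg[of t h] seg[of t 0] that \<open>h > 0\<close>
    by (intro DERIV_diff line[OF assms(2)]) (auto simp: algebra_simps)
  from MVT2[OF \<open>h > 0\<close> this] obtain a where a: "0 < a" "a < h"
    "\<phi> h - \<phi> 0 = h * (f1 ((x + h *\<^sub>R w) + a *\<^sub>R v) - f1 (x + a *\<^sub>R v))" by auto
  have "((\<lambda>s. f1 ((x + a *\<^sub>R v) + s *\<^sub>R w)) has_real_derivative
      frechet_derivative f1 (at ((x + a *\<^sub>R v) + s *\<^sub>R w)) w) (at s)" if "0 \<le> s" "s \<le> h" for s
    by (rule line[OF f1s]) (use seg[of a s] a that in auto)
  from MVT2[OF \<open>h > 0\<close> this] obtain b where b: "0 < b" "b < h"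
    "f1 ((x + a *\<^sub>R v) + h *\<^sub>R w) - f1 ((x + a *\<^sub>R v) + 0 *\<^sub>R w)
      = h * frechet_derivative f1 (at ((x + a *\<^sub>R v) + b *\<^sub>R w)) w" by auto
  have "\<phi> h - \<phi> 0 = h * (h * frechet_derivative f1 (at (x + a *\<^sub>R v + b *\<^sub>R w)) w)"
    using a(3) b(3) by (simp add: algebra_simps)
  then show ?thesis
    using that[of a b] a b by (simp add: \<phi>_def f1_def[abs_def] power2_eq_square algebra_simps)
qed

text \<open>Both mixed derivatives are limits of the same symmetric second difference quotient.\<close>

lemma second_derivative_symmetric:
  fixes f :: "'e::euclidean_space \<Rightarrow> real"
  assumes "open U" "smooth_on U f" "x \<in> U"
  shows "frechet_derivative (\<lambda>y. frechet_derivative f (at y) v) (at x) w =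
         frechet_derivative (\<lambda>y. frechet_derivative f (at y) w) (at x) v"
proof -
  define A where "A y = frechet_derivative (\<lambda>y. frechet_derivative f (at y) v) (at y) w" for y
  define B where "B y = frechet_derivative (\<lambda>y. frechet_derivative f (at y) w) (at y) v" for y
  have cA: "continuous_on U A" and cB: "continuous_on U B"
    unfolding A_def B_def by (intro smooth_on_imp_continuous_on smooth_on_frechet_derivative assms)+
  have "\<bar>A x - B x\<bar> < \<epsilon>" if "\<epsilon> > 0" for \<epsilon>
  proof -
    obtain d where d: "d > 0" "\<And>y. dist y x < d \<Longrightarrow> y \<in> U \<and> \<bar>A y - A x\<bar> < \<epsilon> / 2 \<and> \<bar>B y - B x\<bar> < \<epsilon> / 2"
    proof -
      obtain d1 where "d1 > 0" "\<And>y. dist y x < d1 \<Longrightarrow> y \<in> U"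
        using assms unfolding open_dist by (metis dist_commute)
      moreover obtain d2 where "d2 > 0" "\<And>y. y \<in> U \<Longrightarrow> dist y x < d2 \<Longrightarrow> dist (A y) (A x) < \<epsilon> / 2"
        using cA assms(3) \<open>\<epsilon> > 0\<close> unfolding continuous_on_iff by (meson half_gt_zero)
      moreover obtain d3 where "d3 > 0" "\<And>y. y \<in> U \<Longrightarrow> dist y x < d3 \<Longrightarrow> dist (B y) (B x) < \<epsilon> / 2"
        using cB assms(3) \<open>\<epsilon> > 0\<close> unfolding continuous_on_iff by (meson half_gt_zero)
      ultimately show ?thesis
        using that[of "min d1 (min d2 d3)"] by (auto simp: dist_real_def)
    qed
    define c where "c = norm v + norm w + 1"
    have c: "c > 0" by (simp add: c_def add_nonneg_pos)
    \<comment> \<open>With \<open>c\<close> above the sum of the two norms, the parallelogram with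
      sides \<open>h *\<^sub>R v\<close> and \<open>h *\<^sub>R w\<close> stays within
      \<open>d / 2\<close> of \<open>x\<close>.\<close>
    define h where "h = d / (2 * c)"
    have h: "h > 0" unfolding h_def using d c by simp
    have near: "dist (x + a *\<^sub>R v + b *\<^sub>R w) x < d" if "0 \<le> a" "a \<le> h" "0 \<le> b" "b \<le> h" for a b
    proof -
      have "dist (x + a *\<^sub>R v + b *\<^sub>R w) x \<le> a * norm v + b * norm w"
        using norm_triangle_ineq[of "a *\<^sub>R v" "b *\<^sub>R w"] that by (simp add: dist_norm)
      also have "\<dots> \<le> h * norm v + h * norm w"
        using that by (intro add_mono mult_right_mono) auto
      also have "\<dots> \<le> h * c" using h by (simp add: c_def algebra_simps)
      also have "\<dots> = d / 2" unfolding h_def using c by simp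
      finally show ?thesis using d by simp
    qed
    obtain a b where ab: "0 \<le> a" "a \<le> h" "0 \<le> b" "b \<le> h"
      "f (x + h *\<^sub>R v + h *\<^sub>R w) - f (x + h *\<^sub>R v) - f (x + h *\<^sub>R w) + f x = h\<^sup>2 * A (x + a *\<^sub>R v + b *\<^sub>R w)"
      using second_difference_mvt[OF assms(1,2) h, of x v w] d(2)[OF near] unfolding A_def by blast
    have "x + a *\<^sub>R w + b *\<^sub>R v \<in> U" if "0 \<le> a" "a \<le> h" "0 \<le> b" "b \<le> h" for a b
      using d(2)[OF near[of b a]] that by (simp add: algebra_simps)
    then obtain a' b' where ab': "0 \<le> a'" "a' \<le> h" "0 \<le> b'" "b' \<le> h"
      "f (x + h *\<^sub>R w + h *\<^sub>R v) - f (x + h *\<^sub>R w) - f (x + h *\<^sub>R v) + f x = h\<^sup>2 * B (x + a' *\<^sub>R w + b' *\<^sub>R v)"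
      using second_difference_mvt[OF assms(1,2) h, of x w v] unfolding B_def by blast
    have "h\<^sup>2 * A (x + a *\<^sub>R v + b *\<^sub>R w) = h\<^sup>2 * B (x + a' *\<^sub>R w + b' *\<^sub>R v)"
      using ab(5) ab'(5) by (simp add: algebra_simps)
    then have "A (x + a *\<^sub>R v + b *\<^sub>R w) = B (x + b' *\<^sub>R v + a' *\<^sub>R w)"
      using h by (simp add: algebra_simps)
    moreover have "\<bar>A (x + a *\<^sub>R v + b *\<^sub>R w) - A x\<bar> < \<epsilon> / 2" "\<bar>B (x + b' *\<^sub>R v + a' *\<^sub>R w) - B x\<bar> < \<epsilon> / 2"
      using d(2)[OF near[OF ab(1-4)]] d(2)[OF near[OF ab'(3,4,1,2)]] by auto
    ultimately show ?thesis by linarith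
  qed
  then have "\<not> \<bar>A x - B x\<bar> > 0" by blast
  then show ?thesis by (simp add: A_def B_def)
qed

text \<open>The second-order terms of the commutator of two first-order operators cancel.\<close>

lemma commutator_first_order:
  fixes f :: "'e::euclidean_space \<Rightarrow> real" and P Q :: "'e \<Rightarrow> 'e"
  assumes "open U" "smooth_on U f" "smooth_on U P" "smooth_on U Q" "x \<in> U"
  shows "frechet_derivative (\<lambda>y. frechet_derivative f (at y) (Q y)) (at x) (P x)
       - frechet_derivative (\<lambda>y. frechet_derivative f (at y) (P y)) (at x) (Q x)
       = frechet_derivative f (at x) (frechet_derivative Q (at x) (P x) - frechet_derivative P (at x) (Q x))"
proof -
  define H where "H v w = frechet_derivative (\<lambda>y. frechet_derivative f (at y) v) (at x) w" for v w
  note lin = linear_frechet_derivative[OF smooth_on_differentiable[OF _ assms(5)]]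
  have D: "frechet_derivative (\<lambda>y. frechet_derivative f (at y) (Q y)) (at x) p
      = (\<Sum>b\<in>Basis. (Q x \<bullet> b) * H b p) + frechet_derivative f (at x) (frechet_derivative Q (at x) p)"
    if Q: "smooth_on U Q" for Q and p
  proof -
    have eq: "frechet_derivative f (at y) (Q y) = (\<Sum>b\<in>Basis. (Q y \<bullet> b) * frechet_derivative f (at y) b)"
      if "y \<in> U" for y
      by (subst frechet_derivative_basis_sum[OF smooth_on_differentiable[OF assms(2) that]]) simp
    have "((\<lambda>y. \<Sum>b\<in>Basis. (Q y \<bullet> b) * frechet_derivative f (at y) b) has_derivative
        (\<lambda>p. \<Sum>b\<in>Basis. (Q x \<bullet> b) * H b p + (frechet_derivative Q (at x) p \<bullet> b) * frechet_derivative f (at x) b)) (at x)"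
      unfolding H_def
      by (intro has_derivative_sum has_derivative_mult has_derivative_inner_left
          smooth_on_has_derivative[OF Q assms(5)]
          smooth_on_has_derivative[OF smooth_on_frechet_derivative[OF assms(2)] assms(5)])
    then have "((\<lambda>y. frechet_derivative f (at y) (Q y)) has_derivative
        (\<lambda>p. \<Sum>b\<in>Basis. (Q x \<bullet> b) * H b p + (frechet_derivative Q (at x) p \<bullet> b) * frechet_derivative f (at x) b)) (at x)"
      by (rule has_derivative_transform_within_open[OF _ assms(1,5)]) (simp add: eq)
    from frechet_derivative_at[OF this, symmetric]
    show ?thesis
      using frechet_derivative_basis_sum[OF smooth_on_differentiable[OF assms(2,5)], of "frechet_derivative Q (at x) p"]
      by (simp add: sum.distrib)
  qed
  have Hs: "H v w = H w v" for v w
    unfolding H_def by (rule second_derivative_symmetric[OF assms(1,2,5)])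
  have Hexp: "H b p = (\<Sum>c\<in>Basis. (p \<bullet> c) * H c b)" for b p
    using frechet_derivative_basis_sum[OF smooth_on_differentiable[OF smooth_on_frechet_derivative[OF assms(2)] assms(5)], of b p]
    unfolding H_def[symmetric] by (simp add: Hs)
  have Hsum: "(\<Sum>b\<in>Basis. (q \<bullet> b) * H b p) = (\<Sum>b\<in>Basis. \<Sum>c\<in>Basis. (q \<bullet> b) * (p \<bullet> c) * H c b)" for p q
    by (intro sum.cong refl) (simp only: Hexp[of _ p] sum_distrib_left mult.assoc)
  have "(\<Sum>b\<in>Basis. (Q x \<bullet> b) * H b (P x)) = (\<Sum>b\<in>Basis. (P x \<bullet> b) * H b (Q x))"
    unfolding Hsum by (subst sum.swap) (intro sum.cong refl, simp add: Hs mult_ac)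
  then show ?thesis
    by (simp add: D[OF assms(3)] D[OF assms(4)] linear_diff[OF lin[OF assms(2)]])
qed

declare transpose_matrix_vector [simp del]

section \<open>Inner products and dual inner products\<close>

definition inner_matrix :: "(real^'m \<Rightarrow> real^'m \<Rightarrow> real) \<Rightarrow> real^'m^'m" where
  "inner_matrix p = (\<chi> i j. p (axis i 1) (axis j 1))"

text \<open>The inner product on covectors induced by a metric with Gram matrix \<open>G\<close>:
  covectors are given by their components, and \<open>matrix_inv G\<close> is the inverse
  metric.\<close>

definition dual_inner :: "real^'m^'m \<Rightarrow> real^'m \<Rightarrow> real^'m \<Rightarrow> real" where
  "dual_inner G a b = a \<bullet> (matrix_inv G *v b)"

definition inner_product_form :: "('e::euclidean_space \<Rightarrow> 'e \<Rightarrow> real) \<Rightarrow> bool" where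
  "inner_product_form p \<longleftrightarrow> bilinear p \<and> (\<forall>v w. p v w = p w v) \<and> (\<forall>v. v \<noteq> 0 \<longrightarrow> p v v > 0)"

lemma bilinear_inner_matrix:
  fixes p :: "real^'m \<Rightarrow> real^'m \<Rightarrow> real"
  assumes "bilinear p"
  shows "p v w = v \<bullet> (inner_matrix p *v w)"
proof -
  have lv: "linear (\<lambda>v. p v w)" and lw: "linear (p v)" for v w using assms by (auto simp: bilinear_def)
  have "p v w = p (\<Sum>i\<in>UNIV. v $ i *\<^sub>R axis i 1) w"
    using basis_expansion[of v] by (simp add: scalar_mult_eq_scaleR)
  also have "\<dots> = (\<Sum>i\<in>UNIV. v $ i * p (axis i 1) w)"
    by (simp add: linear_sum[OF lv] linear_scale[OF lv])
  also have "\<dots> = (\<Sum>i\<in>UNIV. v $ i * (\<Sum>j\<in>UNIV. p (axis i 1) (axis j 1) * w $ j))"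
  proof (intro sum.cong refl arg_cong2[where f="(*)"])
    fix i
    have "p (axis i 1) w = p (axis i 1) (\<Sum>j\<in>UNIV. w $ j *\<^sub>R axis j 1)"
      using basis_expansion[of w] by (simp add: scalar_mult_eq_scaleR)
    then show "p (axis i 1) w = (\<Sum>j\<in>UNIV. p (axis i 1) (axis j 1) * w $ j)"
      by (simp add: linear_sum[OF lw] linear_scale[OF lw] mult.commute)
  qed
  finally show ?thesis
    by (simp add: inner_vec_def inner_matrix_def matrix_vector_mult_def)
qed

lemma matrix_inv_mult:
  fixes A :: "real^'m^'m"
  assumes "invertible A"
  shows matrix_inv_right: "A ** matrix_inv A = mat 1" and matrix_inv_left: "matrix_inv A ** A = mat 1"
  using someI_ex[OF assms[unfolded invertible_def]] by (auto simp: matrix_inv_def)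

lemma matrix_inv_unique:
  fixes A B :: "real^'m^'m"
  assumes "B ** A = mat 1" shows "matrix_inv A = B"
proof -
  have "A ** B = mat 1" using assms matrix_left_right_inverse by blast
  with assms have i: "invertible A" by (auto simp: invertible_def)
  have "matrix_inv A = (B ** A) ** matrix_inv A" by (simp add: assms)
  also have "\<dots> = B" using matrix_inv_right[OF i] by (simp add: matrix_mul_assoc[symmetric])
  finally show ?thesis .
qed

context
  fixes p :: "real^'m \<Rightarrow> real^'m \<Rightarrow> real"
  assumes p: "inner_product_form p"
begin

private abbreviation "G \<equiv> inner_matrix p"

lemma inner_matrix_eq: "p v w = v \<bullet> (G *v w)"
  using p by (intro bilinear_inner_matrix) (simp add: inner_product_form_def)

lemma transpose_inner_matrix: "transpose G = G"
  using p by (auto simp: inner_product_form_def transpose_def inner_matrix_def vec_eq_iff)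

lemma invertible_inner_matrix: "invertible G"
proof -
  have "x = 0" if "G *v x = 0" for x
  proof (rule ccontr)
    assume "x \<noteq> 0"
    then have "p x x > 0" using p by (auto simp: inner_product_form_def)
    then show False using that by (simp add: inner_matrix_eq)
  qed
  then show ?thesis
    by (simp add: invertible_left_inverse matrix_left_invertible_ker)
qed

lemma inner_matrix_inv: "G *v (matrix_inv G *v a) = a" "matrix_inv G *v (G *v a) = a"
  using matrix_inv_right[OF invertible_inner_matrix] matrix_inv_left[OF invertible_inner_matrix]
  by (simp_all add: matrix_vector_mul_assoc)

lemma transpose_matrix_inv_inner: "transpose (matrix_inv G) = matrix_inv G"
proof -
  have "transpose (matrix_inv G) ** G = transpose (G ** matrix_inv G)"
    by (simp add: matrix_transpose_mul transpose_inner_matrix)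
  then have "transpose (matrix_inv G) ** G = mat 1"
    by (simp add: matrix_inv_right[OF invertible_inner_matrix] transpose_mat)
  from matrix_inv_unique[OF this] show ?thesis by simp
qed

lemma dual_inner_commute: "dual_inner G a b = dual_inner G b a"
  unfolding dual_inner_def
  by (metis dot_lmul_matrix inner_commute transpose_matrix_inv_inner transpose_matrix_vector)

lemma dual_inner_pos: "a \<noteq> 0 \<Longrightarrow> dual_inner G a a > 0"
proof -
  assume a: "a \<noteq> 0"
  define y where "y = matrix_inv G *v a"
  have ay: "a = G *v y" by (simp add: y_def inner_matrix_inv)
  then have "y \<noteq> 0" using a by auto
  then have "p y y > 0" using p by (auto simp: inner_product_form_def)
  also have "p y y = y \<bullet> a" by (simp add: inner_matrix_eq ay)
  finally show ?thesis by (simp add: dual_inner_def y_def inner_commute)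
qed

text \<open>Each induction step is one step of the Gram-Schmidt process: fewer than
  \<open>CARD('m)\<close> vectors do not span, and a vector outside their span leaves a nonzero
  remainder.\<close>

lemma orthonormal_set_exists:
  "k \<le> CARD('m) \<Longrightarrow> \<exists>B. finite B \<and> card B = k \<and> (\<forall>v\<in>B. \<forall>w\<in>B. p v w = (if v = w then 1 else 0))"
proof (induction k)
  case 0 then show ?case by (intro exI[of _ "{}"]) auto
next
  case (Suc k)
  then obtain B where B: "finite B" "card B = k" "\<forall>v\<in>B. \<forall>w\<in>B. p v w = (if v = w then 1 else 0)" by auto
  have "dim B \<le> k" using B dim_le_card' by metis
  then have "span B \<noteq> UNIV"
    using Suc.prems by (metis DIM_cart DIM_real dim_UNIV dim_span mult.right_neutral not_less_eq_eq)
  then obtain w where w: "w \<notin> span B" by auto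
  define w' where "w' = w - (\<Sum>v\<in>B. p w v *\<^sub>R v)"
  have bl: "linear (\<lambda>v. p v x)" "linear (p x)" for x using p by (auto simp: inner_product_form_def bilinear_def)
  have "(\<Sum>v\<in>B. p w v *\<^sub>R v) \<in> span B" by (intro span_sum span_scale span_base)
  then have "w' \<noteq> 0" using w by (auto simp: w'_def)
  then have pos: "p w' w' > 0" using p by (auto simp: inner_product_form_def)
  have orth: "p w' v = 0" if "v \<in> B" for v
  proof -
    have "p w' v = p w v - (\<Sum>x\<in>B. p w x * p x v)"
      by (simp add: w'_def linear_diff[OF bl(1)] linear_sum[OF bl(1)] linear_scale[OF bl(1)])
    also have "(\<Sum>x\<in>B. p w x * p x v) = (\<Sum>x\<in>B. if x = v then p w v else 0)"
      using B(3) that by (intro sum.cong) auto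
    finally show ?thesis using B(1) that by simp
  qed
  have sym: "p a b = p b a" for a b using p by (auto simp: inner_product_form_def)
  define z where "z = inverse (sqrt (p w' w')) *\<^sub>R w'"
  have zz: "p z z = 1"
    using pos by (simp add: z_def linear_scale[OF bl(1)] linear_scale[OF bl(2)] field_simps)
  have zv: "p z v = 0" "p v z = 0" if "v \<in> B" for v
    using orth[OF that] sym[of v z] by (simp_all add: z_def linear_scale[OF bl(1)])
  have "z \<notin> B" using zz zv by fastforce
  then show ?case using B zz zv by (intro exI[of _ "insert z B"]) auto
qed

text \<open>The columns of \<^term>\<open>V\<close> being orthonormal means \<open>V\<^sup>T G V = 1\<close>, hence \<open>V V\<^sup>T = G\<^sup>-\<^sup>1\<close>.\<close>

lemma orthonormal_set_sum:
  assumes "finite B" "card B = CARD('m)" "\<forall>v\<in>B. \<forall>w\<in>B. p v w = (if v = w then 1 else 0)"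
  shows "(\<Sum>v\<in>B. (a \<bullet> v) * (b \<bullet> v)) = dual_inner G a b"
proof -
  obtain e :: "'m \<Rightarrow> real^'m" where e: "bij_betw e UNIV B"
    using assms(1,2) by (metis finite_same_card_bij finite_class.finite_UNIV)
  then have eB: "e i \<in> B" and e_inj: "e i = e j \<longleftrightarrow> i = j" for i j
    by (auto simp: bij_betw_def inj_on_def)
  define V :: "real^'m^'m" where "V = (\<chi> i j. e j $ i)"
  have Vt: "transpose V *v x = (\<chi> j. e j \<bullet> x)" for x
    by (simp add: V_def transpose_def matrix_vector_mult_def inner_vec_def vec_eq_iff)
  have "(transpose V ** G) ** V = mat 1"
  proof -
    have "((transpose V ** G) ** V) *v axis j 1 = mat 1 *v axis j 1" for j
    proof -
      have "V *v axis j 1 = e j" by (simp add: V_def matrix_vector_mul_component column_def vec_eq_iff matrix_vector_mult_basis)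
      then have "((transpose V ** G) ** V) *v axis j 1 = transpose V *v (G *v e j)"
        by (simp add: matrix_vector_mul_assoc[symmetric])
      also have "\<dots> = (\<chi> i. p (e i) (e j))" by (simp add: Vt inner_matrix_eq)
      also have "\<dots> = axis j 1"
      proof -
        have "p (e i) (e j) = (if i = j then 1 else 0)" for i using assms(3) eB e_inj by metis
        then show ?thesis by (simp add: axis_def)
      qed
      finally show ?thesis by simp
    qed
    then show ?thesis by (simp add: matrix_vector_mult_basis column_def vec_eq_iff)
  qed
  then have "V ** (transpose V ** G) = mat 1" using matrix_left_right_inverse by blast
  then have "(V ** transpose V) ** G = mat 1" by (simp add: matrix_mul_assoc)
  then have inv: "matrix_inv G = V ** transpose V" by (rule matrix_inv_unique)
  have "dual_inner G a b = a \<bullet> (V *v (transpose V *v b))"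
    by (simp add: dual_inner_def inv matrix_vector_mul_assoc)
  also have "\<dots> = (transpose V *v a) \<bullet> (transpose V *v b)"
    by (metis dot_lmul_matrix transpose_matrix_vector transpose_transpose)
  also have "\<dots> = (\<Sum>j\<in>UNIV. (e j \<bullet> a) * (e j \<bullet> b))" by (simp add: Vt inner_vec_def[of "vec_lambda _"])
  also have "\<dots> = (\<Sum>v\<in>B. (v \<bullet> a) * (v \<bullet> b))" by (rule sum.reindex_bij_betw[OF e])
  finally show ?thesis by (simp add: inner_commute)
qed

text \<open>The definite description in \<open>hs_norm_sq\<close> has a value because the sum over
  an orthonormal basis depends on it only through the sum of the matrices \<open>v v^T\<close>,
  which is always \<open>matrix_inv G\<close>.\<close>

lemma hs_norm_sq_eq:
  fixes q :: "real^'n \<Rightarrow> real^'n \<Rightarrow> real" and L :: "real^'m \<Rightarrow> real^'n"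
  assumes "bilinear q" and L: "\<And>v. L v = (\<chi> c. l c \<bullet> v)"
  shows "hs_norm_sq p q L = (\<Sum>c\<in>UNIV. \<Sum>d\<in>UNIV. inner_matrix q $ c $ d * dual_inner G (l c) (l d))"
proof -
  have val: "(\<Sum>v\<in>B. q (L v) (L v)) = (\<Sum>c\<in>UNIV. \<Sum>d\<in>UNIV. inner_matrix q $ c $ d * dual_inner G (l c) (l d))"
    if B: "finite B" "card B = CARD('m)" "\<forall>v\<in>B. \<forall>w\<in>B. p v w = (if v = w then 1 else 0)" for B
  proof -
    have "q (L v) (L v) = (\<Sum>c\<in>UNIV. \<Sum>d\<in>UNIV. inner_matrix q $ c $ d * ((l c \<bullet> v) * (l d \<bullet> v)))" for v
      by (subst bilinear_inner_matrix[OF assms(1)])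
         (simp add: L inner_vec_def[of "vec_lambda _"] matrix_vector_mult_def sum_distrib_left mult_ac)
    then have "(\<Sum>v\<in>B. q (L v) (L v)) = (\<Sum>v\<in>B. \<Sum>c\<in>UNIV. \<Sum>d\<in>UNIV. inner_matrix q $ c $ d * ((l c \<bullet> v) * (l d \<bullet> v)))"
      by simp
    also have "\<dots> = (\<Sum>c\<in>UNIV. \<Sum>v\<in>B. \<Sum>d\<in>UNIV. inner_matrix q $ c $ d * ((l c \<bullet> v) * (l d \<bullet> v)))"
      by (rule sum.swap)
    also have "\<dots> = (\<Sum>c\<in>UNIV. \<Sum>d\<in>UNIV. \<Sum>v\<in>B. inner_matrix q $ c $ d * ((l c \<bullet> v) * (l d \<bullet> v)))"
      by (rule sum.cong[OF refl sum.swap])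
    also have "\<dots> = (\<Sum>c\<in>UNIV. \<Sum>d\<in>UNIV. inner_matrix q $ c $ d * dual_inner G (l c) (l d))"
      by (simp add: sum_distrib_left[symmetric] orthonormal_set_sum[OF B])
    finally show ?thesis .
  qed
  obtain B where B: "finite B" "card B = CARD('m)" "\<forall>v\<in>B. \<forall>w\<in>B. p v w = (if v = w then 1 else 0)"
    using orthonormal_set_exists[of "CARD('m)"] by blast
  have dim: "DIM(real^'m) = CARD('m)" by simp
  show ?thesis
    unfolding hs_norm_sq_def dim
  proof (rule the_equality)
    show "\<exists>B. finite B \<and> card B = CARD('m) \<and> (\<forall>v\<in>B. \<forall>w\<in>B. p v w = (if v = w then 1 else 0)) \<and>
      (\<Sum>c\<in>UNIV. \<Sum>d\<in>UNIV. inner_matrix q $ c $ d * dual_inner G (l c) (l d)) = (\<Sum>v\<in>B. q (L v) (L v))"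
      by (intro exI[of _ B] conjI B val[OF B, symmetric])
  next
    fix r
    assume "\<exists>B. finite B \<and> card B = CARD('m) \<and> (\<forall>v\<in>B. \<forall>w\<in>B. p v w = (if v = w then 1 else 0)) \<and>
      r = (\<Sum>v\<in>B. q (L v) (L v))"
    then obtain B' where B': "finite B'" "card B' = CARD('m)" "\<forall>v\<in>B'. \<forall>w\<in>B'. p v w = (if v = w then 1 else 0)"
      "r = (\<Sum>v\<in>B'. q (L v) (L v))" by blast
    show "r = (\<Sum>c\<in>UNIV. \<Sum>d\<in>UNIV. inner_matrix q $ c $ d * dual_inner G (l c) (l d))"
      unfolding B'(4) by (rule val[OF B'(1-3)])
  qed
qed

text \<open>Horizontal conformality in terms of covectors: testing on the horizontal vectors
  \<open>G\<^sup>-\<^sup>1 L\<^sup>T a\<close> shows that \<open>L G\<^sup>-\<^sup>1 L\<^sup>T\<close> is \<open>\<lambda>\<^sup>2\<close> times the inverse of the matrix of \<^term>\<open>q\<close>.\<close>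

lemma horizontally_conformal_dual:
  fixes q :: "real^'n \<Rightarrow> real^'n \<Rightarrow> real" and L :: "real^'m \<Rightarrow> real^'n"
  assumes "bilinear q" and L: "\<And>v. L v = (\<chi> c. l c \<bullet> v)" and "surj L"
    and hc: "\<And>v w. (\<And>k. L k = 0 \<Longrightarrow> p k v = 0) \<Longrightarrow> (\<And>k. L k = 0 \<Longrightarrow> p k w = 0) \<Longrightarrow> q (L v) (L w) = \<kappa> * p v w"
  shows "(\<Sum>d\<in>UNIV. inner_matrix q $ a $ d * dual_inner G (l d) (l b)) = (if a = b then \<kappa> else 0)"
proof -
  define A :: "real^'m^'n" where "A = (\<chi> c. l c)"
  define S where "S = A ** matrix_inv G ** transpose A"
  have LA: "L v = A *v v" for v by (simp add: L A_def matrix_vector_mult_def inner_vec_def)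
  have Sel: "S $ c $ d = dual_inner G (l c) (l d)" for c d
  proof -
    have "S *v axis d 1 = A *v (matrix_inv G *v (transpose A *v axis d 1))"
      by (simp add: S_def matrix_vector_mul_assoc matrix_mul_assoc)
    moreover have "S *v axis d 1 = column d S" by (rule matrix_vector_mult_basis)
    ultimately have "S $ c $ d = (A *v (matrix_inv G *v (transpose A *v axis d 1))) $ c"
      by (simp add: column_def vec_eq_iff)
    then have "S $ c $ d = A $ c \<bullet> (matrix_inv G *v (transpose A *v axis d 1))"
      by (simp add: matrix_vector_mult_def[of A] inner_vec_def)
    moreover have "transpose A *v axis d 1 = l d" by (simp add: A_def transpose_def matrix_vector_mult_basis column_def vec_eq_iff)
    ultimately show ?thesis by (simp add: dual_inner_def A_def)
  qed
  define h where "h a = matrix_inv G *v (transpose A *v a)" for a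
  have Lh: "L (h a) = S *v a" for a by (simp add: LA h_def S_def matrix_vector_mul_assoc matrix_mul_assoc)
  have adj: "v \<bullet> (transpose A *v a) = L v \<bullet> a" for v a
    by (metis LA dot_lmul_matrix inner_commute transpose_matrix_vector transpose_transpose)
  have ph: "p v (h a) = L v \<bullet> a" for v a
    by (simp add: inner_matrix_eq h_def inner_matrix_inv adj)
  have key: "(S *v a) \<bullet> (inner_matrix q *v (S *v b)) = \<kappa> * ((S *v a) \<bullet> b)" for a b
    using hc[of "h a" "h b"] by (simp add: ph Lh bilinear_inner_matrix[OF assms(1)])
  \<comment> \<open>For a kernel vector \<open>b\<close> of \<open>S\<close> the covector
    \<open>A^T b\<close> has dual norm 0, so \<open>b\<close> is orthogonal to the range of
    \<open>L\<close>, which is everything. Being injective, \<open>S\<close> is onto and can be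
    cancelled from \<open>key\<close>.\<close>
  have "b = 0" if "S *v b = 0" for b
  proof (rule ccontr)
    assume "b \<noteq> 0"
    have "dual_inner G (transpose A *v b) (transpose A *v b) = L (h b) \<bullet> b"
      by (simp add: dual_inner_def h_def[symmetric] inner_commute[of "transpose A *v b"] adj)
    then have "transpose A *v b = 0" using dual_inner_pos Lh that by force
    then have "L v \<bullet> b = 0" for v using adj[of v b] by simp
    then have "b \<bullet> b = 0" using \<open>surj L\<close> by (metis surjD)
    then show False using \<open>b \<noteq> 0\<close> by simp
  qed
  then have "surj ((*v) S)"
    using matrix_left_invertible_ker[of S] matrix_left_right_inverse[of _ S] matrix_right_invertible_surjective[of S] by metis
  then have all: "y \<bullet> (inner_matrix q *v (S *v b)) = \<kappa> * (y \<bullet> b)" for y b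
    using key by (metis surjD)
  have "axis a 1 \<bullet> (inner_matrix q *v (S *v axis b 1)) = \<kappa> * (axis a 1 \<bullet> axis b (1::real))" by (rule all)
  moreover have "axis a 1 \<bullet> (inner_matrix q *v (S *v axis b 1)) = (\<Sum>d\<in>UNIV. inner_matrix q $ a $ d * dual_inner G (l d) (l b))"
    by (simp add: inner_axis' matrix_vector_mult_def[of "inner_matrix q"] matrix_vector_mult_basis column_def Sel)
  ultimately show ?thesis by (simp add: inner_axis_axis)
qed

end

lemma dual_inner_add: "dual_inner G (a + a') b = dual_inner G a b + dual_inner G a' b"
    "dual_inner G a (b + b') = dual_inner G a b + dual_inner G a b'"
  by (simp_all add: dual_inner_def inner_add_left inner_add_right matrix_vector_right_distrib)

lemma dual_inner_scale: "dual_inner G (r *\<^sub>R a) b = r * dual_inner G a b"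
    "dual_inner G a (r *\<^sub>R b) = r * dual_inner G a b"
  by (simp_all add: dual_inner_def matrix_vector_mult_scaleR)

lemma dual_inner_zero [simp]: "dual_inner G 0 b = 0" "dual_inner G a 0 = 0"
  by (simp_all add: dual_inner_def)

text \<open>Here \<open>P\<close> is the Jacobian matrix of a change of coordinates: covectors and
  metric are both pulled back by it, and the inverse metric absorbs the factors.\<close>

lemma dual_inner_change_basis:
  fixes P G :: "real^'m^'m"
  assumes "invertible P" "invertible G"
  shows "dual_inner (transpose P ** G ** P) (transpose P *v a) (transpose P *v b) = dual_inner G a b"
proof -
  have tP: "transpose P ** transpose (matrix_inv P) = mat 1" "transpose (matrix_inv P) ** transpose P = mat 1"
    using matrix_inv_left[OF assms(1)] matrix_inv_right[OF assms(1)]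
    by (simp_all add: matrix_transpose_mul[symmetric] transpose_mat)
  have "(matrix_inv P ** matrix_inv G ** transpose (matrix_inv P)) ** (transpose P ** G ** P)
      = matrix_inv P ** (matrix_inv G ** ((transpose (matrix_inv P) ** transpose P) ** G)) ** P"
    by (simp add: matrix_mul_assoc)
  also have "\<dots> = mat 1"
    by (simp add: tP matrix_inv_left[OF assms(1)] matrix_inv_left[OF assms(2)])
  finally have "matrix_inv (transpose P ** G ** P) = matrix_inv P ** matrix_inv G ** transpose (matrix_inv P)"
    by (rule matrix_inv_unique)
  then have "dual_inner (transpose P ** G ** P) (transpose P *v a) (transpose P *v b)
      = (transpose P *v a) \<bullet> (matrix_inv P *v (matrix_inv G *v ((transpose (matrix_inv P) ** transpose P) *v b)))"
    by (simp add: dual_inner_def matrix_vector_mul_assoc matrix_mul_assoc)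
  also have "\<dots> = (transpose P *v a) \<bullet> (matrix_inv P *v (matrix_inv G *v b))" by (simp add: tP)
  also have "\<dots> = a \<bullet> (P *v (matrix_inv P *v (matrix_inv G *v b)))"
    by (metis dot_lmul_matrix transpose_matrix_vector)
  also have "\<dots> = a \<bullet> (matrix_inv G *v b)"
  proof -
    have "P *v (matrix_inv P *v x) = x" for x
      by (simp add: matrix_vector_mul_assoc matrix_inv_right[OF assms(1)])
    then show ?thesis by simp
  qed
  finally show ?thesis by (simp add: dual_inner_def)
qed

lemma smooth_on_det:
  fixes A :: "'e::euclidean_space \<Rightarrow> real^'m^'m"
  assumes "open S" "\<And>i j. smooth_on S (\<lambda>x. A x $ i $ j)"
  shows "smooth_on S (\<lambda>x. det (A x))"
  unfolding det_def using assms by (intro smooth_on_sum smooth_on_mult smooth_on_prod) auto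

text \<open>Cramer's rule writes each entry as a quotient of determinants, which are polynomials in
  the entries.\<close>

lemma smooth_on_matrix_inv:
  fixes A :: "'e::euclidean_space \<Rightarrow> real^'m^'m"
  assumes "open S" "\<And>i j. smooth_on S (\<lambda>x. A x $ i $ j)" "\<And>x. x \<in> S \<Longrightarrow> invertible (A x)"
  shows "smooth_on S (\<lambda>x. matrix_inv (A x) $ i $ j)"
proof -
  define B where "B x = (\<chi> k l. if l = i then axis j 1 $ k else A x $ k $ l)" for x
  have "smooth_on S (\<lambda>x. B x $ k $ l)" for k l
    using assms(1,2) by (cases "l = i") (auto simp: B_def)
  then have *: "smooth_on S (\<lambda>x. det (B x) / det (A x))"
    using assms by (intro smooth_on_divide smooth_on_det) (auto simp: invertible_det_nz)
  have "det (B x) / det (A x) = matrix_inv (A x) $ i $ j" if "x \<in> S" for x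
  proof -
    have "A x *v (matrix_inv (A x) *v axis j 1) = axis j 1"
      by (simp add: matrix_vector_mul_assoc matrix_inv_right[OF assms(3)[OF that]])
    moreover have "det (A x) \<noteq> 0" using assms(3)[OF that] by (simp add: invertible_det_nz)
    ultimately have "matrix_inv (A x) *v axis j 1 = (\<chi> i. det (\<chi> k l. if l = i then axis j 1 $ k else A x $ k $ l) / det (A x))"
      using cramer by blast
    then have "(matrix_inv (A x) *v axis j 1) $ i = det (B x) / det (A x)" by (simp add: B_def)
    then show ?thesis by (simp add: matrix_vector_mult_basis column_def)
  qed
  then show ?thesis
    using smooth_on_cong[OF assms(1) _ *, of "\<lambda>x. matrix_inv (A x) $ i $ j"] by blast
qed

section \<open>Smooth functions on manifolds\<close>

definition smooth_fn :: "('a, 'e::euclidean_space) mfd \<Rightarrow> 'a set \<Rightarrow> ('a \<Rightarrow> 'f::real_normed_vector) \<Rightarrow> bool" where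
  "smooth_fn M W f \<longleftrightarrow> (\<forall>c\<in>charts M. smooth_on (snd c ` (fst c \<inter> W)) (\<lambda>z. f (chart_inv c z)))"

text \<open>For \<open>c = chart_at M x\<close> this is the differential of \<open>f\<close>,
  tangent vectors being given by their components in the preferred chart;
  \<open>chart_deriv_coord_vec\<close> converts from other charts.\<close>

definition chart_deriv :: "('a, 'e::euclidean_space) chart \<Rightarrow> ('a \<Rightarrow> 'f::real_normed_vector) \<Rightarrow> 'a \<Rightarrow> 'e \<Rightarrow> 'f" where
  "chart_deriv c f x = frechet_derivative (\<lambda>z. f (chart_inv c z)) (at (snd c x))"

locale manifold =
  fixes M :: "('a, 'e::euclidean_space) mfd"
  assumes M: "smooth_manifold M"
begin

lemma chart_openin: "c \<in> charts M \<Longrightarrow> openin (mtop M) (fst c)"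
  and chart_image_open: "c \<in> charts M \<Longrightarrow> open (snd c ` fst c)"
  and chart_homeo: "c \<in> charts M \<Longrightarrow> homeomorphic_map (subtopology (mtop M) (fst c)) (top_of_set (snd c ` fst c)) (snd c)"
  using M by (auto simp: smooth_manifold_def topological_chart_def)

lemma chart_subset: "c \<in> charts M \<Longrightarrow> fst c \<subseteq> points M"
  using chart_openin openin_subset by blast

lemma topspace_chart: "c \<in> charts M \<Longrightarrow> topspace (subtopology (mtop M) (fst c)) = fst c"
  using chart_subset[of c] by (simp add: Int_absorb1)

lemma chart_inj: "c \<in> charts M \<Longrightarrow> inj_on (snd c) (fst c)"
  using homeomorphic_imp_injective_map[OF chart_homeo, of c] topspace_chart[of c] by simp

lemma chart_inv_left [simp]: "c \<in> charts M \<Longrightarrow> x \<in> fst c \<Longrightarrow> chart_inv c (snd c x) = x"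
  unfolding chart_inv_def by (rule inv_into_f_f[OF chart_inj])

lemma chart_inv_right: "z \<in> snd c ` fst c \<Longrightarrow> snd c (chart_inv c z) = z"
  and chart_inv_mem: "z \<in> snd c ` fst c \<Longrightarrow> chart_inv c z \<in> fst c"
  unfolding chart_inv_def by (auto intro: f_inv_into_f inv_into_into)

lemma chart_cover: "x \<in> points M \<Longrightarrow> \<exists>c\<in>charts M. x \<in> fst c"
  using M unfolding smooth_manifold_def by blast

lemma chart_at: "x \<in> points M \<Longrightarrow> chart_at M x \<in> charts M" "x \<in> points M \<Longrightarrow> x \<in> fst (chart_at M x)"
  using someI_ex[of "\<lambda>c. c \<in> charts M \<and> x \<in> fst c"] chart_cover[of x] unfolding chart_at_def by blast+

lemma chart_continuous: "c \<in> charts M \<Longrightarrow> continuous_map (subtopology (mtop M) (fst c)) euclidean (snd c)"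
  using homeomorphic_imp_continuous_map[OF chart_homeo] continuous_map_in_subtopology by blast

lemma chart_inv_continuous:
  assumes "c \<in> charts M" shows "continuous_map (top_of_set (snd c ` fst c)) (mtop M) (chart_inv c)"
proof -
  obtain g where g: "homeomorphic_maps (subtopology (mtop M) (fst c)) (top_of_set (snd c ` fst c)) (snd c) g"
    using chart_homeo[OF assms] homeomorphic_map_maps by blast
  have "continuous_map (top_of_set (snd c ` fst c)) (mtop M) g"
    using g continuous_map_in_subtopology unfolding homeomorphic_maps_def by blast
  moreover have "g z = chart_inv c z" if "z \<in> snd c ` fst c" for z
  proof -
    obtain x where x: "x \<in> fst c" "z = snd c x" using \<open>z \<in> snd c ` fst c\<close> by blast
    then have "g z = x" using g topspace_chart[OF assms] unfolding homeomorphic_maps_def by auto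
    then show ?thesis using x assms by simp
  qed
  ultimately show ?thesis by (auto intro: continuous_map_eq)
qed

lemma chart_image_openin:
  assumes "c \<in> charts M" "openin (mtop M) W" shows "open (snd c ` (fst c \<inter> W))"
proof -
  have "openin (subtopology (mtop M) (fst c)) (fst c \<inter> W)"
    using assms(2) by (metis openin_subtopology_Int2)
  then have "openin (top_of_set (snd c ` fst c)) (snd c ` (fst c \<inter> W))"
    using homeomorphic_imp_open_map[OF chart_homeo[OF assms(1)]] unfolding open_map_def by blast
  then show ?thesis using chart_image_open[OF assms(1)] openin_open_trans by blast
qed

lemma chart_preimage_openin:
  assumes "c \<in> charts M" "open T" shows "openin (mtop M) {x \<in> fst c. snd c x \<in> T}"
proof -
  have "openin (subtopology (mtop M) (fst c)) {x \<in> topspace (subtopology (mtop M) (fst c)). snd c x \<in> T}"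
    by (rule openin_continuous_map_preimage[OF chart_continuous[OF assms(1)]]) (use assms in auto)
  from openin_trans_full[OF this chart_openin[OF assms(1)]]
  show ?thesis unfolding topspace_chart[OF assms(1)] .
qed

lemma transition_smooth: "c \<in> charts M \<Longrightarrow> d \<in> charts M \<Longrightarrow> smooth_on (snd c ` (fst c \<inter> fst d)) (transition c d)"
  using M unfolding smooth_manifold_def compatible_def by blast

lemma transition_open: "c \<in> charts M \<Longrightarrow> d \<in> charts M \<Longrightarrow> open (snd c ` (fst c \<inter> fst d))"
  by (rule chart_image_openin[OF _ chart_openin])

lemma transition_has_derivative:
  assumes "c \<in> charts M" "d \<in> charts M" "x \<in> fst c" "x \<in> fst d"
  shows "(transition c d has_derivative frechet_derivative (transition c d) (at (snd c x))) (at (snd c x))"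
  by (rule smooth_on_has_derivative[OF transition_smooth[OF assms(1,2)]]) (use assms in auto)

lemma transition_apply: "c \<in> charts M \<Longrightarrow> x \<in> fst c \<Longrightarrow> transition c d (snd c x) = snd d x"
  by (simp add: transition_def)

lemma smooth_fn_subset: "smooth_fn M W f \<Longrightarrow> W' \<subseteq> W \<Longrightarrow> smooth_fn M W' f"
  unfolding smooth_fn_def by (meson Int_mono image_mono order_refl smooth_on_subset)

lemma smooth_fn_cong:
  assumes "openin (mtop M) W" "\<And>x. x \<in> W \<Longrightarrow> f x = g x" "smooth_fn M W f"
  shows "smooth_fn M W g"
  unfolding smooth_fn_def
proof
  fix c assume c: "c \<in> charts M"
  show "smooth_on (snd c ` (fst c \<inter> W)) (\<lambda>z. g (chart_inv c z))"
  proof (rule smooth_on_cong[OF chart_image_openin[OF c assms(1)]])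
    show "smooth_on (snd c ` (fst c \<inter> W)) (\<lambda>z. f (chart_inv c z))"
      using assms(3) c by (auto simp: smooth_fn_def)
  qed (use assms(2) c in auto)
qed

lemma smooth_fn_local:
  assumes "\<And>x. x \<in> W \<Longrightarrow> \<exists>W'. openin (mtop M) W' \<and> x \<in> W' \<and> smooth_fn M W' f"
  shows "smooth_fn M W f"
  unfolding smooth_fn_def
proof
  fix c assume c: "c \<in> charts M"
  show "smooth_on (snd c ` (fst c \<inter> W)) (\<lambda>z. f (chart_inv c z))"
  proof (rule smooth_on_local)
    fix z assume "z \<in> snd c ` (fst c \<inter> W)"
    then obtain x where x: "x \<in> fst c" "x \<in> W" "z = snd c x" by auto
    obtain W' where W': "openin (mtop M) W'" "x \<in> W'" "smooth_fn M W' f" using assms x by blast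
    then show "\<exists>U. open U \<and> z \<in> U \<and> smooth_on U (\<lambda>z. f (chart_inv c z))"
      using chart_image_openin[OF c W'(1)] x c unfolding smooth_fn_def by blast
  qed
qed

text \<open>In any other chart the function is its expression in \<open>c\<close> composed with a
  transition map.\<close>

lemma smooth_fn_chartI:
  fixes f :: "'a \<Rightarrow> 'f::real_normed_vector"
  assumes "c \<in> charts M" "W \<subseteq> fst c" "openin (mtop M) W" "smooth_on (snd c ` W) (\<lambda>z. f (chart_inv c z))"
  shows "smooth_fn M W f"
  unfolding smooth_fn_def
proof
  fix d assume d: "d \<in> charts M"
  let ?S = "snd d ` (fst d \<inter> W)"
  have S: "open ?S" by (rule chart_image_openin[OF d assms(3)])
  have T: "open (snd c ` W)" using chart_image_openin[OF assms(1,3)] assms(2) by (simp add: Int_absorb1)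
  have "smooth_on ?S (\<lambda>z. f (chart_inv c (transition d c z)))"
    by (rule smooth_on_compose[OF S T smooth_on_subset[OF transition_smooth[OF d assms(1)]] assms(4)])
       (use assms(2) d in \<open>auto simp: transition_def\<close>)
  then show "smooth_on ?S (\<lambda>z. f (chart_inv d z))"
    by (rule smooth_on_cong[OF S, rotated]) (use assms(1,2) d in \<open>auto simp: transition_def\<close>)
qed

lemma smooth_fn_chart: "c \<in> charts M \<Longrightarrow> smooth_fn M (fst c) (snd c)"
proof (rule smooth_fn_chartI)
  assume c: "c \<in> charts M"
  show "smooth_on (snd c ` fst c) (\<lambda>z. snd c (chart_inv c z))"
    by (rule smooth_on_cong[OF chart_image_open[OF c] _ smooth_on_id[OF chart_image_open[OF c]]])
       (simp add: chart_inv_right)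
qed (auto simp: chart_openin)

lemma smooth_fn_const [simp]: "openin (mtop M) W \<Longrightarrow> smooth_fn M W (\<lambda>x. c)"
  by (auto simp: smooth_fn_def intro!: smooth_on_const chart_image_openin)

lemma smooth_fn_add:
  "openin (mtop M) W \<Longrightarrow> smooth_fn M W f \<Longrightarrow> smooth_fn M W g \<Longrightarrow> smooth_fn M W (\<lambda>x. f x + g x)"
  by (auto simp: smooth_fn_def intro!: smooth_on_add chart_image_openin)

lemma smooth_fn_mult:
  fixes f g :: "'a \<Rightarrow> real"
  shows "openin (mtop M) W \<Longrightarrow> smooth_fn M W f \<Longrightarrow> smooth_fn M W g \<Longrightarrow> smooth_fn M W (\<lambda>x. f x * g x)"
  by (auto simp: smooth_fn_def intro!: smooth_on_mult chart_image_openin)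

lemma smooth_fn_scaleR:
  "openin (mtop M) W \<Longrightarrow> smooth_fn M W f \<Longrightarrow> smooth_fn M W g \<Longrightarrow> smooth_fn M W (\<lambda>x. f x *\<^sub>R g x)"
  by (auto simp: smooth_fn_def intro!: smooth_on_scaleR chart_image_openin)

lemma smooth_fn_sum:
  "openin (mtop M) W \<Longrightarrow> (\<And>i. i \<in> I \<Longrightarrow> smooth_fn M W (f i)) \<Longrightarrow> smooth_fn M W (\<lambda>x. \<Sum>i\<in>I. f i x)"
  by (auto simp: smooth_fn_def intro!: smooth_on_sum chart_image_openin)

lemma smooth_fn_prod:
  fixes f :: "'i \<Rightarrow> 'a \<Rightarrow> real"
  shows "openin (mtop M) W \<Longrightarrow> (\<And>i. i \<in> I \<Longrightarrow> smooth_fn M W (f i)) \<Longrightarrow> smooth_fn M W (\<lambda>x. \<Prod>i\<in>I. f i x)"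
  by (auto simp: smooth_fn_def intro!: smooth_on_prod chart_image_openin)

lemma smooth_fn_divide:
  fixes f g :: "'a \<Rightarrow> real"
  assumes "openin (mtop M) W" "smooth_fn M W f" "smooth_fn M W g" "\<And>x. x \<in> W \<Longrightarrow> g x \<noteq> 0"
  shows "smooth_fn M W (\<lambda>x. f x / g x)"
  unfolding smooth_fn_def
proof
  fix c assume c: "c \<in> charts M"
  show "smooth_on (snd c ` (fst c \<inter> W)) (\<lambda>z. f (chart_inv c z) / g (chart_inv c z))"
    by (rule smooth_on_divide[OF chart_image_openin[OF c assms(1)]]) (use assms c in \<open>auto simp: smooth_fn_def\<close>)
qed

lemma smooth_fn_compose:
  fixes f :: "'a \<Rightarrow> 'f::euclidean_space" and \<psi> :: "'f \<Rightarrow> 'g::real_normed_vector"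
  assumes "openin (mtop M) W" "smooth_fn M W f" "open T" "smooth_on T \<psi>" "\<And>x. x \<in> W \<Longrightarrow> f x \<in> T"
  shows "smooth_fn M W (\<lambda>x. \<psi> (f x))"
  unfolding smooth_fn_def
proof
  fix c assume c: "c \<in> charts M"
  show "smooth_on (snd c ` (fst c \<inter> W)) (\<lambda>z. \<psi> (f (chart_inv c z)))"
    by (rule smooth_on_compose[OF chart_image_openin[OF c assms(1)] assms(3) _ assms(4)])
       (use assms c in \<open>auto simp: smooth_fn_def\<close>)
qed

lemma smooth_fn_vec_iff:
  fixes f :: "'a \<Rightarrow> real^'n"
  assumes "openin (mtop M) W"
  shows "smooth_fn M W f \<longleftrightarrow> (\<forall>i. smooth_fn M W (\<lambda>x. f x $ i))"
proof -
  have "smooth_on (snd c ` (fst c \<inter> W)) (\<lambda>z. f (chart_inv c z)) \<longleftrightarrow>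
      (\<forall>i. smooth_on (snd c ` (fst c \<inter> W)) (\<lambda>z. f (chart_inv c z) $ i))" if "c \<in> charts M" for c
    by (rule smooth_on_vec_iff[OF chart_image_openin[OF that assms]])
  then show ?thesis unfolding smooth_fn_def by blast
qed

lemma smooth_fn_continuous:
  assumes "openin (mtop M) W" "smooth_fn M W f"
  shows "continuous_map (subtopology (mtop M) W) euclidean f"
proof -
  have Wsub: "W \<subseteq> points M" using assms(1) openin_subset by blast
  have loc: "continuous_map (subtopology (mtop M) (fst c \<inter> W)) euclidean f" if c: "c \<in> charts M" for c
  proof -
    have 1: "continuous_map (subtopology (mtop M) (fst c \<inter> W)) (top_of_set (snd c ` (fst c \<inter> W))) (snd c)"
      using continuous_map_from_subtopology_mono[OF chart_continuous[OF c], of "fst c \<inter> W"]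
      by (auto simp: continuous_map_in_subtopology)
    have 2: "continuous_map (top_of_set (snd c ` (fst c \<inter> W))) euclidean (\<lambda>z. f (chart_inv c z))"
      using assms(2) c smooth_on_imp_continuous_on unfolding smooth_fn_def by auto
    show ?thesis
      by (rule continuous_map_eq[OF continuous_map_compose[OF 1 2]]) (use c in auto)
  qed
  show ?thesis
  proof (rule pasting_lemma)
    fix c assume c: "c \<in> charts M"
    show "openin (subtopology (mtop M) W) (fst c \<inter> W)"
      using chart_openin[OF c] by (metis inf_commute openin_subtopology_Int)
    show "continuous_map (subtopology (subtopology (mtop M) W) (fst c \<inter> W)) euclidean f"
      using loc[OF c] by (simp add: subtopology_subtopology Int_absorb1 Int_commute)
  next
    fix x assume "x \<in> topspace (subtopology (mtop M) W)"
    then show "\<exists>j. j \<in> charts M \<and> x \<in> fst j \<inter> W \<and> f x = f x" using chart_cover[of x] Wsub by fastforce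
  qed auto
qed

lemma chart_deriv_change:
  assumes "openin (mtop M) W" "smooth_fn M W f" "c \<in> charts M" "d \<in> charts M" "x \<in> fst c" "x \<in> fst d" "x \<in> W"
  shows "chart_deriv c f x v = chart_deriv d f x (frechet_derivative (transition c d) (at (snd c x)) v)"
proof -
  have fd: "((\<lambda>z. f (chart_inv d z)) has_derivative chart_deriv d f x) (at (transition c d (snd c x)))"
    unfolding chart_deriv_def transition_apply[OF assms(3,5)]
    by (rule smooth_on_has_derivative[of "snd d ` (fst d \<inter> W)"]) (use assms in \<open>auto simp: smooth_fn_def\<close>)
  have "((\<lambda>z. f (chart_inv d (transition c d z))) has_derivative
      (\<lambda>v. chart_deriv d f x (frechet_derivative (transition c d) (at (snd c x)) v))) (at (snd c x))"
    by (rule has_derivative_compose[OF transition_has_derivative fd]) (use assms in auto)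
  then have "((\<lambda>z. f (chart_inv c z)) has_derivative
      (\<lambda>v. chart_deriv d f x (frechet_derivative (transition c d) (at (snd c x)) v))) (at (snd c x))"
    by (rule has_derivative_transform_within_open[OF _ transition_open[OF assms(3,4)]])
       (use assms in \<open>auto simp: transition_def\<close>)
  from frechet_derivative_at[OF this, symmetric] show ?thesis by (simp add: chart_deriv_def)
qed

text \<open>The change rule is applied to the coordinate map of \<open>c\<close>, whose derivative
  in the chart \<open>c\<close> is the identity.\<close>

lemma transition_derivative_inverse:
  assumes "c \<in> charts M" "d \<in> charts M" "x \<in> fst c" "x \<in> fst d"
  shows "frechet_derivative (transition d c) (at (snd d x)) (frechet_derivative (transition c d) (at (snd c x)) v) = v"
proof -
  have "smooth_fn M (fst c) (snd c)" using assms by (intro smooth_fn_chart)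
  from chart_deriv_change[OF chart_openin[OF assms(1)] this assms(1,2,3,4,3), of v]
  have "chart_deriv c (snd c) x v = chart_deriv d (snd c) x (frechet_derivative (transition c d) (at (snd c x)) v)" .
  moreover have "chart_deriv d (snd c) x = frechet_derivative (transition d c) (at (snd d x))"
    by (simp add: chart_deriv_def transition_def comp_def)
  moreover have "chart_deriv c (snd c) x v = v"
  proof -
    have "((\<lambda>z. z) has_derivative (\<lambda>v. v)) (at (snd c x))" by (rule has_derivative_ident)
    then have "((\<lambda>z. snd c (chart_inv c z)) has_derivative (\<lambda>v. v)) (at (snd c x))"
      by (rule has_derivative_transform_within_open[OF _ chart_image_open[OF assms(1)]])
         (use assms in \<open>auto simp: chart_inv_right\<close>)
    from frechet_derivative_at[OF this, symmetric] show ?thesis by (simp add: chart_deriv_def)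
  qed
  ultimately show ?thesis by simp
qed

lemma chart_deriv_has_derivative:
  assumes "smooth_fn M W f" "c \<in> charts M" "x \<in> fst c" "x \<in> W"
  shows "((\<lambda>z. f (chart_inv c z)) has_derivative chart_deriv c f x) (at (snd c x))"
  unfolding chart_deriv_def
  by (rule smooth_on_has_derivative[of "snd c ` (fst c \<inter> W)"]) (use assms in \<open>auto simp: smooth_fn_def\<close>)

lemma chart_deriv_linear:
  assumes "smooth_fn M W f" "c \<in> charts M" "x \<in> fst c" "x \<in> W"
  shows "linear (chart_deriv c f x)"
  using chart_deriv_has_derivative[OF assms] has_derivative_linear by blast

lemma chart_deriv_eqI:
  assumes "((\<lambda>z. f (chart_inv c z)) has_derivative D) (at (snd c x))"
  shows "chart_deriv c f x = D"
  using frechet_derivative_at[OF assms] by (simp add: chart_deriv_def)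

lemma chart_deriv_cong:
  assumes "openin (mtop M) W" "c \<in> charts M" "x \<in> fst c" "x \<in> W" "smooth_fn M W f" "\<And>y. y \<in> W \<Longrightarrow> f y = g y"
  shows "chart_deriv c f x = chart_deriv c g x"
proof (rule chart_deriv_eqI[symmetric])
  show "((\<lambda>z. g (chart_inv c z)) has_derivative chart_deriv c f x) (at (snd c x))"
    by (rule has_derivative_transform_within_open[OF chart_deriv_has_derivative[OF assms(5,2,3,4)]
          chart_image_openin[OF assms(2,1)]]) (use assms in auto)
qed

lemma smooth_fn_chart_deriv:
  assumes "openin (mtop M) W" "smooth_fn M W f" "c \<in> charts M"
  shows "smooth_fn M (fst c \<inter> W) (\<lambda>x. chart_deriv c f x v)"
proof (rule smooth_fn_chartI[OF assms(3)])
  show "openin (mtop M) (fst c \<inter> W)" using assms chart_openin by blast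
  have "smooth_on (snd c ` (fst c \<inter> W)) (\<lambda>z. f (chart_inv c z))"
    using assms by (auto simp: smooth_fn_def)
  from smooth_on_frechet_derivative[OF this, of v]
  show "smooth_on (snd c ` (fst c \<inter> W)) (\<lambda>z. chart_deriv c f (chart_inv c z) v)"
    by (rule smooth_on_cong[OF chart_image_openin[OF assms(3,1)], rotated])
       (use assms(3) in \<open>auto simp: chart_deriv_def\<close>)
qed auto

end

lemma (in manifold) coord_vec_bij:
  assumes "c \<in> charts M" "x \<in> fst c"
  shows "linear (coord_vec M c x)" "bij (coord_vec M c x)"
proof -
  have x: "x \<in> points M" using chart_subset assms by blast
  note ca = chart_at[OF x]
  show "linear (coord_vec M c x)"
    unfolding coord_vec_def using has_derivative_linear[OF transition_has_derivative[OF assms(1) ca(1) assms(2) ca(2)]] .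
  show "bij (coord_vec M c x)"
    unfolding coord_vec_def
    by (rule o_bij[of "frechet_derivative (transition (chart_at M x) c) (at (snd (chart_at M x) x))"])
       (auto simp: fun_eq_iff transition_derivative_inverse assms ca)
qed

lemma (in manifold) chart_deriv_coord_vec:
  assumes "openin (mtop M) W" "smooth_fn M W f" "c \<in> charts M" "x \<in> fst c" "x \<in> W"
  shows "chart_deriv c f x v = chart_deriv (chart_at M x) f x (coord_vec M c x v)"
proof -
  have x: "x \<in> points M" using chart_subset assms by blast
  show ?thesis unfolding coord_vec_def by (rule chart_deriv_change[OF assms(1-3) chart_at(1)[OF x] assms(4) chart_at(2)[OF x] assms(5)])
qed

section \<open>Maps between manifolds\<close>

locale manifold_pair = manifold M + N: manifold N
  for M :: "('a, 'e::euclidean_space) mfd" and N :: "('b, 'f::euclidean_space) mfd"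
begin

text \<open>\<open>mderiv\<close> refers to the preferred chart at \<open>u x\<close>, which may
  jump from point to point. Here one chart \<open>d\<close> of the target serves a whole open set,
  at the price of a conversion by \<open>coord_vec\<close>.\<close>

lemma mderiv_chart:
  assumes "openin (mtop M) W" "d \<in> charts N" "\<And>y. y \<in> W \<Longrightarrow> u y \<in> fst d" "smooth_fn M W (\<lambda>y. snd d (u y))" "x \<in> W"
  shows "mderiv M N u x v = coord_vec N d (u x) (chart_deriv (chart_at M x) (\<lambda>y. snd d (u y)) x v)"
proof -
  have x: "x \<in> points M" using assms(1,5) openin_subset by blast
  note c = chart_at[OF x]
  have ux: "u x \<in> points N" using assms N.chart_subset by blast
  note d' = N.chart_at[OF ux]
  let ?c = "chart_at M x" let ?d = "chart_at N (u x)"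
  have 1: "((\<lambda>z. snd d (u (chart_inv ?c z))) has_derivative chart_deriv ?c (\<lambda>y. snd d (u y)) x) (at (snd ?c x))"
    by (rule chart_deriv_has_derivative[OF assms(4) c assms(5)])
  have 2: "(transition d ?d has_derivative coord_vec N d (u x)) (at (snd d (u (chart_inv ?c (snd ?c x)))))"
    using N.transition_has_derivative[OF assms(2) d'(1) _ d'(2)] assms(3,5) c by (simp add: coord_vec_def)
  have "((\<lambda>z. transition d ?d (snd d (u (chart_inv ?c z)))) has_derivative
     (\<lambda>v. coord_vec N d (u x) (chart_deriv ?c (\<lambda>y. snd d (u y)) x v))) (at (snd ?c x))"
    by (rule has_derivative_compose[OF 1 2])
  then have "(snd ?d \<circ> u \<circ> chart_inv ?c has_derivative
     (\<lambda>v. coord_vec N d (u x) (chart_deriv ?c (\<lambda>y. snd d (u y)) x v))) (at (snd ?c x))"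
    by (rule has_derivative_transform_within_open[OF _ chart_image_openin[OF c(1) assms(1)]])
       (use assms c in \<open>auto simp: N.transition_apply\<close>)
  from frechet_derivative_at[OF this, symmetric] show ?thesis by (simp add: mderiv_def)
qed

lemma smooth_map_preimage_openin:
  assumes "smooth_map M N u" "openin (mtop N) Q"
  shows "openin (mtop M) {x \<in> points M. u x \<in> Q}"
  using assms openin_continuous_map_preimage unfolding smooth_map_def by blast

lemma smooth_map_points: "smooth_map M N u \<Longrightarrow> x \<in> points M \<Longrightarrow> u x \<in> points N"
  unfolding smooth_map_def continuous_map_def by blast

lemma smooth_map_fn:
  assumes "smooth_map M N u" "d \<in> charts N"
  shows "smooth_fn M {x \<in> points M. u x \<in> fst d} (\<lambda>x. snd d (u x))"
  unfolding smooth_fn_def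
proof
  fix c assume c: "c \<in> charts M"
  have "fst c \<inter> {x \<in> points M. u x \<in> fst d} = fst c \<inter> u -` fst d" using chart_subset[OF c] by auto
  then show "smooth_on (snd c ` (fst c \<inter> {x \<in> points M. u x \<in> fst d})) (\<lambda>z. snd d (u (chart_inv c z)))"
    using assms c by (auto simp: smooth_map_def comp_def)
qed

end

section \<open>The inner product of differentials\<close>

locale riemannian_manifold = manifold M for M :: "('a, real^'m) mfd" +
  fixes g :: "'a \<Rightarrow> real^'m \<Rightarrow> real^'m \<Rightarrow> real"
  assumes metric: "riemannian_metric M g"
begin

lemma metric_inner: "x \<in> points M \<Longrightarrow> inner_product_form (g x)"
  using metric by (simp add: riemannian_metric_def inner_product_form_def)

definition grad_vec :: "('a, real^'m) chart \<Rightarrow> ('a \<Rightarrow> real) \<Rightarrow> 'a \<Rightarrow> real^'m" where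
  "grad_vec c f x = (\<chi> i. chart_deriv c f x (axis i 1))"

text \<open>The inner product of the differentials of \<open>f\<close> and \<open>h\<close>,
  equivalently of their gradients. It allows gradient fields to be handled as derivations on
  functions.\<close>

definition Gam :: "('a \<Rightarrow> real) \<Rightarrow> ('a \<Rightarrow> real) \<Rightarrow> 'a \<Rightarrow> real" where
  "Gam f h x = dual_inner (inner_matrix (g x)) (grad_vec (chart_at M x) f x) (grad_vec (chart_at M x) h x)"

lemma linear_eq_inner_axis:
  fixes L :: "real^'m \<Rightarrow> real"
  assumes "linear L" shows "L v = (\<chi> i. L (axis i 1)) \<bullet> v"
proof -
  have "L v = L (\<Sum>i\<in>UNIV. v $ i *\<^sub>R axis i 1)" using basis_expansion[of v] by (simp add: scalar_mult_eq_scaleR)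
  then show ?thesis by (simp add: linear_sum[OF assms] linear_scale[OF assms] inner_vec_def mult.commute)
qed

text \<open>An instance of \<open>dual_inner_change_basis\<close>, with \<open>P\<close> the matrix
  of \<open>coord_vec\<close>.\<close>

lemma Gam_chart:
  assumes "openin (mtop M) W" "smooth_fn M W f" "smooth_fn M W h" "c \<in> charts M" "x \<in> fst c" "x \<in> W"
  shows "Gam f h x = dual_inner (gram M g c x) (grad_vec c f x) (grad_vec c h x)"
proof -
  have x: "x \<in> points M" using chart_subset assms by blast
  define P where "P = matrix (coord_vec M c x)"
  have lin: "linear (coord_vec M c x)" and bij: "bij (coord_vec M c x)" using coord_vec_bij assms by auto
  have P: "P *v v = coord_vec M c x v" for v unfolding P_def using matrix_works[of "coord_vec M c x" v] lin by (simp add: linear_matrix_vector_mul_eq)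
  have "surj ((*v) P)" using bij by (simp add: P bij_is_surj)
  then have invP: "invertible P" by (metis invertible_right_inverse matrix_right_invertible_surjective)
  have grad: "grad_vec c f x = transpose P *v grad_vec (chart_at M x) f x" if f: "smooth_fn M W f" for f
  proof -
    have l: "linear (chart_deriv (chart_at M x) f x)" by (rule chart_deriv_linear[OF f chart_at[OF x] assms(6)])
    have "grad_vec c f x $ i = (transpose P *v grad_vec (chart_at M x) f x) $ i" for i
    proof -
      have "grad_vec c f x $ i = chart_deriv (chart_at M x) f x (P *v axis i 1)"
        using chart_deriv_coord_vec[OF assms(1) f assms(4-6)] by (simp add: grad_vec_def P)
      also have "\<dots> = grad_vec (chart_at M x) f x \<bullet> (P *v axis i 1)"
        by (subst linear_eq_inner_axis[OF l]) (simp add: grad_vec_def)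
      also have "\<dots> = (transpose P *v grad_vec (chart_at M x) f x) \<bullet> axis i 1"
        by (metis dot_lmul_matrix transpose_matrix_vector)
      finally show ?thesis by (simp add: inner_axis)
    qed
    then show ?thesis by (simp add: vec_eq_iff)
  qed
  have gram: "gram M g c x = transpose P ** inner_matrix (g x) ** P"
  proof -
    have "gram M g c x $ i $ j = (transpose P ** inner_matrix (g x) ** P) $ i $ j" for i j
    proof -
      have "gram M g c x $ i $ j = (P *v axis i 1) \<bullet> (inner_matrix (g x) *v (P *v axis j 1))"
        by (simp add: gram_def P inner_matrix_eq[OF metric_inner[OF x]])
      also have "\<dots> = axis i 1 \<bullet> (transpose P *v (inner_matrix (g x) *v (P *v axis j 1)))"
        by (metis dot_lmul_matrix transpose_matrix_vector transpose_transpose)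
      also have "\<dots> = axis i 1 \<bullet> ((transpose P ** inner_matrix (g x) ** P) *v axis j 1)"
        by (simp add: matrix_vector_mul_assoc matrix_mul_assoc)
      finally show ?thesis by (simp add: inner_axis' matrix_vector_mult_basis[of "_ ** _"] column_def)
    qed
    then show ?thesis by (simp add: vec_eq_iff)
  qed
  show ?thesis
    unfolding Gam_def grad[OF assms(2)] grad[OF assms(3)] gram
    by (rule dual_inner_change_basis[symmetric, OF invP invertible_inner_matrix[OF metric_inner[OF x]]])
qed

lemma gram_invertible:
  assumes "c \<in> charts M" "x \<in> fst c"
  shows "inner_product_form (\<lambda>v w. g x (coord_vec M c x v) (coord_vec M c x w))"
    "gram M g c x = inner_matrix (\<lambda>v w. g x (coord_vec M c x v) (coord_vec M c x w))"
proof -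
  have x: "x \<in> points M" using chart_subset assms by blast
  have lin: "linear (coord_vec M c x)" and bij: "bij (coord_vec M c x)" using coord_vec_bij assms by auto
  have bl: "linear (g x v)" "linear (\<lambda>v. g x v w)" for v w using metric_inner[OF x] by (auto simp: inner_product_form_def bilinear_def)
  have "coord_vec M c x v \<noteq> 0" if "v \<noteq> 0" for v
    using that bij linear_0[OF lin] by (metis bij_is_inj injD)
  then show "inner_product_form (\<lambda>v w. g x (coord_vec M c x v) (coord_vec M c x w))"
    using metric_inner[OF x] linear_compose[OF lin bl(1)] linear_compose[OF lin bl(2)]
    by (auto simp: inner_product_form_def bilinear_def comp_def)
  show "gram M g c x = inner_matrix (\<lambda>v w. g x (coord_vec M c x v) (coord_vec M c x w))"
    by (simp add: gram_def inner_matrix_def)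
qed

lemma smooth_gram: "c \<in> charts M \<Longrightarrow> smooth_fn M (fst c) (\<lambda>x. gram M g c x $ i $ j)"
  using metric by (intro smooth_fn_chartI) (auto simp: riemannian_metric_def gram_def chart_openin)

text \<open>\<open>chart_at M x\<close> depends on \<open>x\<close> without any continuity, so
  smoothness is read off from \<open>Gam_chart\<close> in a fixed chart.\<close>

lemma smooth_Gam:
  assumes "openin (mtop M) W" "smooth_fn M W f" "smooth_fn M W h"
  shows "smooth_fn M W (Gam f h)"
proof (rule smooth_fn_local)
  fix x assume "x \<in> W"
  then obtain c where c: "c \<in> charts M" "x \<in> fst c"
    using assms(1) openin_subset chart_cover by blast
  have op: "openin (mtop M) (fst c \<inter> W)" using assms chart_openin c by blast
  let ?S = "snd c ` (fst c \<inter> W)"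
  have S: "open ?S" by (rule chart_image_openin[OF c(1) assms(1)])
  have "smooth_on ?S (\<lambda>z. matrix_inv (gram M g c (chart_inv c z)) $ i $ j)" for i j
  proof (rule smooth_on_matrix_inv[OF S])
    show "smooth_on ?S (\<lambda>z. gram M g c (chart_inv c z) $ i $ j)" for i j
      using smooth_fn_subset[OF smooth_gram[OF c(1)], of "fst c \<inter> W" i j] c(1) by (auto simp: smooth_fn_def Int_absorb1)
    show "invertible (gram M g c (chart_inv c z))" if "z \<in> ?S" for z
    proof -
      from that obtain x where x: "x \<in> fst c" "z = snd c x" by blast
      show ?thesis
        using gram_invertible[OF c(1) x(1)] c(1) x invertible_inner_matrix by simp
    qed
  qed
  then have inv: "smooth_fn M (fst c \<inter> W) (\<lambda>x. matrix_inv (gram M g c x) $ i $ j)" for i j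
    by (intro smooth_fn_chartI[OF c(1) _ op]) auto
  have gr: "smooth_fn M (fst c \<inter> W) (\<lambda>x. grad_vec c f x $ i)" if "smooth_fn M W f" for f i
    using smooth_fn_chart_deriv[OF assms(1) that c(1)] by (simp add: grad_vec_def)
  have "smooth_fn M (fst c \<inter> W) (\<lambda>x. \<Sum>i\<in>UNIV. grad_vec c f x $ i * (\<Sum>j\<in>UNIV. matrix_inv (gram M g c x) $ i $ j * grad_vec c h x $ j))"
    by (intro smooth_fn_sum smooth_fn_mult op inv gr assms)
  then have "smooth_fn M (fst c \<inter> W) (Gam f h)"
    by (rule smooth_fn_cong[OF op, rotated])
       (use Gam_chart[OF assms c(1)] in \<open>auto simp: dual_inner_def inner_vec_def matrix_vector_mult_def\<close>)
  then show "\<exists>W'. openin (mtop M) W' \<and> x \<in> W' \<and> smooth_fn M W' (Gam f h)"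
    using op c \<open>x \<in> W\<close> by blast
qed

end

section \<open>Change of variables for arbitrary finite index types\<close>

text \<open>The library proves the change of variables formula for well-ordered index types only;
  every finite type has a well-ordered copy.\<close>

typedef 'a wo = "UNIV :: 'a set" morphisms of_wo to_wo by auto

lemma of_wo_to_wo [simp]: "of_wo (to_wo x) = x" "to_wo (of_wo y) = y"
  by (simp_all add: to_wo_inverse of_wo_inverse)

instance wo :: (finite) finite
proof
  have "UNIV = range (to_wo :: 'a \<Rightarrow> 'a wo)" by (metis of_wo_to_wo(2) surj_def)
  then show "finite (UNIV :: 'a wo set)" by (metis finite_class.finite_UNIV finite_imageI)
qed

instantiation wo :: (finite) wellorder
begin

definition "x \<le> y \<longleftrightarrow> to_nat (of_wo x) \<le> to_nat (of_wo y)"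
definition "x < y \<longleftrightarrow> to_nat (of_wo x) < to_nat (of_wo y)"

instance
proof
  fix P :: "'a wo \<Rightarrow> bool" and a
  assume *: "\<And>x. (\<And>y. y < x \<Longrightarrow> P y) \<Longrightarrow> P x"
  show "P a"
    by (induction "to_nat (of_wo a)" arbitrary: a rule: less_induct) (metis * less_wo_def)
qed (auto simp: less_eq_wo_def less_wo_def of_wo_inject)

end

definition to_wo_vec :: "real^'m \<Rightarrow> real^('m wo)" where "to_wo_vec x = (\<chi> i. x $ of_wo i)"
definition of_wo_vec :: "real^('m wo) \<Rightarrow> real^'m" where "of_wo_vec x = (\<chi> i. x $ to_wo i)"

lemma wo_vec_inverse [simp]: "of_wo_vec (to_wo_vec x) = x" "to_wo_vec (of_wo_vec y) = y"
  by (simp_all add: to_wo_vec_def of_wo_vec_def vec_eq_iff)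

lemma bounded_linear_wo_vec: "bounded_linear (to_wo_vec :: real^'m \<Rightarrow> real^('m wo))"
    "bounded_linear (of_wo_vec :: real^('m wo) \<Rightarrow> real^'m)"
  by (auto simp: linear_conv_bounded_linear[symmetric] to_wo_vec_def of_wo_vec_def linear_iff vec_eq_iff)

lemma measurable_wo_vec [measurable]: "(to_wo_vec :: real^'m \<Rightarrow> _) \<in> borel_measurable borel"
    "(of_wo_vec :: real^('m wo) \<Rightarrow> real^'m) \<in> borel_measurable borel"
  using bounded_linear_wo_vec linear_continuous_on borel_measurable_continuous_onI by blast+

lemma bij_of_wo: "bij (of_wo :: 'a wo \<Rightarrow> 'a)" "bij (to_wo :: 'a \<Rightarrow> 'a wo)"
  by (rule o_bij[of to_wo], auto) (rule o_bij[of of_wo], auto)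

text \<open>Reindexing maps boxes to boxes with the same product of side lengths, and this
  determines Lebesgue measure.\<close>

lemma lborel_wo: "(lborel :: (real^'m) measure) = distr lborel borel of_wo_vec"
proof (rule lborel_eqI)
  fix l u :: "real^'m"
  assume le: "\<And>b. b \<in> Basis \<Longrightarrow> l \<bullet> b \<le> u \<bullet> b"
  have le': "l $ i \<le> u $ i" for i using le[of "axis i 1"] by (simp add: inner_axis axis_in_Basis_iff)
  have vim: "of_wo_vec -` box l u = box (to_wo_vec l) (to_wo_vec u)"
  proof -
    have "(\<forall>i. P (of_wo i) i) \<longleftrightarrow> (\<forall>i. P i (to_wo i))" for P :: "'m \<Rightarrow> 'm wo \<Rightarrow> bool"
      by (metis of_wo_to_wo)
    from this[of "\<lambda>i j. l $ i < x $ j \<and> x $ j < u $ i" for x]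
    show ?thesis by (auto simp: mem_box_cart of_wo_vec_def to_wo_vec_def)
  qed
  have "emeasure (distr lborel borel of_wo_vec) (box l u) = emeasure lborel (box (to_wo_vec l) (to_wo_vec u))"
    by (subst emeasure_distr) (auto simp: vim)
  also have "\<dots> = (\<Prod>b\<in>Basis. (to_wo_vec u - to_wo_vec l) \<bullet> b)"
    by (rule emeasure_lborel_box) (auto simp: Basis_vec_def inner_axis to_wo_vec_def le')
  also have "(\<Prod>b\<in>Basis. (to_wo_vec u - to_wo_vec l) \<bullet> b) = (\<Prod>i\<in>UNIV. u $ of_wo i - l $ of_wo i)"
  proof -
    have B: "(Basis :: (real^('m wo)) set) = range (\<lambda>i. axis i 1)" by (auto simp: Basis_vec_def)
    show ?thesis unfolding B by (subst prod.reindex) (auto simp: inj_on_def axis_eq_axis inner_axis to_wo_vec_def)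
  qed
  also have "\<dots> = (\<Prod>i\<in>UNIV. u $ i - l $ i)" by (rule prod.reindex_bij_betw[OF bij_of_wo(1)])
  also have "\<dots> = (\<Prod>b\<in>Basis. (u - l) \<bullet> b)"
  proof -
    have B: "(Basis :: (real^'m) set) = range (\<lambda>i. axis i 1)" by (auto simp: Basis_vec_def)
    show ?thesis unfolding B by (subst prod.reindex) (auto simp: inj_on_def axis_eq_axis inner_axis)
  qed
  finally show "emeasure (distr lborel borel of_wo_vec) (box l u) = ennreal (\<Prod>b\<in>Basis. (u - l) \<bullet> b)" .
qed simp

text \<open>Conjugation by the bijection \<open>to_wo\<close> is a bijection between the
  permutations of the two types and preserves signs.\<close>

lemma det_wo:
  fixes A :: "real^'m^'m"
  shows "det (\<chi> i j. A $ of_wo i $ of_wo j) = det A"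
proof -
  let ?P = "{p. p permutes (UNIV :: 'm set)}" and ?Q = "{p. p permutes (UNIV :: 'm wo set)}"
  define \<Phi> :: "('m \<Rightarrow> 'm) \<Rightarrow> 'm wo \<Rightarrow> 'm wo" where "\<Phi> p = to_wo \<circ> p \<circ> of_wo" for p
  have \<Phi>: "\<Phi> p = map_permutation UNIV to_wo p" for p
  proof -
    have "inv_into UNIV to_wo = (of_wo :: 'm wo \<Rightarrow> 'm)" by (rule inv_unique_comp) (auto simp: fun_eq_iff)
    moreover have "range (to_wo :: 'm \<Rightarrow> 'm wo) = UNIV" using bij_is_surj[OF bij_of_wo(2)] .
    ultimately show ?thesis by (simp add: \<Phi>_def map_permutation_def restrict_id_def fun_eq_iff)
  qed
  have bij: "bij_betw \<Phi> ?P ?Q"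
  proof (rule bij_betwI[where g="\<lambda>q. of_wo \<circ> q \<circ> to_wo"])
    show "\<Phi> \<in> ?P \<rightarrow> ?Q"
    proof
      fix p :: "'m \<Rightarrow> 'm" assume "p \<in> ?P"
      then have "bij (\<Phi> p)" unfolding \<Phi>_def by (intro bij_comp bij_of_wo permutes_bij[of p UNIV]) simp
      then show "\<Phi> p \<in> ?Q" using bij_imp_permutes[of "\<Phi> p" UNIV] by simp
    qed
    show "(\<lambda>q. of_wo \<circ> q \<circ> to_wo) \<in> ?Q \<rightarrow> ?P"
    proof
      fix q :: "'m wo \<Rightarrow> 'm wo" assume "q \<in> ?Q"
      then have "bij (of_wo \<circ> q \<circ> to_wo)" by (intro bij_comp bij_of_wo permutes_bij[of q UNIV]) simp
      then show "of_wo \<circ> q \<circ> to_wo \<in> ?P" using bij_imp_permutes[of "of_wo \<circ> q \<circ> to_wo" UNIV] by simp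
    qed
  qed (auto simp: \<Phi>_def fun_eq_iff)
  have "det (\<chi> i j. A $ of_wo i $ of_wo j) = (\<Sum>q\<in>?Q. of_int (sign q) * (\<Prod>i\<in>UNIV. A $ of_wo i $ of_wo (q i)))"
    by (simp add: det_def)
  also have "\<dots> = (\<Sum>p\<in>?P. of_int (sign (\<Phi> p)) * (\<Prod>i\<in>UNIV. A $ of_wo i $ of_wo (\<Phi> p i)))"
    by (rule sum.reindex_bij_betw[OF bij, symmetric])
  also have "\<dots> = (\<Sum>p\<in>?P. of_int (sign p) * (\<Prod>i\<in>UNIV. A $ i $ p i))"
  proof (intro sum.cong refl)
    fix p assume "p \<in> ?P"
    then have "sign (\<Phi> p) = sign p" unfolding \<Phi> by (intro sign_map_permutation) (use bij_of_wo in \<open>auto simp: bij_def\<close>)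
    moreover have "(\<Prod>i\<in>UNIV. A $ of_wo i $ of_wo (\<Phi> p i)) = (\<Prod>i\<in>UNIV. A $ i $ p i)"
      using prod.reindex_bij_betw[OF bij_of_wo(1), of "\<lambda>i. A $ i $ p i"] by (simp add: \<Phi>_def)
    ultimately show "of_int (sign (\<Phi> p)) * (\<Prod>i\<in>UNIV. A $ of_wo i $ of_wo (\<Phi> p i)) = of_int (sign p) * (\<Prod>i\<in>UNIV. A $ i $ p i)"
      by simp
  qed
  finally show ?thesis by (simp add: det_def)
qed

text \<open>The formula for absolutely integrable functions says that one side is integrable with
  integral \<open>b\<close> iff the other is. For nonnegative measurable integrands this settles the
  finite case, and otherwise both integrals are infinite.\<close>

lemma nn_integral_change_of_variables_wo:
  fixes g :: "real^'m::{finite,wellorder} \<Rightarrow> real^'m::_" and f :: "real^'m::_ \<Rightarrow> real"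
  assumes S: "S \<in> sets borel"
    and der: "\<And>x. x \<in> S \<Longrightarrow> (g has_derivative g' x) (at x within S)" and inj: "inj_on g S"
    and f: "\<And>y. f y \<ge> 0"
    and m1: "(\<lambda>y. f y * indicator (g ` S) y) \<in> borel_measurable borel"
    and m2: "(\<lambda>x. \<bar>det (matrix (g' x))\<bar> * f (g x) * indicator S x) \<in> borel_measurable borel"
  shows "(\<integral>\<^sup>+ x. ennreal (\<bar>det (matrix (g' x))\<bar> * f (g x) * indicator S x) \<partial>lborel)
       = (\<integral>\<^sup>+ y. ennreal (f y * indicator (g ` S) y) \<partial>lborel)"
proof -
  define D where "D x = \<bar>det (matrix (g' x))\<bar> * f (g x) * indicator S x" for x
  define E where "E y = f y * indicator (g ` S) y" for y
  have D0: "D x \<ge> 0" and E0: "E x \<ge> 0" for x using f by (auto simp: D_def E_def)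
  have Sl: "S \<in> sets lebesgue" using S by simp
  have conv: "h absolutely_integrable_on T \<longleftrightarrow> integrable lborel (\<lambda>x. h x * indicator T x)"
      "h absolutely_integrable_on T \<Longrightarrow> integral T h = (\<integral>x. h x * indicator T x \<partial>lborel)"
    if "(\<lambda>x. h x * indicator T x) \<in> borel_measurable borel" for h :: "real^'m::_ \<Rightarrow> real" and T
  proof -
    have m: "(\<lambda>x. h x * indicator T x) \<in> borel_measurable lborel" using that by simp
    show "h absolutely_integrable_on T \<longleftrightarrow> integrable lborel (\<lambda>x. h x * indicator T x)"
      using integrable_completion[OF m] by (simp add: set_integrable_def mult.commute)
    assume "h absolutely_integrable_on T"
    from set_lebesgue_integral_eq_integral(2)[OF this]
    show "integral T h = (\<integral>x. h x * indicator T x \<partial>lborel)"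
      using integral_completion[OF m] by (simp add: set_lebesgue_integral_def mult.commute)
  qed
  let ?h = "\<lambda>x. \<bar>det (matrix (g' x))\<bar> * f (g x)"
  \<comment> \<open>The equivalence concerns vector-valued functions, so real functions are viewed
    as functions into \<open>real^1\<close>.\<close>
  have vec: "(\<lambda>x. \<bar>det (matrix (g' x))\<bar> *\<^sub>R (vec (f (g x)) :: real^1)) = (\<lambda>x. vec (?h x))"
    by (simp add: fun_eq_iff vec_eq_iff)
  have "((\<lambda>x. vec (?h x) :: real^1) absolutely_integrable_on S \<and> integral S (\<lambda>x. vec (?h x) :: real^1) = vec b) \<longleftrightarrow>
      ((\<lambda>x. vec (f x) :: real^1) absolutely_integrable_on g ` S \<and> integral (g ` S) (\<lambda>x. vec (f x) :: real^1) = vec b)" for b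
    using has_absolute_integral_change_of_variables[OF Sl der inj, of "\<lambda>y. vec (f y) :: real^1" "vec b"]
    unfolding vec by simp
  then have iff: "(?h absolutely_integrable_on S \<and> integral S ?h = b) \<longleftrightarrow>
      (f absolutely_integrable_on g ` S \<and> integral (g ` S) f = b)" for b
    by (simp add: absolutely_integrable_on_1_iff integral_on_1_eq vec_eq_iff)
  have int: "(integrable lborel D \<and> integral\<^sup>L lborel D = b) \<longleftrightarrow> (integrable lborel E \<and> integral\<^sup>L lborel E = b)" for b
  proof -
    have conv3: "(h absolutely_integrable_on T \<and> integral T h = b) \<longleftrightarrow>
        (integrable lborel (\<lambda>x. h x * indicator T x) \<and> (\<integral>x. h x * indicator T x \<partial>lborel) = b)"
      if "(\<lambda>x. h x * indicator T x) \<in> borel_measurable borel" for h :: "real^'m::_ \<Rightarrow> real" and T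
      using conv[OF that] by auto
    show ?thesis
      using iff[of b] unfolding conv3[OF m1] conv3[OF m2] D_def[abs_def] E_def[abs_def] .
  qed
  have fin: "integrable lborel h \<longleftrightarrow> (\<integral>\<^sup>+ x. ennreal (h x) \<partial>lborel) < \<infinity>"
    if "h \<in> borel_measurable borel" "\<And>x. h x \<ge> 0" for h :: "real^'m::_ \<Rightarrow> real"
    using that by (simp add: integrable_iff_bounded)
  show ?thesis
  proof (cases "integrable lborel D")
    case True
    then have "integrable lborel E" "integral\<^sup>L lborel E = integral\<^sup>L lborel D" using int by auto
    then show ?thesis
      using nn_integral_eq_integral[OF True] nn_integral_eq_integral[of lborel E] D0 E0
      unfolding D_def[symmetric] E_def[symmetric] by simp
  next
    case False
    then have "\<not> integrable lborel E" using int by auto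
    then show ?thesis
      using False fin[of D] fin[of E] D0 E0 m1 m2 unfolding D_def[symmetric] E_def[symmetric]
      by (simp add: D_def[abs_def] E_def[abs_def] less_top[symmetric])
  qed
qed

lemma nn_integral_change_of_variables:
  fixes g :: "real^'m \<Rightarrow> real^'m" and f :: "real^'m \<Rightarrow> real"
  assumes S: "S \<in> sets borel"
    and der: "\<And>x. x \<in> S \<Longrightarrow> (g has_derivative g' x) (at x within S)" and inj: "inj_on g S"
    and f: "\<And>y. f y \<ge> 0"
    and m1: "(\<lambda>y. f y * indicator (g ` S) y) \<in> borel_measurable borel"
    and m2: "(\<lambda>x. \<bar>det (matrix (g' x))\<bar> * f (g x) * indicator S x) \<in> borel_measurable borel"
  shows "(\<integral>\<^sup>+ x. ennreal (\<bar>det (matrix (g' x))\<bar> * f (g x) * indicator S x) \<partial>lborel)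
       = (\<integral>\<^sup>+ y. ennreal (f y * indicator (g ` S) y) \<partial>lborel)"
proof -
  define G where "G x = to_wo_vec (g (of_wo_vec x))" for x
  define G' where "G' x v = to_wo_vec (g' (of_wo_vec x) (of_wo_vec v))" for x v
  define T where "T = to_wo_vec ` S"
  have T: "T = of_wo_vec -` S" unfolding T_def by (auto intro: rev_image_eqI)
  have GT: "G ` T = of_wo_vec -` (g ` S)" unfolding T_def G_def by (auto simp: image_iff) (metis wo_vec_inverse(2))
  have indT: "indicator T x = (indicator S (of_wo_vec x) :: real)" for x by (simp add: T indicator_def)
  have indG: "indicator (G ` T) x = (indicator (g ` S) (of_wo_vec x) :: real)" for x by (simp add: GT indicator_def)
  have det: "det (matrix (G' x)) = det (matrix (g' (of_wo_vec x)))" for x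
  proof -
    have "of_wo_vec (axis j 1) = (axis (of_wo j) 1 :: real^'m)" for j :: "'m wo"
      by (auto simp: of_wo_vec_def axis_def vec_eq_iff)
    then have "matrix (G' x) = (\<chi> i j. matrix (g' (of_wo_vec x)) $ of_wo i $ of_wo j)"
      by (simp add: matrix_def G'_def to_wo_vec_def)
    then show ?thesis by (simp add: det_wo)
  qed
  have main: "(\<integral>\<^sup>+ x. ennreal (\<bar>det (matrix (G' x))\<bar> * f (of_wo_vec (G x)) * indicator T x) \<partial>lborel)
      = (\<integral>\<^sup>+ y. ennreal (f (of_wo_vec y) * indicator (G ` T) y) \<partial>lborel)"
  proof (rule nn_integral_change_of_variables_wo[of T G G' "\<lambda>y. f (of_wo_vec y)"])
    show "T \<in> sets borel" unfolding T using measurable_sets_borel[OF measurable_wo_vec(2) S] by simp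
    show "(G has_derivative G' x) (at x within T)" if "x \<in> T" for x
    proof -
      have S': "of_wo_vec x \<in> S" using that by (simp add: T)
      have 1: "(of_wo_vec has_derivative of_wo_vec) (at x within T)"
        by (rule bounded_linear_imp_has_derivative[OF bounded_linear_wo_vec(2)])
      have 2: "(g has_derivative g' (of_wo_vec x)) (at (of_wo_vec x) within of_wo_vec ` T)"
        by (rule has_derivative_subset[OF der[OF S']]) (auto simp: T)
      show ?thesis unfolding G_def G'_def
        by (rule bounded_linear.has_derivative[OF bounded_linear_wo_vec(1) has_derivative_in_compose[OF 1 2]])
    qed
    show "inj_on G T"
      using inj unfolding inj_on_def G_def T by (metis vimageE wo_vec_inverse)
    show "(\<lambda>y. f (of_wo_vec y) * indicator (G ` T) y) \<in> borel_measurable borel"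
      unfolding indG using measurable_compose[OF measurable_wo_vec(2) m1] .
    show "(\<lambda>x. \<bar>det (matrix (G' x))\<bar> * f (of_wo_vec (G x)) * indicator T x) \<in> borel_measurable borel"
      unfolding indT det G_def using measurable_compose[OF measurable_wo_vec(2) m2] by simp
  qed (use f in auto)
  have "(\<integral>\<^sup>+ x. ennreal (h x) \<partial>lborel) = (\<integral>\<^sup>+ y. ennreal (h (of_wo_vec y)) \<partial>lborel)"
    if "h \<in> borel_measurable borel" for h :: "real^'m \<Rightarrow> real"
    by (subst lborel_wo, subst nn_integral_distr) (use that in auto)
  from this[OF m1] this[OF m2] main show ?thesis
    unfolding indT indG det by (simp add: G_def)
qed

section \<open>The Riemannian measure\<close>

context riemannian_manifold
begin

definition vol_density :: "('a, real^'m) chart \<Rightarrow> real^'m \<Rightarrow> real" where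
  "vol_density c y = sqrt (det (gram M g c (chart_inv c y)))"

text \<open>For a matrix \<open>V\<close> with orthonormal rows, \<open>V G V^T\<close> is the
  identity, so \<open>det G\<close> is the reciprocal of a square.\<close>

lemma det_inner_matrix_pos:
  fixes p :: "real^'k \<Rightarrow> real^'k \<Rightarrow> real"
  assumes p: "inner_product_form p" shows "det (inner_matrix p) > 0"
proof -
  obtain B where B: "finite B" "card B = CARD('k)" "\<forall>v\<in>B. \<forall>w\<in>B. p v w = (if v = w then 1 else 0)"
    using orthonormal_set_exists[OF p, of "CARD('k)"] by blast
  obtain e :: "'k \<Rightarrow> real^'k" where e: "bij_betw e UNIV B"
    using B by (metis finite_same_card_bij finite_class.finite_UNIV)
  define V :: "real^'k^'k" where "V = (\<chi> i. e i)"
  have "V ** inner_matrix p ** transpose V = mat 1"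
  proof -
    have "(V ** inner_matrix p ** transpose V) $ i $ j = p (e i) (e j)" for i j
    proof -
      have "(V ** inner_matrix p ** transpose V) *v axis j 1 = V *v (inner_matrix p *v (transpose V *v axis j 1))"
        by (simp add: matrix_vector_mul_assoc matrix_mul_assoc)
      moreover have "transpose V *v axis j 1 = e j"
        by (simp add: V_def transpose_def matrix_vector_mult_basis column_def vec_eq_iff)
      ultimately have "column j (V ** inner_matrix p ** transpose V) = V *v (inner_matrix p *v e j)"
        by (simp only: matrix_vector_mult_basis)
      then have "column j (V ** inner_matrix p ** transpose V) $ i = (V *v (inner_matrix p *v e j)) $ i" by simp
      then show ?thesis
        by (simp add: column_def inner_matrix_eq[OF p] V_def matrix_vector_mult_def[of V] matrix_vector_mult_def[of "vec_lambda _"] inner_vec_def)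
    qed
    moreover have "p (e i) (e j) = (if i = j then 1 else 0)" for i j
      using B(3) e by (auto simp: bij_betw_def inj_on_def)
    ultimately show ?thesis by (simp add: vec_eq_iff mat_def)
  qed
  then have "det (V ** inner_matrix p ** transpose V) = 1" by simp
  then have "det V * det V * det (inner_matrix p) = 1" by (simp add: det_mul mult_ac)
  then show ?thesis by (metis mult_eq_0_iff zero_less_mult_pos zero_less_one not_real_square_gt_zero)
qed

lemma det_gram_pos: "c \<in> charts M \<Longrightarrow> x \<in> fst c \<Longrightarrow> det (gram M g c x) > 0"
  using gram_invertible det_inner_matrix_pos by metis

lemma coord_vec_transition:
  assumes "c \<in> charts M" "d \<in> charts M" "x \<in> fst c" "x \<in> fst d"
  shows "coord_vec M c x v = coord_vec M d x (frechet_derivative (transition c d) (at (snd c x)) v)"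
proof -
  have x: "x \<in> points M" using chart_subset assms by blast
  let ?e = "chart_at M x"
  have "chart_deriv c (snd ?e) x v = chart_deriv d (snd ?e) x (frechet_derivative (transition c d) (at (snd c x)) v)"
    by (rule chart_deriv_change[OF chart_openin smooth_fn_chart]) (use assms chart_at[OF x] in auto)
  then show ?thesis by (simp add: chart_deriv_def coord_vec_def transition_def comp_def)
qed

lemma gram_transition:
  assumes "c \<in> charts M" "d \<in> charts M" "x \<in> fst c" "x \<in> fst d"
  shows "gram M g c x = transpose (matrix (frechet_derivative (transition c d) (at (snd c x)))) ** gram M g d x
           ** matrix (frechet_derivative (transition c d) (at (snd c x)))"
proof -
  define P where "P = matrix (frechet_derivative (transition c d) (at (snd c x)))"
  have lin: "linear (frechet_derivative (transition c d) (at (snd c x)))"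
    using has_derivative_linear[OF transition_has_derivative[OF assms]] .
  have P: "P *v v = frechet_derivative (transition c d) (at (snd c x)) v" for v
    unfolding P_def using matrix_works[of "frechet_derivative (transition c d) (at (snd c x))" v] lin
    by (simp add: linear_matrix_vector_mul_eq)
  note gi = gram_invertible[OF assms(2,4)]
  have "gram M g c x $ i $ j = (transpose P ** gram M g d x ** P) $ i $ j" for i j
  proof -
    have "gram M g c x $ i $ j = (P *v axis i 1) \<bullet> (gram M g d x *v (P *v axis j 1))"
      unfolding gi(2) inner_matrix_eq[OF gi(1), symmetric] by (simp add: gram_def P coord_vec_transition[OF assms])
    also have "\<dots> = axis i 1 \<bullet> (transpose P *v (gram M g d x *v (P *v axis j 1)))"
      by (metis dot_lmul_matrix transpose_matrix_vector transpose_transpose)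
    also have "\<dots> = axis i 1 \<bullet> ((transpose P ** gram M g d x ** P) *v axis j 1)"
      by (simp add: matrix_vector_mul_assoc matrix_mul_assoc)
    finally show ?thesis by (simp add: inner_axis' matrix_vector_mult_basis[of "_ ** _"] column_def)
  qed
  then show ?thesis by (simp add: vec_eq_iff P_def)
qed

lemma vol_density_transition:
  assumes "c \<in> charts M" "d \<in> charts M" "x \<in> fst c" "x \<in> fst d"
  shows "vol_density c (snd c x) =
    \<bar>det (matrix (frechet_derivative (transition c d) (at (snd c x))))\<bar> * vol_density d (snd d x)"
  using assms by (simp add: vol_density_def gram_transition[OF assms] det_mul real_sqrt_mult mult_ac flip: power2_eq_square)

lemma smooth_vol_density_sq: "c \<in> charts M \<Longrightarrow> smooth_fn M (fst c) (\<lambda>x. det (gram M g c x))"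
  unfolding det_def by (intro smooth_fn_sum smooth_fn_mult smooth_fn_prod smooth_gram smooth_fn_const chart_openin)

lemma vol_density_continuous:
  assumes "c \<in> charts M" shows "continuous_on (snd c ` fst c) (vol_density c)"
proof -
  have "smooth_on (snd c ` fst c) (\<lambda>z. det (gram M g c (chart_inv c z)))"
    using smooth_vol_density_sq[OF assms] assms by (auto simp: smooth_fn_def)
  then show ?thesis unfolding vol_density_def
    by (intro continuous_intros smooth_on_imp_continuous_on)
qed

section \<open>Borel sets of the manifold and volumes of sets inside one chart\<close>

definition borel_M :: "'a measure" where
  "borel_M = sigma (points M) {U. openin (mtop M) U}"

lemma space_borel_M [simp]: "space borel_M = points M"
  and sets_borel_M: "sets borel_M = sigma_sets (points M) {U. openin (mtop M) U}"
proof -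
  have "{U. openin (mtop M) U} \<subseteq> Pow (points M)" using openin_subset by auto
  then show "space borel_M = points M" "sets borel_M = sigma_sets (points M) {U. openin (mtop M) U}"
    by (auto simp: borel_M_def)
qed

lemma borel_M_open: "openin (mtop M) U \<Longrightarrow> U \<in> sets borel_M"
  unfolding sets_borel_M by (rule sigma_sets.Basic) simp

lemma chart_image_borel:
  assumes c: "c \<in> charts M" and A: "A \<in> sets borel_M"
  shows "snd c ` (fst c \<inter> A) \<in> sets borel"
proof -
  from A have "A \<in> sigma_sets (points M) {U. openin (mtop M) U}" by (simp add: sets_borel_M)
  then show ?thesis
  proof induction
    case (Basic U)
    then show ?case using chart_image_openin[OF c] by auto
  next
    case Empty then show ?case by simp
  next
    case (Compl U)
    have "snd c ` (fst c \<inter> (points M - U)) = snd c ` fst c - snd c ` (fst c \<inter> U)"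
      using chart_subset[OF c] chart_inj[OF c] by (auto simp: inj_on_def)
    then show ?case using Compl chart_image_open[OF c] by auto
  next
    case (Union U)
    have "snd c ` (fst c \<inter> (\<Union>i. U i)) = (\<Union>i. snd c ` (fst c \<inter> U i))" by auto
    then show ?case using Union by auto
  qed
qed

definition chart_vol :: "('a, real^'m) chart \<Rightarrow> 'a set \<Rightarrow> ennreal" where
  "chart_vol c A = (\<integral>\<^sup>+ y. ennreal (vol_density c y * indicator (snd c ` (fst c \<inter> A)) y) \<partial>lborel)"

lemma vol_density_indicator_measurable:
  assumes c: "c \<in> charts M" and A: "A \<in> sets borel_M"
  shows "(\<lambda>y. vol_density c y * indicator (snd c ` (fst c \<inter> A)) y) \<in> borel_measurable borel"
proof -
  have "(\<lambda>y. if y \<in> snd c ` fst c then vol_density c y else 0) \<in> borel_measurable borel"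
    by (rule borel_measurable_continuous_on_if) (use chart_image_open[OF c] vol_density_continuous[OF c] in auto)
  then have "(\<lambda>y. (if y \<in> snd c ` fst c then vol_density c y else 0) * indicator (snd c ` (fst c \<inter> A)) y) \<in> borel_measurable borel"
    using chart_image_borel[OF c A] by measurable
  moreover have "(\<lambda>y. (if y \<in> snd c ` fst c then vol_density c y else 0) * indicator (snd c ` (fst c \<inter> A)) y)
     = (\<lambda>y. vol_density c y * indicator (snd c ` (fst c \<inter> A)) y)"
    by (auto simp: fun_eq_iff indicator_def)
  ultimately show ?thesis by simp
qed

lemma vol_density_pos:
  assumes "c \<in> charts M" "y \<in> snd c ` fst c" shows "vol_density c y > 0"
  using assms det_gram_pos[OF assms(1)] by (auto simp: vol_density_def)

lemma vol_density_nonneg [simp]: "c \<in> charts M \<Longrightarrow> y \<in> snd c ` fst c \<Longrightarrow> vol_density c y \<ge> 0"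
  by (simp add: vol_density_pos less_imp_le)

text \<open>The absolute Jacobian in the change of variables is exactly the factor by which the
  volume density transforms.\<close>

lemma chart_vol_transition:
  assumes c: "c \<in> charts M" and d: "d \<in> charts M" and A: "A \<in> sets borel_M" "A \<subseteq> fst c \<inter> fst d"
  shows "chart_vol c A = chart_vol d A"
proof -
  let ?S = "snd c ` A" and ?g = "transition c d"
  let ?g' = "\<lambda>y. frechet_derivative ?g (at y)"
  have S: "snd c ` (fst c \<inter> A) = ?S" "snd d ` (fst d \<inter> A) = snd d ` A" using A(2) by (auto simp: Int_absorb1)
  have gS: "?g ` ?S = snd d ` A" unfolding image_image by (rule image_cong) (use A(2) c in \<open>auto intro!: transition_apply\<close>)
  \<comment> \<open>The absolute value makes the integrand nonnegative also outside the chart image,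
    where \<open>vol_density\<close> has no meaning.\<close>
  define f where "f y = \<bar>vol_density d y\<bar>" for y
  have eq: "\<bar>det (matrix (?g' y))\<bar> * f (?g y) * indicator ?S y = vol_density c y * indicator ?S y" for y
  proof (cases "y \<in> ?S")
    case True
    then obtain x where x: "x \<in> A" "y = snd c x" by auto
    then have x': "x \<in> fst c" "x \<in> fst d" using A(2) by auto
    then have "f (?g y) = vol_density d (snd d x)" using x c d by (simp add: f_def transition_apply)
    then show ?thesis using vol_density_transition[OF c d x'] x by simp
  qed simp
  have feq: "f y * indicator (snd d ` A) y = vol_density d y * indicator (snd d ` A) y" for y
    using A(2) d by (cases "y \<in> snd d ` A") (auto simp: f_def)
  have "(\<integral>\<^sup>+ y. ennreal (\<bar>det (matrix (?g' y))\<bar> * f (?g y) * indicator ?S y) \<partial>lborel)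
      = (\<integral>\<^sup>+ y. ennreal (f y * indicator (?g ` ?S) y) \<partial>lborel)"
  proof (rule nn_integral_change_of_variables)
    show "?S \<in> sets borel" using chart_image_borel[OF c A(1)] S by simp
    show "(?g has_derivative ?g' y) (at y within ?S)" if "y \<in> ?S" for y
      using that transition_has_derivative[OF c d] A(2) by (auto intro: has_derivative_at_withinI)
    show "inj_on ?g ?S"
    proof (rule inj_on_inverseI[where g="transition d c"])
      fix y assume "y \<in> ?S"
      then obtain x where x: "y = snd c x" "x \<in> fst c" "x \<in> fst d" using A(2) by blast
      then show "transition d c (?g y) = y" using c d by (simp add: transition_apply)
    qed
    show "(\<lambda>y. f y * indicator (?g ` ?S) y) \<in> borel_measurable borel"
      using vol_density_indicator_measurable[OF d A(1)] unfolding gS feq S .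
    show "(\<lambda>y. \<bar>det (matrix (?g' y))\<bar> * f (?g y) * indicator ?S y) \<in> borel_measurable borel"
      using vol_density_indicator_measurable[OF c A(1)] unfolding eq S .
  qed (simp add: f_def)
  then show ?thesis unfolding eq gS feq chart_vol_def S .
qed

lemma chart_vol_suminf:
  assumes c: "c \<in> charts M" and A: "range A \<subseteq> sets borel_M" "disjoint_family A"
  shows "chart_vol c (\<Union>i. A i) = suminf (\<lambda>i. chart_vol c (A i))"
proof -
  let ?B = "\<lambda>i. snd c ` (fst c \<inter> A i)"
  have disj: "disjoint_family ?B"
    using A(2) chart_inj[OF c] unfolding disjoint_family_on_def inj_on_def by blast
  have B: "snd c ` (fst c \<inter> (\<Union>i. A i)) = (\<Union>i. ?B i)" by auto
  have "ennreal (vol_density c y * indicator (\<Union>i. ?B i) y) = suminf (\<lambda>i. ennreal (vol_density c y * indicator (?B i) y))" for y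
  proof (cases "y \<in> snd c ` fst c")
    case True
    then have "suminf (\<lambda>i. ennreal (vol_density c y * indicator (?B i) y)) = suminf (\<lambda>i. ennreal (vol_density c y) * indicator (?B i) y)"
      using c by (simp add: ennreal_mult ennreal_indicator)
    also have "\<dots> = ennreal (vol_density c y) * indicator (\<Union>i. ?B i) y"
      using suminf_indicator[OF disj, of y] by (simp add: ennreal_suminf_cmult)
    finally show ?thesis using True c by (simp add: ennreal_mult ennreal_indicator)
  next
    case False
    then have "y \<notin> (\<Union>i. ?B i)" by auto
    then show ?thesis by (simp add: indicator_def)
  qed
  then have "chart_vol c (\<Union>i. A i) = (\<integral>\<^sup>+ y. suminf (\<lambda>i. ennreal (vol_density c y * indicator (?B i) y)) \<partial>lborel)"
    by (simp add: chart_vol_def B)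
  also have "\<dots> = suminf (\<lambda>i. chart_vol c (A i))"
    unfolding chart_vol_def using vol_density_indicator_measurable[OF c] A(1)
    by (intro nn_integral_suminf) (auto intro!: measurable_compose[OF _ measurable_ennreal])
  finally show ?thesis .
qed

lemma chart_vol_empty [simp]: "chart_vol c {} = 0"
  by (simp add: chart_vol_def)

lemma chart_vol_eq:
  assumes c: "c \<in> charts M" and A: "A \<subseteq> fst c"
  shows "chart_vol c A = (\<integral>\<^sup>+ y. ennreal (sqrt (det (gram M g c (chart_inv c y)))) * indicator (snd c ` A) y \<partial>lborel)"
proof -
  have "snd c ` (fst c \<inter> A) = snd c ` A" using A by (simp add: Int_absorb1)
  then have "ennreal (vol_density c y * indicator (snd c ` (fst c \<inter> A)) y)
    = ennreal (sqrt (det (gram M g c (chart_inv c y)))) * indicator (snd c ` A) y" for y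
    by (cases "y \<in> snd c ` A") (simp_all add: vol_density_def)
  then show ?thesis by (simp add: chart_vol_def)
qed

end

locale compact_riemannian = riemannian_manifold +
  assumes compact: "compact_space (mtop M)"
begin

lemma finite_atlas:
  obtains cs where "set cs \<subseteq> charts M" "points M = (\<Union>k<length cs. fst (cs ! k))"
proof -
  have "\<exists>\<F>. finite \<F> \<and> \<F> \<subseteq> fst ` charts M \<and> points M \<subseteq> \<Union>\<F>"
    using compact chart_openin chart_cover unfolding compact_space_def
    by (intro compactinD) auto
  then obtain \<F> where F: "finite \<F>" "\<F> \<subseteq> fst ` charts M" "points M \<subseteq> \<Union>\<F>" by blast
  then obtain C where C: "C \<subseteq> charts M" "finite C" "\<F> = fst ` C"
    by (meson finite_subset_image)
  obtain cs where cs: "set cs = C" using finite_list[OF C(2)] by blast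
  have "(\<Union>c\<in>set cs. fst c) \<subseteq> points M" using C(1) cs chart_subset by blast
  then have "points M = (\<Union>c\<in>set cs. fst c)" using F(3) C(3) cs by auto
  also have "\<dots> = (\<Union>k<length cs. fst (cs ! k))"
  proof -
    have "set cs = (!) cs ` {..<length cs}" by (auto simp: set_conv_nth)
    then show ?thesis by (metis image_image)
  qed
  finally show ?thesis using that[of cs] C cs by auto
qed

definition is_riemannian_measure :: "'a measure \<Rightarrow> bool" where
  "is_riemannian_measure \<mu> \<longleftrightarrow> space \<mu> = points M \<and> sets \<mu> = sets borel_M \<and>
     (\<forall>c\<in>charts M. \<forall>A\<in>sets \<mu>. A \<subseteq> fst c \<longrightarrow> emeasure \<mu> A = chart_vol c A)"

lemma riemannian_measure_THE: "riemannian_measure M g = (THE \<mu>. is_riemannian_measure \<mu>)"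
proof -
  have "(\<forall>c\<in>charts M. \<forall>A\<in>sets \<mu>. A \<subseteq> fst c \<longrightarrow> emeasure \<mu> A =
      (\<integral>\<^sup>+ y. ennreal (sqrt (det (gram M g c (chart_inv c y)))) * indicator (snd c ` A) y \<partial>lborel)) \<longleftrightarrow>
    (\<forall>c\<in>charts M. \<forall>A\<in>sets \<mu>. A \<subseteq> fst c \<longrightarrow> emeasure \<mu> A = chart_vol c A)" for \<mu> :: "'a measure"
    by (intro ball_cong refl imp_cong) (simp add: chart_vol_eq)
  then show ?thesis unfolding riemannian_measure_def is_riemannian_measure_def sets_borel_M by simp
qed

text \<open>A finite atlas cuts the manifold into finitely many disjoint Borel pieces, each inside
  one chart, which leaves no freedom for the measure. This gives uniqueness, and the right-hand side
  is the definition of the measure in the existence proof.\<close>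

lemma is_riemannian_measure_formula:
  assumes cs: "set cs \<subseteq> charts M" "points M = (\<Union>k<length cs. fst (cs ! k))"
    and \<mu>: "is_riemannian_measure \<mu>" and A: "A \<in> sets borel_M"
  shows "emeasure \<mu> A = (\<Sum>k<length cs. chart_vol (cs ! k) (A \<inter> disjointed (\<lambda>k. if k < length cs then fst (cs ! k) else {}) k))"
proof -
  let ?D = "\<lambda>k. if k < length cs then fst (cs ! k) else {}"
  let ?P = "disjointed ?D"
  have D: "range ?D \<subseteq> sets borel_M" using cs(1) by (auto intro!: borel_M_open chart_openin)
  have P: "range ?P \<subseteq> sets borel_M" by (rule sets.range_disjointed_sets[OF D])
  have UP: "(\<Union>k. ?P k) = points M" unfolding UN_disjointed_eq using cs(2) by (auto split: if_splits)
  have sets: "sets \<mu> = sets borel_M" using \<mu> by (simp add: is_riemannian_measure_def)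
  have out: "?P k = {}" if "k \<ge> length cs" for k using that disjointed_subset[of ?D k] by auto
  have A': "A = (\<Union>k<length cs. A \<inter> ?P k)"
  proof -
    have "A \<subseteq> points M" using A sets.sets_into_space[of A borel_M] by simp
    then have "A = (\<Union>k. A \<inter> ?P k)" using UP by auto
    moreover have "A \<inter> ?P k \<subseteq> (\<Union>k<length cs. A \<inter> ?P k)" for k
    proof (cases "k < length cs")
      case True then show ?thesis by blast
    next
      case False then show ?thesis using out[of k] by simp
    qed
    ultimately show ?thesis by blast
  qed
  have "(\<Sum>k<length cs. emeasure \<mu> (A \<inter> ?P k)) = emeasure \<mu> (\<Union>k<length cs. A \<inter> ?P k)"
  proof (rule sum_emeasure)
    show "disjoint_family_on (\<lambda>k. A \<inter> ?P k) {..<length cs}"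
      using disjoint_family_disjointed[of ?D] unfolding disjoint_family_on_def by blast
  qed (use A P sets in auto)
  moreover have "emeasure \<mu> (A \<inter> ?P k) = chart_vol (cs ! k) (A \<inter> ?P k)" if "k < length cs" for k
  proof -
    have "cs ! k \<in> charts M" using cs(1) that nth_mem by blast
    moreover have "A \<inter> ?P k \<in> sets \<mu>" unfolding sets using A P by blast
    moreover have "A \<inter> ?P k \<subseteq> fst (cs ! k)" using disjointed_subset[of ?D k] that by auto
    ultimately show ?thesis using \<mu> unfolding is_riemannian_measure_def by blast
  qed
  ultimately show ?thesis using A' by simp
qed

lemma is_riemannian_measure_unique:
  assumes "is_riemannian_measure \<mu>" "is_riemannian_measure \<nu>" shows "\<mu> = \<nu>"
proof (rule measure_eqI)
  show "sets \<mu> = sets \<nu>" using assms by (simp add: is_riemannian_measure_def)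
  fix A assume "A \<in> sets \<mu>"
  then have A: "A \<in> sets borel_M" using assms by (simp add: is_riemannian_measure_def)
  obtain cs where "set cs \<subseteq> charts M" "points M = (\<Union>k<length cs. fst (cs ! k))" by (rule finite_atlas)
  from is_riemannian_measure_formula[OF this _ A] assms show "emeasure \<mu> A = emeasure \<nu> A" by simp
qed

text \<open>The charts assigned to the pieces are arbitrary; that the measure has the right density
  in every chart follows from \<open>chart_vol_transition\<close>, piece by piece.\<close>

lemma is_riemannian_measure_exists: "\<exists>\<mu>. is_riemannian_measure \<mu>"
proof -
  obtain cs where cs: "set cs \<subseteq> charts M" "points M = (\<Union>k<length cs. fst (cs ! k))" by (rule finite_atlas)
  let ?D = "\<lambda>k. if k < length cs then fst (cs ! k) else {}"
  let ?P = "disjointed ?D"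
  have D: "range ?D \<subseteq> sets borel_M" using cs(1) by (auto intro!: borel_M_open chart_openin)
  have P: "?P k \<in> sets borel_M" for k using sets.range_disjointed_sets[OF D] by auto
  have UP: "(\<Union>k. ?P k) = points M" unfolding UN_disjointed_eq using cs(2) by (auto split: if_splits)
  have out: "?P k = {}" if "k \<ge> length cs" for k using that disjointed_subset[of ?D k] by auto
  have disj: "disjoint_family ?P" by (rule disjoint_family_disjointed)
  define m where "m A = (\<Sum>k<length cs. chart_vol (cs ! k) (A \<inter> ?P k))" for A
  define \<mu> where "\<mu> = measure_of (points M) (sets borel_M) m"
  have sp: "sets borel_M \<subseteq> Pow (points M)" using sets.space_closed[of borel_M] by simp
  have sa: "sigma_algebra (points M) (sets borel_M)" using sets.sigma_algebra_axioms[of borel_M] by simp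
  have sets: "sets \<mu> = sets borel_M" "space \<mu> = points M"
    unfolding \<mu>_def using sp sa by (simp_all add: sigma_algebra.sigma_sets_eq)
  have "countably_additive (sets \<mu>) m"
    unfolding countably_additive_def
  proof (intro allI impI)
    fix A :: "nat \<Rightarrow> 'a set"
    assume A: "range A \<subseteq> sets \<mu>" "disjoint_family A"
    have "chart_vol (cs ! k) ((\<Union>i. A i) \<inter> ?P k) = suminf (\<lambda>i. chart_vol (cs ! k) (A i \<inter> ?P k))" if "k < length cs" for k
    proof -
      have "(\<Union>i. A i) \<inter> ?P k = (\<Union>i. A i \<inter> ?P k)" by auto
      moreover have "disjoint_family (\<lambda>i. A i \<inter> ?P k)" using A(2) unfolding disjoint_family_on_def by blast
      moreover have "range (\<lambda>i. A i \<inter> ?P k) \<subseteq> sets borel_M" using A(1) P sets(1) by auto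
      moreover have "cs ! k \<in> charts M" using cs(1) that nth_mem by blast
      ultimately show ?thesis using chart_vol_suminf[of "cs ! k" "\<lambda>i. A i \<inter> ?P k"] by simp
    qed
    then have "m (\<Union>i. A i) = (\<Sum>k<length cs. suminf (\<lambda>i. chart_vol (cs ! k) (A i \<inter> ?P k)))" by (simp add: m_def)
    also have "\<dots> = suminf (\<lambda>i. m (A i))" unfolding m_def by (rule suminf_sum[symmetric]) (rule summableI)
    finally show "suminf (\<lambda>i. m (A i)) = m (\<Union>i. A i)" by simp
  qed
  moreover have "positive (sets \<mu>) m" by (simp add: positive_def m_def)
  ultimately have em: "emeasure \<mu> A = m A" if "A \<in> sets borel_M" for A
    using that sets sp by (intro emeasure_measure_of[OF \<mu>_def]) auto
  have "emeasure \<mu> A = chart_vol c A" if c: "c \<in> charts M" and A: "A \<in> sets \<mu>" "A \<subseteq> fst c" for c A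
  proof -
    have A': "A \<in> sets borel_M" using A sets by simp
    have Asub: "A \<subseteq> points M" using A' sp by auto
    have "m A = (\<Sum>k<length cs. chart_vol c (A \<inter> ?P k))"
      unfolding m_def
    proof (rule sum.cong[OF refl])
      fix k assume k: "k \<in> {..<length cs}"
      then have "?P k \<subseteq> fst (cs ! k)" using disjointed_subset[of ?D k] by auto
      then show "chart_vol (cs ! k) (A \<inter> ?P k) = chart_vol c (A \<inter> ?P k)"
        using k cs(1) c A(2) A' P[of k] by (intro chart_vol_transition) auto
    qed
    also have "\<dots> = suminf (\<lambda>k. chart_vol c (A \<inter> ?P k))"
      by (rule suminf_finite[symmetric]) (use out in auto)
    also have "\<dots> = chart_vol c (\<Union>k. A \<inter> ?P k)"
    proof (rule chart_vol_suminf[OF c, symmetric])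
      show "range (\<lambda>k. A \<inter> ?P k) \<subseteq> sets borel_M" using A' P by auto
      show "disjoint_family (\<lambda>k. A \<inter> ?P k)" using disj unfolding disjoint_family_on_def by blast
    qed
    also have "(\<Union>k. A \<inter> ?P k) = A" using UP Asub by auto
    finally show ?thesis using em[OF A'] by simp
  qed
  then show ?thesis using sets unfolding is_riemannian_measure_def by blast
qed

section \<open>Integrals of continuous functions against the Riemannian measure\<close>

abbreviation "vol \<equiv> riemannian_measure M g"

lemma is_riemannian_measure_vol: "is_riemannian_measure vol"
  unfolding riemannian_measure_THE
  by (rule theI') (use is_riemannian_measure_exists is_riemannian_measure_unique in blast)

lemma space_vol [simp]: "space vol = points M" and sets_vol: "sets vol = sets borel_M"
  and emeasure_vol: "c \<in> charts M \<Longrightarrow> A \<in> sets borel_M \<Longrightarrow> A \<subseteq> fst c \<Longrightarrow> emeasure vol A = chart_vol c A"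
  using is_riemannian_measure_vol unfolding is_riemannian_measure_def by auto

lemma continuous_measurable_vol:
  fixes f :: "'a \<Rightarrow> real"
  assumes "continuous_map (mtop M) euclideanreal f" shows "f \<in> borel_measurable vol"
proof (rule borel_measurableI)
  fix S :: "real set" assume "open S"
  then have "openin (mtop M) {x \<in> points M. f x \<in> S}"
    using openin_continuous_map_preimage[OF assms] by simp
  moreover have "f -` S \<inter> space vol = {x \<in> points M. f x \<in> S}" by auto
  ultimately show "f -` S \<inter> space vol \<in> sets vol" using borel_M_open sets_vol by auto
qed

text \<open>Around each point the density is bounded on a closed coordinate ball, and finitely many
  of the open balls cover.\<close>

lemma finite_measure_vol: "finite_measure vol"
proof
  have loc: "\<exists>U. openin (mtop M) U \<and> x \<in> U \<and> emeasure vol U < \<infinity>" if x: "x \<in> points M" for x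
  proof -
    obtain c where c: "c \<in> charts M" "x \<in> fst c" using chart_cover[OF x] by blast
    obtain e where e: "e > 0" "cball (snd c x) e \<subseteq> snd c ` fst c"
      using chart_image_open[OF c(1)] c(2) open_contains_cball by blast
    have "compact (vol_density c ` cball (snd c x) e)"
      using e(2) vol_density_continuous[OF c(1)] by (intro compact_continuous_image) (auto intro: continuous_on_subset)
    then obtain B where B: "\<And>y. y \<in> cball (snd c x) e \<Longrightarrow> \<bar>vol_density c y\<bar> \<le> B"
      by (metis bounded_iff compact_imp_bounded image_eqI real_norm_def)
    define U where "U = {z \<in> fst c. snd c z \<in> ball (snd c x) e}"
    have U: "openin (mtop M) U" unfolding U_def by (rule chart_preimage_openin[OF c(1) open_ball])
    have "emeasure vol U = chart_vol c U"
      by (rule emeasure_vol[OF c(1) borel_M_open[OF U]]) (auto simp: U_def)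
    also have "\<dots> \<le> (\<integral>\<^sup>+ y. ennreal B * indicator (cball (snd c x) e) y \<partial>lborel)"
      unfolding chart_vol_def
    proof (rule nn_integral_mono)
      fix y
      show "ennreal (vol_density c y * indicator (snd c ` (fst c \<inter> U)) y) \<le> ennreal B * indicator (cball (snd c x) e) y"
        using B[of y] by (cases "y \<in> snd c ` (fst c \<inter> U)") (auto simp: U_def indicator_def intro!: ennreal_leI)
    qed
    also have "\<dots> = ennreal B * emeasure lborel (cball (snd c x) e)" by (rule nn_integral_cmult_indicator) simp
    also have "\<dots> < \<infinity>" using emeasure_bounded_finite[OF bounded_cball, of "snd c x" e] by (simp add: ennreal_mult_less_top)
    finally show ?thesis using U c e(1) by (intro exI[of _ U]) (auto simp: U_def)
  qed
  then obtain U where U: "\<And>x. x \<in> points M \<Longrightarrow> openin (mtop M) (U x) \<and> x \<in> U x \<and> emeasure vol (U x) < \<infinity>" by metis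
  have "\<exists>\<F>. finite \<F> \<and> \<F> \<subseteq> U ` points M \<and> points M \<subseteq> \<Union>\<F>"
    using compact U unfolding compact_space_def by (intro compactinD) auto
  then obtain X where X: "finite X" "X \<subseteq> points M" "points M \<subseteq> (\<Union>x\<in>X. U x)"
    by (metis finite_subset_image)
  have "emeasure vol (points M) \<le> emeasure vol (\<Union>x\<in>X. U x)"
    using X U by (intro emeasure_mono) (auto simp: sets_vol intro!: sets.finite_UN borel_M_open)
  also have "\<dots> \<le> (\<Sum>x\<in>X. emeasure vol (U x))"
    using X U by (intro emeasure_subadditive_finite) (auto simp: sets_vol intro!: borel_M_open)
  also have "\<dots> < \<infinity>" using X U by (simp add: subset_iff)
  finally show "emeasure vol (space vol) \<noteq> \<infinity>" by simp
qed

lemma emeasure_vol_open_pos: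
  assumes "openin (mtop M) U" "U \<noteq> {}" shows "emeasure vol U > 0"
proof -
  obtain x where x: "x \<in> U" using assms by blast
  then obtain c where c: "c \<in> charts M" "x \<in> fst c" using chart_cover openin_subset[OF assms(1)] by blast
  let ?V = "fst c \<inter> U"
  have V: "openin (mtop M) ?V" using assms chart_openin[OF c(1)] by blast
  let ?S = "snd c ` ?V"
  have S: "open ?S" by (rule chart_image_openin[OF c(1) assms(1)])
  have "chart_vol c ?V \<noteq> 0"
  proof
    assume z: "chart_vol c ?V = 0"
    have S': "snd c ` (fst c \<inter> ?V) = ?S" by (simp add: Int_absorb1)
    have "(\<lambda>y. ennreal (vol_density c y * indicator ?S y)) \<in> borel_measurable lborel"
      using vol_density_indicator_measurable[OF c(1) borel_M_open[OF V]] unfolding S' by simp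
    then have "AE y in lborel. ennreal (vol_density c y * indicator ?S y) = 0"
      using z unfolding chart_vol_def S' by (simp add: nn_integral_0_iff_AE)
    then have "AE y in lborel. y \<notin> ?S"
    proof (rule AE_mp, intro AE_I2 impI notI)
      fix y assume "ennreal (vol_density c y * indicator ?S y) = 0" "y \<in> ?S"
      then have "vol_density c y \<le> 0" by (simp add: ennreal_eq_0_iff)
      moreover have "y \<in> snd c ` fst c" using \<open>y \<in> ?S\<close> by auto
      ultimately show False using vol_density_pos[OF c(1)] by fastforce
    qed
    then have "?S \<in> null_sets lborel" using S by (subst (asm) AE_iff_null_sets[symmetric]) auto
    then have "negligible ?S" by (simp add: negligible_iff_null_sets null_sets_completionI)
    then show False using open_not_negligible[OF S] x c by blast
  qed
  moreover have "emeasure vol ?V = chart_vol c ?V" by (rule emeasure_vol[OF c(1) borel_M_open[OF V]]) auto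
  moreover have "emeasure vol ?V \<le> emeasure vol U"
    using assms by (intro emeasure_mono) (auto simp: sets_vol borel_M_open)
  ultimately show ?thesis by (metis le_zero_eq not_gr_zero)
qed

lemma continuous_bounded:
  fixes f :: "'a \<Rightarrow> real"
  assumes "continuous_map (mtop M) euclideanreal f"
  obtains B where "\<And>x. x \<in> points M \<Longrightarrow> \<bar>f x\<bar> \<le> B"
proof -
  have "compact (f ` points M)"
    using image_compactin[OF compact[unfolded compact_space_def] assms] by simp
  then show ?thesis using that by (metis bounded_iff compact_imp_bounded image_eqI real_norm_def)
qed

lemma continuous_integrable_vol:
  fixes f :: "'a \<Rightarrow> real"
  assumes "continuous_map (mtop M) euclideanreal f" shows "integrable vol f"
proof -
  obtain B where B: "\<And>x. x \<in> points M \<Longrightarrow> \<bar>f x\<bar> \<le> B" using continuous_bounded[OF assms] by blast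
  interpret finite_measure vol by (rule finite_measure_vol)
  show ?thesis by (rule integrable_const_bound[of _ B]) (use B continuous_measurable_vol[OF assms] in auto)
qed

lemma continuous_integral_pos:
  fixes f :: "'a \<Rightarrow> real"
  assumes f: "continuous_map (mtop M) euclideanreal f" "\<And>x. x \<in> points M \<Longrightarrow> f x \<ge> 0" and x: "x \<in> points M" "f x > 0"
  shows "(\<integral>x. f x \<partial>vol) > 0"
proof -
  have i: "integrable vol f" by (rule continuous_integrable_vol[OF f(1)])
  have nn: "(\<integral>x. f x \<partial>vol) \<ge> 0" by (rule integral_nonneg_AE) (use f(2) in auto)
  have "(\<integral>x. f x \<partial>vol) \<noteq> 0"
  proof
    assume "(\<integral>x. f x \<partial>vol) = 0"
    then have ae: "AE x in vol. f x = 0"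
      by (subst (asm) integral_nonneg_eq_0_iff_AE[OF i]) (use f(2) in auto)
    define U where "U = {x \<in> points M. f x \<in> {0<..}}"
    have U: "openin (mtop M) U" unfolding U_def using openin_continuous_map_preimage[OF f(1), of "{0<..}"] by simp
    have "AE x in vol. x \<notin> U" using ae by eventually_elim (auto simp: U_def)
    then have "U \<in> null_sets vol" using borel_M_open[OF U] by (subst (asm) AE_iff_null_sets[symmetric]) (auto simp: sets_vol)
    then show False using emeasure_vol_open_pos[OF U] x null_setsD1[of U vol] unfolding U_def by auto
  qed
  then show ?thesis using nn by simp
qed

end

section \<open>Extending cocycles from small singular simplices\<close>

text \<open>The homomorphism on integral chains with the value \<open>f a\<close> on the generator
  \<open>a\<close>; for a cochain \<open>f\<close> it is the Kronecker pairing.\<close>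

definition pairing :: "('x \<Rightarrow> real) \<Rightarrow> ('x \<Rightarrow>\<^sub>0 int) \<Rightarrow> real" where
  "pairing f x = (\<Sum>a\<in>Poly_Mapping.keys x. of_int (Poly_Mapping.lookup x a) * f a)"

lemma pairing_superset:
  assumes "finite S" "Poly_Mapping.keys x \<subseteq> S"
  shows "pairing f x = (\<Sum>a\<in>S. of_int (Poly_Mapping.lookup x a) * f a)"
  unfolding pairing_def by (rule sum.mono_neutral_left) (use assms in \<open>auto simp: in_keys_iff\<close>)

lemma pairing_diff: "pairing f (x - y) = pairing f x - pairing f y"
proof -
  let ?S = "Poly_Mapping.keys x \<union> Poly_Mapping.keys y"
  have "Poly_Mapping.keys (x - y) \<subseteq> ?S" by (rule keys_diff)
  then have "pairing f (x - y) = (\<Sum>a\<in>?S. of_int (Poly_Mapping.lookup (x - y) a) * f a)"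
    by (intro pairing_superset) auto
  also have "\<dots> = pairing f x - pairing f y"
    by (subst (1 2) pairing_superset[of ?S]) (auto simp: lookup_minus sum_subtractf[symmetric] algebra_simps)
  finally show ?thesis .
qed

lemma pairing_0 [simp]: "pairing f 0 = 0" by (simp add: pairing_def)

lemma pairing_uminus: "pairing f (- x) = - pairing f x"
  using pairing_diff[of f 0 x] by simp

lemma pairing_add: "pairing f (x + y) = pairing f x + pairing f y"
  using pairing_diff[of f x "- y"] by (simp add: pairing_uminus)

lemma pairing_of [simp]: "pairing f (frag_of s) = f s"
  by (simp add: pairing_def)

lemma pairing_sum: "pairing f (\<Sum>i\<in>I. x i) = (\<Sum>i\<in>I. pairing f (x i))"
  by (induction I rule: infinite_finite_induct) (auto simp: pairing_add)

lemma pairing_sign: "pairing f (frag_cmul ((-1) ^ k) x) = (-1) ^ k * pairing f x"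
  by (cases "even k") (auto simp: pairing_uminus)

lemma pairing_boundary:
  "pairing f (chain_boundary (Suc p) (frag_of \<sigma>)) = (\<Sum>k\<le>Suc p. (-1) ^ k * f (singular_face (Suc p) k \<sigma>))"
  by (simp add: chain_boundary_of pairing_sum pairing_sign del: sum.atMost_Suc)

definition small_simplex :: "'a set set \<Rightarrow> nat \<Rightarrow> 'a topology \<Rightarrow> ((nat \<Rightarrow> real) \<Rightarrow> 'a) \<Rightarrow> bool" where
  "small_simplex \<V> p X \<sigma> \<longleftrightarrow> (\<exists>V\<in>\<V>. singular_simplex p (subtopology X V) \<sigma>)"

definition small_chain :: "'a set set \<Rightarrow> nat \<Rightarrow> 'a topology \<Rightarrow> 'a chain \<Rightarrow> bool" where
  "small_chain \<V> p X c \<longleftrightarrow> Poly_Mapping.keys c \<subseteq> {\<sigma>. small_simplex \<V> p X \<sigma>}"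

lemma small_chain_of [simp]: "small_chain \<V> p X (frag_of \<sigma>) \<longleftrightarrow> small_simplex \<V> p X \<sigma>"
  by (simp add: small_chain_def)

lemma small_chain_0 [simp]: "small_chain \<V> p X 0"
  by (simp add: small_chain_def)

lemma small_chain_diff: "small_chain \<V> p X c \<Longrightarrow> small_chain \<V> p X d \<Longrightarrow> small_chain \<V> p X (c - d)"
  unfolding small_chain_def using keys_diff[of c d] by blast

lemma small_chain_subtopology:
  "V \<in> \<V> \<Longrightarrow> singular_chain p (subtopology X V) c \<Longrightarrow> small_chain \<V> p X c"
  unfolding small_chain_def small_simplex_def singular_chain_def by blast

lemma small_simplex_imp_singular: "small_simplex \<V> p X \<sigma> \<Longrightarrow> singular_simplex p X \<sigma>"
  unfolding small_simplex_def using singular_simplex_subtopology by blast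

text \<open>An additive chain operator that respects subspaces cannot leave the member of the cover
  that contains a small simplex. It is applied to subdivision and to the chain homotopy.\<close>

lemma small_chain_map:
  assumes T0: "T 0 = 0" and Td: "\<And>c d. T (c - d) = T c - T d"
    and T: "\<And>V c. singular_chain p (subtopology X V) c \<Longrightarrow> singular_chain q (subtopology X V) (T c)"
    and c: "small_chain \<V> p X c"
  shows "small_chain \<V> q X (T c)"
  using c unfolding small_chain_def[of _ p]
proof (induction c rule: frag_induction)
  case zero
  then show ?case by (simp add: T0)
next
  case (one \<sigma>)
  then obtain V where V: "V \<in> \<V>" "singular_simplex p (subtopology X V) \<sigma>" by (auto simp: small_simplex_def)
  then have "singular_chain p (subtopology X V) (frag_of \<sigma>)" by (simp add: singular_chain_of)
  from small_chain_subtopology[OF V(1) T[OF this]] show ?case .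
next
  case (diff c d)
  then show ?case by (simp add: Td small_chain_diff)
qed

text \<open>\<open>\<theta>\<close> need not be a cocycle on large simplices. The correction terms make
  \<open>\<theta> (Sd\<^sup>k x) - (\<Sum>j<k. \<theta> (T (Sd\<^sup>j (\<partial> x))))\<close> eventually constant in \<open>k\<close>, where \<open>T\<close> is the chain
  homotopy from the identity to the subdivision \<open>Sd\<close>.\<close>

lemma small_cocycle_extension:
  fixes X :: "'a topology" and \<theta> :: "((nat \<Rightarrow> real) \<Rightarrow> 'a) \<Rightarrow> real"
  assumes opn: "\<And>V. V \<in> \<V> \<Longrightarrow> openin X V" and cov: "topspace X \<subseteq> \<Union>\<V>"
    and cocycle: "\<And>\<tau>. small_simplex \<V> (Suc n) X \<tau> \<Longrightarrow> (\<Sum>k\<le>Suc n. (-1) ^ k * \<theta> (singular_face (Suc n) k \<tau>)) = 0"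
  obtains \<theta>' where "\<theta>' \<in> cochains n X" "coboundary n X \<theta>' = (\<lambda>\<sigma>. 0)"
    "\<And>\<sigma>. small_simplex \<V> n X \<sigma> \<Longrightarrow> \<theta>' \<sigma> = \<theta> \<sigma>"
proof -
  obtain T :: "nat \<Rightarrow> 'a chain \<Rightarrow> 'a chain" where T0: "\<And>p. T p 0 = 0" and Td: "\<And>p c1 c2. T p (c1-c2) = T p c1 - T p c2"
    and Tc: "\<And>p X c. singular_chain p X c \<Longrightarrow> singular_chain (Suc p) X (T p c)"
    and Th: "\<And>p X c. singular_chain p X c \<Longrightarrow>
        chain_boundary (Suc p) (T p c) + T (p - Suc 0) (chain_boundary p c) = singular_subdivision p c - c"
    using chain_homotopic_singular_subdivision by metis
  let ?Sd = "\<lambda>p k. (singular_subdivision p ^^ k) :: 'a chain \<Rightarrow> 'a chain"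
  have Sdc: "singular_chain p Y (?Sd p k c)" if "singular_chain p Y c" for p k c and Y :: "'a topology"
    using that by (induction k) (auto intro: singular_chain_singular_subdivision)
  have Sdb: "chain_boundary p (?Sd p k c) = ?Sd (p - Suc 0) k (chain_boundary p c)"
    if "singular_chain p Y c" for p k c and Y :: "'a topology"
    by (induction k) (use chain_boundary_singular_subdivision[OF Sdc[OF that]] in auto)
  have Sd_small: "small_chain \<V> p X (?Sd p k c)" if "small_chain \<V> p X c" for p k c
    by (rule small_chain_map[OF _ _ _ that]) (auto simp: singular_subdivision_power_diff intro: Sdc)
  have bd0: "pairing \<theta> (chain_boundary (Suc n) z) = 0" if "small_chain \<V> (Suc n) X z" for z
    using that unfolding small_chain_def
  proof (induction z rule: frag_induction)
    case (one \<tau>)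
    then have "small_simplex \<V> (Suc n) X \<tau>" by simp
    from cocycle[OF this] show ?case by (simp only: pairing_boundary)
  qed (auto simp: chain_boundary_diff pairing_diff)
  \<comment> \<open>In degree 0 the index \<open>n - Suc 0\<close> is harmless: the boundary is 0,
    and \<open>T\<close> maps 0 to 0.\<close>
  define a where "a k x = pairing \<theta> (?Sd n k x) - (\<Sum>j<k. pairing \<theta> (T (n - Suc 0) (?Sd (n - Suc 0) j (chain_boundary n x))))" for k x
  have a_diff: "a k (x - y) = a k x - a k y" for k x y
    by (simp add: a_def singular_subdivision_power_diff pairing_diff chain_boundary_diff Td sum_subtractf)
  have a_0: "a k 0 = 0" for k by (simp add: a_def T0)
  \<comment> \<open>If the subdivided chain is small, so is its image under \<open>T\<close>, and
    \<open>\<theta>\<close> vanishes on the boundary of the latter. The chain homotopy formula turns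
    this into the equality of consecutive terms.\<close>
  have step: "a (Suc k) x = a k x" if x: "singular_chain n X x" and sm: "small_chain \<V> n X (?Sd n k x)" for k x
  proof -
    let ?y = "?Sd n k x"
    have "small_chain \<V> (Suc n) X (T n ?y)"
      by (rule small_chain_map[OF T0 Td _ sm]) (rule Tc)
    then have "pairing \<theta> (chain_boundary (Suc n) (T n ?y)) = 0" by (rule bd0)
    moreover have "chain_boundary (Suc n) (T n ?y) = ?Sd n (Suc k) x - ?y - T (n - Suc 0) (?Sd (n - Suc 0) k (chain_boundary n x))"
      using Th[OF Sdc[OF x, of k]] Sdb[OF x, of k] by (simp add: algebra_simps)
    ultimately show ?thesis by (simp add: a_def pairing_diff)
  qed
  have eventually_small: "\<exists>K. \<forall>k\<ge>K. small_chain \<V> p X (?Sd p k x)" if x: "singular_chain p X x" for p x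
  proof -
    obtain K where K: "\<And>m f. \<lbrakk>K \<le> m; f \<in> Poly_Mapping.keys (?Sd p m x)\<rbrakk> \<Longrightarrow> \<exists>V \<in> \<V>. f \<in> (standard_simplex p) \<rightarrow> V"
      using sufficient_iterated_singular_subdivision_exists[OF opn cov x] by blast
    have "small_chain \<V> p X (?Sd p k x)" if "k \<ge> K" for k
      unfolding small_chain_def small_simplex_def
    proof (intro subsetI CollectI)
      fix f assume f: "f \<in> Poly_Mapping.keys (?Sd p k x)"
      then have "singular_simplex p X f" using Sdc[OF x, of k] by (auto simp: singular_chain_def)
      then show "\<exists>V\<in>\<V>. singular_simplex p (subtopology X V) f"
        using K[OF that f] by (auto simp: singular_simplex_subtopology)
    qed
    then show ?thesis by blast
  qed
  \<comment> \<open>The eventual value of the sequence. On a small simplex the sequence is constant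
    from \<open>k = 0\<close> on, so the value is that of \<open>\<theta>\<close>.\<close>
  define \<theta>' where "\<theta>' \<sigma> = (if singular_simplex n X \<sigma> then (THE r. \<exists>K. \<forall>k\<ge>K. a k (frag_of \<sigma>) = r) else 0)" for \<sigma>
  have lim: "\<exists>K. \<forall>k\<ge>K. a k (frag_of \<sigma>) = \<theta>' \<sigma>" if \<sigma>: "singular_simplex n X \<sigma>" for \<sigma>
  proof -
    have ch: "singular_chain n X (frag_of \<sigma>)" using \<sigma> by (simp add: singular_chain_of)
    obtain K where K: "\<And>k. k \<ge> K \<Longrightarrow> small_chain \<V> n X (?Sd n k (frag_of \<sigma>))" using eventually_small[OF ch] by blast
    have "a k (frag_of \<sigma>) = a K (frag_of \<sigma>)" if "k \<ge> K" for k
      using that by (induction k rule: dec_induct) (use step[OF ch K] in auto)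
    then have ev: "\<exists>K'. \<forall>k\<ge>K'. a k (frag_of \<sigma>) = a K (frag_of \<sigma>)" by blast
    have "(THE r. \<exists>K. \<forall>k\<ge>K. a k (frag_of \<sigma>) = r) = a K (frag_of \<sigma>)"
    proof (rule the_equality)
      show "\<exists>K'. \<forall>k\<ge>K'. a k (frag_of \<sigma>) = a K (frag_of \<sigma>)" by (rule ev)
    next
      fix r assume "\<exists>K. \<forall>k\<ge>K. a k (frag_of \<sigma>) = r"
      then obtain K1 where "\<forall>k\<ge>K1. a k (frag_of \<sigma>) = r" by blast
      moreover obtain K2 where "\<forall>k\<ge>K2. a k (frag_of \<sigma>) = a K (frag_of \<sigma>)" using ev by blast
      ultimately show "r = a K (frag_of \<sigma>)" by (metis max.cobounded1 max.cobounded2)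
    qed
    then show ?thesis using ev \<sigma> by (simp add: \<theta>'_def)
  qed
  have lim_chain: "\<exists>K. \<forall>k\<ge>K. a k x = pairing \<theta>' x" if "singular_chain n X x" for x
    using that unfolding singular_chain_def
  proof (induction x rule: frag_induction)
    case zero
    then show ?case by (simp add: a_0)
  next
    case (one \<sigma>)
    then show ?case using lim[of \<sigma>] by simp
  next
    case (diff c d)
    then obtain K1 K2 where "\<forall>k\<ge>K1. a k c = pairing \<theta>' c" "\<forall>k\<ge>K2. a k d = pairing \<theta>' d" by blast
    then show ?case by (intro exI[of _ "max K1 K2"]) (simp add: a_diff pairing_diff)
  qed
  show ?thesis
  proof (rule that[of \<theta>'])
    show "\<theta>' \<in> cochains n X" by (simp add: cochains_def \<theta>'_def)
    show "coboundary n X \<theta>' = (\<lambda>\<sigma>. 0)"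
    proof
      fix \<tau>
      have "(\<Sum>k\<le>Suc n. (-1) ^ k * \<theta>' (singular_face (Suc n) k \<tau>)) = 0" if \<tau>: "singular_simplex (Suc n) X \<tau>"
      proof -
        have ch: "singular_chain (Suc n) X (frag_of \<tau>)" using \<tau> by (simp add: singular_chain_of)
        let ?b = "chain_boundary (Suc n) (frag_of \<tau>)"
        have b: "singular_chain n X ?b" using singular_chain_boundary_alt[OF ch] .
        obtain K1 where K1: "\<forall>k\<ge>K1. a k ?b = pairing \<theta>' ?b" using lim_chain[OF b] by blast
        obtain K2 where K2: "\<forall>k\<ge>K2. small_chain \<V> (Suc n) X (?Sd (Suc n) k (frag_of \<tau>))"
          using eventually_small[OF ch] by blast
        let ?K = "max K1 K2"
        \<comment> \<open>On a boundary the correction terms vanish; what is left is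
          \<open>\<theta>\<close> on the boundary of a small chain.\<close>
        have "chain_boundary n ?b = 0" using chain_boundary_boundary_alt[OF ch] .
        then have "a ?K ?b = pairing \<theta> (?Sd n ?K ?b)" by (simp add: a_def T0)
        also have "?Sd n ?K ?b = chain_boundary (Suc n) (?Sd (Suc n) ?K (frag_of \<tau>))" using Sdb[OF ch, of ?K] by simp
        also have "pairing \<theta> \<dots> = 0" using bd0 K2 by simp
        finally have "pairing \<theta>' ?b = 0" using K1 by simp
        then show ?thesis by (simp only: pairing_boundary)
      qed
      then show "coboundary n X \<theta>' \<tau> = 0" by (simp add: coboundary_def del: sum.atMost_Suc)
    qed
    fix \<sigma> assume sm: "small_simplex \<V> n X \<sigma>"
    then have \<sigma>: "singular_simplex n X \<sigma>" by (rule small_simplex_imp_singular)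
    have ch: "singular_chain n X (frag_of \<sigma>)" using \<sigma> by (simp add: singular_chain_of)
    have "a k (frag_of \<sigma>) = \<theta> \<sigma>" for k
    proof (induction k)
      case 0
      then show ?case by (simp add: a_def)
    next
      case (Suc k)
      then show ?case using step[OF ch Sd_small] sm by simp
    qed
    then show "\<theta>' \<sigma> = \<theta> \<sigma>" using lim[OF \<sigma>] by auto
  qed
qed

text \<open>In a trivial quotient the coset of \<open>f\<close> is the subgroup of coboundaries
  itself, and \<open>f\<close> belongs to its own coset because 0 is a coboundary.\<close>

lemma trivial_cohomology_primitive:
  fixes X :: "'a topology"
  assumes triv: "trivial_group (real_cohomology_group (Suc p) X)"
    and f: "f \<in> cochains (Suc p) X" "coboundary (Suc p) X f = (\<lambda>\<sigma>. 0)"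
  obtains c where "\<And>\<sigma>. singular_simplex (Suc p) X \<sigma> \<Longrightarrow> f \<sigma> = (\<Sum>k\<le>Suc p. (-1) ^ k * c (singular_face (Suc p) k \<sigma>))"
proof -
  let ?G = "cocycle_group (Suc p) X" and ?B = "coboundaries (Suc p) X"
  have "f \<in> carrier ?G" using f by (simp add: cocycle_group_def)
  then have "?B #>\<^bsub>?G\<^esub> f \<in> carrier (?G Mod ?B)" by (auto simp: FactGroup_def RCOSETS_def)
  then have "?B #>\<^bsub>?G\<^esub> f = ?B"
    using triv unfolding trivial_group_def real_cohomology_group_def by (simp add: FactGroup_def)
  moreover have "(\<lambda>\<sigma>. 0) \<in> ?B"
  proof -
    have "coboundary p X (\<lambda>\<sigma>. 0) = (\<lambda>\<sigma>. 0)" by (simp add: coboundary_def fun_eq_iff)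
    moreover have "(\<lambda>\<sigma>. 0) \<in> cochains p X" by (simp add: cochains_def)
    ultimately show ?thesis by (force simp: coboundaries_def image_iff)
  qed
  then have "f \<in> ?B #>\<^bsub>?G\<^esub> f" by (force simp: r_coset_def cocycle_group_def)
  ultimately have "f \<in> ?B" by simp
  then obtain c where "c \<in> cochains p X" "f = coboundary p X c" by (auto simp: coboundaries_def)
  then show ?thesis using that[of c] by (simp add: coboundary_def del: sum.atMost_Suc)
qed

section \<open>Partitions of unity and straightening of simplices\<close>

text \<open>The coface map on vertex numbers: the increasing injection that omits
  \<open>k\<close>.\<close>

definition skip :: "nat \<Rightarrow> nat \<Rightarrow> nat" where "skip k l = (if l < k then l else Suc l)"

context manifold
begin

lemma Hausdorff: "Hausdorff_space (mtop M)"
  using M by (simp add: smooth_manifold_def)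

text \<open>A bump in coordinates, extended by 0. The set \<open>K\<close> is the preimage of a
  closed coordinate ball; it is compact, hence closed in the Hausdorff space, and this makes the
  extension smooth across the boundary of the chart domain.\<close>

lemma bump_function:
  assumes V: "openin (mtop M) V" "x \<in> V"
  obtains f :: "'a \<Rightarrow> real" and K where "smooth_fn M (points M) f" "\<And>y. f y \<ge> 0" "f x > 0" "closedin (mtop M) K"
    "K \<subseteq> V" "\<And>y. y \<in> points M - K \<Longrightarrow> f y = 0"
proof -
  obtain c where c: "c \<in> charts M" "x \<in> fst c" using V chart_cover openin_subset by blast
  let ?S = "snd c ` (fst c \<inter> V)"
  have S: "open ?S" "snd c x \<in> ?S" using chart_image_openin[OF c(1) V(1)] c V by auto
  then obtain e where e: "e > 0" "cball (snd c x) e \<subseteq> ?S" using open_contains_cball by blast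
  obtain b :: "'e \<Rightarrow> real" where b: "smooth_on UNIV b" "\<And>y. b y \<ge> 0" "\<And>y. b y > 0 \<longleftrightarrow> dist (snd c x) y < e"
    using smooth_bump_exists[OF e(1), of "snd c x"] by blast
  define f where "f y = (if y \<in> fst c then b (snd c y) else 0)" for y
  define K where "K = chart_inv c ` cball (snd c x) e"
  have "compactin (top_of_set (snd c ` fst c)) (cball (snd c x) e)"
    using e(2) by (auto simp: compactin_subtopology)
  then have "compactin (mtop M) K" unfolding K_def by (rule image_compactin[OF _ chart_inv_continuous[OF c(1)]])
  then have K: "closedin (mtop M) K" by (rule compactin_imp_closedin[OF Hausdorff])
  have KV: "K \<subseteq> V" using e(2) c(1) by (force simp: K_def)
  have zero: "f y = 0" if "y \<in> points M - K" for y
  proof (cases "y \<in> fst c \<and> snd c y \<in> cball (snd c x) e")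
    case True
    then have "y \<in> K" unfolding K_def using c(1) by (metis chart_inv_left imageI)
    then show ?thesis using that by blast
  next
    case False
    then have "y \<in> fst c \<Longrightarrow> \<not> b (snd c y) > 0" by (simp add: b(3))
    then show ?thesis using b(2)[of "snd c y"] by (auto simp: f_def)
  qed
  have "smooth_fn M (points M) f"
  proof (rule smooth_fn_local)
    fix y assume y: "y \<in> points M"
    show "\<exists>W. openin (mtop M) W \<and> y \<in> W \<and> smooth_fn M W f"
    proof (cases "y \<in> fst c")
      case True
      have "smooth_fn M (fst c) (\<lambda>y. b (snd c y))"
        by (rule smooth_fn_compose[OF chart_openin[OF c(1)] smooth_fn_chart[OF c(1)] open_UNIV b(1)]) simp
      then have "smooth_fn M (fst c) f"
        by (rule smooth_fn_cong[OF chart_openin[OF c(1)], rotated]) (simp add: f_def)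
      then show ?thesis using True chart_openin[OF c(1)] by blast
    next
      case False
      have op: "openin (mtop M) (points M - K)" using K by blast
      have "K \<subseteq> fst c" using e(2) c(1) by (force simp: K_def)
      then have "y \<in> points M - K" using False y by blast
      moreover have "smooth_fn M (points M - K) f"
        by (rule smooth_fn_cong[OF op _ smooth_fn_const[OF op, of 0]]) (simp add: zero)
      ultimately show ?thesis using op by blast
    qed
  qed
  moreover have "f x > 0" using c e(1) by (simp add: f_def b(3))
  ultimately show ?thesis using that[of f K] b(2) K KV zero by (simp add: f_def)
qed

lemma smooth_continuous: "smooth_fn M (points M) f \<Longrightarrow> continuous_map (mtop M) euclidean f"
  using smooth_fn_continuous[of "points M" f] by simp

lemma open_pos_set:
  fixes f :: "'a \<Rightarrow> real"
  assumes "continuous_map (mtop M) euclideanreal f" shows "openin (mtop M) {y \<in> points M. f y > r}"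
  using openin_continuous_map_preimage[OF assms, of "{r<..}"] by simp

lemma compact_finite_subcover:
  assumes "compact_space (mtop M)" "\<And>x. x \<in> points M \<Longrightarrow> openin (mtop M) (U x) \<and> x \<in> U x"
  obtains X where "finite X" "X \<subseteq> points M" "points M \<subseteq> (\<Union>x\<in>X. U x)"
proof -
  have "\<exists>\<F>. finite \<F> \<and> \<F> \<subseteq> U ` points M \<and> points M \<subseteq> \<Union>\<F>"
    using assms unfolding compact_space_def by (intro compactinD) auto
  then show ?thesis using that by (metis finite_subset_image)
qed

text \<open>The sets \<open>Q x\<close> are shrunk to closed sets \<open>C x\<close>, finitely many of which cover. A bump function
  around \<open>y\<close> is supported away from those \<open>C x\<close> that do not contain \<open>y\<close>. Hence if \<open>z \<in> C x\<close> lies in its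
  support, then \<open>y \<in> Q x\<close>.\<close>

lemma star_partition_of_unity:
  assumes comp: "compact_space (mtop M)" and Q: "\<And>x. x \<in> points M \<Longrightarrow> openin (mtop M) (Q x) \<and> x \<in> Q x"
  obtains I and \<phi> :: "'a \<Rightarrow> 'a \<Rightarrow> real" and K where "finite I" "I \<subseteq> points M"
    "\<And>i. i \<in> I \<Longrightarrow> smooth_fn M (points M) (\<phi> i)" "\<And>i. i \<in> I \<Longrightarrow> closedin (mtop M) (K i)"
    "\<And>i y. i \<in> I \<Longrightarrow> y \<in> points M - K i \<Longrightarrow> \<phi> i y = 0"
    "\<And>y. y \<in> points M \<Longrightarrow> (\<Sum>i\<in>I. \<phi> i y) = 1"
    "\<And>y. y \<in> points M \<Longrightarrow> \<exists>x\<in>points M. insert y {i \<in> I. y \<in> K i} \<subseteq> Q x"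
    "\<And>i. i \<in> I \<Longrightarrow> K i \<subseteq> Q i"
proof -
  have "\<exists>f C. smooth_fn M (points M) f \<and> (\<forall>y. f y \<ge> (0::real)) \<and> f x > 0 \<and> closedin (mtop M) C \<and> C \<subseteq> Q x \<and>
      (\<forall>y\<in>points M - C. f y = 0)" if "x \<in> points M" for x
    using bump_function[of "Q x" x] Q[OF that] by metis
  then obtain f C where fC: "\<And>x. x \<in> points M \<Longrightarrow> smooth_fn M (points M) (f x) \<and> (\<forall>y. f x y \<ge> (0::real)) \<and> f x x > 0 \<and>
      closedin (mtop M) (C x) \<and> C x \<subseteq> Q x \<and> (\<forall>y\<in>points M - C x. f x y = 0)" by metis
  have op: "openin (mtop M) {y \<in> points M. f x y > 0}" if "x \<in> points M" for x
    using fC[OF that] open_pos_set smooth_continuous by blast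
  obtain X where X: "finite X" "X \<subseteq> points M" "points M \<subseteq> (\<Union>x\<in>X. {y \<in> points M. f x y > 0})"
    using compact_finite_subcover[OF comp, of "\<lambda>x. {y \<in> points M. f x y > 0}"] op fC by blast
  define N where "N y = points M - (\<Union>x\<in>{x\<in>X. y \<notin> C x}. C x)" for y
  have N: "openin (mtop M) (N y)" for y
    unfolding N_def using X fC by (intro openin_diff openin_topspace closedin_Union) auto
  have "\<exists>h K. smooth_fn M (points M) h \<and> (\<forall>y. h y \<ge> (0::real)) \<and> h x > 0 \<and> closedin (mtop M) K \<and> K \<subseteq> N x \<inter> Q x \<and>
      (\<forall>y\<in>points M - K. h y = 0)" if x: "x \<in> points M" for x
  proof -
    have "openin (mtop M) (N x \<inter> Q x)" "x \<in> N x \<inter> Q x" using N Q[OF x] x by (auto simp: N_def)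
    from bump_function[OF this] show ?thesis by metis
  qed
  then obtain h K where hK: "\<And>x. x \<in> points M \<Longrightarrow> smooth_fn M (points M) (h x) \<and> (\<forall>y. h x y \<ge> (0::real)) \<and> h x x > 0 \<and>
      closedin (mtop M) (K x) \<and> K x \<subseteq> N x \<inter> Q x \<and> (\<forall>y\<in>points M - K x. h x y = 0)" by metis
  have op': "openin (mtop M) {y \<in> points M. h x y > 0}" if "x \<in> points M" for x
    using hK[OF that] open_pos_set smooth_continuous by blast
  obtain I where I: "finite I" "I \<subseteq> points M" "points M \<subseteq> (\<Union>x\<in>I. {y \<in> points M. h x y > 0})"
    using compact_finite_subcover[OF comp, of "\<lambda>x. {y \<in> points M. h x y > 0}"] op' hK by blast
  define s where "s y = (\<Sum>i\<in>I. h i y)" for y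
  have s: "s y > 0" if y: "y \<in> points M" for y
  proof -
    obtain i where i: "i \<in> I" "h i y > 0" using I(3) y by blast
    have "h i y \<le> s y" unfolding s_def by (rule member_le_sum) (use i I hK in auto)
    then show ?thesis using i by simp
  qed
  have ss: "smooth_fn M (points M) s" unfolding s_def
    by (rule smooth_fn_sum[OF openin_topspace]) (use I hK in blast)
  show ?thesis
  proof (rule that[of I "\<lambda>i y. h i y / s y" K])
    show "smooth_fn M (points M) (\<lambda>y. h i y / s y)" if "i \<in> I" for i
      by (rule smooth_fn_divide[OF openin_topspace _ ss]) (use that I hK s in \<open>auto simp: less_imp_neq[symmetric]\<close>)
    show "(\<Sum>i\<in>I. h i y / s y) = 1" if "y \<in> points M" for y
      using s[OF that] by (simp add: sum_divide_distrib[symmetric] s_def[symmetric])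
    show "\<exists>x\<in>points M. insert y {i \<in> I. y \<in> K i} \<subseteq> Q x" if y: "y \<in> points M" for y
    proof -
      obtain x where x: "x \<in> X" "f x y > 0" using X(3) y by blast
      then have yC: "y \<in> C x" using fC X(2) y by (metis DiffI in_mono less_irrefl)
      have "i \<in> Q x" if i: "i \<in> I" "y \<in> K i" for i
      proof -
        have "y \<in> N i" using hK I i by blast
        then have "i \<in> C x" using x(1) yC by (auto simp: N_def)
        then show ?thesis using fC x(1) X(2) by blast
      qed
      moreover have "y \<in> Q x" using yC fC x(1) X(2) by blast
      ultimately show ?thesis using x X by blast
    qed
    fix i assume i: "i \<in> I"
    then have "i \<in> points M" using I(2) by blast
    note hKi = hK[OF this]
    show "K i \<subseteq> Q i" "closedin (mtop M) (K i)" using hKi by blast+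
    show "h i y / s y = 0" if "y \<in> points M - K i" for y using hKi that by simp
  qed (fact I)+
qed

text \<open>A substitute for geodesic simplices. The \<open>p i\<close> start as vertices with
  barycentric weights \<open>w i\<close>; each chart of the list draws them towards the barycentre
  computed in that chart, by the amount given by its cutoff function. Where some cutoff function is
  1, nearby points end up merged, and the common point is the point of the simplex. Points with
  cutoff 0 have a case of their own, as they may lie outside the chart domain.\<close>

primrec evolve :: "(('a, 'e) chart \<times> ('a \<Rightarrow> real)) list \<Rightarrow> 'i set \<Rightarrow> ('i \<Rightarrow> real) \<Rightarrow> ('i \<Rightarrow> 'a) \<Rightarrow> 'i \<Rightarrow> 'a" where
  "evolve [] I w p = p"
| "evolve (cx # L) I w p = evolve L I w (\<lambda>i. if snd cx (p i) = 0 then p i else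
     chart_inv (fst cx) ((1 - snd cx (p i)) *\<^sub>R snd (fst cx) (p i) + snd cx (p i) *\<^sub>R (\<Sum>l\<in>I. w l *\<^sub>R snd (fst cx) (p l))))"

lemma evolve_eq: "p i = p j \<Longrightarrow> evolve L I w p i = evolve L I w p j"
  by (induction L arbitrary: p) auto

definition cutoff :: "('a, 'e) chart \<times> ('a \<Rightarrow> real) \<Rightarrow> bool" where
  "cutoff cx \<longleftrightarrow> fst cx \<in> charts M \<and> continuous_map (mtop M) euclideanreal (snd cx) \<and>
     (\<forall>x\<in>points M. 0 \<le> snd cx x \<and> snd cx x \<le> 1) \<and>
     (\<exists>K. closedin (mtop M) K \<and> K \<subseteq> fst (fst cx) \<and> (\<forall>x\<in>points M - K. snd cx x = 0))"

text \<open>If all the weight sits at \<open>k\<close>, the barycentre is \<open>p k\<close> in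
  every chart, so this point never moves.\<close>

lemma evolve_vertex:
  assumes "\<forall>cx\<in>set L. cutoff cx" "finite I" "k \<in> I" "w k = 1" "\<And>l. l \<in> I \<Longrightarrow> l \<noteq> k \<Longrightarrow> w l = 0" "p k \<in> points M"
  shows "evolve L I w p k = p k"
  using assms(1,6)
proof (induction L arbitrary: p)
  case (Cons cx L)
  have "(\<Sum>l\<in>I. w l *\<^sub>R snd (fst cx) (p l)) = (\<Sum>l\<in>I. if l = k then snd (fst cx) (p k) else 0)"
    by (intro sum.cong) (use assms(4,5) in auto)
  then have sum: "(\<Sum>l\<in>I. w l *\<^sub>R snd (fst cx) (p l)) = snd (fst cx) (p k)" using assms(2,3) by simp
  have "p k \<in> fst (fst cx)" if "snd cx (p k) \<noteq> 0"
  proof -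
    obtain K where "K \<subseteq> fst (fst cx)" "\<forall>x\<in>points M - K. snd cx x = 0"
      using Cons.prems(1) unfolding cutoff_def by auto
    then show ?thesis using that Cons.prems(2) by blast
  qed
  then have "chart_inv (fst cx) ((1 - snd cx (p k)) *\<^sub>R snd (fst cx) (p k) + snd cx (p k) *\<^sub>R snd (fst cx) (p k)) = p k"
    if "snd cx (p k) \<noteq> 0"
    using that Cons.prems by (simp add: cutoff_def algebra_simps)
  then show ?case using Cons sum by simp
qed simp

text \<open>\<open>X\<close> parametrises a family of weights and points. Only the points with index
  in \<open>S\<close> have to lie in the small set \<open>Q\<close>; the weights vanish elsewhere,
  so that far-away points, whose coordinates are meaningless in the current chart, do not affect the
  barycentre.\<close>

definition admissible :: "'z topology \<Rightarrow> 'i set \<Rightarrow> ('z \<Rightarrow> 'i \<Rightarrow> real) \<Rightarrow> ('z \<Rightarrow> 'i \<Rightarrow> 'a) \<Rightarrow> 'i set \<Rightarrow> 'a set \<Rightarrow> bool" where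
  "admissible X I w p S Q \<longleftrightarrow> S \<subseteq> I \<and> (\<forall>i\<in>I. continuous_map X euclideanreal (\<lambda>z. w z i)) \<and>
     (\<forall>z\<in>topspace X. (\<forall>i\<in>I. w z i \<ge> 0) \<and> (\<Sum>i\<in>I. w z i) = 1 \<and> (\<forall>i\<in>I - S. w z i = 0)) \<and>
     (\<forall>i\<in>S. continuous_map X (mtop M) (\<lambda>z. p z i)) \<and> (\<forall>z\<in>topspace X. \<forall>i\<in>S. p z i \<in> Q)"

lemma admissible_mono: "admissible X I w p S Q \<Longrightarrow> Q \<subseteq> Q' \<Longrightarrow> admissible X I w p S Q'"
  unfolding admissible_def by blast

text \<open>A coordinate ball is convex, hence contains the barycentre and the segments leading to
  it. On it the two cases of the step agree in one formula, which is continuous in the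
  parameter.\<close>

lemma admissible_step:
  fixes X :: "'z topology" and I :: "'i set"
  assumes ad: "admissible X I w p S Q" and cx: "cutoff (c, \<eta>)" and fin: "finite I"
    and Q: "Q = {y \<in> fst c. snd c y \<in> ball y0 e}" "ball y0 e \<subseteq> snd c ` fst c"
  shows "admissible X I w (\<lambda>z i. if \<eta> (p z i) = 0 then p z i else
      chart_inv c ((1 - \<eta> (p z i)) *\<^sub>R snd c (p z i) + \<eta> (p z i) *\<^sub>R (\<Sum>l\<in>I. w z l *\<^sub>R snd c (p z l)))) S Q"
    (is "admissible X I w ?p' S Q")
proof -
  have c: "c \<in> charts M" and \<eta>: "continuous_map (mtop M) euclideanreal \<eta>" "\<And>x. x \<in> points M \<Longrightarrow> 0 \<le> \<eta> x \<and> \<eta> x \<le> 1"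
    using cx by (auto simp: cutoff_def)
  have pQ: "p z i \<in> Q" if "i \<in> S" "z \<in> topspace X" for i z using ad that by (auto simp: admissible_def)
  then have pc: "p z i \<in> fst c" "snd c (p z i) \<in> ball y0 e" if "i \<in> S" "z \<in> topspace X" for i z
    using that Q(1) by blast+
  define bar where "bar z = (\<Sum>l\<in>S. w z l *\<^sub>R snd c (p z l))" for z
  have finS: "finite S" using ad fin finite_subset by (auto simp: admissible_def)
  have bar_eq: "(\<Sum>l\<in>I. w z l *\<^sub>R snd c (p z l)) = bar z" if "z \<in> topspace X" for z
    unfolding bar_def by (rule sum.mono_neutral_right) (use ad that fin in \<open>auto simp: admissible_def\<close>)
  have bar_ball: "bar z \<in> ball y0 e" if z: "z \<in> topspace X" for z
    unfolding bar_def
  proof (rule convex_sum[OF finS convex_ball])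
    have "(\<Sum>i\<in>S. w z i) = (\<Sum>i\<in>I. w z i)"
      by (rule sum.mono_neutral_left) (use ad z fin in \<open>auto simp: admissible_def\<close>)
    then show "(\<Sum>i\<in>S. w z i) = 1" using ad z by (auto simp: admissible_def)
  qed (use ad z pc in \<open>auto simp: admissible_def\<close>)
  define q where "q z i = (1 - \<eta> (p z i)) *\<^sub>R snd c (p z i) + \<eta> (p z i) *\<^sub>R bar z" for z i
  have q_ball: "q z i \<in> ball y0 e" if "i \<in> S" "z \<in> topspace X" for i z
  proof -
    have "p z i \<in> points M" using pc(1)[OF that] chart_subset[OF c] by blast
    then show ?thesis unfolding q_def
      using \<eta>(2) by (intro convexD[OF convex_ball]) (use pc(2)[OF that] bar_ball[OF that(2)] in auto)
  qed
  have p': "?p' z i = chart_inv c (q z i)" if "i \<in> S" "z \<in> topspace X" for i z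
    using pc(1)[OF that] c by (simp add: q_def bar_eq[OF that(2)])
  have cont_c: "continuous_map X euclidean (\<lambda>z. snd c (p z i))" if "i \<in> S" for i
  proof -
    have "continuous_map X (subtopology (mtop M) (fst c)) (\<lambda>z. p z i)"
      using ad that pc(1)[OF that] by (auto simp: admissible_def continuous_map_in_subtopology)
    from continuous_map_compose[OF this chart_continuous[OF c]] show ?thesis by (simp add: comp_def)
  qed
  have cont_\<eta>: "continuous_map X euclideanreal (\<lambda>z. \<eta> (p z i))" if "i \<in> S" for i
    using continuous_map_compose[OF _ \<eta>(1), of X "\<lambda>z. p z i"] ad that by (auto simp: admissible_def comp_def)
  have cont_w: "continuous_map X euclideanreal (\<lambda>z. w z i)" if "i \<in> S" for i
    using ad that by (auto simp: admissible_def)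
  have scal: "continuous_map X euclidean (\<lambda>z. a z *\<^sub>R b z)"
    if "continuous_map X euclideanreal a" "continuous_map X euclidean b" for a and b :: "'z \<Rightarrow> 'e"
    using that continuous_map_compose[OF continuous_map_pairedI[OF that], of euclidean "\<lambda>(r, v). r *\<^sub>R v"]
    by (simp add: comp_def case_prod_unfold continuous_intros flip: euclidean_product_topology)
  have cont_bar: "continuous_map X euclidean bar"
    unfolding bar_def using finS cont_w cont_c scal by (intro continuous_map_sum) auto
  have cont_q: "continuous_map X euclidean (\<lambda>z. q z i)" if "i \<in> S" for i
    unfolding q_def using cont_\<eta>[OF that] cont_c[OF that] cont_bar
    by (intro continuous_map_add scal continuous_map_diff) auto
  have "continuous_map X (mtop M) (\<lambda>z. ?p' z i)" if "i \<in> S" for i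
  proof -
    have "continuous_map X (top_of_set (snd c ` fst c)) (\<lambda>z. q z i)"
      using cont_q[OF that] q_ball[OF that] Q(2) by (auto simp: continuous_map_in_subtopology)
    from continuous_map_compose[OF this chart_inv_continuous[OF c]]
    show ?thesis by (rule continuous_map_eq) (simp add: p' that del: if_split)
  qed
  moreover have "?p' z i \<in> Q" if "i \<in> S" "z \<in> topspace X" for z i
    unfolding p'[OF that] Q(1) using q_ball[OF that] Q(2) chart_inv_mem[of "q z i" c] chart_inv_right[of "q z i" c]
    by (metis (no_types, lifting) mem_Collect_eq subsetD)
  ultimately show ?thesis using ad unfolding admissible_def by blast
qed

text \<open>All admissible families are quantified over because the induction on the list replaces
  \<open>p\<close> by the family after the first step. The type arguments determine the types of the
  bound variables \<open>X\<close> and \<open>I\<close>.\<close>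

definition evolves_into :: "'z itself \<Rightarrow> 'i itself \<Rightarrow> (('a, 'e) chart \<times> ('a \<Rightarrow> real)) list \<Rightarrow> 'a \<Rightarrow> 'a set \<Rightarrow> 'a set \<Rightarrow> bool" where
  "evolves_into _ _ L x Q V \<longleftrightarrow> (\<forall>(X :: 'z topology) (I :: 'i set) w p S. finite I \<longrightarrow> admissible X I w p S Q \<longrightarrow>
     (\<forall>i\<in>S. continuous_map X (mtop M) (\<lambda>z. evolve L I (w z) (p z) i)) \<and>
     (\<forall>i\<in>S. \<forall>z\<in>topspace X. evolve L I (w z) (p z) i \<in> V) \<and>
     ((\<exists>cx\<in>set L. \<exists>W. openin (mtop M) W \<and> x \<in> W \<and> (\<forall>y\<in>W. snd cx y = 1)) \<longrightarrow>
        (\<forall>i\<in>S. \<forall>j\<in>S. \<forall>z\<in>topspace X. evolve L I (w z) (p z) i = evolve L I (w z) (p z) j)))"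

lemma evolves_intoD:
  fixes X :: "'z topology" and I :: "'i set"
  assumes "evolves_into TYPE('z) TYPE('i) L x Q V" "finite I" "admissible X I w p S Q"
  shows "i \<in> S \<Longrightarrow> continuous_map X (mtop M) (\<lambda>z. evolve L I (w z) (p z) i)"
    "i \<in> S \<Longrightarrow> z \<in> topspace X \<Longrightarrow> evolve L I (w z) (p z) i \<in> V"
    "\<lbrakk>\<exists>cx\<in>set L. \<exists>W. openin (mtop M) W \<and> x \<in> W \<and> (\<forall>y\<in>W. snd cx y = 1); i \<in> S; j \<in> S; z \<in> topspace X\<rbrakk>
       \<Longrightarrow> evolve L I (w z) (p z) i = evolve L I (w z) (p z) j"
  using assms(1)[unfolded evolves_into_def, rule_format, OF assms(2,3)] by blast+

text \<open>Each step keeps the points inside a set that is convex in the chart of the step, and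
  merges the points at which the cutoff function is 1.\<close>

lemma evolve_local:
  fixes V :: "'a set"
  assumes "\<forall>cx\<in>set L. cutoff cx" "openin (mtop M) V" "x \<in> V"
  shows "\<exists>Q. openin (mtop M) Q \<and> x \<in> Q \<and> Q \<subseteq> V \<and> evolves_into TYPE('z) TYPE('i) L x Q V"
  using assms
proof (induction L arbitrary: V)
  case Nil
  then show ?case by (intro exI[of _ V]) (auto simp: admissible_def evolves_into_def)
next
  case (Cons cx L)
  obtain c \<eta> where cx: "cx = (c, \<eta>)" by (cases cx)
  have cut: "cutoff (c, \<eta>)" and c: "c \<in> charts M" using Cons.prems(1) cx by (auto simp: cutoff_def)
  obtain K where K: "closedin (mtop M) K" "K \<subseteq> fst c" "\<And>y. y \<in> points M - K \<Longrightarrow> \<eta> y = 0"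
    using cut by (auto simp: cutoff_def)
  have L: "\<forall>cx\<in>set L. cutoff cx" using Cons.prems(1) by simp
  obtain Q1 where Q1: "openin (mtop M) Q1" "x \<in> Q1" "Q1 \<subseteq> V" and ev: "evolves_into TYPE('z) TYPE('i) L x Q1 V"
    using Cons.IH[OF L Cons.prems(2,3)] by blast
  let ?hd = "\<exists>W. openin (mtop M) W \<and> x \<in> W \<and> (\<forall>y\<in>W. \<eta> y = 1)"
  let ?tl = "\<exists>cx\<in>set L. \<exists>W. openin (mtop M) W \<and> x \<in> W \<and> (\<forall>y\<in>W. snd cx y = 1)"
  let ?step = "\<lambda>(I :: 'i set) w p z i. if \<eta> (p z i) = 0 then p z i else
      chart_inv c ((1 - \<eta> (p z i)) *\<^sub>R snd c (p z i) + \<eta> (p z i) *\<^sub>R (\<Sum>l\<in>I. w z l *\<^sub>R snd c (p z l)))"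
  have evolve_Cons: "evolve (cx # L) I (w z) (p z) = evolve L I (w z) (?step I w p z)" for I w p and z :: 'z
    unfolding evolve.simps cx fst_conv snd_conv ..
  show ?case
  \<comment> \<open>Off \<open>K\<close> the cutoff function vanishes, and the step is the identity
    near \<open>x\<close>; on \<open>K\<close> the point lies in the chart domain, and a convex
    coordinate ball is available.\<close>
  proof (cases "x \<in> K")
    case False
    define Q where "Q = Q1 \<inter> (points M - K)"
    have Q: "openin (mtop M) Q" "x \<in> Q" "Q \<subseteq> V" unfolding Q_def using Q1 K(1) False openin_subset by blast+
    have nhd: "\<not> ?hd" using K(3)[of x] False Q(2) by (force simp: Q_def)
    have adm: "admissible X I w (?step I w p) S Q1" if ad: "admissible X I w p S Q" for X :: "'z topology" and I w p S
    proof -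
      have "p z i \<in> Q" if "i \<in> S" "z \<in> topspace X" for z i using ad that by (auto simp: admissible_def)
      then have eq: "?step I w p z i = p z i" "p z i \<in> Q1" if "i \<in> S" "z \<in> topspace X" for z i
        using that K(3)[of "p z i"] by (auto simp: Q_def)
      have "continuous_map X (mtop M) (\<lambda>z. ?step I w p z i)" if "i \<in> S" for i
      proof (rule continuous_map_eq)
        show "continuous_map X (mtop M) (\<lambda>z. p z i)" using ad that unfolding admissible_def by blast
        show "p z i = ?step I w p z i" if "z \<in> topspace X" for z by (rule eq(1)[OF \<open>i \<in> S\<close> that, symmetric])
      qed
      moreover have "?step I w p z i \<in> Q1" if "i \<in> S" "z \<in> topspace X" for z i
        unfolding eq(1)[OF that] by (rule eq(2)[OF that])
      ultimately show ?thesis using ad unfolding admissible_def by blast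
    qed
    have "evolves_into TYPE('z) TYPE('i) (cx # L) x Q V"
      unfolding evolves_into_def evolve_Cons
    proof (intro conjI allI impI ballI)
      fix X :: "'z topology" and I :: "'i set" and w p S
      assume fin: "finite I" and ad: "admissible X I w p S Q"
      note ev1 = evolves_intoD[OF ev fin adm[OF ad]]
      fix i assume i: "i \<in> S"
      show "continuous_map X (mtop M) (\<lambda>z. evolve L I (w z) (?step I w p z) i)" by (rule ev1(1)[OF i])
      show "evolve L I (w z) (?step I w p z) i \<in> V" if "z \<in> topspace X" for z by (rule ev1(2)[OF i that])
      assume "\<exists>cx\<in>set (cx # L). \<exists>W. openin (mtop M) W \<and> x \<in> W \<and> (\<forall>y\<in>W. snd cx y = 1)"
      then have ?tl using nhd by (auto simp: cx)
      then show "evolve L I (w z) (?step I w p z) i = evolve L I (w z) (?step I w p z) j"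
        if "j \<in> S" "z \<in> topspace X" for j z
        by (rule ev1(3)[OF _ i that])
    qed
    then show ?thesis using Q by blast
  next
    case True
    obtain W where W: "openin (mtop M) W" "x \<in> W" "?hd \<longrightarrow> (\<forall>y\<in>W. \<eta> y = 1)"
    proof (cases ?hd)
      case False
      then show ?thesis using that[of "points M"] Q1 openin_subset by blast
    qed (use that in blast)
    have S: "open (snd c ` (fst c \<inter> (Q1 \<inter> W)))"
      by (rule chart_image_openin[OF c openin_Int[OF Q1(1) W(1)]])
    have "snd c x \<in> snd c ` (fst c \<inter> (Q1 \<inter> W))" using True K(2) Q1(2) W(2) by blast
    then obtain e where e: "e > 0" "ball (snd c x) e \<subseteq> snd c ` (fst c \<inter> (Q1 \<inter> W))" using S open_contains_ball by blast
    define Q where "Q = {y \<in> fst c. snd c y \<in> ball (snd c x) e}"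
    have Qs: "Q \<subseteq> Q1 \<inter> W"
    proof
      fix y assume y: "y \<in> Q"
      then obtain y' where "y' \<in> fst c \<inter> (Q1 \<inter> W)" "snd c y = snd c y'" using e(2) by (auto simp: Q_def)
      moreover from this have "y = y'" using y chart_inj[OF c] by (auto simp: Q_def inj_on_def)
      ultimately show "y \<in> Q1 \<inter> W" by simp
    qed
    have Q: "openin (mtop M) Q" "x \<in> Q" "Q \<subseteq> V"
      using chart_preimage_openin[OF c open_ball] True K(2) e(1) Qs Q1(3) by (auto simp: Q_def)
    have ball: "ball (snd c x) e \<subseteq> snd c ` fst c" using e(2) by blast
    have ad': "admissible X I w (?step I w p) S Q" if "admissible X I w p S Q" "finite I" for X :: "'z topology" and I w p S
      by (rule admissible_step[OF that(1) cut that(2) Q_def ball])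
    have ad1: "admissible X I w (?step I w p) S Q1" if "admissible X I w p S Q" "finite I" for X :: "'z topology" and I w p S
      by (rule admissible_mono[OF ad'[OF that]]) (use Qs in blast)
    have merge: "evolve L I (w z) (?step I w p z) i = evolve L I (w z) (?step I w p z) j"
      if "admissible X I w p S Q" ?hd "i \<in> S" "j \<in> S" "z \<in> topspace X" for X :: "'z topology" and I w p S i j z
    proof (rule evolve_eq)
      have "p z i \<in> Q" "p z j \<in> Q" using that by (auto simp: admissible_def)
      then have "\<eta> (p z i) = 1" "\<eta> (p z j) = 1" using Qs W(3) that(2) by auto
      then show "?step I w p z i = ?step I w p z j" by simp
    qed
    have "evolves_into TYPE('z) TYPE('i) (cx # L) x Q V"
      unfolding evolves_into_def evolve_Cons
    proof (intro conjI allI impI ballI)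
      fix X :: "'z topology" and I :: "'i set" and w p S
      assume fin: "finite I" and ad: "admissible X I w p S Q"
      note ev1 = evolves_intoD[OF ev fin ad1[OF ad fin]]
      fix i assume i: "i \<in> S"
      show "continuous_map X (mtop M) (\<lambda>z. evolve L I (w z) (?step I w p z) i)" by (rule ev1(1)[OF i])
      show "evolve L I (w z) (?step I w p z) i \<in> V" if "z \<in> topspace X" for z by (rule ev1(2)[OF i that])
      assume "\<exists>cx\<in>set (cx # L). \<exists>W. openin (mtop M) W \<and> x \<in> W \<and> (\<forall>y\<in>W. snd cx y = 1)"
      then have "?hd \<or> ?tl" by (auto simp: cx)
      then show "evolve L I (w z) (?step I w p z) i = evolve L I (w z) (?step I w p z) j"
        if "j \<in> S" "z \<in> topspace X" for j z
        using ev1(3)[OF _ i that] merge[OF ad _ i that] by blast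
    qed
    then show ?thesis using Q by blast
  qed
qed

lemma cutoff_list_exists:
  assumes comp: "compact_space (mtop M)"
  obtains L where "\<forall>cx\<in>set L. cutoff cx"
    "\<And>x. x \<in> points M \<Longrightarrow> \<exists>cx\<in>set L. \<exists>W. openin (mtop M) W \<and> x \<in> W \<and> (\<forall>y\<in>W. snd cx y = 1)"
proof -
  have "\<exists>cx W. cutoff cx \<and> openin (mtop M) W \<and> x \<in> W \<and> (\<forall>y\<in>W. snd cx y = 1)" if x: "x \<in> points M" for x
  proof -
    obtain c where c: "c \<in> charts M" "x \<in> fst c" using chart_cover[OF x] by blast
    obtain f :: "'a \<Rightarrow> real" and K where f: "smooth_fn M (points M) f" "\<And>y. f y \<ge> 0" "f x > 0" "closedin (mtop M) K"
      "K \<subseteq> fst c" "\<And>y. y \<in> points M - K \<Longrightarrow> f y = 0"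
      using bump_function[OF chart_openin[OF c(1)] c(2)] by metis
    \<comment> \<open>Equal to 1 wherever \<open>f y > f x / 2\<close>, which is a neighbourhood of
      \<open>x\<close>. Truncation at 1 costs smoothness, but \<open>cutoff\<close> asks for
      continuity only.\<close>
    define \<eta> where "\<eta> y = min 1 (2 / f x * f y)" for y
    have cf: "continuous_map (mtop M) euclideanreal f" by (rule smooth_continuous[OF f(1)])
    have "continuous_map (mtop M) euclideanreal \<eta>"
      unfolding \<eta>_def by (intro continuous_map_real_min continuous_map_real_mult cf) auto
    then have "cutoff (c, \<eta>)" using c f by (auto simp: cutoff_def \<eta>_def)
    moreover have "openin (mtop M) {y \<in> points M. f y > f x / 2}" by (rule open_pos_set[OF cf])
    moreover have "\<eta> y = 1" if "f y > f x / 2" for y using that f(3) by (simp add: \<eta>_def field_simps)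
    ultimately show ?thesis using f(3) x
      by (intro exI[of _ "(c, \<eta>)"] exI[of _ "{y \<in> points M. f y > f x / 2}"]) auto
  qed
  then obtain cx W where cW: "\<And>x. x \<in> points M \<Longrightarrow> cutoff (cx x) \<and> openin (mtop M) (W x) \<and> x \<in> W x \<and> (\<forall>y\<in>W x. snd (cx x) y = 1)"
    by metis
  obtain X where X: "finite X" "X \<subseteq> points M" "points M \<subseteq> (\<Union>x\<in>X. W x)"
    using compact_finite_subcover[OF comp, of W] cW by blast
  obtain xs where xs: "set xs = X" using finite_list[OF X(1)] by blast
  show ?thesis
  proof (rule that[of "map cx xs"])
    show "\<forall>c\<in>set (map cx xs). cutoff c" using cW X(2) xs by auto
    fix x assume "x \<in> points M"
    then obtain y where "y \<in> X" "x \<in> W y" using X(3) by blast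
    then show "\<exists>cx'\<in>set (map cx xs). \<exists>W. openin (mtop M) W \<and> x \<in> W \<and> (\<forall>y\<in>W. snd cx' y = 1)"
      using cW X(2) xs by auto
  qed
qed

text \<open>The face map inserts the coordinate 0 at position \<open>k\<close>, so the sum sees the
  other vertices only.\<close>

lemma sum_simplical_face:
  fixes h :: "nat \<Rightarrow> real"
  assumes "k \<le> Suc n"
  shows "(\<Sum>l\<le>Suc n. simplical_face k t l * h l) = (\<Sum>l\<le>n. t l * h (skip k l))"
proof -
  have inj: "inj_on (skip k) {..n}" by (auto simp: inj_on_def skip_def split: if_splits)
  have img: "skip k ` {..n} = {..Suc n} - {k}"
  proof (intro equalityI subsetI)
    fix l assume "l \<in> {..Suc n} - {k}"
    then show "l \<in> skip k ` {..n}"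
      using assms by (cases "l < k") (auto simp: skip_def image_iff intro: bexI[of _ l] bexI[of _ "l - 1"])
  qed (auto simp: skip_def)
  have "(\<Sum>l\<le>Suc n. simplical_face k t l * h l) = (\<Sum>l\<in>{..Suc n} - {k}. simplical_face k t l * h l)"
    by (rule sum.mono_neutral_right) (auto simp: simplical_face_def)
  also have "\<dots> = (\<Sum>l\<le>n. simplical_face k t (skip k l) * h (skip k l))"
    unfolding img[symmetric] by (rule sum.reindex_cong[OF inj refl]) simp
  also have "\<dots> = (\<Sum>l\<le>n. t l * h (skip k l))"
    by (intro sum.cong) (auto simp: simplical_face_def skip_def)
  finally show ?thesis .
qed

text \<open>After the evolution all vertices are merged, so the result does not depend on the vertex
  at which it is read off. Passing to a face removes a vertex of weight 0, hence straightened
  simplices restrict to straightened simplices. The point \<open>y\<close> certifies that the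
  vertices of \<open>J\<close> are close together.\<close>

lemma straightening:
  assumes comp: "compact_space (mtop M)" and \<V>: "\<And>V. V \<in> \<V> \<Longrightarrow> openin (mtop M) V" "points M \<subseteq> \<Union>\<V>"
  obtains I and \<phi> :: "'a \<Rightarrow> 'a \<Rightarrow> real" and K and A :: "nat \<Rightarrow> (nat \<Rightarrow> 'a) \<Rightarrow> (nat \<Rightarrow> real) \<Rightarrow> 'a"
  where "finite I" "I \<subseteq> points M"
    "\<And>i. i \<in> I \<Longrightarrow> smooth_fn M (points M) (\<phi> i)" "\<And>i. i \<in> I \<Longrightarrow> closedin (mtop M) (K i)"
    "\<And>i y. i \<in> I \<Longrightarrow> y \<in> points M - K i \<Longrightarrow> \<phi> i y = 0"
    "\<And>y. y \<in> points M \<Longrightarrow> (\<Sum>i\<in>I. \<phi> i y) = 1"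
    "\<And>y. y \<in> points M \<Longrightarrow> \<exists>V\<in>\<V>. insert y {i \<in> I. y \<in> K i} \<subseteq> V"
    "\<And>y n J. y \<in> points M \<Longrightarrow> J ` {..n} \<subseteq> {i \<in> I. y \<in> K i} \<Longrightarrow> small_simplex \<V> n (mtop M) (A n J)"
    "\<And>y n J k. y \<in> points M \<Longrightarrow> J ` {..n} \<subseteq> {i \<in> I. y \<in> K i} \<Longrightarrow> k \<le> n \<Longrightarrow> A n J (\<lambda>j. if j = k then 1 else 0) = J k"
    "\<And>y n J k. y \<in> points M \<Longrightarrow> J ` {..Suc n} \<subseteq> {i \<in> I. y \<in> K i} \<Longrightarrow> k \<le> Suc n \<Longrightarrow>
       singular_face (Suc n) k (A (Suc n) J) = A n (\<lambda>l. J (skip k l))"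
proof -
  obtain L where L: "\<forall>cx\<in>set L. cutoff cx"
    "\<And>x. x \<in> points M \<Longrightarrow> \<exists>cx\<in>set L. \<exists>W. openin (mtop M) W \<and> x \<in> W \<and> (\<forall>y\<in>W. snd cx y = 1)"
    using cutoff_list_exists[OF comp] by blast
  have "\<exists>V. V \<in> \<V> \<and> x \<in> V" if "x \<in> points M" for x using \<V>(2) that by blast
  then obtain V where V: "\<And>x. x \<in> points M \<Longrightarrow> V x \<in> \<V> \<and> x \<in> V x" by metis
  let ?ev = "\<lambda>x Q. evolves_into TYPE(nat \<Rightarrow> real) TYPE('a) L x Q (V x)"
  have "\<exists>Q. openin (mtop M) Q \<and> x \<in> Q \<and> Q \<subseteq> V x \<and> ?ev x Q" if x: "x \<in> points M" for x
    by (rule evolve_local[OF L(1)]) (use V[OF x] \<V>(1) in auto)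
  then obtain Q where Q: "\<And>x. x \<in> points M \<Longrightarrow> openin (mtop M) (Q x) \<and> x \<in> Q x \<and> Q x \<subseteq> V x \<and> ?ev x (Q x)" by metis
  obtain I and \<phi> :: "'a \<Rightarrow> 'a \<Rightarrow> real" and K where I: "finite I" "I \<subseteq> points M"
    "\<And>i. i \<in> I \<Longrightarrow> smooth_fn M (points M) (\<phi> i)" "\<And>i. i \<in> I \<Longrightarrow> closedin (mtop M) (K i)"
    "\<And>i y. i \<in> I \<Longrightarrow> y \<in> points M - K i \<Longrightarrow> \<phi> i y = 0"
    "\<And>y. y \<in> points M \<Longrightarrow> (\<Sum>i\<in>I. \<phi> i y) = 1"
    "\<And>y. y \<in> points M \<Longrightarrow> \<exists>x\<in>points M. insert y {i \<in> I. y \<in> K i} \<subseteq> Q x"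
  proof (rule star_partition_of_unity[OF comp])
    show "openin (mtop M) (Q x) \<and> x \<in> Q x" if "x \<in> points M" for x using Q[OF that] by simp
  qed (rule that)
  \<comment> \<open>Barycentric coordinates pushed forward along \<open>J\<close>: the weights of
    repeated vertices add up.\<close>
  define w where "w n J t i = (\<Sum>l\<le>n. t l * (if J l = i then 1 else 0))" for n and J :: "nat \<Rightarrow> 'a" and t :: "nat \<Rightarrow> real" and i
  \<comment> \<open>Singular simplices are extensional functions, hence the restriction. The index
    \<open>J 0\<close> stands for any of the merged vertices.\<close>
  define A where "A n J = restrict (\<lambda>t. evolve L I (w n J t) (\<lambda>i. i) (J 0)) (standard_simplex n)" for n J
  let ?X = "\<lambda>n. subtopology (powertop_real UNIV) (standard_simplex n)"
  have adm: "admissible (?X n) I (w n J) (\<lambda>t i. i) (J ` {..n}) (Q x)"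
    if J: "J ` {..n} \<subseteq> {i \<in> I. y \<in> K i}" "{i \<in> I. y \<in> K i} \<subseteq> Q x" for J n x y
    unfolding admissible_def
  proof (intro conjI ballI)
    show "J ` {..n} \<subseteq> I" using J by blast
    show "continuous_map (?X n) euclideanreal (\<lambda>t. w n J t i)" if "i \<in> I" for i
      unfolding w_def
      by (intro continuous_map_sum continuous_map_real_mult continuous_map_from_subtopology continuous_map_product_projection) auto
    fix t assume "t \<in> topspace (?X n)"
    then have t: "\<And>l. t l \<ge> 0" "(\<Sum>l\<le>n. t l) = 1" by (auto simp: standard_simplex_def)
    show "w n J t i \<ge> 0" for i unfolding w_def by (intro sum_nonneg) (use t in auto)
    have "(\<Sum>i\<in>I. w n J t i) = (\<Sum>l\<le>n. \<Sum>i\<in>I. t l * (if J l = i then 1 else 0))"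
      unfolding w_def by (rule sum.swap)
    also have "\<dots> = (\<Sum>l\<le>n. t l)"
      using I(1) J by (intro sum.cong) (auto simp: sum_distrib_left[symmetric])
    finally show "(\<Sum>i\<in>I. w n J t i) = 1" using t by simp
    show "w n J t i = 0" if "i \<in> I - J ` {..n}" for i unfolding w_def using that by (intro sum.neutral) auto
    show "i \<in> Q x" if "i \<in> J ` {..n}" for i using that J by blast
  next
    fix i assume "i \<in> J ` {..n}"
    then show "continuous_map (?X n) (mtop M) (\<lambda>t. i)" using J I(2) by auto
  qed
  have near: "\<exists>x\<in>points M. ?ev x (Q x) \<and> {i \<in> I. y \<in> K i} \<subseteq> Q x" if "y \<in> points M" for y
    using I(7)[OF that] Q by blast
  show ?thesis
  proof (rule that[of I \<phi> K A])
    show "\<exists>V\<in>\<V>. insert y {i \<in> I. y \<in> K i} \<subseteq> V" if "y \<in> points M" for y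
      using I(7)[OF that] V Q by (meson subset_trans)
    show "small_simplex \<V> n (mtop M) (A n J)" if y: "y \<in> points M" and J: "J ` {..n} \<subseteq> {i \<in> I. y \<in> K i}" for y n J
    proof -
      obtain x where x: "x \<in> points M" "?ev x (Q x)" "{i \<in> I. y \<in> K i} \<subseteq> Q x" using near[OF y] by blast
      note ev = evolves_intoD[OF x(2) I(1) adm[OF J x(3)]]
      have J0: "J 0 \<in> J ` {..n}" by auto
      have "continuous_map (?X n) (mtop M) (A n J)"
        by (rule continuous_map_eq[OF ev(1)[OF J0]]) (simp add: A_def)
      moreover have "A n J t \<in> V x" if "t \<in> standard_simplex n" for t
        using ev(2)[OF J0, of t] that by (simp add: A_def)
      ultimately have "singular_simplex n (subtopology (mtop M) (V x)) (A n J)"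
        by (auto simp: singular_simplex_def continuous_map_in_subtopology A_def)
      then show ?thesis using V[OF x(1)] unfolding small_simplex_def by blast
    qed
    show "A n J (\<lambda>j. if j = k then 1 else 0) = J k"
      if y: "y \<in> points M" and J: "J ` {..n} \<subseteq> {i \<in> I. y \<in> K i}" and k: "k \<le> n" for y n J k
    proof -
      obtain x where x: "x \<in> points M" "?ev x (Q x)" "{i \<in> I. y \<in> K i} \<subseteq> Q x" using near[OF y] by blast
      note ev = evolves_intoD[OF x(2) I(1) adm[OF J x(3)]]
      let ?t = "\<lambda>j. if j = k then 1 else (0::real)"
      have t: "?t \<in> standard_simplex n" using k by simp
      have wk: "w n J ?t i = (if i = J k then 1 else 0)" for i
        unfolding w_def using k by (simp add: if_distrib[of "\<lambda>r. r * _"] cong: if_cong)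
      have Jk: "J k \<in> I" "J k \<in> points M" using J k I(2) by auto
      have "A n J ?t = evolve L I (w n J ?t) (\<lambda>i. i) (J 0)" using t by (simp add: A_def)
      also have "\<dots> = evolve L I (w n J ?t) (\<lambda>i. i) (J k)"
        by (rule ev(3)[OF L(2)[OF x(1)]]) (use t k in auto)
      also have "\<dots> = J k"
        by (rule evolve_vertex[OF L(1) I(1) Jk(1)]) (use Jk in \<open>auto simp: wk\<close>)
      finally show ?thesis .
    qed
    show "singular_face (Suc n) k (A (Suc n) J) = A n (\<lambda>l. J (skip k l))"
      if y: "y \<in> points M" and J: "J ` {..Suc n} \<subseteq> {i \<in> I. y \<in> K i}" and k: "k \<le> Suc n" for y n J k
    proof
      obtain x where x: "x \<in> points M" "?ev x (Q x)" "{i \<in> I. y \<in> K i} \<subseteq> Q x" using near[OF y] by blast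
      note ev = evolves_intoD[OF x(2) I(1) adm[OF J x(3)]]
      fix t
      show "singular_face (Suc n) k (A (Suc n) J) t = A n (\<lambda>l. J (skip k l)) t"
      proof (cases "t \<in> standard_simplex n")
        case True
        let ?t = "simplical_face k t"
        have t: "?t \<in> standard_simplex (Suc n)" using simplical_face_in_standard_simplex[of "Suc n" k t] True k by simp
        have "w (Suc n) J ?t = w n (\<lambda>l. J (skip k l)) t"
          unfolding w_def using sum_simplical_face[OF k, of t "\<lambda>l. if J l = i then 1 else 0" for i] by (intro ext) metis
        moreover have "evolve L I (w (Suc n) J ?t) (\<lambda>i. i) (J 0) = evolve L I (w (Suc n) J ?t) (\<lambda>i. i) (J (skip k 0))"
        proof -
          have "J 0 \<in> J ` {..Suc n}" "J (skip k 0) \<in> J ` {..Suc n}" by (auto simp: skip_def)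
          then show ?thesis by (rule ev(3)[OF L(2)[OF x(1)]]) (use t in simp)
        qed
        ultimately show ?thesis using True t by (simp add: A_def singular_face_def)
      next
        case False
        then show ?thesis by (simp add: A_def singular_face_def)
      qed
    qed
  qed (fact I)+
qed

end

section \<open>Horizontal derivatives of a conformal submersion\<close>

text \<open>Jacobi's formula. The derivative is the sum of the determinants with one row
  differentiated; when that row is expanded in the rows of \<open>A x\<close>, a single coefficient
  survives.\<close>

lemma has_derivative_det:
  fixes A :: "'e::real_normed_vector \<Rightarrow> real^'n^'n"
  assumes A: "\<And>i j. ((\<lambda>x. A x $ i $ j) has_derivative (\<lambda>v. A' v $ i $ j)) (at x)" and inv: "invertible (A x)"
  shows "((\<lambda>x. det (A x)) has_derivative (\<lambda>v. det (A x) * (\<Sum>i\<in>UNIV. \<Sum>j\<in>UNIV. A' v $ i $ j * matrix_inv (A x) $ j $ i))) (at x)"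
proof -
  define R where "R v i = (\<chi> k. if k = i then A' v $ i else A x $ k)" for v i
  have "((\<lambda>x. det (A x)) has_derivative (\<lambda>v. \<Sum>p | p permutes UNIV. of_int (sign p) *
      (\<Sum>i\<in>UNIV. A' v $ i $ p i * (\<Prod>j\<in>UNIV - {i}. A x $ j $ p j)))) (at x)"
    unfolding det_def
    by (intro has_derivative_sum has_derivative_mult_right has_derivative_prod A)
  also have "(\<lambda>v. \<Sum>p | p permutes UNIV. of_int (sign p) *
      (\<Sum>i\<in>UNIV. A' v $ i $ p i * (\<Prod>j\<in>UNIV - {i}. A x $ j $ p j))) = (\<lambda>v. \<Sum>i\<in>UNIV. det (R v i))"
  proof
    fix v
    have "(\<Prod>j\<in>UNIV. R v i $ j $ p j) = A' v $ i $ p i * (\<Prod>j\<in>UNIV - {i}. A x $ j $ p j)" for i and p :: "'n \<Rightarrow> 'n"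
    proof -
      have "(\<Prod>j\<in>UNIV. R v i $ j $ p j) = R v i $ i $ p i * (\<Prod>j\<in>UNIV - {i}. R v i $ j $ p j)"
        by (rule prod.remove) auto
      also have "(\<Prod>j\<in>UNIV - {i}. R v i $ j $ p j) = (\<Prod>j\<in>UNIV - {i}. A x $ j $ p j)"
        by (rule prod.cong) (auto simp: R_def)
      finally show ?thesis by (simp add: R_def)
    qed
    then show "(\<Sum>p | p permutes UNIV. of_int (sign p) *
      (\<Sum>i\<in>UNIV. A' v $ i $ p i * (\<Prod>j\<in>UNIV - {i}. A x $ j $ p j))) = (\<Sum>i\<in>UNIV. det (R v i))"
      unfolding det_def by (simp add: sum_distrib_left) (rule sum.swap)
  qed
  also have "(\<lambda>v. \<Sum>i\<in>UNIV. det (R v i)) = (\<lambda>v. det (A x) * (\<Sum>i\<in>UNIV. \<Sum>j\<in>UNIV. A' v $ i $ j * matrix_inv (A x) $ j $ i))"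
  proof
    fix v
    have "det (R v i) = (\<Sum>j\<in>UNIV. A' v $ i $ j * matrix_inv (A x) $ j $ i) * det (A x)" for i
    proof -
      \<comment> \<open>The coordinates of the differentiated row in the basis formed by the rows of
        \<open>A x\<close>.\<close>
      define c where "c k = (\<Sum>j\<in>UNIV. A' v $ i $ j * matrix_inv (A x) $ j $ k)" for k
      have row: "A' v $ i = (\<Sum>k\<in>UNIV. c k *s A x $ k)"
      proof -
        have "(\<Sum>k\<in>UNIV. c k * A x $ k $ l) = A' v $ i $ l" for l
        proof -
          have "(\<Sum>k\<in>UNIV. c k * A x $ k $ l) = (\<Sum>k\<in>UNIV. \<Sum>j\<in>UNIV. A' v $ i $ j * (matrix_inv (A x) $ j $ k * A x $ k $ l))"
            by (simp add: c_def sum_distrib_right mult.assoc)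
          also have "\<dots> = (\<Sum>j\<in>UNIV. A' v $ i $ j * (\<Sum>k\<in>UNIV. matrix_inv (A x) $ j $ k * A x $ k $ l))"
            by (subst sum.swap) (simp add: sum_distrib_left)
          also have "\<dots> = (\<Sum>j\<in>UNIV. A' v $ i $ j * mat 1 $ j $ l)"
            unfolding matrix_inv_left[OF inv, symmetric] by (simp add: matrix_matrix_mult_def)
          finally show ?thesis by (simp add: mat_def if_distrib cong: if_cong)
        qed
        then show ?thesis by (simp add: vec_eq_iff)
      qed
      have "det (R v i) = det (\<chi> k. if k = i then (\<Sum>k\<in>UNIV. c k *s A x $ k) else A x $ k)"
        unfolding R_def row ..
      also have "\<dots> = (\<Sum>k\<in>UNIV. det (\<chi> j. if j = i then c k *s A x $ k else A x $ j))"
        by (rule det_linear_row_sum) simp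
      also have "\<dots> = (\<Sum>k\<in>UNIV. c k * det (\<chi> j. if j = i then A x $ k else A x $ j))"
        by (simp add: det_row_mul)
      also have "\<dots> = (\<Sum>k\<in>UNIV. if k = i then c i * det (A x) else 0)"
      proof (intro sum.cong refl)
        fix k
        have "det (\<chi> j. if j = i then A x $ k else A x $ j) = 0" if "k \<noteq> i"
          by (rule det_identical_rows[of i k]) (use that in \<open>auto simp: row_def vec_eq_iff\<close>)
        moreover have "(\<chi> j. if j = i then A x $ i else A x $ j) = A x" by (simp add: vec_eq_iff)
        ultimately show "c k * det (\<chi> j. if j = i then A x $ k else A x $ j) = (if k = i then c i * det (A x) else 0)"
          by auto
      qed
      finally show ?thesis by (simp add: c_def)
    qed
    then have "(\<Sum>i\<in>UNIV. det (R v i)) = (\<Sum>i\<in>UNIV. \<Sum>j\<in>UNIV. A' v $ i $ j * matrix_inv (A x) $ j $ i) * det (A x)"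
      by (simp only: sum_distrib_right)
    then show "(\<Sum>i\<in>UNIV. det (R v i)) = det (A x) * (\<Sum>i\<in>UNIV. \<Sum>j\<in>UNIV. A' v $ i $ j * matrix_inv (A x) $ j $ i)"
      by (simp only: mult.commute)
  qed
  finally show ?thesis .
qed

context manifold
begin

lemma chart_deriv_const [simp]: "chart_deriv c (\<lambda>x. r) x v = 0"
  by (simp add: chart_deriv_def)

lemma chart_deriv_add:
  assumes "smooth_fn M W f" "smooth_fn M W g" "c \<in> charts M" "x \<in> fst c" "x \<in> W"
  shows "chart_deriv c (\<lambda>x. f x + g x) x v = chart_deriv c f x v + chart_deriv c g x v"
  by (subst chart_deriv_eqI[OF has_derivative_add[OF chart_deriv_has_derivative[OF assms(1,3-5)] chart_deriv_has_derivative[OF assms(2-5)]]]) simp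

lemma chart_deriv_mult:
  fixes f g :: "'a \<Rightarrow> real"
  assumes "smooth_fn M W f" "smooth_fn M W g" "c \<in> charts M" "x \<in> fst c" "x \<in> W"
  shows "chart_deriv c (\<lambda>x. f x * g x) x v = f x * chart_deriv c g x v + chart_deriv c f x v * g x"
  using chart_deriv_eqI[OF has_derivative_mult[OF chart_deriv_has_derivative[OF assms(1,3-5)] chart_deriv_has_derivative[OF assms(2-5)]]]
    assms by simp

lemma chart_deriv_compose:
  fixes f :: "'a \<Rightarrow> 'f::euclidean_space"
  assumes "smooth_fn M W f" "c \<in> charts M" "x \<in> fst c" "x \<in> W" "smooth_on T \<psi>" "f x \<in> T"
  shows "chart_deriv c (\<lambda>x. \<psi> (f x)) x v = frechet_derivative \<psi> (at (f x)) (chart_deriv c f x v)"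
proof -
  have "(\<psi> has_derivative frechet_derivative \<psi> (at (f x))) (at (f (chart_inv c (snd c x))))"
    using smooth_on_has_derivative[OF assms(5,6)] assms by simp
  from chart_deriv_eqI[OF has_derivative_compose[OF chart_deriv_has_derivative[OF assms(1-4)] this]]
  show ?thesis by simp
qed

lemma chart_deriv_nth:
  fixes f :: "'a \<Rightarrow> real^'n"
  assumes "smooth_fn M W f" "c \<in> charts M" "x \<in> fst c" "x \<in> W"
  shows "chart_deriv c (\<lambda>x. f x $ k) x v = chart_deriv c f x v $ k"
  using chart_deriv_eqI[OF bounded_linear.has_derivative[OF bounded_linear_vec_nth chart_deriv_has_derivative[OF assms]]] by simp

end

definition partial :: "'n \<Rightarrow> (real^'n \<Rightarrow> real) \<Rightarrow> real^'n \<Rightarrow> real" where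
  "partial k \<psi> y = frechet_derivative \<psi> (at y) (axis k 1)"

lemma frechet_derivative_partial:
  fixes \<psi> :: "real^'n \<Rightarrow> real"
  assumes "\<psi> differentiable (at y)"
  shows "frechet_derivative \<psi> (at y) v = (\<Sum>k\<in>UNIV. v $ k * partial k \<psi> y)"
proof -
  have lin: "linear (frechet_derivative \<psi> (at y))" by (rule linear_frechet_derivative[OF assms])
  have "frechet_derivative \<psi> (at y) v = frechet_derivative \<psi> (at y) (\<Sum>i\<in>UNIV. v $ i *\<^sub>R axis i 1)"
    using basis_expansion[of v] by (simp add: scalar_mult_eq_scaleR)
  then show ?thesis by (simp add: linear_sum[OF lin] linear_scale[OF lin] partial_def)
qed

context riemannian_manifold
begin

lemma Gam_commute: "x \<in> points M \<Longrightarrow> Gam f h x = Gam h f x"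
  unfolding Gam_def by (rule dual_inner_commute[OF metric_inner])

lemma Gam_const [simp]: "Gam f (\<lambda>x. r) x = 0"
proof -
  have "grad_vec (chart_at M x) (\<lambda>x. r) x = 0" by (simp add: grad_vec_def vec_eq_iff)
  then show ?thesis by (simp add: Gam_def)
qed

lemma Gam_cong:
  assumes "openin (mtop M) W" "x \<in> W" "smooth_fn M W h" "\<And>y. y \<in> W \<Longrightarrow> h y = h' y"
  shows "Gam f h x = Gam f h' x"
proof -
  have x: "x \<in> points M" using assms openin_subset by blast
  have "chart_deriv (chart_at M x) h x = chart_deriv (chart_at M x) h' x"
    by (rule chart_deriv_cong[OF assms(1) chart_at[OF x] assms(2,3)]) (rule assms(4))
  then show ?thesis by (simp add: Gam_def grad_vec_def)
qed

context
  fixes W x assumes W: "openin (mtop M) W" "x \<in> W"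
begin

private lemma x: "x \<in> points M" using W openin_subset by blast

lemma Gam_add:
  assumes "smooth_fn M W h" "smooth_fn M W k"
  shows "Gam f (\<lambda>x. h x + k x) x = Gam f h x + Gam f k x"
proof -
  have "grad_vec (chart_at M x) (\<lambda>x. h x + k x) x = grad_vec (chart_at M x) h x + grad_vec (chart_at M x) k x"
    using chart_deriv_add[OF assms chart_at[OF x] W(2)] by (simp add: grad_vec_def vec_eq_iff)
  then show ?thesis by (simp add: Gam_def dual_inner_add)
qed

lemma Gam_mult:
  assumes "smooth_fn M W h" "smooth_fn M W k"
  shows "Gam f (\<lambda>x. h x * k x) x = h x * Gam f k x + k x * Gam f h x"
proof -
  have "grad_vec (chart_at M x) (\<lambda>x. h x * k x) x = h x *\<^sub>R grad_vec (chart_at M x) k x + k x *\<^sub>R grad_vec (chart_at M x) h x"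
    using chart_deriv_mult[OF assms chart_at[OF x] W(2)] by (simp add: grad_vec_def vec_eq_iff mult.commute)
  then show ?thesis by (simp add: Gam_def dual_inner_add dual_inner_scale)
qed

lemma Gam_compose:
  fixes Y :: "'a \<Rightarrow> real^'n"
  assumes Y: "smooth_fn M W Y" and \<psi>: "smooth_on T \<psi>" "Y x \<in> T"
  shows "Gam f (\<lambda>x. \<psi> (Y x)) x = (\<Sum>k\<in>UNIV. partial k \<psi> (Y x) * Gam f (\<lambda>x. Y x $ k) x)"
proof -
  let ?c = "chart_at M x"
  have "grad_vec ?c (\<lambda>x. \<psi> (Y x)) x = (\<Sum>k\<in>UNIV. partial k \<psi> (Y x) *\<^sub>R grad_vec ?c (\<lambda>x. Y x $ k) x)"
    using chart_deriv_nth[OF Y chart_at[OF x] W(2)]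
    by (simp add: grad_vec_def vec_eq_iff chart_deriv_compose[OF Y chart_at[OF x] W(2) \<psi>]
        frechet_derivative_partial[OF smooth_on_differentiable[OF \<psi>]] mult.commute)
  then have "Gam f (\<lambda>x. \<psi> (Y x)) x = dual_inner (inner_matrix (g x)) (grad_vec ?c f x) (\<Sum>k\<in>UNIV. partial k \<psi> (Y x) *\<^sub>R grad_vec ?c (\<lambda>x. Y x $ k) x)"
    by (simp add: Gam_def)
  also have "\<dots> = (\<Sum>k\<in>UNIV. dual_inner (inner_matrix (g x)) (grad_vec ?c f x) (partial k \<psi> (Y x) *\<^sub>R grad_vec ?c (\<lambda>x. Y x $ k) x))"
    by (induction rule: finite_induct[OF finite_class.finite_UNIV]) (simp_all add: dual_inner_add)
  finally show ?thesis by (simp add: dual_inner_scale Gam_def)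
qed

end
end

locale conformal_submersion = compact_riemannian M gM + N: riemannian_manifold N gN + manifold_pair M N
  for M :: "('a, real^'m) mfd" and gM and N :: "('b, real^'n) mfd" and gN +
  fixes u :: "'a \<Rightarrow> 'b" and dil :: "'a \<Rightarrow> real"
  assumes hcs: "horizontally_conformal_submersion M gM N gN u dil"
begin

lemma smooth_u: "smooth_map M N u" and surj_du: "x \<in> points M \<Longrightarrow> surj (mderiv M N u x)"
  and dil_pos: "x \<in> points M \<Longrightarrow> dil x > 0"
  using hcs by (auto simp: horizontally_conformal_submersion_def submersion_def)

lemma smooth_dil: "smooth_fn M (points M) dil"
proof -
  have dil: "smooth_map M (open_mfd UNIV) dil" using hcs by (auto simp: horizontally_conformal_submersion_def)
  show ?thesis
    unfolding smooth_fn_def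
  proof
    fix c assume c: "c \<in> charts M"
    have "(UNIV, id) \<in> charts (open_mfd UNIV :: (real, real) mfd)" by (simp add: open_mfd_def)
    from dil[unfolded smooth_map_def, THEN conjunct2, rule_format, OF c this]
    show "smooth_on (snd c ` (fst c \<inter> points M)) (\<lambda>z. dil (chart_inv c z))"
      using chart_subset[OF c] by (simp add: comp_def Int_absorb2)
  qed
qed

definition udom :: "('b, real^'n) chart \<Rightarrow> 'a set" where "udom d = {x \<in> points M. u x \<in> fst d}"
definition Y :: "('b, real^'n) chart \<Rightarrow> 'a \<Rightarrow> real^'n" where "Y d x = snd d (u x)"
text \<open>The metric of \<open>N\<close> is moved to the coordinate space, where partial
  derivatives are available.\<close>

definition Hc :: "('b, real^'n) chart \<Rightarrow> real^'n \<Rightarrow> real^'n^'n" where "Hc d y = gram N gN d (chart_inv d y)"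

text \<open>\<open>D d a f\<close> is the derivative of \<open>f\<close> along the horizontal lift of the \<open>a\<close>-th coordinate
  field of the chart \<open>d\<close> of \<open>N\<close>.\<close>

definition D :: "('b, real^'n) chart \<Rightarrow> 'n \<Rightarrow> ('a \<Rightarrow> real) \<Rightarrow> 'a \<Rightarrow> real" where
  "D d a f x = (\<Sum>b\<in>UNIV. Hc d (Y d x) $ a $ b * Gam (\<lambda>x. Y d x $ b) f x) / (dil x)\<^sup>2"

lemma openin_udom: "d \<in> charts N \<Longrightarrow> openin (mtop M) (udom d)"
  unfolding udom_def by (rule smooth_map_preimage_openin[OF smooth_u N.chart_openin])

lemma udom_points: "udom d \<subseteq> points M" by (auto simp: udom_def)

lemma smooth_Y: "d \<in> charts N \<Longrightarrow> smooth_fn M (udom d) (Y d)"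
  unfolding udom_def Y_def[abs_def] by (rule smooth_map_fn[OF smooth_u])

lemma smooth_Y_nth: "d \<in> charts N \<Longrightarrow> smooth_fn M (udom d) (\<lambda>x. Y d x $ b)"
  using smooth_Y smooth_fn_vec_iff[OF openin_udom] by blast

lemma Y_image: "x \<in> udom d \<Longrightarrow> Y d x \<in> snd d ` fst d"
  by (auto simp: udom_def Y_def)

lemma Hc_Y: "d \<in> charts N \<Longrightarrow> x \<in> udom d \<Longrightarrow> Hc d (Y d x) = gram N gN d (u x)"
  by (auto simp: Hc_def Y_def udom_def)

lemma smooth_Hc: "d \<in> charts N \<Longrightarrow> smooth_on (snd d ` fst d) (\<lambda>y. Hc d y $ i $ j)"
  using N.smooth_gram[of d i j] by (auto simp: smooth_fn_def Hc_def)

lemma Hc_inner: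
  assumes "d \<in> charts N" "y \<in> snd d ` fst d"
  shows "\<exists>p. inner_product_form p \<and> Hc d y = inner_matrix p"
proof -
  from assms(2) obtain x where x: "x \<in> fst d" "y = snd d x" by blast
  then have "Hc d y = gram N gN d x" using assms(1) by (simp add: Hc_def)
  then show ?thesis using N.gram_invertible[OF assms(1) x(1)] by metis
qed

lemma Hc_sym:
  assumes "d \<in> charts N" "y \<in> snd d ` fst d" shows "Hc d y $ i $ j = Hc d y $ j $ i"
proof -
  obtain p where p: "inner_product_form p" "Hc d y = inner_matrix p" using Hc_inner[OF assms] by blast
  have "transpose (Hc d y) $ i $ j = Hc d y $ i $ j" using transpose_inner_matrix[OF p(1)] p(2) by simp
  then show ?thesis by (simp add: transpose_def)
qed

lemma Hc_invertible:
  assumes "d \<in> charts N" "y \<in> snd d ` fst d" shows "invertible (Hc d y)"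
  using Hc_inner[OF assms] invertible_inner_matrix by auto

lemma det_Hc_pos:
  assumes "d \<in> charts N" "y \<in> snd d ` fst d" shows "det (Hc d y) > 0"
  using Hc_inner[OF assms] det_inner_matrix_pos by auto

lemma smooth_Hc_Y: "d \<in> charts N \<Longrightarrow> smooth_fn M (udom d) (\<lambda>x. Hc d (Y d x) $ i $ j)"
  by (rule smooth_fn_compose[OF openin_udom smooth_Y N.chart_image_open smooth_Hc Y_image])

lemma smooth_dil_sq: "openin (mtop M) W \<Longrightarrow> smooth_fn M W (\<lambda>x. (dil x)\<^sup>2)"
  unfolding power2_eq_square using smooth_fn_subset[OF smooth_dil] openin_subset
  by (intro smooth_fn_mult) blast+

text \<open>The usual coordinate formula for twice the energy density, stated for a general map
  because it is applied to \<open>u\<close> and to its variations.\<close>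

lemma hs_norm_chart:
  assumes d: "d \<in> charts N" and W: "openin (mtop M) W" "x \<in> W" "\<And>y. y \<in> W \<Longrightarrow> v y \<in> fst d" "smooth_fn M W (\<lambda>y. snd d (v y))"
  shows "hs_norm_sq (gM x) (gN (v x)) (mderiv M N v x) =
    (\<Sum>a\<in>UNIV. \<Sum>b\<in>UNIV. gram N gN d (v x) $ a $ b * Gam (\<lambda>y. snd d (v y) $ a) (\<lambda>y. snd d (v y) $ b) x)"
proof -
  have x: "x \<in> points M" using W openin_subset by blast
  let ?c = "chart_at M x"
  define L where "L = chart_deriv ?c (\<lambda>y. snd d (v y)) x"
  define q where "q a b = gN (v x) (coord_vec N d (v x) a) (coord_vec N d (v x) b)" for a b
  have q: "inner_product_form q" "inner_matrix q = gram N gN d (v x)"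
    using N.gram_invertible[OF d W(3)[OF W(2)]] by (simp_all add: q_def[abs_def])
  have "hs_norm_sq (gM x) (gN (v x)) (mderiv M N v x) = hs_norm_sq (gM x) q L"
    unfolding hs_norm_sq_def q_def L_def using mderiv_chart[OF W(1) d W(3,4,2)] by simp
  also have "\<dots> = (\<Sum>a\<in>UNIV. \<Sum>b\<in>UNIV. inner_matrix q $ a $ b * dual_inner (inner_matrix (gM x))
      (grad_vec ?c (\<lambda>y. snd d (v y) $ a) x) (grad_vec ?c (\<lambda>y. snd d (v y) $ b) x))"
  proof (rule hs_norm_sq_eq[OF metric_inner[OF x]])
    show "bilinear q" using q by (simp add: inner_product_form_def)
    fix w
    have "L w $ k = grad_vec ?c (\<lambda>y. snd d (v y) $ k) x \<bullet> w" for k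
    proof -
      have s: "smooth_fn M W (\<lambda>y. snd d (v y) $ k)" using W(4) unfolding smooth_fn_vec_iff[OF W(1)] by blast
      have "L w $ k = chart_deriv ?c (\<lambda>y. snd d (v y) $ k) x w"
        unfolding L_def by (rule chart_deriv_nth[OF W(4) chart_at[OF x] W(2), symmetric])
      also have "\<dots> = grad_vec ?c (\<lambda>y. snd d (v y) $ k) x \<bullet> w"
        unfolding grad_vec_def by (rule linear_eq_inner_axis[OF chart_deriv_linear[OF s chart_at[OF x] W(2)]])
      finally show ?thesis .
    qed
    then show "L w = (\<chi> k. grad_vec ?c (\<lambda>y. snd d (v y) $ k) x \<bullet> w)" by (simp add: vec_eq_iff)
  qed
  finally show ?thesis by (simp add: q(2) Gam_def)
qed

text \<open>The form in which conformality is used: the inner products of the differentials of the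
  coordinates of \<open>u\<close> form \<open>(dil x)\<^sup>2\<close> times the inverse metric
  matrix of \<open>N\<close>.\<close>

lemma horizontal_dual:
  assumes d: "d \<in> charts N" and x: "x \<in> udom d"
  shows "(\<Sum>b\<in>UNIV. Hc d (Y d x) $ a $ b * Gam (\<lambda>x. Y d x $ b) (\<lambda>x. Y d x $ c) x) = (if a = c then (dil x)\<^sup>2 else 0)"
proof -
  have xM: "x \<in> points M" and ux: "u x \<in> fst d" using x by (auto simp: udom_def)
  let ?c = "chart_at M x"
  define L where "L = chart_deriv ?c (Y d) x"
  define C where "C = coord_vec N d (u x)"
  define q where "q a b = gN (u x) (C a) (C b)" for a b
  have q: "inner_product_form q" "inner_matrix q = Hc d (Y d x)"
    using N.gram_invertible[OF d ux] by (simp_all add: q_def[abs_def] C_def Hc_Y[OF d x])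
  have linC: "linear C" and bijC: "bij C" using N.coord_vec_bij[OF d ux] by (auto simp: C_def)
  have md: "mderiv M N u x v = C (L v)" for v
    unfolding C_def L_def Y_def[abs_def]
    by (rule mderiv_chart[OF openin_udom[OF d] d]) (use x smooth_Y[OF d] in \<open>auto simp: udom_def Y_def[abs_def]\<close>)
  have L0: "L v = 0 \<longleftrightarrow> mderiv M N u x v = 0" for v
    unfolding md using bijC linear_0[OF linC] by (metis bij_is_inj injD)
  have "(\<Sum>b\<in>UNIV. inner_matrix q $ a $ b * dual_inner (inner_matrix (gM x))
      (grad_vec ?c (\<lambda>y. Y d y $ b) x) (grad_vec ?c (\<lambda>y. Y d y $ c) x)) = (if a = c then (dil x)\<^sup>2 else 0)"
  proof (rule horizontally_conformal_dual[OF metric_inner[OF xM]])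
    show "bilinear q" using q by (simp add: inner_product_form_def)
    fix w
    have "L w $ k = grad_vec ?c (\<lambda>y. Y d y $ k) x \<bullet> w" for k
    proof -
      have "L w $ k = chart_deriv ?c (\<lambda>y. Y d y $ k) x w"
        unfolding L_def by (rule chart_deriv_nth[OF smooth_Y[OF d] chart_at[OF xM] x, symmetric])
      also have "\<dots> = grad_vec ?c (\<lambda>y. Y d y $ k) x \<bullet> w"
        unfolding grad_vec_def by (rule linear_eq_inner_axis[OF chart_deriv_linear[OF smooth_Y_nth[OF d] chart_at[OF xM] x]])
      finally show ?thesis .
    qed
    then show "L w = (\<chi> k. grad_vec ?c (\<lambda>y. Y d y $ k) x \<bullet> w)" by (simp add: vec_eq_iff)
  next
    show "surj L"
    proof (rule surjI)
      fix b
      obtain v where "mderiv M N u x v = C b" using surj_du[OF xM] by (metis surjD)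
      then have "L v = b" unfolding md using bijC by (metis bij_is_inj injD)
      then show "L (SOME v. L v = b) = b" by (rule someI)
    qed
  next
    fix v w
    assume v: "\<And>k. L k = 0 \<Longrightarrow> gM x k v = 0" and w: "\<And>k. L k = 0 \<Longrightarrow> gM x k w = 0"
    have "v \<in> horizontal_space M gM N u x" "w \<in> horizontal_space M gM N u x"
      using v w by (auto simp: horizontal_space_def vertical_space_def L0)
    then show "q (L v) (L w) = (dil x)\<^sup>2 * gM x v w"
      using hcs xM unfolding horizontally_conformal_submersion_def q_def md[symmetric] by blast
  qed
  then show ?thesis by (simp add: q(2) Gam_def)
qed

context
  fixes d W x assumes d: "d \<in> charts N" and W: "openin (mtop M) W" "W \<subseteq> udom d" "x \<in> W"
begin

private lemma xM: "x \<in> points M" using W udom_points by blast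

lemma D_const [simp]: "D d a (\<lambda>x. r) x = 0"
  by (simp add: D_def)

lemma D_add: "smooth_fn M W f \<Longrightarrow> smooth_fn M W h \<Longrightarrow> D d a (\<lambda>x. f x + h x) x = D d a f x + D d a h x"
  by (simp add: D_def Gam_add[OF W(1,3)] sum.distrib add_divide_distrib algebra_simps)

lemma D_mult: "smooth_fn M W f \<Longrightarrow> smooth_fn M W h \<Longrightarrow> D d a (\<lambda>x. f x * h x) x = f x * D d a h x + h x * D d a f x"
  by (simp add: D_def Gam_mult[OF W(1,3)] sum.distrib add_divide_distrib sum_distrib_left algebra_simps)

lemma D_cmult: "smooth_fn M W f \<Longrightarrow> D d a (\<lambda>x. r * f x) x = r * D d a f x"
  using D_mult[of "\<lambda>x. r" f] W(1) by simp

lemma D_cong: "smooth_fn M W f \<Longrightarrow> (\<And>y. y \<in> W \<Longrightarrow> f y = h y) \<Longrightarrow> D d a f x = D d a h x"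
  using Gam_cong[OF W(1,3), of f h] by (simp add: D_def)

lemma D_sum:
  "(\<And>i. i \<in> I \<Longrightarrow> smooth_fn M W (f i)) \<Longrightarrow> D d a (\<lambda>x. \<Sum>i\<in>I. f i x) x = (\<Sum>i\<in>I. D d a (f i) x)"
proof (induction I rule: infinite_finite_induct)
  case (insert j I)
  then show ?case using D_add[of "f j" "\<lambda>x. \<Sum>i\<in>I. f i x"] smooth_fn_sum[OF W(1), of I f] by simp
qed (use D_const[of a 0] in auto)

lemma D_prod:
  assumes "finite I"
  shows "(\<And>i. i \<in> I \<Longrightarrow> smooth_fn M W (f i)) \<Longrightarrow>
    D d a (\<lambda>x. \<Prod>i\<in>I. f i x) x = (\<Sum>i\<in>I. D d a (f i) x * (\<Prod>j\<in>I - {i}. f j x))"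
  using assms
proof (induction I rule: finite_induct)
  case empty
  then show ?case using D_const[of a 1] by simp
next
  case (insert j I)
  have "D d a (\<lambda>x. \<Prod>i\<in>insert j I. f i x) x = f j x * D d a (\<lambda>x. \<Prod>i\<in>I. f i x) x + (\<Prod>i\<in>I. f i x) * D d a (f j) x"
    using insert D_mult[of "f j" "\<lambda>x. \<Prod>i\<in>I. f i x"] smooth_fn_prod[OF W(1), of I f] by simp
  also have "\<dots> = (\<Prod>i\<in>I. f i x) * D d a (f j) x + (\<Sum>i\<in>I. D d a (f i) x * (f j x * (\<Prod>k\<in>I - {i}. f k x)))"
    using insert by (simp add: sum_distrib_left mult_ac)
  also have "(\<Sum>i\<in>I. D d a (f i) x * (f j x * (\<Prod>k\<in>I - {i}. f k x))) = (\<Sum>i\<in>I. D d a (f i) x * (\<Prod>k\<in>insert j I - {i}. f k x))"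
  proof (intro sum.cong refl)
    fix i assume "i \<in> I"
    then have "insert j I - {i} = insert j (I - {i})" using insert by auto
    then show "D d a (f i) x * (f j x * (\<Prod>k\<in>I - {i}. f k x)) = D d a (f i) x * (\<Prod>k\<in>insert j I - {i}. f k x)"
      using insert by simp
  qed
  finally show ?case using insert by (simp add: mult.commute)
qed

text \<open>This is the reason for the division by \<open>(dil x)\<^sup>2\<close> in
  \<open>D\<close>: the fields become lifts of the coordinate fields.\<close>

lemma D_Y: "D d a (\<lambda>x. Y d x $ c) x = (if a = c then 1 else 0)"
  using horizontal_dual[OF d, of x a c] W dil_pos[OF xM] by (auto simp: D_def)

lemma D_compose:
  assumes "smooth_on T \<psi>" "Y d x \<in> T"
  shows "D d a (\<lambda>x. \<psi> (Y d x)) x = partial a \<psi> (Y d x)"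
proof -
  have "smooth_fn M W (Y d)" using smooth_fn_subset[OF smooth_Y[OF d] W(2)] .
  then have "D d a (\<lambda>x. \<psi> (Y d x)) x = (\<Sum>k\<in>UNIV. partial k \<psi> (Y d x) * D d a (\<lambda>x. Y d x $ k) x)"
    unfolding D_def using Gam_compose[where Y="Y d" and \<psi>=\<psi> and T=T, OF W(1,3) _ assms]
    by (simp add: sum_distrib_left sum_divide_distrib) (subst sum.swap, simp add: mult_ac)
  then show ?thesis by (simp add: D_Y if_distrib cong: if_cong)
qed

end

lemma smooth_D:
  assumes d: "d \<in> charts N" and W: "openin (mtop M) W" "W \<subseteq> udom d" and f: "smooth_fn M W f"
  shows "smooth_fn M W (D d a f)"
  unfolding D_def
proof (intro smooth_fn_divide smooth_fn_sum smooth_fn_mult smooth_Gam W f smooth_dil_sq)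
  show "smooth_fn M W (\<lambda>x. Hc d (Y d x) $ a $ b)" for b by (rule smooth_fn_subset[OF smooth_Hc_Y[OF d] W(2)])
  show "smooth_fn M W (\<lambda>x. Y d x $ b)" for b by (rule smooth_fn_subset[OF smooth_Y_nth[OF d] W(2)])
  show "(dil x)\<^sup>2 \<noteq> 0" if "x \<in> W" for x
  proof -
    have "x \<in> points M" using that W(2) udom_points by blast
    then show ?thesis using dil_pos[of x] by simp
  qed
qed

end

section \<open>The first variation of the energy\<close>

text \<open>The Lipschitz bound dominates the difference quotients by a constant, which is
  integrable for a finite measure.\<close>

lemma has_real_derivative_integral:
  fixes f :: "real \<Rightarrow> 'x \<Rightarrow> real"
  assumes fin: "finite_measure \<mu>" and "\<delta> > 0"
    and int: "\<And>t. \<bar>t\<bar> < \<delta> \<Longrightarrow> integrable \<mu> (f t)"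
    and der: "\<And>x. x \<in> space \<mu> \<Longrightarrow> ((\<lambda>t. f t x) has_real_derivative f' x) (at 0)"
    and lip: "\<And>t x. \<bar>t\<bar> < \<delta> \<Longrightarrow> x \<in> space \<mu> \<Longrightarrow> \<bar>f t x - f 0 x\<bar> \<le> C * \<bar>t\<bar>"
  shows "((\<lambda>t. \<integral>x. f t x \<partial>\<mu>) has_real_derivative (\<integral>x. f' x \<partial>\<mu>)) (at 0)"
  unfolding has_field_derivative_iff tendsto_at_iff_sequentially comp_def
proof (intro allI impI)
  interpret finite_measure \<mu> by (rule fin)
  fix X :: "nat \<Rightarrow> real"
  assume X: "\<forall>i. X i \<in> UNIV - {0}" "X \<longlonglongrightarrow> 0"
  have ev: "eventually (\<lambda>n. \<bar>X n\<bar> < \<delta>) sequentially"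
    using tendstoD[OF X(2) \<open>\<delta> > 0\<close>] by (simp add: dist_real_def)
  \<comment> \<open>Outside the interval of length \<open>2 * \<delta>\<close> the integrands need
    not be integrable, so these finitely many quotients are set to 0.\<close>
  define s where "s n x = (if \<bar>X n\<bar> < \<delta> then (f (X n) x - f 0 x) / X n else 0)" for n x
  have s_int: "integrable \<mu> (s n)" for n
    unfolding s_def using int[of "X n"] int[of 0] \<open>\<delta> > 0\<close> by (cases "\<bar>X n\<bar> < \<delta>") auto
  have s_lim: "(\<lambda>n. s n x) \<longlonglongrightarrow> f' x" if x: "x \<in> space \<mu>" for x
  proof -
    have "((\<lambda>h. (f h x - f 0 x) / h) \<longlongrightarrow> f' x) (at 0)"
      using der[OF x] by (simp add: has_field_derivative_iff)
    then have "(\<lambda>n. (f (X n) x - f 0 x) / X n) \<longlonglongrightarrow> f' x"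
      using X unfolding tendsto_at_iff_sequentially comp_def by blast
    then show ?thesis
      by (rule Lim_transform_eventually) (use ev in eventually_elim, simp add: s_def)
  qed
  have s_bound: "norm (s n x) \<le> \<bar>C\<bar>" if "x \<in> space \<mu>" for n x
  proof (cases "\<bar>X n\<bar> < \<delta>")
    case True
    have "X n \<noteq> 0" using X(1) by auto
    have "\<bar>f (X n) x - f 0 x\<bar> \<le> \<bar>C\<bar> * \<bar>X n\<bar>"
      using lip[OF True that] mult_right_mono[OF abs_ge_self[of C] abs_ge_zero[of "X n"]] by linarith
    then show ?thesis using True \<open>X n \<noteq> 0\<close> by (simp add: s_def abs_divide field_simps)
  qed (simp add: s_def)
  have "(\<lambda>n. \<integral>x. s n x \<partial>\<mu>) \<longlonglongrightarrow> (\<integral>x. f' x \<partial>\<mu>)"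
  proof (rule integral_dominated_convergence[where w="\<lambda>_. \<bar>C\<bar>"])
    show sm: "s n \<in> borel_measurable \<mu>" for n using s_int by auto
    show "f' \<in> borel_measurable \<mu>" by (rule borel_measurable_LIMSEQ_real[OF s_lim sm])
  qed (use s_lim s_bound in auto)
  then show "(\<lambda>n. ((\<integral>x. f (X n) x \<partial>\<mu>) - (\<integral>x. f 0 x \<partial>\<mu>)) / (X n - 0)) \<longlonglongrightarrow> (\<integral>x. f' x \<partial>\<mu>)"
  proof (rule Lim_transform_eventually)
    show "\<forall>\<^sub>F n in sequentially. (\<integral>x. s n x \<partial>\<mu>) = ((\<integral>x. f (X n) x \<partial>\<mu>) - (\<integral>x. f 0 x \<partial>\<mu>)) / (X n - 0)"
      using ev by eventually_elim (use int[of 0] int \<open>\<delta> > 0\<close> in \<open>simp add: s_def\<close>)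
  qed
qed

text \<open>\<open>F\<close> is differentiable on \<open>{0..}\<close>, so the energy densities of
  the varied maps have to stay in that set.\<close>

lemma hs_norm_sq_nonneg:
  fixes q :: "real^'n \<Rightarrow> real^'n \<Rightarrow> real" and L :: "real^'m \<Rightarrow> real^'n"
  assumes p: "inner_product_form p" and q: "inner_product_form q" and L: "\<And>v. L v = (\<chi> c. l c \<bullet> v)"
  shows "hs_norm_sq p q L \<ge> 0"
proof -
  have bq: "bilinear q" using q by (simp add: inner_product_form_def)
  obtain B where B: "finite B" "card B = CARD('m)" "\<forall>v\<in>B. \<forall>w\<in>B. p v w = (if v = w then 1 else 0)"
    using orthonormal_set_exists[OF p, of "CARD('m)"] by blast
  have "hs_norm_sq p q L = (\<Sum>c\<in>UNIV. \<Sum>d\<in>UNIV. inner_matrix q $ c $ d * (\<Sum>v\<in>B. (l c \<bullet> v) * (l d \<bullet> v)))"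
    unfolding hs_norm_sq_eq[OF p bq L] orthonormal_set_sum[OF p B] ..
  also have "\<dots> = (\<Sum>c\<in>UNIV. \<Sum>d\<in>UNIV. \<Sum>v\<in>B. inner_matrix q $ c $ d * ((l c \<bullet> v) * (l d \<bullet> v)))"
    by (simp add: sum_distrib_left)
  also have "\<dots> = (\<Sum>c\<in>UNIV. \<Sum>v\<in>B. \<Sum>d\<in>UNIV. inner_matrix q $ c $ d * ((l c \<bullet> v) * (l d \<bullet> v)))"
    by (rule sum.cong[OF refl sum.swap])
  also have "\<dots> = (\<Sum>v\<in>B. \<Sum>c\<in>UNIV. \<Sum>d\<in>UNIV. inner_matrix q $ c $ d * ((l c \<bullet> v) * (l d \<bullet> v)))"
    by (rule sum.swap)
  also have "\<dots> = (\<Sum>v\<in>B. q (L v) (L v))"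
    by (intro sum.cong refl, subst bilinear_inner_matrix[OF bq])
       (simp add: L inner_vec_def[of "vec_lambda _"] matrix_vector_mult_def sum_distrib_left mult_ac)
  also have "\<dots> \<ge> 0"
  proof (rule sum_nonneg)
    fix v
    show "q (L v) (L v) \<ge> 0"
    proof (cases "L v = 0")
      case True
      have "linear (q 0)" using bq by (simp add: bilinear_def)
      then show ?thesis using True by (simp add: linear_0)
    next
      case False
      then show ?thesis using q by (auto simp: inner_product_form_def less_imp_le)
    qed
  qed
  finally show ?thesis .
qed

context conformal_submersion
begin

text \<open>The trace of the relation \<open>horizontal_dual\<close>.\<close>

lemma energy_density_u:
  assumes x: "x \<in> points M"
  shows "hs_norm_sq (gM x) (gN (u x)) (mderiv M N u x) = real CARD('n) * (dil x)\<^sup>2"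
proof -
  obtain d where d: "d \<in> charts N" "u x \<in> fst d" using N.chart_cover smooth_map_points[OF smooth_u x] by blast
  have xd: "x \<in> udom d" using x d by (simp add: udom_def)
  have "hs_norm_sq (gM x) (gN (u x)) (mderiv M N u x) =
    (\<Sum>a\<in>UNIV. \<Sum>b\<in>UNIV. gram N gN d (u x) $ a $ b * Gam (\<lambda>y. snd d (u y) $ a) (\<lambda>y. snd d (u y) $ b) x)"
    by (rule hs_norm_chart[OF d(1) openin_udom[OF d(1)] xd])
       (use smooth_Y[OF d(1)] in \<open>auto simp: udom_def Y_def[abs_def]\<close>)
  also have "\<dots> = (\<Sum>a\<in>UNIV. \<Sum>b\<in>UNIV. Hc d (Y d x) $ a $ b * Gam (\<lambda>y. Y d y $ b) (\<lambda>y. Y d y $ a) x)"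
    unfolding Hc_Y[OF d(1) xd] unfolding Y_def by (intro sum.cong refl arg_cong2[where f="(*)"] Gam_commute x)
  also have "\<dots> = (\<Sum>a\<in>(UNIV::'n set). (dil x)\<^sup>2)"
    by (simp add: horizontal_dual[OF d(1) xd])
  finally show ?thesis by simp
qed

end

text \<open>The variation moves \<open>u\<close> inside one coordinate domain of \<open>N\<close>,
  linearly in the coordinates. As \<open>V\<close> vanishes off the closed set \<open>K\<close>, the
  varied map agrees with \<open>u\<close> near the boundary of \<open>udom d\<close> and stays
  smooth there.\<close>

locale chart_variation = conformal_submersion M gM N gN u dil
  for M :: "('a, real^'m) mfd" and gM and N :: "('b, real^'n) mfd" and gN u dil +
  fixes d :: "('b, real^'n) chart" and V :: "'a \<Rightarrow> real^'n" and K :: "'a set"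
  assumes d: "d \<in> charts N" and V: "smooth_fn M (udom d) V"
    and K: "closedin (mtop M) K" "K \<subseteq> udom d" and V0: "\<And>x. x \<in> udom d - K \<Longrightarrow> V x = 0"
begin

definition U :: "real \<Rightarrow> 'a \<Rightarrow> 'b" where
  "U t x = (if x \<in> udom d then chart_inv d (Y d x + t *\<^sub>R V x) else u x)"

abbreviation "img \<equiv> snd d ` fst d"

lemma compact_K: "compactin (mtop M) K"
  by (rule closedin_compact_space[OF compact K(1)])

lemma bounded_on_K:
  fixes f :: "'a \<Rightarrow> real"
  assumes "continuous_map (subtopology (mtop M) (udom d)) euclideanreal f"
  obtains B where "B \<ge> 0" "\<And>x. x \<in> K \<Longrightarrow> \<bar>f x\<bar> \<le> B"
proof -
  have "compactin (subtopology (mtop M) (udom d)) K"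
    using compact_K K(2) by (simp add: compactin_subtopology)
  from image_compactin[OF this assms] have "bounded (f ` K)" by (simp add: compact_imp_bounded)
  then obtain B where B: "\<And>x. x \<in> K \<Longrightarrow> \<bar>f x\<bar> \<le> B" unfolding bounded_iff by (metis image_eqI real_norm_def)
  show ?thesis using that[of "max B 0"] B by (metis max.cobounded1 max.cobounded2 order_trans)
qed

lemma image_K_compact:
  assumes "smooth_fn M (udom d) f" shows "compact (f ` K)"
proof -
  have "compactin (subtopology (mtop M) (udom d)) K"
    using compact_K K(2) by (simp add: compactin_subtopology)
  from image_compactin[OF this smooth_fn_continuous[OF openin_udom[OF d] assms]] show ?thesis by simp
qed

text \<open>The compact image of \<open>K\<close> has a positive distance from the complement of the
  chart image, and \<open>V\<close> is bounded on \<open>K\<close>. The compact set \<open>S\<close>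
  later bounds the metric coefficients uniformly in \<open>t\<close>.\<close>

lemma variation_range:
  obtains \<delta> S where "\<delta> > 0" "\<delta> \<le> 1" "compact S" "S \<subseteq> img"
    "\<And>t x. \<bar>t\<bar> < \<delta> \<Longrightarrow> x \<in> K \<Longrightarrow> Y d x + t *\<^sub>R V x \<in> S"
proof -
  have cY: "compact (Y d ` K)" by (rule image_K_compact[OF smooth_Y[OF d]])
  have "Y d ` K \<subseteq> img" using Y_image K(2) by blast
  then obtain r where r: "r > 0" "(\<Union>y\<in>Y d ` K. ball y r) \<subseteq> img"
    using compact_subset_open_imp_ball_epsilon_subset[OF cY N.chart_image_open[OF d]] by blast
  obtain c where c: "\<And>x. x \<in> K \<Longrightarrow> norm (V x) \<le> c"
    using compact_imp_bounded[OF image_K_compact[OF V]] unfolding bounded_iff by blast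
  define c' where "c' = max c 0 + 1"
  have c': "c' > 0" "\<And>x. x \<in> K \<Longrightarrow> norm (V x) \<le> c'" using c unfolding c'_def by (auto simp: max_def) fastforce+
  define S where "S = {y + z | y z. y \<in> Y d ` K \<and> z \<in> cball 0 (r / 2)}"
  show ?thesis
  proof (rule that[of "min 1 (r / 2 / c')" S])
    show "compact S" unfolding S_def by (rule compact_sums[OF cY compact_cball])
    show "S \<subseteq> img"
    proof
      fix s assume "s \<in> S"
      then obtain y z where yz: "y \<in> Y d ` K" "norm z \<le> r / 2" "s = y + z" by (auto simp: S_def)
      then have "s \<in> ball y r" using r(1) by (simp add: dist_norm)
      then show "s \<in> img" using r(2) yz(1) by blast
    qed
    fix t x assume t: "\<bar>t\<bar> < min 1 (r / 2 / c')" and x: "x \<in> K"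
    have "norm (t *\<^sub>R V x) \<le> \<bar>t\<bar> * c'" using c'(2)[OF x] by (simp add: mult_left_mono)
    also have "\<dots> \<le> r / 2 / c' * c'" using t c'(1) by (intro mult_right_mono) auto
    also have "\<dots> = r / 2" using c'(1) by simp
    finally have "t *\<^sub>R V x \<in> cball 0 (r / 2)" by simp
    then show "Y d x + t *\<^sub>R V x \<in> S" using x unfolding S_def by blast
  qed (use r(1) c'(1) in auto)
qed

lemma smooth_YV: "smooth_fn M (udom d) (\<lambda>x. Y d x + t *\<^sub>R V x)"
  by (intro smooth_fn_add smooth_fn_scaleR smooth_fn_const openin_udom d smooth_Y V)

lemma smooth_V_nth: "smooth_fn M (udom d) (\<lambda>x. V x $ k)"
  using V unfolding smooth_fn_vec_iff[OF openin_udom[OF d]] by blast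

definition E :: "real \<Rightarrow> 'a \<Rightarrow> real" where
  "E t x = hs_norm_sq (gM x) (gN (U t x)) (mderiv M N (U t) x)"

text \<open>\<open>GA\<close>, \<open>GB\<close> and \<open>GC\<close> are the coefficients of 1,
  \<open>t\<close> and \<open>t\<^sup>2\<close> in the inner product of the differentials of the
  components \<open>a\<close> and \<open>b\<close> of the varied coordinates.\<close>

abbreviation "GA a b x \<equiv> Gam (\<lambda>y. Y d y $ a) (\<lambda>y. Y d y $ b) x"
abbreviation "GB a b x \<equiv> Gam (\<lambda>y. Y d y $ a) (\<lambda>y. V y $ b) x + Gam (\<lambda>y. Y d y $ b) (\<lambda>y. V y $ a) x"
abbreviation "GC a b x \<equiv> Gam (\<lambda>y. V y $ a) (\<lambda>y. V y $ b) x"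

lemma smooth_G: "smooth_fn M (udom d) (\<lambda>x. GA a b x)" "smooth_fn M (udom d) (\<lambda>x. GB a b x)" "smooth_fn M (udom d) (\<lambda>x. GC a b x)"
  by (intro smooth_fn_add smooth_Gam openin_udom d smooth_Y_nth smooth_V_nth)+

context
  fixes \<delta> :: real assumes \<delta>: "\<delta> > 0" "\<And>t x. \<bar>t\<bar> < \<delta> \<Longrightarrow> x \<in> udom d \<Longrightarrow> Y d x + t *\<^sub>R V x \<in> img"
begin

lemma U_udom: "\<bar>t\<bar> < \<delta> \<Longrightarrow> x \<in> udom d \<Longrightarrow> U t x \<in> fst d" "\<bar>t\<bar> < \<delta> \<Longrightarrow> x \<in> udom d \<Longrightarrow> snd d (U t x) = Y d x + t *\<^sub>R V x"
  using N.chart_inv_mem[OF \<delta>(2)] N.chart_inv_right[OF \<delta>(2)] by (auto simp: U_def)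

lemma U_out: "x \<in> points M - K \<Longrightarrow> U t x = u x"
  using V0[of x] d by (auto simp: U_def Y_def udom_def)

text \<open>The open sets \<open>udom d\<close> and \<open>points M - K\<close> cover: on the first
  the coordinate formula applies, on the second the variation is \<open>u\<close> for all
  times.\<close>

lemma U_smooth_map:
  "smooth_map (prod_mfd (open_mfd {-\<delta><..<\<delta>}) M) N (\<lambda>(t, x). U t x)"
  unfolding smooth_map_def
proof (intro conjI ballI)
  let ?I = "{-\<delta><..<\<delta>}"
  let ?P = "prod_topology (top_of_set ?I) (mtop M)"
  have W1: "openin (mtop M) (udom d)" by (rule openin_udom[OF d])
  have W2: "openin (mtop M) (points M - K)" using K(1) by blast
  have absI: "t \<in> ?I \<longleftrightarrow> \<bar>t\<bar> < \<delta>" for t by auto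
  have cont1: "continuous_map (prod_topology (top_of_set ?I) (subtopology (mtop M) (udom d))) (mtop N) (\<lambda>(t, x). U t x)"
  proof -
    let ?Q = "prod_topology (top_of_set ?I) (subtopology (mtop M) (udom d))"
    have c1: "continuous_map ?Q euclidean (\<lambda>p. f (snd p))" if "smooth_fn M (udom d) f" for f :: "'a \<Rightarrow> real^'n"
      using continuous_map_compose[OF continuous_map_snd smooth_fn_continuous[OF W1 that]] by (simp add: comp_def)
    have c2: "continuous_map ?Q euclideanreal fst"
      using continuous_map_into_fulltopology[OF continuous_map_fst[of "top_of_set ?I" "subtopology (mtop M) (udom d)"]] by simp
    have "continuous_map ?Q euclidean (\<lambda>p. fst p *\<^sub>R V (snd p))"
      using continuous_map_compose[OF continuous_map_pairedI[OF c2 c1[OF V]], of euclidean "\<lambda>(r, v). r *\<^sub>R v"]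
      by (simp add: comp_def case_prod_unfold continuous_intros flip: euclidean_product_topology)
    then have "continuous_map ?Q euclidean (\<lambda>p. Y d (snd p) + fst p *\<^sub>R V (snd p))"
      by (intro continuous_map_add c1 smooth_Y d)
    then have "continuous_map ?Q (top_of_set img) (\<lambda>p. Y d (snd p) + fst p *\<^sub>R V (snd p))"
      using \<delta>(2) by (auto simp: continuous_map_in_subtopology absI)
    from continuous_map_compose[OF this N.chart_inv_continuous[OF d]]
    show ?thesis by (rule continuous_map_eq) (auto simp: U_def)
  qed
  have cont2: "continuous_map (prod_topology (top_of_set ?I) (subtopology (mtop M) (points M - K))) (mtop N) (\<lambda>(t, x). U t x)"
  proof -
    have "continuous_map (mtop M) (mtop N) u" using smooth_u by (simp add: smooth_map_def)
    from continuous_map_compose[OF continuous_map_snd continuous_map_from_subtopology[OF this]]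
    show ?thesis by (rule continuous_map_eq) (use U_out in auto)
  qed
  have "continuous_map ?P (mtop N) (\<lambda>(t, x). U t x)"
  proof (rule pasting_lemma[where I="{udom d, points M - K}" and T="\<lambda>W. ?I \<times> W" and f="\<lambda>_. \<lambda>(t, x). U t x"])
    fix W assume W: "W \<in> {udom d, points M - K}"
    then have oW: "openin (mtop M) W" using W1 W2 by auto
    show "openin ?P (?I \<times> W)" using oW by (simp add: openin_prod_Times_iff)
    show "continuous_map (subtopology ?P (?I \<times> W)) (mtop N) (\<lambda>(t, x). U t x)"
      using cont1 cont2 W by (auto simp: subtopology_Times subtopology_subtopology)
  next
    fix p assume "p \<in> topspace ?P"
    then show "\<exists>W. W \<in> {udom d, points M - K} \<and> p \<in> ?I \<times> W \<and> (case p of (t, x) \<Rightarrow> U t x) = (case p of (t, x) \<Rightarrow> U t x)"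
      using K(2) by (cases p) auto
  qed auto
  then show "continuous_map (mtop (prod_mfd (open_mfd ?I) M)) (mtop N) (\<lambda>(t, x). U t x)"
    by (simp add: prod_mfd_def open_mfd_def)
  fix c' d' assume "c' \<in> charts (prod_mfd (open_mfd ?I) M)" and d': "d' \<in> charts N"
  then obtain c where c: "c \<in> charts M" "c' = (?I \<times> fst c, map_prod id (snd c))"
    by (auto simp: prod_mfd_def open_mfd_def)
  have "inj_on (map_prod id (snd c)) (?I \<times> fst c)"
    using N.chart_inj chart_inj[OF c(1)] by (auto simp: inj_on_def)
  then have inv: "chart_inv c' (t, snd c x) = (t, x)" if "t \<in> ?I" "x \<in> fst c" for t x
    unfolding chart_inv_def c(2) fst_conv snd_conv
    using inv_into_f_f[of "map_prod id (snd c)" "?I \<times> fst c" "(t, x)"] that by simp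
  let ?G = "snd d' \<circ> (\<lambda>(t, x). U t x) \<circ> chart_inv c'"
  show "smooth_on (snd c' ` (fst c' \<inter> (\<lambda>(t, x). U t x) -` fst d')) ?G"
  proof (rule smooth_on_local)
    fix p assume "p \<in> snd c' ` (fst c' \<inter> (\<lambda>(t, x). U t x) -` fst d')"
    then obtain t0 x0 where p: "p = (t0, snd c x0)" "t0 \<in> ?I" "x0 \<in> fst c" "U t0 x0 \<in> fst d'" by (auto simp: c(2))
    show "\<exists>Q. open Q \<and> p \<in> Q \<and> smooth_on Q ?G"
    proof (cases "x0 \<in> udom d")
      case True
      define P where "P = ?I \<times> snd c ` (fst c \<inter> udom d)"
      have P: "open P" unfolding P_def by (intro open_Times chart_image_openin c W1 open_greaterThanLessThan)
      define \<zeta> where "\<zeta> q = Y d (chart_inv c (snd q)) + fst q *\<^sub>R V (chart_inv c (snd q))" for q :: "real \<times> (real^'m)"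
      have sc: "smooth_on P (\<lambda>q. f (chart_inv c (snd q)))" if "smooth_fn M (udom d) f" for f :: "'a \<Rightarrow> real^'n"
        by (rule smooth_on_compose[OF P chart_image_openin[OF c(1) W1] smooth_on_snd[OF P smooth_on_id[OF P]]])
           (use that c in \<open>auto simp: smooth_fn_def P_def\<close>)
      have s\<zeta>: "smooth_on P \<zeta>" unfolding \<zeta>_def[abs_def]
        by (intro smooth_on_add smooth_on_scaleR smooth_on_fst smooth_on_id P sc smooth_Y d V)
      let ?T = "snd d ` (fst d \<inter> fst d')"
      have T: "open ?T" by (rule N.transition_open[OF d d'])
      define Q where "Q = P \<inter> \<zeta> -` ?T"
      have Q: "open Q" unfolding Q_def
        by (rule continuous_open_preimage[OF smooth_on_imp_continuous_on[OF s\<zeta>] P T])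
      have \<zeta>p: "\<zeta> p = Y d x0 + t0 *\<^sub>R V x0" using p(1,3) c(1) by (simp add: \<zeta>_def)
      have "\<bar>t0\<bar> < \<delta>" using p(2) by auto
      then have "U t0 x0 \<in> fst d \<inter> fst d'" "snd d (U t0 x0) = \<zeta> p"
        using U_udom[OF _ True] p(4) \<zeta>p by auto
      then have "\<zeta> p \<in> ?T" by (metis imageI)
      then have pQ: "p \<in> Q" using p True by (auto simp: Q_def P_def)
      have sm: "smooth_on Q (\<lambda>q. transition d d' (\<zeta> q))"
        by (rule smooth_on_compose[OF Q T smooth_on_subset[OF s\<zeta>] N.transition_smooth[OF d d']]) (auto simp: Q_def)
      have "smooth_on Q ?G"
      proof (rule smooth_on_cong[OF Q _ sm])
        fix q assume "q \<in> Q"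
        then obtain t x where q: "q = (t, snd c x)" "t \<in> ?I" "x \<in> fst c" "x \<in> udom d" by (auto simp: Q_def P_def)
        then show "transition d d' (\<zeta> q) = ?G q"
          using c(1) by (simp add: inv transition_def \<zeta>_def U_def)
      qed
      then show ?thesis using Q pQ by blast
    next
      case False
      then have x0: "x0 \<in> points M - K" using K(2) p(3) chart_subset[OF c(1)] by blast
      let ?W = "(points M - K) \<inter> udom d'"
      have W: "openin (mtop M) ?W" using W2 openin_udom[OF d'] by blast
      define Q where "Q = ?I \<times> snd c ` (fst c \<inter> ?W)"
      have Q: "open Q" unfolding Q_def by (intro open_Times chart_image_openin c W open_greaterThanLessThan)
      have "U t0 x0 = u x0" using U_out[OF x0] by simp
      then have pQ: "p \<in> Q" using p x0 by (auto simp: Q_def udom_def)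
      have sm: "smooth_on Q (\<lambda>q. Y d' (chart_inv c (snd q)))"
        by (rule smooth_on_compose[OF Q chart_image_openin[OF c(1) W] smooth_on_snd[OF Q smooth_on_id[OF Q]]])
           (use smooth_fn_subset[OF smooth_Y[OF d'], of ?W] c in \<open>auto simp: smooth_fn_def Q_def\<close>)
      have "smooth_on Q ?G"
      proof (rule smooth_on_cong[OF Q _ sm])
        fix q assume "q \<in> Q"
        then obtain t x where q: "q = (t, snd c x)" "t \<in> ?I" "x \<in> fst c" "x \<in> ?W" by (auto simp: Q_def)
        then show "Y d' (chart_inv c (snd q)) = ?G q"
          using c(1) U_out[of x t] by (simp add: inv Y_def)
      qed
      then show ?thesis using Q pQ by blast
    qed
  qed
qed

lemma E_in:
  assumes t: "\<bar>t\<bar> < \<delta>" and x: "x \<in> udom d"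
  shows "E t x = (\<Sum>a\<in>UNIV. \<Sum>b\<in>UNIV. Hc d (Y d x + t *\<^sub>R V x) $ a $ b * (GA a b x + t * GB a b x + t\<^sup>2 * GC a b x))"
proof -
  have xM: "x \<in> points M" using x udom_points by blast
  note W = openin_udom[OF d]
  have sm: "smooth_fn M (udom d) (\<lambda>y. snd d (U t y))"
    by (rule smooth_fn_cong[OF W _ smooth_YV[of t]]) (simp add: U_udom(2)[OF t])
  have smn: "smooth_fn M (udom d) (\<lambda>y. Y d y $ a + t * V y $ a)" for a
    by (intro smooth_fn_add smooth_fn_mult smooth_fn_const W smooth_Y_nth d smooth_V_nth)
  have smt: "smooth_fn M (udom d) (\<lambda>y. t * V y $ a)" for a
    by (intro smooth_fn_mult smooth_fn_const W smooth_V_nth)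
  have Gr: "Gam f (\<lambda>y. Y d y $ b + t * V y $ b) x = Gam f (\<lambda>y. Y d y $ b) x + t * Gam f (\<lambda>y. V y $ b) x" for f b
    by (simp add: Gam_add[OF W x smooth_Y_nth[OF d] smt] Gam_mult[OF W x smooth_fn_const[OF W] smooth_V_nth])
  have G: "Gam (\<lambda>y. snd d (U t y) $ a) (\<lambda>y. snd d (U t y) $ b) x = GA a b x + t * GB a b x + t\<^sup>2 * GC a b x" for a b
  proof -
    have eq: "Y d y $ a + t * V y $ a = snd d (U t y) $ a" if "y \<in> udom d" for y a
      using U_udom(2)[OF t that] by simp
    have cg: "Gam f (\<lambda>y. snd d (U t y) $ b) x = Gam f (\<lambda>y. Y d y $ b + t * V y $ b) x" for f b
      by (rule Gam_cong[OF W x smn, symmetric]) (rule eq)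
    have "Gam (\<lambda>y. snd d (U t y) $ a) (\<lambda>y. snd d (U t y) $ b) x
        = Gam (\<lambda>y. Y d y $ b + t * V y $ b) (\<lambda>y. Y d y $ a + t * V y $ a) x"
      unfolding cg by (simp only: Gam_commute[OF xM, of "\<lambda>y. snd d (U t y) $ a"] cg)
    also have "\<dots> = Gam (\<lambda>y. Y d y $ b + t * V y $ b) (\<lambda>y. Y d y $ a) x + t * Gam (\<lambda>y. Y d y $ b + t * V y $ b) (\<lambda>y. V y $ a) x"
      by (rule Gr)
    also have "\<dots> = GA a b x + t * GB a b x + t\<^sup>2 * GC a b x"
      by (simp add: Gam_commute[OF xM, of "\<lambda>y. Y d y $ b + t * V y $ b"] Gr Gam_commute[OF xM, of "\<lambda>y. V y $ a" "\<lambda>y. Y d y $ b"]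
          algebra_simps power2_eq_square)
    finally show ?thesis .
  qed
  have "E t x = (\<Sum>a\<in>UNIV. \<Sum>b\<in>UNIV. gram N gN d (U t x) $ a $ b * Gam (\<lambda>y. snd d (U t y) $ a) (\<lambda>y. snd d (U t y) $ b) x)"
    unfolding E_def by (rule hs_norm_chart[OF d W x U_udom(1)[OF t] sm])
  moreover have "gram N gN d (U t x) = Hc d (Y d x + t *\<^sub>R V x)"
    using x by (simp add: Hc_def U_def)
  ultimately show ?thesis by (simp add: G)
qed

lemma E_out:
  assumes x: "x \<in> points M - K"
  shows "E t x = real CARD('n) * (dil x)\<^sup>2"
proof -
  obtain d' where d': "d' \<in> charts N" "u x \<in> fst d'" using N.chart_cover smooth_map_points[OF smooth_u] x by blast
  let ?W = "(points M - K) \<inter> udom d'"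
  have W: "openin (mtop M) ?W" "x \<in> ?W" using K(1) openin_udom[OF d'(1)] x d' by (auto simp: udom_def)
  have eq: "U t y = u y" if "y \<in> ?W" for y using U_out that by simp
  have su: "smooth_fn M ?W (\<lambda>y. snd d' (u y))"
    using smooth_fn_subset[OF smooth_Y[OF d'(1)], of ?W] by (simp add: Y_def[abs_def])
  have sU: "smooth_fn M ?W (\<lambda>y. snd d' (U t y))" by (rule smooth_fn_cong[OF W(1) _ su]) (simp add: eq)
  have sun: "smooth_fn M ?W (\<lambda>y. snd d' (u y) $ a)" for a using su unfolding smooth_fn_vec_iff[OF W(1)] by blast
  have "E t x = (\<Sum>a\<in>UNIV. \<Sum>b\<in>UNIV. gram N gN d' (U t x) $ a $ b * Gam (\<lambda>y. snd d' (U t y) $ a) (\<lambda>y. snd d' (U t y) $ b) x)"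
    unfolding E_def by (rule hs_norm_chart[OF d'(1) W _ sU]) (use eq in \<open>auto simp: udom_def\<close>)
  also have "\<dots> = (\<Sum>a\<in>UNIV. \<Sum>b\<in>UNIV. gram N gN d' (u x) $ a $ b * Gam (\<lambda>y. snd d' (u y) $ a) (\<lambda>y. snd d' (u y) $ b) x)"
  proof (intro sum.cong refl)
    fix a b
    have xM: "x \<in> points M" using x by blast
    have cg: "Gam f (\<lambda>y. snd d' (U t y) $ b) x = Gam f (\<lambda>y. snd d' (u y) $ b) x" for f b
      by (rule Gam_cong[OF W sun, symmetric]) (simp add: eq)
    show "gram N gN d' (U t x) $ a $ b * Gam (\<lambda>y. snd d' (U t y) $ a) (\<lambda>y. snd d' (U t y) $ b) x =
        gram N gN d' (u x) $ a $ b * Gam (\<lambda>y. snd d' (u y) $ a) (\<lambda>y. snd d' (u y) $ b) x"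
      unfolding cg by (simp only: Gam_commute[OF xM, of "\<lambda>y. snd d' (U t y) $ a"] cg eq[OF W(2)]) (simp only: Gam_commute[OF xM, of "\<lambda>y. snd d' (u y) $ b"])
  qed
  also have "\<dots> = hs_norm_sq (gM x) (gN (u x)) (mderiv M N u x)"
    by (rule hs_norm_chart[OF d'(1) W _ su, symmetric]) (auto simp: udom_def)
  also have "\<dots> = real CARD('n) * (dil x)\<^sup>2" using energy_density_u x by blast
  finally show ?thesis .
qed

end
end

context conformal_submersion
begin

lemma hs_norm_chart_nonneg:
  assumes d: "d \<in> charts N" and W: "openin (mtop M) W" "x \<in> W" "\<And>y. y \<in> W \<Longrightarrow> v y \<in> fst d" "smooth_fn M W (\<lambda>y. snd d (v y))"
  shows "hs_norm_sq (gM x) (gN (v x)) (mderiv M N v x) \<ge> 0"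
proof -
  have x: "x \<in> points M" using W openin_subset by blast
  have vx: "v x \<in> fst d" "v x \<in> points N" using W(2,3) N.chart_subset[OF d] by blast+
  define L where "L = mderiv M N v x"
  have "L = coord_vec N d (v x) \<circ> chart_deriv (chart_at M x) (\<lambda>y. snd d (v y)) x"
    unfolding L_def using mderiv_chart[OF W(1) d W(3,4,2)] by (simp add: fun_eq_iff)
  then have L: "linear L"
    using linear_compose[OF chart_deriv_linear[OF W(4) chart_at[OF x] W(2)] N.coord_vec_bij(1)[OF d vx(1)]] by simp
  show ?thesis
    unfolding L_def[symmetric]
  proof (rule hs_norm_sq_nonneg[OF metric_inner[OF x] N.metric_inner[OF vx(2)]])
    fix w
    have "L w $ c = (\<chi> i. L (axis i 1) $ c) \<bullet> w" for c
      by (rule linear_eq_inner_axis) (use linear_compose[OF L bounded_linear.linear[OF bounded_linear_vec_nth[of c]]] in \<open>simp add: comp_def\<close>)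
    then show "L w = (\<chi> c. (\<chi> i. L (axis i 1) $ c) \<bullet> w)" by (simp add: vec_eq_iff)
  qed
qed

end

context chart_variation
begin

definition E' :: "real \<Rightarrow> 'a \<Rightarrow> real" where
  "E' t x = (\<Sum>a\<in>UNIV. \<Sum>b\<in>UNIV.
     (\<Sum>k\<in>UNIV. V x $ k * partial k (\<lambda>y. Hc d y $ a $ b) (Y d x + t *\<^sub>R V x)) * (GA a b x + t * GB a b x + t\<^sup>2 * GC a b x)
     + Hc d (Y d x + t *\<^sub>R V x) $ a $ b * (GB a b x + 2 * t * GC a b x))"

lemma U_0: "U 0 = u"
  using d by (auto simp: U_def fun_eq_iff Y_def udom_def)

lemma E_0: "x \<in> points M \<Longrightarrow> E 0 x = real CARD('n) * (dil x)\<^sup>2"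
  by (simp add: E_def U_0 energy_density_u)

lemma smooth_partial_Hc: "smooth_on img (partial k (\<lambda>y. Hc d y $ a $ b))"
  unfolding partial_def by (rule smooth_on_frechet_derivative[OF smooth_Hc[OF d]])

context
  fixes \<delta> S assumes \<delta>: "\<delta> > 0" "\<delta> \<le> 1" and S: "compact S" "S \<subseteq> img"
    and range: "\<And>t x. \<bar>t\<bar> < \<delta> \<Longrightarrow> x \<in> K \<Longrightarrow> Y d x + t *\<^sub>R V x \<in> S"
begin

lemma range_img: "\<bar>t\<bar> < \<delta> \<Longrightarrow> x \<in> udom d \<Longrightarrow> Y d x + t *\<^sub>R V x \<in> img"
  using range[of t x] S(2) V0[of x] Y_image[of x d] by (cases "x \<in> K") auto

lemma E_nonneg:
  assumes t: "\<bar>t\<bar> < \<delta>" and x: "x \<in> points M" shows "E t x \<ge> 0"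
proof (cases "x \<in> udom d")
  case True
  show ?thesis unfolding E_def
  proof (rule hs_norm_chart_nonneg[OF d openin_udom[OF d] True])
    show "U t y \<in> fst d" if "y \<in> udom d" for y by (rule U_udom(1)[OF \<delta>(1) range_img t that])
    show "smooth_fn M (udom d) (\<lambda>y. snd d (U t y))"
      by (rule smooth_fn_cong[OF openin_udom[OF d] _ smooth_YV[of t]]) (simp add: U_udom(2)[OF \<delta>(1) range_img t])
  qed
next
  case False
  then have "x \<notin> K" using K(2) by blast
  then show ?thesis using E_out[OF \<delta>(1) range_img, of x t] x by simp
qed

lemma E_deriv:
  assumes t: "\<bar>t\<bar> < \<delta>" and x: "x \<in> udom d"
  shows "((\<lambda>s. E s x) has_real_derivative E' t x) (at t)"
proof -
  have H: "((\<lambda>s. Hc d (Y d x + s *\<^sub>R V x) $ a $ b) has_real_derivative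
      (\<Sum>k\<in>UNIV. V x $ k * partial k (\<lambda>y. Hc d y $ a $ b) (Y d x + t *\<^sub>R V x))) (at t)" for a b
  proof -
    let ?h = "\<lambda>y. Hc d y $ a $ b" and ?z = "Y d x + t *\<^sub>R V x"
    note z = range_img[OF t x]
    have 1: "((\<lambda>s. Y d x + s *\<^sub>R V x) has_derivative (\<lambda>r. r *\<^sub>R V x)) (at t)"
      by (auto intro!: derivative_eq_intros)
    have 2: "((\<lambda>s. ?h (Y d x + s *\<^sub>R V x)) has_derivative (\<lambda>r. frechet_derivative ?h (at ?z) (r *\<^sub>R V x))) (at t)"
      by (rule has_derivative_compose[OF 1 smooth_on_has_derivative[OF smooth_Hc[OF d] z]])
    have "frechet_derivative ?h (at ?z) (r *\<^sub>R V x) = (\<Sum>k\<in>UNIV. V x $ k * partial k ?h ?z) * r" for r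
      by (subst frechet_derivative_partial[OF smooth_on_differentiable[OF smooth_Hc[OF d] z]])
         (simp add: sum_distrib_left mult_ac)
    then show ?thesis using 2 by (simp add: has_field_derivative_def)
  qed
  have P: "((\<lambda>s. p + s * q + s\<^sup>2 * r) has_real_derivative (q + 2 * t * r)) (at t)" for p q r :: real
    by (auto intro!: derivative_eq_intros)
  have "((\<lambda>s. \<Sum>a\<in>UNIV. \<Sum>b\<in>UNIV. Hc d (Y d x + s *\<^sub>R V x) $ a $ b * (GA a b x + s * GB a b x + s\<^sup>2 * GC a b x))
      has_real_derivative E' t x) (at t)"
    unfolding E'_def
  proof (rule DERIV_sum, rule DERIV_sum)
    fix a b
    show "((\<lambda>s. Hc d (Y d x + s *\<^sub>R V x) $ a $ b * (GA a b x + s * GB a b x + s\<^sup>2 * GC a b x)) has_real_derivative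
       (\<Sum>k\<in>UNIV. V x $ k * partial k (\<lambda>y. Hc d y $ a $ b) (Y d x + t *\<^sub>R V x)) * (GA a b x + t * GB a b x + t\<^sup>2 * GC a b x)
       + Hc d (Y d x + t *\<^sub>R V x) $ a $ b * (GB a b x + 2 * t * GC a b x)) (at t)"
      by (rule DERIV_cong[OF DERIV_mult[OF H P]]) (simp add: mult.commute)
  qed
  then show ?thesis
    by (rule has_field_derivative_transform_within_open[of _ _ _ "{-\<delta><..<\<delta>}"])
       (use t x E_in[OF \<delta>(1) range_img, of _ x] in auto)
qed

text \<open>Compactness of \<open>K\<close> and \<open>S\<close> bounds every ingredient. The bound
  is the Lipschitz constant in \<open>t\<close> that permits differentiation under the
  integral.\<close>

lemma E'_bounded: "\<exists>C. \<forall>t x. \<bar>t\<bar> < \<delta> \<longrightarrow> x \<in> K \<longrightarrow> \<bar>E' t x\<bar> \<le> C"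
proof -
  note cont = smooth_fn_continuous[OF openin_udom[OF d]]
  have "\<exists>B\<ge>0. \<forall>x\<in>K. \<bar>GA a b x\<bar> \<le> B" for a b using bounded_on_K[OF cont[OF smooth_G(1)]] by metis
  then obtain BA where BA: "\<And>a b. BA a b \<ge> 0" "\<And>a b x. x \<in> K \<Longrightarrow> \<bar>GA a b x\<bar> \<le> BA a b" by metis
  have "\<exists>B\<ge>0. \<forall>x\<in>K. \<bar>GB a b x\<bar> \<le> B" for a b using bounded_on_K[OF cont[OF smooth_G(2)]] by metis
  then obtain BB where BB: "\<And>a b. BB a b \<ge> 0" "\<And>a b x. x \<in> K \<Longrightarrow> \<bar>GB a b x\<bar> \<le> BB a b" by metis
  have "\<exists>B\<ge>0. \<forall>x\<in>K. \<bar>GC a b x\<bar> \<le> B" for a b using bounded_on_K[OF cont[OF smooth_G(3)]] by metis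
  then obtain BC where BC: "\<And>a b. BC a b \<ge> 0" "\<And>a b x. x \<in> K \<Longrightarrow> \<bar>GC a b x\<bar> \<le> BC a b" by metis
  have "\<exists>B\<ge>0. \<forall>x\<in>K. \<bar>V x $ k\<bar> \<le> B" for k using bounded_on_K[OF cont[OF smooth_V_nth]] by metis
  then obtain BV where BV: "\<And>k. BV k \<ge> 0" "\<And>k x. x \<in> K \<Longrightarrow> \<bar>V x $ k\<bar> \<le> BV k" by metis
  have bS: "\<exists>B\<ge>0. \<forall>y\<in>S. \<bar>h y\<bar> \<le> B" if "smooth_on img h" for h :: "real^'n \<Rightarrow> real"
  proof -
    have "compact (h ` S)"
      using S smooth_on_imp_continuous_on[OF that] by (intro compact_continuous_image) (auto intro: continuous_on_subset)
    then obtain B where B: "\<And>y. y \<in> S \<Longrightarrow> \<bar>h y\<bar> \<le> B" by (metis bounded_iff compact_imp_bounded image_eqI real_norm_def)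
    then have "\<forall>y\<in>S. \<bar>h y\<bar> \<le> max B 0" by (meson max.coboundedI1)
    then show ?thesis by (metis max.cobounded2)
  qed
  obtain BH where BH: "\<And>a b. BH a b \<ge> 0" "\<And>a b y. y \<in> S \<Longrightarrow> \<bar>Hc d y $ a $ b\<bar> \<le> BH a b"
    using bS[OF smooth_Hc[OF d]] by metis
  obtain BP where BP: "\<And>k a b. BP k a b \<ge> 0" "\<And>k a b y. y \<in> S \<Longrightarrow> \<bar>partial k (\<lambda>y. Hc d y $ a $ b) y\<bar> \<le> BP k a b"
    using bS[OF smooth_partial_Hc] by metis
  let ?C = "\<Sum>a\<in>UNIV. \<Sum>b\<in>UNIV. (\<Sum>k\<in>UNIV. BV k * BP k a b) * (BA a b + BB a b + BC a b) + BH a b * (BB a b + 2 * BC a b)"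
  have "\<bar>E' t x\<bar> \<le> ?C" if t: "\<bar>t\<bar> < \<delta>" and x: "x \<in> K" for t x
  proof -
    note y = range[OF t x]
    have t1: "\<bar>t\<bar> \<le> 1" using t \<delta> by linarith
    have tt: "\<bar>t * r\<bar> \<le> \<bar>r\<bar>" "\<bar>t\<^sup>2 * r\<bar> \<le> \<bar>r\<bar>" for r
      using t1 mult_left_le_one_le[of "\<bar>r\<bar>" "\<bar>t\<bar>"] mult_left_le_one_le[of "\<bar>r\<bar>" "\<bar>t\<bar>\<^sup>2"]
      by (auto simp: abs_mult abs_square_le_1[THEN iffD2])
    have 1: "\<bar>\<Sum>k\<in>UNIV. V x $ k * partial k (\<lambda>y. Hc d y $ a $ b) (Y d x + t *\<^sub>R V x)\<bar> \<le> (\<Sum>k\<in>UNIV. BV k * BP k a b)" for a b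
      by (rule order_trans[OF sum_abs], rule sum_mono) (simp add: abs_mult mult_mono' BV(2)[OF x] BP(2)[OF y])
    have 2: "\<bar>GA a b x + t * GB a b x + t\<^sup>2 * GC a b x\<bar> \<le> BA a b + BB a b + BC a b" for a b
      using BA(2)[OF x, of a b] BB(2)[OF x, of a b] BC(2)[OF x, of a b] tt(1)[of "GB a b x"] tt(2)[of "GC a b x"] by linarith
    have 3: "\<bar>GB a b x + 2 * t * GC a b x\<bar> \<le> BB a b + 2 * BC a b" for a b
      using BB(2)[OF x, of a b] BC(2)[OF x, of a b] tt(1)[of "GC a b x"] by (simp add: mult.assoc)
    show ?thesis
      unfolding E'_def
    proof (rule order_trans[OF sum_abs], rule sum_mono, rule order_trans[OF sum_abs], rule sum_mono)
      fix a b
      show "\<bar>(\<Sum>k\<in>UNIV. V x $ k * partial k (\<lambda>y. Hc d y $ a $ b) (Y d x + t *\<^sub>R V x)) * (GA a b x + t * GB a b x + t\<^sup>2 * GC a b x)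
        + Hc d (Y d x + t *\<^sub>R V x) $ a $ b * (GB a b x + 2 * t * GC a b x)\<bar>
        \<le> (\<Sum>k\<in>UNIV. BV k * BP k a b) * (BA a b + BB a b + BC a b) + BH a b * (BB a b + 2 * BC a b)"
      proof (rule order_trans[OF abs_triangle_ineq], unfold abs_mult, rule add_mono)
        show "\<bar>\<Sum>k\<in>UNIV. V x $ k * partial k (\<lambda>y. Hc d y $ a $ b) (Y d x + t *\<^sub>R V x)\<bar> * \<bar>GA a b x + t * GB a b x + t\<^sup>2 * GC a b x\<bar>
          \<le> (\<Sum>k\<in>UNIV. BV k * BP k a b) * (BA a b + BB a b + BC a b)"
          by (rule mult_mono'[OF 1 2]) auto
        show "\<bar>Hc d (Y d x + t *\<^sub>R V x) $ a $ b\<bar> * \<bar>GB a b x + 2 * t * GC a b x\<bar> \<le> BH a b * (BB a b + 2 * BC a b)"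
          by (rule mult_mono'[OF BH(2)[OF y] 3]) auto
      qed
    qed
  qed
  then show ?thesis by blast
qed

lemma E_continuous:
  assumes t: "\<bar>t\<bar> < \<delta>" shows "continuous_map (mtop M) euclideanreal (E t)"
proof (rule pasting_lemma[where I="{udom d, points M - K}" and T="\<lambda>W. W" and f="\<lambda>_. E t"])
  have W1: "openin (mtop M) (udom d)" by (rule openin_udom[OF d])
  have W2: "openin (mtop M) (points M - K)" using K(1) by blast
  fix W assume W: "W \<in> {udom d, points M - K}"
  then show "openin (mtop M) W" using W1 W2 by auto
  have sH: "smooth_fn M (udom d) (\<lambda>x. Hc d (Y d x + t *\<^sub>R V x) $ a $ b)" for a b
    by (rule smooth_fn_compose[OF W1 smooth_YV N.chart_image_open[OF d] smooth_Hc[OF d] range_img[OF t]])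
  have "smooth_fn M (udom d) (E t)"
  proof (rule smooth_fn_cong[OF W1])
    show "smooth_fn M (udom d) (\<lambda>x. \<Sum>a\<in>UNIV. \<Sum>b\<in>UNIV. Hc d (Y d x + t *\<^sub>R V x) $ a $ b * (GA a b x + t * GB a b x + t\<^sup>2 * GC a b x))"
      by (intro smooth_fn_sum smooth_fn_mult smooth_fn_add smooth_fn_const W1 sH smooth_G)
  qed (simp add: E_in[OF \<delta>(1) range_img t])
  then have 1: "continuous_map (subtopology (mtop M) (udom d)) euclideanreal (E t)" by (rule smooth_fn_continuous[OF W1])
  have "smooth_fn M (points M - K) (E t)"
  proof (rule smooth_fn_cong[OF W2])
    show "smooth_fn M (points M - K) (\<lambda>x. real CARD('n) * (dil x)\<^sup>2)"
      by (intro smooth_fn_mult smooth_fn_const smooth_dil_sq W2)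
  qed (simp add: E_out[OF \<delta>(1) range_img])
  then have 2: "continuous_map (subtopology (mtop M) (points M - K)) euclideanreal (E t)" by (rule smooth_fn_continuous[OF W2])
  show "continuous_map (subtopology (mtop M) W) euclideanreal (E t)" using W 1 2 by auto
next
  fix x assume "x \<in> topspace (mtop M)"
  then show "\<exists>W. W \<in> {udom d, points M - K} \<and> x \<in> W \<and> E t x = E t x" using K(2) by auto
qed auto

end

text \<open>Differentiation under the integral: off \<open>K\<close> the integrand does not depend
  on \<open>t\<close>, and on \<open>K\<close> it is Lipschitz in \<open>t\<close> because
  \<open>F'\<close> is bounded on the compact range of the energy densities.\<close>

lemma first_variation:
  fixes F F' :: "real \<Rightarrow> real"
  assumes F: "\<And>t. t \<ge> 0 \<Longrightarrow> (F has_real_derivative F' t) (at t within {0..})" and F': "continuous_on {0..} F'"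
    and harm: "F_harmonic F M gM N gN u"
  shows "(\<integral>x. (if x \<in> udom d then F' (real CARD('n) * (dil x)\<^sup>2 / 2) * (E' 0 x / 2) else 0) \<partial>vol) = 0"
proof -
  obtain \<delta> S where \<delta>: "\<delta> > 0" "\<delta> \<le> 1" and S: "compact S" "S \<subseteq> img"
    and range: "\<And>t x. \<bar>t\<bar> < \<delta> \<Longrightarrow> x \<in> K \<Longrightarrow> Y d x + t *\<^sub>R V x \<in> S" using variation_range by metis
  note img = range_img[OF \<delta> S range]
  define f where "f t x = F (E t x / 2)" for t x
  have F_cont: "continuous_on {0..} F"
    by (rule DERIV_continuous_on) (use F in auto)
  have E0: "E t x \<ge> 0" if "\<bar>t\<bar> < \<delta>" "x \<in> points M" for t x by (rule E_nonneg[OF \<delta> S range that])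
  obtain C1 where C1: "\<And>t x. \<bar>t\<bar> < \<delta> \<Longrightarrow> x \<in> K \<Longrightarrow> \<bar>E' t x\<bar> \<le> C1"
    using E'_bounded[OF \<delta> S range] by blast
  have E_lip: "\<bar>E t x - E 0 x\<bar> \<le> \<bar>C1\<bar> * \<bar>t\<bar>" if t: "\<bar>t\<bar> < \<delta>" and x: "x \<in> points M" for t x
  proof (cases "x \<in> K")
    case True
    then have xd: "x \<in> udom d" using K(2) by blast
    have "norm (E t x - E 0 x) \<le> \<bar>C1\<bar> * norm (t - 0)"
    proof (rule field_differentiable_bound[of "{-\<delta><..<\<delta>}" "\<lambda>s. E s x" "\<lambda>s. E' s x"])
      show "((\<lambda>s. E s x) has_real_derivative E' s x) (at s within {-\<delta><..<\<delta>})" if "s \<in> {-\<delta><..<\<delta>}" for s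
        by (rule has_field_derivative_at_within[OF E_deriv[OF \<delta> S range _ xd]]) (use that in auto)
      show "norm (E' s x) \<le> \<bar>C1\<bar>" if "s \<in> {-\<delta><..<\<delta>}" for s
        using order_trans[OF C1[of s x] abs_ge_self] True that by auto
    qed (use t \<delta> in auto)
    then show ?thesis by simp
  next
    case False
    then have "E t x = E 0 x" using E_out[OF \<delta>(1) img] x by simp
    then show ?thesis by simp
  qed
  obtain B0 where B0: "\<And>x. x \<in> points M \<Longrightarrow> \<bar>E 0 x\<bar> \<le> B0"
    using continuous_bounded[OF E_continuous[OF \<delta> S range, of 0]] \<delta>(1) by auto
  \<comment> \<open>A common bound for \<open>E t x / 2\<close>: the Lipschitz estimate adds at most
    \<open>\<bar>C1\<bar>\<close> to \<open>E 0 x\<close>, since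
    \<open>\<bar>t\<bar> < 1\<close>.\<close>
  define R where "R = (\<bar>B0\<bar> + \<bar>C1\<bar>) / 2"
  have ER: "E t x / 2 \<in> {0..R}" if "\<bar>t\<bar> < \<delta>" "x \<in> points M" for t x
  proof -
    have "\<bar>C1\<bar> * \<bar>t\<bar> \<le> \<bar>C1\<bar>" using that(1) \<delta>(2) by (simp add: mult_left_le)
    then show ?thesis using E_lip[OF that] B0[OF that(2)] E0[OF that] by (auto simp: R_def)
  qed
  have "compact (F' ` {0..R})" using F' by (intro compact_continuous_image) (auto intro: continuous_on_subset)
  then obtain C2 where C2: "\<And>r. r \<in> {0..R} \<Longrightarrow> \<bar>F' r\<bar> \<le> C2" by (metis bounded_iff compact_imp_bounded image_eqI real_norm_def)
  have f_lip: "\<bar>f t x - f 0 x\<bar> \<le> (\<bar>C2\<bar> * \<bar>C1\<bar>) * \<bar>t\<bar>" if t: "\<bar>t\<bar> < \<delta>" and x: "x \<in> points M" for t x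
  proof -
    have "norm (F (E t x / 2) - F (E 0 x / 2)) \<le> \<bar>C2\<bar> * norm (E t x / 2 - E 0 x / 2)"
    proof (rule field_differentiable_bound[of "{0..R}" F F'])
      show "(F has_real_derivative F' r) (at r within {0..R})" if "r \<in> {0..R}" for r
        using F[of r] that by (auto intro: DERIV_subset)
      show "norm (F' r) \<le> \<bar>C2\<bar>" if "r \<in> {0..R}" for r using C2[OF that] by auto
    qed (use ER[OF t x] ER[of 0 x] x \<delta>(1) in auto)
    also have "\<dots> \<le> \<bar>C2\<bar> * (\<bar>C1\<bar> * \<bar>t\<bar>)"
      using E_lip[OF t x] by (intro mult_left_mono) auto
    finally show ?thesis by (simp add: f_def mult.assoc)
  qed
  have f_int: "integrable vol (f t)" if t: "\<bar>t\<bar> < \<delta>" for t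
  proof (rule continuous_integrable_vol)
    have "continuous_map (mtop M) (top_of_set {0..}) (\<lambda>x. E t x / 2)"
      using continuous_map_real_mult_left[OF E_continuous[OF \<delta> S range t], of "1/2"] E0[OF t]
      by (auto simp: continuous_map_in_subtopology)
    from continuous_map_compose[OF this, of euclideanreal F] F_cont
    show "continuous_map (mtop M) euclideanreal (f t)" by (simp add: comp_def f_def[abs_def])
  qed
  define f' where "f' x = (if x \<in> udom d then F' (real CARD('n) * (dil x)\<^sup>2 / 2) * (E' 0 x / 2) else 0)" for x
  have f_der: "((\<lambda>t. f t x) has_real_derivative f' x) (at 0)" if x: "x \<in> points M" for x
  proof (cases "x \<in> udom d")
    case True
    let ?I = "{-\<delta><..<\<delta>}"
    have "((\<lambda>t. E t x / 2) has_real_derivative (E' 0 x / 2)) (at 0 within ?I)"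
      by (rule has_field_derivative_at_within[OF DERIV_cdivide[OF E_deriv[OF \<delta> S range _ True]]]) (use \<delta> in auto)
    \<comment> \<open>The derivative of \<open>F\<close> at 0 is one-sided, so the chain rule is
      used within the image of the energy density, a subset of \<open>{0..}\<close>.\<close>
    moreover have "(F has_real_derivative F' (E 0 x / 2)) (at (E 0 x / 2) within (\<lambda>t. E t x / 2) ` ?I)"
      by (rule DERIV_subset[OF F]) (use E0 x \<delta>(1) in auto)
    ultimately have "(F \<circ> (\<lambda>t. E t x / 2) has_real_derivative F' (E 0 x / 2) * (E' 0 x / 2)) (at 0 within ?I)"
      by (rule DERIV_image_chain[rotated])
    then show ?thesis
      using \<delta>(1) True x by (simp add: at_within_open[of 0 ?I] f_def f'_def comp_def E_0)
  next
    case False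
    then have "x \<notin> K" using K(2) by blast
    then have "f t x = f 0 x" for t using E_out[OF \<delta>(1) img, of x] x by (simp add: f_def)
    then have "(\<lambda>t. f t x) = (\<lambda>t. f 0 x)" by blast
    then show ?thesis using False by (simp add: f'_def)
  qed
  have 1: "((\<lambda>t. \<integral>x. f t x \<partial>vol) has_real_derivative (\<integral>x. f' x \<partial>vol)) (at 0)"
    by (rule has_real_derivative_integral[OF finite_measure_vol \<delta>(1) f_int f_der f_lip]) (simp_all add: space_vol)
  have "((\<lambda>t. F_energy F M gM N gN (U t)) has_real_derivative 0) (at 0)"
    using harm[unfolded F_harmonic_def, THEN conjunct2, rule_format, OF \<delta>(1), of U]
      U_smooth_map[OF \<delta>(1) img] by (simp add: U_0)
  moreover have "F_energy F M gM N gN (U t) = (\<integral>x. f t x \<partial>vol)" for t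
    by (simp add: F_energy_def f_def E_def)
  ultimately have "((\<lambda>t. \<integral>x. f t x \<partial>vol) has_real_derivative 0) (at 0)" by simp
  from DERIV_unique[OF 1 this] show ?thesis by (simp add: f'_def[abs_def])
qed

end

section \<open>Null Lagrangians\<close>

context conformal_submersion
begin

text \<open>The reciprocal of the volume density of \<open>N\<close> in the chart
  \<open>d\<close>.\<close>

definition rho :: "('b, real^'n) chart \<Rightarrow> real^'n \<Rightarrow> real" where
  "rho d y = inverse (sqrt (det (Hc d y)))"

lemma smooth_rho:
  assumes d: "d \<in> charts N" shows "smooth_on (snd d ` fst d) (rho d)"
  unfolding rho_def
  by (rule smooth_on_compose[OF N.chart_image_open[OF d] _ smooth_on_det smooth_on_inverse_sqrt])
     (use N.chart_image_open[OF d] smooth_Hc[OF d] det_Hc_pos[OF d] in auto)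

lemma rho_pos: "d \<in> charts N \<Longrightarrow> y \<in> snd d ` fst d \<Longrightarrow> rho d y > 0"
  using det_Hc_pos[of d y] by (simp add: rho_def)

lemma partial_rho:
  assumes d: "d \<in> charts N" and y: "y \<in> snd d ` fst d"
  shows "partial a (rho d) y = - (rho d y / 2) *
    (\<Sum>i\<in>UNIV. \<Sum>j\<in>UNIV. partial a (\<lambda>y. Hc d y $ i $ j) y * matrix_inv (Hc d y) $ j $ i)"
proof -
  let ?A' = "\<lambda>v. \<chi> i j. frechet_derivative (\<lambda>y. Hc d y $ i $ j) (at y) v"
  let ?S = "\<lambda>v. \<Sum>i\<in>UNIV. \<Sum>j\<in>UNIV. ?A' v $ i $ j * matrix_inv (Hc d y) $ j $ i"
  let ?t = "det (Hc d y)"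
  have t: "?t > 0" by (rule det_Hc_pos[OF d y])
  have 1: "((\<lambda>y. det (Hc d y)) has_derivative (\<lambda>v. ?t * ?S v)) (at y)"
    by (rule has_derivative_det[where A="Hc d" and A'="?A'"])
       (simp_all add: smooth_on_has_derivative[OF smooth_Hc[OF d] y] Hc_invertible[OF d y])
  have 2: "((\<lambda>r. inverse (sqrt r)) has_real_derivative - (inverse (sqrt ?t) / 2) / ?t) (at ?t)"
    using t by (auto intro!: derivative_eq_intros simp: field_simps power2_eq_square real_sqrt_mult_self)
  have "((\<lambda>y. inverse (sqrt (det (Hc d y)))) has_derivative (\<lambda>v. - (inverse (sqrt ?t) / 2) / ?t * (?t * ?S v))) (at y)"
    using has_derivative_compose[OF 1 2[unfolded has_field_derivative_def]] by simp
  then have "frechet_derivative (rho d) (at y) = (\<lambda>v. - (inverse (sqrt ?t) / 2) / ?t * (?t * ?S v))"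
    unfolding rho_def[abs_def] by (rule frechet_derivative_at[symmetric])
  then show ?thesis using t by (simp add: partial_def rho_def)
qed

text \<open>The value of the wedge product of the differentials of the \<open>f b\<close> on the
  horizontal lifts of the coordinate fields of \<open>d\<close>.\<close>

definition jac :: "('b, real^'n) chart \<Rightarrow> ('n \<Rightarrow> 'a \<Rightarrow> real) \<Rightarrow> 'a \<Rightarrow> real" where
  "jac d f x = det (\<chi> b a. D d a (f b) x)"

text \<open>The cofactors of the row \<open>k\<close> of the Jacobian matrix; they have divergence zero because horizontal
  derivatives commute.\<close>

definition cofac :: "('b, real^'n) chart \<Rightarrow> ('n \<Rightarrow> 'a \<Rightarrow> real) \<Rightarrow> 'n \<Rightarrow> 'n \<Rightarrow> 'a \<Rightarrow> real" where
  "cofac d f k a x = (\<Sum>p | p permutes UNIV \<and> p k = a. of_int (sign p) * (\<Prod>b\<in>UNIV - {k}. D d (p b) (f b) x))"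

text \<open>Laplace expansion along the row \<open>k\<close>: the permutations are grouped by their
  value at \<open>k\<close>.\<close>

lemma jac_cofac: "jac d f x = (\<Sum>a\<in>UNIV. cofac d f k a x * D d a (f k) x)"
proof -
  have "jac d f x = (\<Sum>p | p permutes UNIV. of_int (sign p) * (\<Prod>b\<in>UNIV. D d (p b) (f b) x))"
    by (simp add: jac_def det_def)
  also have "\<dots> = (\<Sum>p | p permutes UNIV. of_int (sign p) * (\<Prod>b\<in>UNIV - {k}. D d (p b) (f b) x) * D d (p k) (f k) x)"
    by (intro sum.cong refl) (simp add: prod.remove[of UNIV k] mult_ac)
  also have "\<dots> = (\<Sum>a\<in>UNIV. \<Sum>p | p \<in> {p. p permutes UNIV} \<and> p k = a.
      of_int (sign p) * (\<Prod>b\<in>UNIV - {k}. D d (p b) (f b) x) * D d (p k) (f k) x)"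
    by (rule sum.group[symmetric]) (auto simp: finite_permutations)
  also have "\<dots> = (\<Sum>a\<in>UNIV. cofac d f k a x * D d a (f k) x)"
    unfolding cofac_def sum_distrib_right by (intro sum.cong refl) auto
  finally show ?thesis .
qed

lemma smooth_cofac:
  assumes d: "d \<in> charts N" and W: "openin (mtop M) W" "W \<subseteq> udom d" and f: "\<And>b. smooth_fn M W (f b)"
  shows "smooth_fn M W (cofac d f k a)"
  unfolding cofac_def by (intro smooth_fn_sum smooth_fn_mult smooth_fn_prod smooth_fn_const smooth_D d W f)

lemma smooth_jac:
  assumes d: "d \<in> charts N" and W: "openin (mtop M) W" "W \<subseteq> udom d" and f: "\<And>b. smooth_fn M W (f b)"
  shows "smooth_fn M W (jac d f)"
  unfolding jac_cofac[of d f _ undefined, THEN eq_reflection, abs_def] by (intro smooth_fn_sum smooth_fn_mult smooth_cofac smooth_D d W f)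

text \<open>Vanishing of the brackets of the lifts, expressed by their action on functions because
  the integral formulas involve the derivations \<open>D\<close> only.\<close>

definition horizontal_commuting :: bool where
  "horizontal_commuting \<longleftrightarrow> (\<forall>d\<in>charts N. \<forall>W f a b x. openin (mtop M) W \<longrightarrow> W \<subseteq> udom d \<longrightarrow> smooth_fn M W f \<longrightarrow> x \<in> W \<longrightarrow>
     D d a (D d b f) x = D d b (D d a f) x)"

lemma cofac_divergence:
  assumes comm: horizontal_commuting
    and d: "d \<in> charts N" and W: "openin (mtop M) W" "W \<subseteq> udom d" "x \<in> W" and f: "\<And>b. smooth_fn M W (f b)"
  shows "(\<Sum>a\<in>UNIV. D d a (cofac d f k a) x) = 0"
proof -
  note sD = smooth_D[OF d W(1,2) f]
  have comm': "D d a (D d b (f c)) x = D d b (D d a (f c)) x" for a b c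
    using comm d W f unfolding horizontal_commuting_def by blast
  let ?T = "\<lambda>c p. of_int (sign p) * (D d (p k) (D d (p c) (f c)) x * (\<Prod>b\<in>UNIV - {k} - {c}. D d (p b) (f b) x)) :: real"
  have 1: "D d a (cofac d f k a) x = (\<Sum>p | p \<in> {p. p permutes UNIV} \<and> p k = a. \<Sum>c\<in>UNIV - {k}. ?T c p)" for a
  proof -
    have "D d a (cofac d f k a) x = (\<Sum>p | p permutes UNIV \<and> p k = a. D d a (\<lambda>x. of_int (sign p) * (\<Prod>b\<in>UNIV - {k}. D d (p b) (f b) x)) x)"
      unfolding cofac_def[abs_def] by (intro D_sum[OF d W] smooth_fn_mult smooth_fn_prod smooth_fn_const W sD)
    also have "\<dots> = (\<Sum>p | p permutes UNIV \<and> p k = a. \<Sum>c\<in>UNIV - {k}. ?T c p)"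
    proof (intro sum.cong refl)
      fix p assume p: "p \<in> {p. p permutes UNIV \<and> p k = a}"
      have "D d a (\<lambda>x. of_int (sign p) * (\<Prod>b\<in>UNIV - {k}. D d (p b) (f b) x)) x
        = of_int (sign p) * D d a (\<lambda>x. \<Prod>b\<in>UNIV - {k}. D d (p b) (f b) x) x"
        by (intro D_cmult[OF d W] smooth_fn_prod W sD)
      also have "D d a (\<lambda>x. \<Prod>b\<in>UNIV - {k}. D d (p b) (f b) x) x
         = (\<Sum>c\<in>UNIV - {k}. D d a (D d (p c) (f c)) x * (\<Prod>b\<in>UNIV - {k} - {c}. D d (p b) (f b) x))"
        by (rule D_prod[OF d W]) (use sD in auto)
      finally show "D d a (\<lambda>x. of_int (sign p) * (\<Prod>b\<in>UNIV - {k}. D d (p b) (f b) x)) x = (\<Sum>c\<in>UNIV - {k}. ?T c p)"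
        using p by (simp add: sum_distrib_left)
    qed
    finally show ?thesis by simp
  qed
  have "(\<Sum>a\<in>UNIV. D d a (cofac d f k a) x) = (\<Sum>p | p permutes UNIV. \<Sum>c\<in>UNIV - {k}. ?T c p)"
    unfolding 1 by (rule sum.group) (auto simp: finite_permutations)
  also have "\<dots> = (\<Sum>c\<in>UNIV - {k}. \<Sum>p | p permutes UNIV. ?T c p)" by (rule sum.swap)
  also have "\<dots> = 0"
  proof (rule sum.neutral, rule ballI)
    fix c assume c: "c \<in> UNIV - {k}"
    \<comment> \<open>Exchanging the values of \<open>p\<close> at \<open>k\<close> and
      \<open>c\<close> swaps the order of the two derivatives and reverses the sign, so the sum
      equals its own negative.\<close>
    let ?t = "Transposition.transpose k c"
    have tp: "?t permutes UNIV" by (rule permutes_swap_id) auto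
    have "(\<Sum>p | p permutes UNIV. ?T c p) = (\<Sum>p | p permutes UNIV. ?T c (p \<circ> ?t))"
      by (rule sum_permutations_compose_right[OF tp])
    also have "\<dots> = (\<Sum>p | p permutes UNIV. - ?T c p)"
    proof (intro sum.cong refl)
      fix p :: "'n \<Rightarrow> 'n" assume "p \<in> {p. p permutes UNIV}"
      then have p: "p permutes UNIV" by simp
      have "sign (p \<circ> ?t) = - sign p"
        using c p by (simp add: sign_compose sign_swap_id permutation_swap_id permutation_permutes[THEN iffD2] exI[of _ UNIV])
      moreover have "(\<Prod>b\<in>UNIV - {k} - {c}. D d ((p \<circ> ?t) b) (f b) x) = (\<Prod>b\<in>UNIV - {k} - {c}. D d (p b) (f b) x)"
        by (intro prod.cong refl) (auto simp: transpose_def)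
      ultimately show "?T c (p \<circ> ?t) = - ?T c p" by (simp add: comm'[of "p c"])
    qed
    finally show "(\<Sum>p | p permutes UNIV. ?T c p) = 0" by (simp add: sum_negf)
  qed
  finally show ?thesis .
qed

end

context chart_variation
begin

text \<open>The energy density changes by a metric term, from moving along \<open>V\<close> in
  \<open>N\<close>, and by a term with the derivatives of \<open>V\<close>. For
  \<open>V = rho Q\<close> the derivative of \<open>rho\<close> in the second term cancels the first
  by Jacobi's formula, and a pure divergence of \<open>Q\<close> remains.\<close>

lemma E'_divergence:
  assumes x: "x \<in> udom d" and Q: "\<And>a. smooth_fn M (udom d) (\<lambda>x. Q a x)"
    and VQ: "\<And>x a. x \<in> udom d \<Longrightarrow> V x $ a = rho d (Y d x) * Q a x"
  shows "E' 0 x / 2 = (dil x)\<^sup>2 * rho d (Y d x) * (\<Sum>a\<in>UNIV. D d a (Q a) x)"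
proof -
  note W = openin_udom[OF d] subset_refl x
  have xM: "x \<in> points M" using x udom_points by blast
  have dil: "(dil x)\<^sup>2 \<noteq> 0" using dil_pos[OF xM] by simp
  note y = Y_image[OF x]
  let ?A = "Hc d (Y d x)"
  define P where "P a = (\<Sum>i\<in>UNIV. \<Sum>j\<in>UNIV. partial a (\<lambda>y. Hc d y $ i $ j) (Y d x) * matrix_inv ?A $ j $ i)" for a
  have GA: "GA a b x = (dil x)\<^sup>2 * matrix_inv ?A $ a $ b" for a b
  proof -
    define G where "G = (\<chi> a b. GA a b x / (dil x)\<^sup>2)"
    have "?A ** G = mat 1"
      using horizontal_dual[OF d x] dil
      by (simp add: vec_eq_iff matrix_matrix_mult_def mat_def G_def sum_divide_distrib[symmetric])
    then have "G ** ?A = mat 1" using matrix_left_right_inverse by blast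
    then have "matrix_inv ?A = G" by (rule matrix_inv_unique)
    then show ?thesis using dil by (simp add: G_def)
  qed
  have s\<rho>: "smooth_fn M (udom d) (\<lambda>x. rho d (Y d x))"
    by (rule smooth_fn_compose[OF W(1) smooth_Y[OF d] N.chart_image_open[OF d] smooth_rho[OF d] Y_image])
  have DV: "D d a (\<lambda>x. V x $ a) x = rho d (Y d x) * D d a (Q a) x - Q a x * rho d (Y d x) / 2 * P a" for a
  proof -
    have "D d a (\<lambda>x. V x $ a) x = D d a (\<lambda>x. rho d (Y d x) * Q a x) x"
      by (rule D_cong[OF d W smooth_V_nth VQ])
    also have "\<dots> = rho d (Y d x) * D d a (Q a) x + Q a x * D d a (\<lambda>x. rho d (Y d x)) x"
      by (rule D_mult[OF d W s\<rho> Q])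
    also have "D d a (\<lambda>x. rho d (Y d x)) x = - (rho d (Y d x) / 2) * P a"
      unfolding D_compose[OF d W smooth_rho[OF d] y] partial_rho[OF d y] P_def ..
    finally show ?thesis by simp
  qed
  have 1: "(\<Sum>a\<in>UNIV. \<Sum>b\<in>UNIV. (\<Sum>k\<in>UNIV. V x $ k * partial k (\<lambda>y. Hc d y $ a $ b) (Y d x)) * GA a b x)
     = (dil x)\<^sup>2 * (\<Sum>k\<in>UNIV. V x $ k * P k)"
  proof -
    have "(\<Sum>a\<in>UNIV. \<Sum>b\<in>UNIV. (\<Sum>k\<in>UNIV. V x $ k * partial k (\<lambda>y. Hc d y $ a $ b) (Y d x)) * GA a b x)
      = (\<Sum>a\<in>UNIV. \<Sum>b\<in>UNIV. \<Sum>k\<in>UNIV. (dil x)\<^sup>2 * (V x $ k * (partial k (\<lambda>y. Hc d y $ a $ b) (Y d x) * matrix_inv ?A $ b $ a)))"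
      by (subst Gam_commute[OF xM], subst GA) (simp add: sum_distrib_right sum_distrib_left mult_ac)
    also have "\<dots> = (\<Sum>a\<in>UNIV. \<Sum>k\<in>UNIV. \<Sum>b\<in>UNIV. (dil x)\<^sup>2 * (V x $ k * (partial k (\<lambda>y. Hc d y $ a $ b) (Y d x) * matrix_inv ?A $ b $ a)))"
      by (intro sum.cong refl sum.swap)
    also have "\<dots> = (\<Sum>k\<in>UNIV. \<Sum>a\<in>UNIV. \<Sum>b\<in>UNIV. (dil x)\<^sup>2 * (V x $ k * (partial k (\<lambda>y. Hc d y $ a $ b) (Y d x) * matrix_inv ?A $ b $ a)))"
      by (rule sum.swap)
    finally show ?thesis by (simp add: P_def sum_distrib_left)
  qed
  have DG: "(\<Sum>b\<in>UNIV. ?A $ a $ b * Gam (\<lambda>y. Y d y $ b) h x) = (dil x)\<^sup>2 * D d a h x" for a h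
    using dil by (simp add: D_def)
  have 2: "(\<Sum>a\<in>UNIV. \<Sum>b\<in>UNIV. ?A $ a $ b * GB a b x) = 2 * (dil x)\<^sup>2 * (\<Sum>a\<in>UNIV. D d a (\<lambda>x. V x $ a) x)"
  proof -
    have "(\<Sum>a\<in>UNIV. \<Sum>b\<in>UNIV. ?A $ a $ b * GB a b x) =
      (\<Sum>a\<in>UNIV. \<Sum>b\<in>UNIV. ?A $ b $ a * Gam (\<lambda>y. Y d y $ a) (\<lambda>y. V y $ b) x)
      + (\<Sum>a\<in>UNIV. \<Sum>b\<in>UNIV. ?A $ a $ b * Gam (\<lambda>y. Y d y $ b) (\<lambda>y. V y $ a) x)"
      by (simp only: distrib_left sum.distrib Hc_sym[OF d y])
    also have "(\<Sum>a\<in>UNIV. \<Sum>b\<in>UNIV. ?A $ b $ a * Gam (\<lambda>y. Y d y $ a) (\<lambda>y. V y $ b) x)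
      = (\<Sum>b\<in>UNIV. \<Sum>a\<in>UNIV. ?A $ b $ a * Gam (\<lambda>y. Y d y $ a) (\<lambda>y. V y $ b) x)" by (rule sum.swap)
    finally show ?thesis by (simp only: DG) (simp add: sum_distrib_left mult.assoc)
  qed
  have "E' 0 x = (dil x)\<^sup>2 * (\<Sum>k\<in>UNIV. V x $ k * P k) + 2 * (dil x)\<^sup>2 * (\<Sum>a\<in>UNIV. D d a (\<lambda>x. V x $ a) x)"
    unfolding E'_def 1[symmetric] 2[symmetric] by (simp add: sum.distrib)
  also have "\<dots> = 2 * ((dil x)\<^sup>2 * rho d (Y d x) * (\<Sum>a\<in>UNIV. D d a (Q a) x))"
    unfolding DV VQ[OF x] by (simp add: sum_subtractf sum_distrib_left sum_divide_distrib[symmetric] algebra_simps)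
  finally show ?thesis by simp
qed

end

locale flat_harmonic = conformal_submersion M gM N gN u dil
  for M :: "('a, real^'m) mfd" and gM and N :: "('b, real^'n) mfd" and gN u dil +
  fixes F F' :: "real \<Rightarrow> real"
  assumes F: "\<And>t. t \<ge> 0 \<Longrightarrow> (F has_real_derivative F' t) (at t within {0..})" and F': "continuous_on {0..} F'"
    and F'_pos: "\<And>t. t > 0 \<Longrightarrow> F' t > 0"
    and harmonic: "F_harmonic F M gM N gN u" and comm: horizontal_commuting
begin

text \<open>The argument of \<open>F'\<close> is the energy density of \<open>u\<close> by
  \<open>energy_density_u\<close>; the last factor is the one produced by
  \<open>E'_divergence\<close>.\<close>

definition weight :: "'a \<Rightarrow> real" where
  "weight x = F' (real CARD('n) * (dil x)\<^sup>2 / 2) * (dil x)\<^sup>2"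

text \<open>The variation field has its support in \<open>K\<close> because \<open>f k\<close> does.
  By the product rule its divergence is the Jacobian, the cofactors being divergence free.\<close>

lemma integral_jac_chart:
  assumes d: "d \<in> charts N" and f: "\<And>b. smooth_fn M (udom d) (f b)"
    and K: "closedin (mtop M) K" "K \<subseteq> udom d" and fk: "\<And>x. x \<in> udom d - K \<Longrightarrow> f k x = 0"
  shows "(\<integral>x. (if x \<in> udom d then weight x * (rho d (Y d x) * jac d f x) else 0) \<partial>vol) = 0"
proof -
  define Q where "Q a x = f k x * cofac d f k a x" for a x
  define V where "V x = (\<chi> a. rho d (Y d x) * Q a x)" for x
  note W = openin_udom[OF d] subset_refl
  have sC: "smooth_fn M (udom d) (cofac d f k a)" for a by (rule smooth_cofac[OF d W f])
  have sQ: "smooth_fn M (udom d) (Q a)" for a unfolding Q_def[abs_def] by (intro smooth_fn_mult W sC f)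
  have s\<rho>: "smooth_fn M (udom d) (\<lambda>x. rho d (Y d x))"
    by (rule smooth_fn_compose[OF W(1) smooth_Y[OF d] N.chart_image_open[OF d] smooth_rho[OF d] Y_image])
  interpret chart_variation M gM N gN u dil d V K
  proof
    show "smooth_fn M (udom d) V"
      unfolding smooth_fn_vec_iff[OF W(1)] V_def by (simp add: smooth_fn_mult W s\<rho> sQ)
    show "V x = 0" if "x \<in> udom d - K" for x using fk[OF that] by (simp add: V_def Q_def vec_eq_iff)
  qed (use d K in auto)
  have "E' 0 x / 2 = (dil x)\<^sup>2 * rho d (Y d x) * jac d f x" if x: "x \<in> udom d" for x
  proof -
    have "(\<Sum>a\<in>UNIV. D d a (Q a) x) = (\<Sum>a\<in>UNIV. f k x * D d a (cofac d f k a) x + cofac d f k a x * D d a (f k) x)"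
      unfolding Q_def[abs_def] by (intro sum.cong refl D_mult[OF d W x f sC])
    also have "\<dots> = f k x * (\<Sum>a\<in>UNIV. D d a (cofac d f k a) x) + jac d f x"
      by (simp only: sum.distrib sum_distrib_left[symmetric] jac_cofac[of d f x k])
    also have "(\<Sum>a\<in>UNIV. D d a (cofac d f k a) x) = 0" by (rule cofac_divergence[OF comm d W x f])
    finally show ?thesis using E'_divergence[of x Q, OF x sQ] by (simp add: V_def)
  qed
  then have "(\<lambda>x. if x \<in> udom d then weight x * (rho d (Y d x) * jac d f x) else 0)
    = (\<lambda>x. if x \<in> udom d then F' (real CARD('n) * (dil x)\<^sup>2 / 2) * (E' 0 x / 2) else 0)"
    by (auto simp: weight_def fun_eq_iff)
  then show ?thesis using first_variation[OF F F' harmonic] by simp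
qed

end

section \<open>Orientations\<close>

definition tdet :: "('a, real^'n) chart \<Rightarrow> ('a, real^'n) chart \<Rightarrow> 'a \<Rightarrow> real" where
  "tdet c d x = det (matrix (frechet_derivative (transition c d) (at (snd c x))))"

locale cartesian_manifold = manifold M for M :: "('a, real^'n) mfd"
begin

lemma tdet_trans:
  assumes c: "c \<in> charts M" "d \<in> charts M" "e \<in> charts M" and x: "x \<in> fst c" "x \<in> fst d" "x \<in> fst e"
  shows "tdet c e x = tdet d e x * tdet c d x"
proof -
  have "chart_deriv c (snd e) x v = chart_deriv d (snd e) x (frechet_derivative (transition c d) (at (snd c x)) v)" for v
    by (rule chart_deriv_change[OF chart_openin[OF c(3)] smooth_fn_chart[OF c(3)] c(1,2) x])
  then have "frechet_derivative (transition c e) (at (snd c x)) =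
      frechet_derivative (transition d e) (at (snd d x)) \<circ> frechet_derivative (transition c d) (at (snd c x))"
    by (simp add: fun_eq_iff chart_deriv_def transition_def comp_def)
  then show ?thesis
    unfolding tdet_def
    by (simp add: matrix_compose[OF has_derivative_linear[OF transition_has_derivative] has_derivative_linear[OF transition_has_derivative]]
        c x det_mul)
qed

lemma tdet_self: "c \<in> charts M \<Longrightarrow> x \<in> fst c \<Longrightarrow> tdet c c x = 1"
proof -
  assume c: "c \<in> charts M" "x \<in> fst c"
  have 0: "((\<lambda>z. z) has_derivative (\<lambda>v. v)) (at (snd c x))" by simp
  have "(transition c c has_derivative (\<lambda>v. v)) (at (snd c x))"
    by (rule has_derivative_transform_within_open[OF 0 chart_image_open[OF c(1)]])
       (use c in \<open>auto simp: transition_def\<close>)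
  then show ?thesis
    unfolding tdet_def by (simp add: frechet_derivative_at[symmetric] matrix_id_mat_1[unfolded id_def])
qed

lemma tdet_nonzero:
  assumes "c \<in> charts M" "d \<in> charts M" "x \<in> fst c" "x \<in> fst d" shows "tdet c d x \<noteq> 0"
  using tdet_trans[of c d c x] tdet_self[of c x] assms by auto

lemma tdet_openin:
  assumes c: "c \<in> charts M" "d \<in> charts M" and T: "open T"
  shows "openin (mtop M) {x \<in> fst c \<inter> fst d. tdet c d x \<in> T}"
proof -
  let ?W = "fst c \<inter> fst d"
  have W: "openin (mtop M) ?W" using chart_openin c by blast
  have s: "smooth_fn M ?W (\<lambda>x. chart_deriv c (snd d) x v)" for v
    by (rule smooth_fn_chart_deriv[OF chart_openin[OF c(2)] smooth_fn_chart[OF c(2)] c(1)])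
  have "tdet c d x = det (\<chi> i j. chart_deriv c (snd d) x (axis j 1) $ i)" for x
    by (simp add: tdet_def matrix_def chart_deriv_def transition_def comp_def)
  moreover have "smooth_fn M ?W (\<lambda>x. det (\<chi> i j. chart_deriv c (snd d) x (axis j 1) $ i))"
    unfolding det_def using s[unfolded smooth_fn_vec_iff[OF W]]
    by (simp only: vec_lambda_beta) (intro smooth_fn_sum smooth_fn_mult smooth_fn_prod smooth_fn_const W; blast)
  ultimately have "smooth_fn M ?W (tdet c d)" by presburger
  from openin_continuous_map_preimage[OF smooth_fn_continuous[OF W this], of T] T
  have "openin (subtopology (mtop M) ?W) {x \<in> topspace (subtopology (mtop M) ?W). tdet c d x \<in> T}" by simp
  moreover have "topspace (subtopology (mtop M) ?W) = ?W" using chart_subset[OF c(1)] by auto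
  ultimately show ?thesis using W openin_trans_full by metis
qed

text \<open>The oriented atlas need not consist of charts of \<open>M\<close>, and changing the
  atlas would change \<open>chart_at\<close> and with it the representation of tangent vectors. So
  the given charts are kept, and \<open>P d\<close> records where \<open>d\<close> agrees with the
  orientation. Both parts are open because the transition determinants are continuous and
  nonzero.\<close>

lemma orientation_sets:
  assumes "orientable M"
  obtains P where "\<And>d. d \<in> charts M \<Longrightarrow> openin (mtop M) (P d)" "\<And>d. d \<in> charts M \<Longrightarrow> P d \<subseteq> fst d"
    "\<And>d. d \<in> charts M \<Longrightarrow> openin (mtop M) (fst d - P d)"
    "\<And>d d' x. d \<in> charts M \<Longrightarrow> d' \<in> charts M \<Longrightarrow> x \<in> fst d \<Longrightarrow> x \<in> fst d' \<Longrightarrow> (x \<in> P d \<longleftrightarrow> x \<in> P d') \<longleftrightarrow> tdet d d' x > 0"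
proof -
  obtain A where A: "smooth_manifold (M\<lparr>charts := A\<rparr>)" "\<And>c d. c \<in> A \<Longrightarrow> d \<in> charts M \<Longrightarrow> compatible c d"
    "\<And>c d x. c \<in> A \<Longrightarrow> d \<in> A \<Longrightarrow> x \<in> fst c \<inter> fst d \<Longrightarrow> tdet c d x > 0"
    using assms unfolding orientable_def tdet_def by blast
  \<comment> \<open>The union of the two atlases, in which transition determinants between charts of
    either kind can be composed.\<close>
  let ?B = "M\<lparr>charts := A \<union> charts M\<rparr>"
  have A2: "compatible d c" if "c \<in> A" "d \<in> charts M" for c d
    using A(2)[OF that] by (simp add: compatible_def Int_commute)
  interpret B: cartesian_manifold ?B
    by unfold_locales (use M A(1,2) A2 in \<open>auto simp: smooth_manifold_def\<close>)
  have cov: "\<exists>a\<in>A. x \<in> fst a" if "x \<in> fst d" "d \<in> charts M" for x d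
    using A(1) chart_subset[OF that(2)] that(1) by (auto simp: smooth_manifold_def)
  define P where "P d = (\<Union>a\<in>A. {x \<in> fst a \<inter> fst d. tdet a d x \<in> {0<..}})" for d
  have P: "x \<in> P d \<longleftrightarrow> tdet a d x > 0" if "a \<in> A" "d \<in> charts M" "x \<in> fst a" "x \<in> fst d" for a d x
  proof
    assume "x \<in> P d"
    then obtain b where b: "b \<in> A" "x \<in> fst b" "tdet b d x > 0" by (auto simp: P_def)
    have "tdet a d x = tdet b d x * tdet a b x" by (rule B.tdet_trans) (use that b in auto)
    then show "tdet a d x > 0" using b A(3)[of a b x] that by simp
  qed (use that in \<open>auto simp: P_def\<close>)
  show ?thesis
  proof (rule that[of P])
    fix d assume d: "d \<in> charts M"
    show "openin (mtop M) (P d)"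
      unfolding P_def using B.tdet_openin[of _ d "{0<..}"] d by (intro openin_Union) auto
    show "P d \<subseteq> fst d" by (auto simp: P_def)
    have "fst d - P d = (\<Union>a\<in>A. {x \<in> fst a \<inter> fst d. tdet a d x \<in> {..<0}})"
    proof (rule Set.set_eqI, rule iffI)
      fix x assume x: "x \<in> fst d - P d"
      then obtain a where a: "a \<in> A" "x \<in> fst a" using cov d by blast
      have "tdet a d x \<noteq> 0" by (rule B.tdet_nonzero) (use a x d in auto)
      then have "tdet a d x < 0" using P[OF a(1) d a(2)] x by auto
      then show "x \<in> (\<Union>a\<in>A. {x \<in> fst a \<inter> fst d. tdet a d x \<in> {..<0}})" using a x by auto
    next
      fix x assume "x \<in> (\<Union>a\<in>A. {x \<in> fst a \<inter> fst d. tdet a d x \<in> {..<0}})"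
      then show "x \<in> fst d - P d" using P[OF _ d] by fastforce
    qed
    then show "openin (mtop M) (fst d - P d)"
      using B.tdet_openin[of _ d "{..<0}"] d by (auto intro!: openin_Union)
    fix d' x assume d': "d' \<in> charts M" and x: "x \<in> fst d" "x \<in> fst d'"
    obtain a where a: "a \<in> A" "x \<in> fst a" using cov d x by blast
    have "tdet a d' x = tdet d d' x * tdet a d x" by (rule B.tdet_trans) (use a d d' x in auto)
    moreover have "tdet a d x \<noteq> 0" "tdet d d' x \<noteq> 0" by (rule B.tdet_nonzero; use a d d' x in auto)+
    ultimately show "(x \<in> P d \<longleftrightarrow> x \<in> P d') \<longleftrightarrow> tdet d d' x > 0"
      unfolding P[OF a(1) d a(2) x(1)] P[OF a(1) d' a(2) x(2)] by (auto simp: zero_less_mult_iff)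
  qed
qed

end

context conformal_submersion
begin

sublocale N: cartesian_manifold N ..

context
  fixes d d' x
  assumes d: "d \<in> charts N" and d': "d' \<in> charts N" and x: "x \<in> udom d" "x \<in> udom d'"
begin

private definition "T = matrix (frechet_derivative (transition d d') (at (Y d x)))"

private lemma ux: "u x \<in> fst d" "u x \<in> fst d'" and x_point: "x \<in> points M"
  using x by (auto simp: udom_def)

private lemma gram_T: "Hc d (Y d x) = transpose T ** Hc d' (Y d' x) ** T"
  unfolding Hc_Y[OF d x(1)] Hc_Y[OF d' x(2)] T_def using N.gram_transition[OF d d' ux] by (simp add: Y_def)

private lemma Gam_T:
  assumes f: "openin (mtop M) W" "x \<in> W" "smooth_fn M W f"
  shows "Gam (\<lambda>x. Y d' x $ l) f x = (\<Sum>b\<in>UNIV. T $ l $ b * Gam (\<lambda>x. Y d x $ b) f x)"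
proof -
  let ?W = "udom d \<inter> udom d'"
  let ?S = "snd d ` (fst d \<inter> fst d')"
  let ?\<tau> = "transition d d'"
  have W: "openin (mtop M) ?W" "x \<in> ?W" using openin_udom d d' x by blast+
  have y: "Y d x \<in> ?S" using ux by (simp add: Y_def)
  have s: "smooth_on ?S (\<lambda>y. ?\<tau> y $ l)"
    using N.transition_smooth[OF d d'] unfolding smooth_on_vec_iff[OF N.transition_open[OF d d']] by blast
  have sY: "smooth_fn M ?W (Y d)" by (rule smooth_fn_subset[OF smooth_Y[OF d]]) blast
  have "Gam (\<lambda>x. Y d' x $ l) f x = Gam f (\<lambda>x. Y d' x $ l) x" by (rule Gam_commute[OF x_point])
  also have "\<dots> = Gam f (\<lambda>x. ?\<tau> (Y d x) $ l) x"
    by (rule Gam_cong[OF W smooth_fn_subset[OF smooth_Y_nth[OF d']]])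
       (use N.transition_apply[OF d] in \<open>auto simp: Y_def udom_def\<close>)
  also have "\<dots> = (\<Sum>b\<in>UNIV. partial b (\<lambda>y. ?\<tau> y $ l) (Y d x) * Gam f (\<lambda>x. Y d x $ b) x)"
    by (rule Gam_compose[OF W sY s y])
  also have "\<dots> = (\<Sum>b\<in>UNIV. T $ l $ b * Gam (\<lambda>x. Y d x $ b) f x)"
  proof (intro sum.cong refl)
    fix b
    have "((\<lambda>y. ?\<tau> y $ l) has_derivative (\<lambda>v. frechet_derivative ?\<tau> (at (Y d x)) v $ l)) (at (Y d x))"
      by (rule bounded_linear.has_derivative[OF bounded_linear_vec_nth])
         (use N.transition_has_derivative[OF d d' ux] in \<open>simp add: Y_def\<close>)
    then have "partial b (\<lambda>y. ?\<tau> y $ l) (Y d x) = T $ l $ b"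
      by (simp add: partial_def frechet_derivative_at[symmetric] T_def matrix_def)
    then show "partial b (\<lambda>y. ?\<tau> y $ l) (Y d x) * Gam f (\<lambda>x. Y d x $ b) x = T $ l $ b * Gam (\<lambda>x. Y d x $ b) f x"
      by (simp add: Gam_commute[OF x_point])
  qed
  finally show ?thesis .
qed

private lemma D_T:
  assumes f: "openin (mtop M) W" "x \<in> W" "smooth_fn M W f"
  shows "D d a f x = (\<Sum>k\<in>UNIV. D d' k f x * T $ k $ a)"
proof -
  let ?H = "Hc d' (Y d' x)" and ?G = "\<lambda>b. Gam (\<lambda>x. Y d x $ b) f x"
  have "(\<Sum>k\<in>UNIV. (\<Sum>l\<in>UNIV. ?H $ k $ l * (\<Sum>b\<in>UNIV. T $ l $ b * ?G b)) * T $ k $ a)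
     = (\<Sum>b\<in>UNIV. (\<Sum>l\<in>UNIV. (\<Sum>k\<in>UNIV. T $ k $ a * ?H $ k $ l) * T $ l $ b) * ?G b)" (is "?L = ?R")
  proof -
    have "?L = (\<Sum>k\<in>UNIV. \<Sum>l\<in>UNIV. \<Sum>b\<in>UNIV. T $ k $ a * ?H $ k $ l * T $ l $ b * ?G b)"
      by (simp add: sum_distrib_left sum_distrib_right mult_ac)
    also have "\<dots> = (\<Sum>k\<in>UNIV. \<Sum>b\<in>UNIV. \<Sum>l\<in>UNIV. T $ k $ a * ?H $ k $ l * T $ l $ b * ?G b)"
      by (intro sum.cong refl sum.swap)
    also have "\<dots> = (\<Sum>b\<in>UNIV. \<Sum>k\<in>UNIV. \<Sum>l\<in>UNIV. T $ k $ a * ?H $ k $ l * T $ l $ b * ?G b)"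
      by (rule sum.swap)
    also have "\<dots> = (\<Sum>b\<in>UNIV. \<Sum>l\<in>UNIV. \<Sum>k\<in>UNIV. T $ k $ a * ?H $ k $ l * T $ l $ b * ?G b)"
      by (intro sum.cong refl sum.swap)
    finally show ?thesis by (simp add: sum_distrib_left sum_distrib_right mult_ac)
  qed
  moreover have "Hc d (Y d x) $ a $ b = (\<Sum>l\<in>UNIV. (\<Sum>k\<in>UNIV. T $ k $ a * ?H $ k $ l) * T $ l $ b)" for b
    unfolding gram_T by (simp add: matrix_matrix_mult_def transpose_def)
  ultimately show ?thesis
    by (simp add: D_def Gam_T[OF f] sum_divide_distrib[symmetric])
qed

text \<open>With the transition matrix \<open>T\<close> the Gram matrix transforms by
  \<open>T\<close> on both sides, so \<open>rho\<close> gains the factor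
  \<open>1 / \<bar>det T\<bar>\<close> while \<open>jac\<close> gains \<open>det T\<close>.\<close>

lemma rho_jac_change:
  assumes W: "openin (mtop M) W" "x \<in> W" and f: "\<And>b. smooth_fn M W (f b)"
  shows "rho d (Y d x) * jac d f x = sgn (tdet d d' (u x)) * (rho d' (Y d' x) * jac d' f x)"
proof -
  have T: "det T = tdet d d' (u x)" by (simp add: T_def tdet_def Y_def)
  have "(\<chi> b a. D d a (f b) x) = (\<chi> b a. D d' a (f b) x) ** T"
    by (simp add: vec_eq_iff matrix_matrix_mult_def D_T[OF W f])
  then have 1: "jac d f x = jac d' f x * det T" by (simp add: jac_def det_mul)
  have "det (Hc d (Y d x)) = (det T)\<^sup>2 * det (Hc d' (Y d' x))"
    unfolding gram_T by (simp add: det_mul power2_eq_square)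
  then have "rho d (Y d x) = inverse \<bar>det T\<bar> * rho d' (Y d' x)" by (simp add: rho_def real_sqrt_mult)
  then show ?thesis unfolding 1 by (simp add: T[symmetric] sgn_real_def)
qed

end

lemma jac_const_row:
  assumes d: "d \<in> charts N" and W: "openin (mtop M) W" "x \<in> W" "x \<in> udom d" and c: "\<And>y. y \<in> W \<Longrightarrow> f k y = c"
  shows "jac d f x = 0"
proof -
  let ?W = "W \<inter> udom d"
  have W': "openin (mtop M) ?W" "?W \<subseteq> udom d" "x \<in> ?W" using W openin_udom[OF d] by auto
  have "D d a (f k) x = 0" for a
  proof -
    have "D d a (f k) x = D d a (\<lambda>x. c) x" by (rule D_cong[OF d W', symmetric]) (use W' c in auto)
    then show ?thesis using D_const[OF d W'] by simp
  qed
  then show ?thesis unfolding jac_cofac[of d f x k] by simp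
qed

text \<open>The cofactors of the row \<open>k\<close> do not involve \<open>f k\<close>.\<close>

lemma jac_add_row:
  assumes d: "d \<in> charts N" and W: "openin (mtop M) W" "x \<in> W" "W \<subseteq> udom d" and g: "smooth_fn M W g" and h: "smooth_fn M W h"
  shows "jac d (f(k := \<lambda>x. r * g x + h x)) x = r * jac d (f(k := g)) x + jac d (f(k := h)) x"
proof -
  note W' = W(1,3,2)
  have "cofac d (f(k := g')) k a x = cofac d f k a x" for g' a
    unfolding cofac_def by (intro sum.cong refl arg_cong2[of _ _ _ _ "(*)"] prod.cong) auto
  then have c: "jac d (f(k := g')) x = (\<Sum>a\<in>UNIV. cofac d f k a x * D d a g' x)" for g'
    unfolding jac_cofac[of d _ x k] by simp
  have "D d a (\<lambda>x. r * g x + h x) x = r * D d a g x + D d a h x" for a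
    using D_add[OF d W' _ h, of "\<lambda>x. r * g x"] D_cmult[OF d W' g] smooth_fn_mult[OF W(1) smooth_fn_const[OF W(1)] g] by simp
  then show ?thesis unfolding c by (simp add: sum.distrib sum_distrib_left algebra_simps)
qed

end

context flat_harmonic
begin

lemma weight_pos: "x \<in> points M \<Longrightarrow> weight x > 0"
  using F'_pos[of "real CARD('n) * (dil x)\<^sup>2 / 2"] dil_pos[of x] by (simp add: weight_def)

lemma weight_continuous: "continuous_map (mtop M) euclideanreal weight"
proof -
  have c: "continuous_map (mtop M) euclideanreal (\<lambda>x. (dil x)\<^sup>2)"
    by (rule smooth_continuous[OF smooth_dil_sq[OF openin_topspace]])
  have "continuous_map (mtop M) (top_of_set {0..}) (\<lambda>x. real CARD('n) / 2 * (dil x)\<^sup>2)"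
    using continuous_map_real_mult_left[OF c, of "real CARD('n) / 2"] by (auto simp: continuous_map_in_subtopology)
  from continuous_map_compose[OF this, of euclideanreal F'] F'
  have "continuous_map (mtop M) euclideanreal (\<lambda>x. F' (real CARD('n) / 2 * (dil x)\<^sup>2))" by (simp add: comp_def)
  from continuous_map_real_mult[OF this c] show ?thesis by (simp add: weight_def[abs_def])
qed

end

text \<open>\<open>P d\<close> is the part of the domain of the chart \<open>d\<close> on which \<open>d\<close> is positively oriented, and \<open>J f\<close> is
  the coefficient of \<open>df\<^sub>1 \<and> \<dots> \<and> df\<^sub>n\<close>, restricted to the horizontal distribution, with respect to the pullback of
  the volume form of \<open>N\<close>.\<close>

locale oriented_harmonic = flat_harmonic M gM N gN u dil F F'
  for M :: "('a, real^'m) mfd" and gM and N :: "('b, real^'n) mfd" and gN u dil F F' +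
  fixes P :: "('b, real^'n) chart \<Rightarrow> 'b set"
  assumes P_openin: "\<And>d. d \<in> charts N \<Longrightarrow> openin (mtop N) (P d)" "\<And>d. d \<in> charts N \<Longrightarrow> openin (mtop N) (fst d - P d)"
    and P_subset: "\<And>d. d \<in> charts N \<Longrightarrow> P d \<subseteq> fst d"
    and P_iff: "\<And>d d' y. d \<in> charts N \<Longrightarrow> d' \<in> charts N \<Longrightarrow> y \<in> fst d \<Longrightarrow> y \<in> fst d' \<Longrightarrow> (y \<in> P d \<longleftrightarrow> y \<in> P d') \<longleftrightarrow> tdet d d' y > 0"
begin

definition eps :: "('b, real^'n) chart \<Rightarrow> 'a \<Rightarrow> real" where
  "eps d x = (if u x \<in> P d then 1 else -1)"

definition J :: "('n \<Rightarrow> 'a \<Rightarrow> real) \<Rightarrow> 'a \<Rightarrow> real" where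
  "J f x = (let d = chart_at N (u x) in eps d x * (rho d (Y d x) * jac d f x))"

lemma eps_change:
  assumes "d \<in> charts N" "d' \<in> charts N" "x \<in> udom d" "x \<in> udom d'"
  shows "eps d x * sgn (tdet d d' (u x)) = eps d' x"
  using P_iff[of d d' "u x"] N.tdet_nonzero[of d d' "u x"] assms
  by (auto simp: eps_def udom_def sgn_real_def)

text \<open>The signs \<open>eps\<close> cancel the sign in \<open>rho_jac_change\<close>, so
  \<open>J\<close> is independent of the chart chosen in its definition.\<close>

lemma J_chart:
  assumes d: "d \<in> charts N" "x \<in> udom d" and W: "openin (mtop M) W" "x \<in> W" and f: "\<And>b. smooth_fn M W (f b)"
  shows "J f x = eps d x * (rho d (Y d x) * jac d f x)"
proof -
  let ?d = "chart_at N (u x)"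
  have ux: "u x \<in> points N" using d N.chart_subset[OF d(1)] by (auto simp: udom_def)
  note c = N.chart_at[OF ux]
  have x: "x \<in> udom ?d" using c d by (auto simp: udom_def)
  show ?thesis
    using eps_change[OF c(1) d(1) x d(2), symmetric] rho_jac_change[where f=f, OF c(1) d(1) x d(2) W f]
    by (simp add: J_def Let_def mult.assoc[symmetric])
qed

lemma eps_openin:
  assumes d: "d \<in> charts N" shows "openin (mtop M) {x \<in> udom d. eps d x = s}"
proof -
  have 1: "openin (mtop M) {x \<in> points M. u x \<in> P d}" "openin (mtop M) {x \<in> points M. u x \<in> fst d - P d}"
    by (rule smooth_map_preimage_openin[OF smooth_u P_openin(1)[OF d]] smooth_map_preimage_openin[OF smooth_u P_openin(2)[OF d]])+
  have 2: "{x \<in> udom d. eps d x = 1} = {x \<in> points M. u x \<in> P d}" "{x \<in> udom d. eps d x = - 1} = {x \<in> points M. u x \<in> fst d - P d}"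
    using P_subset[OF d] by (auto simp: udom_def eps_def)
  have 3: "{x \<in> udom d. eps d x = s} = {}" if "s \<noteq> 1" "s \<noteq> - 1" using that by (auto simp: eps_def)
  show ?thesis
  proof (cases "s = 1 \<or> s = -1")
    case True
    then show ?thesis using 1 2 by metis
  qed (simp add: 3)
qed

lemma smooth_J:
  assumes f: "\<And>b. smooth_fn M (points M) (f b)" shows "smooth_fn M (points M) (J f)"
proof (rule smooth_fn_local)
  fix x assume x: "x \<in> points M"
  let ?d = "chart_at N (u x)"
  have c: "?d \<in> charts N" "u x \<in> fst ?d" using N.chart_at smooth_map_points[OF smooth_u x] by auto
  let ?W = "{y \<in> udom ?d. eps ?d y = eps ?d x}"
  have W: "openin (mtop M) ?W" "x \<in> ?W" "?W \<subseteq> udom ?d" using eps_openin[OF c(1)] x c by (auto simp: udom_def)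
  have "smooth_fn M ?W (\<lambda>y. eps ?d x * (rho ?d (Y ?d y) * jac ?d f y))"
  proof (intro smooth_fn_mult smooth_fn_const W)
    show "smooth_fn M ?W (\<lambda>y. rho ?d (Y ?d y))"
      by (rule smooth_fn_compose[OF W(1) smooth_fn_subset[OF smooth_Y[OF c(1)] W(3)] N.chart_image_open[OF c(1)] smooth_rho[OF c(1)]])
         (use Y_image in auto)
    show "smooth_fn M ?W (jac ?d f)"
      by (rule smooth_jac[OF c(1) W(1,3)]) (rule smooth_fn_subset[OF f], use W(3) udom_points in blast)
  qed
  then have "smooth_fn M ?W (J f)"
  proof (rule smooth_fn_cong[OF W(1), rotated])
    fix y assume y: "y \<in> ?W"
    then have "y \<in> udom ?d" "y \<in> points M" using W(3) udom_points by blast+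
    then show "eps ?d x * (rho ?d (Y ?d y) * jac ?d f y) = J f y"
      using J_chart[where f=f, OF c(1) _ openin_topspace _ f, of y] y by simp
  qed
  then show "\<exists>W'. openin (mtop M) W' \<and> x \<in> W' \<and> smooth_fn M W' (J f)" using W by blast
qed

lemma integrable_J: "(\<And>b. smooth_fn M (points M) (f b)) \<Longrightarrow> integrable vol (\<lambda>x. weight x * J f x)"
  by (rule continuous_integrable_vol[OF continuous_map_real_mult[OF weight_continuous smooth_continuous[OF smooth_J]]])

lemma J_const_row:
  assumes W: "openin (mtop M) W" "x \<in> W" and c: "\<And>y. y \<in> W \<Longrightarrow> f k y = c"
  shows "J f x = 0"
proof -
  have x: "x \<in> points M" using W openin_subset by blast
  have "chart_at N (u x) \<in> charts N" "x \<in> udom (chart_at N (u x))"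
    using N.chart_at smooth_map_points[OF smooth_u x] x by (auto simp: udom_def)
  then show ?thesis using jac_const_row[where f=f and k=k, OF _ W _ c] by (simp add: J_def)
qed

lemma J_sum_row:
  assumes I: "finite I" and g: "\<And>i. i \<in> I \<Longrightarrow> smooth_fn M (points M) (g i)" and x: "x \<in> points M"
  shows "J (f(k := \<lambda>x. \<Sum>i\<in>I. r i * g i x)) x = (\<Sum>i\<in>I. r i * J (f(k := g i)) x)"
  using I g
proof (induction I rule: finite_induct)
  case empty
  have "J (f(k := \<lambda>x. 0)) x = 0" by (rule J_const_row[OF openin_topspace x, of _ k 0]) simp
  then show ?case by (simp only: sum.empty)
next
  case (insert i I)
  let ?d = "chart_at N (u x)" and ?h = "\<lambda>x. \<Sum>i\<in>I. r i * g i x"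
  have d: "?d \<in> charts N" "x \<in> udom ?d"
    using N.chart_at smooth_map_points[OF smooth_u x] x by (auto simp: udom_def)
  have g': "smooth_fn M (points M) (g i)" and h: "smooth_fn M (points M) ?h"
    using insert.prems by (auto intro!: smooth_fn_sum smooth_fn_mult smooth_fn_const)
  have "jac ?d (f(k := \<lambda>x. r i * g i x + ?h x)) x = r i * jac ?d (f(k := g i)) x + jac ?d (f(k := ?h)) x"
    by (rule jac_add_row[OF d(1) openin_udom[OF d(1)] d(2) subset_refl]) (rule smooth_fn_subset[OF g' udom_points] smooth_fn_subset[OF h udom_points])+
  then have "J (f(k := \<lambda>x. r i * g i x + ?h x)) x = r i * J (f(k := g i)) x + J (f(k := ?h)) x"
    by (simp add: J_def Let_def algebra_simps)
  then show ?case using insert by (simp del: fun_upd_apply)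
qed

lemma integral_J:
  assumes f: "\<And>b. smooth_fn M (points M) (f b)"
  shows "(\<integral>x. weight x * J f x \<partial>vol) = 0"
proof -
  \<comment> \<open>Any row serves for the decomposition by the partition of unity.\<close>
  define k :: 'n where "k = undefined"
  \<comment> \<open>Neighbourhoods over one chart on which the orientation sign is constant, so that
    it can be taken out of the integral.\<close>
  define Q where "Q x = {y \<in> udom (chart_at N (u x)). eps (chart_at N (u x)) y = eps (chart_at N (u x)) x}" for x
  have d: "chart_at N (u x) \<in> charts N" "x \<in> udom (chart_at N (u x))" if "x \<in> points M" for x
    using N.chart_at smooth_map_points[OF smooth_u that] that by (auto simp: udom_def)
  have Q: "openin (mtop M) (Q x) \<and> x \<in> Q x" if "x \<in> points M" for x
    using eps_openin[OF d(1)[OF that]] d(2)[OF that] by (auto simp: Q_def)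
  obtain I and \<phi> :: "'a \<Rightarrow> 'a \<Rightarrow> real" and K where I: "finite I" "I \<subseteq> points M"
    "\<And>i. i \<in> I \<Longrightarrow> smooth_fn M (points M) (\<phi> i)" "\<And>i. i \<in> I \<Longrightarrow> closedin (mtop M) (K i)"
    "\<And>i y. i \<in> I \<Longrightarrow> y \<in> points M - K i \<Longrightarrow> \<phi> i y = 0"
    "\<And>y. y \<in> points M \<Longrightarrow> (\<Sum>i\<in>I. \<phi> i y) = 1"
    "\<And>y. y \<in> points M \<Longrightarrow> \<exists>x\<in>points M. insert y {i \<in> I. y \<in> K i} \<subseteq> Q x"
    "\<And>i. i \<in> I \<Longrightarrow> K i \<subseteq> Q i"
  proof (rule star_partition_of_unity[OF compact])
    show "openin (mtop M) (Q x) \<and> x \<in> Q x" if "x \<in> points M" for x using Q[OF that] by simp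
  qed (rule that)
  define h where "h i x = \<phi> i x * f k x" for i x
  have sh: "smooth_fn M (points M) (h i)" if "i \<in> I" for i
    unfolding h_def[abs_def] by (intro smooth_fn_mult openin_topspace I(3) that f)
  have sf: "smooth_fn M (points M) ((f(k := h i)) b)" if "i \<in> I" for i b
    using sh[OF that] f by simp
  have zero: "(\<integral>x. weight x * J (f(k := h i)) x \<partial>vol) = 0" if i: "i \<in> I" for i
  proof -
    have iM: "i \<in> points M" using i I(2) by blast
    let ?d = "chart_at N (u i)" and ?f = "f(k := h i)"
    note d = d[OF iM]
    have K: "K i \<subseteq> udom ?d" using I(8)[OF i] by (auto simp: Q_def)
    have 1: "(\<integral>x. (if x \<in> udom ?d then weight x * (rho ?d (Y ?d x) * jac ?d ?f x) else 0) \<partial>vol) = 0"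
    proof (rule integral_jac_chart[OF d(1) _ I(4)[OF i] K])
      show "smooth_fn M (udom ?d) (?f b)" for b by (rule smooth_fn_subset[OF sf[OF i] udom_points])
      show "?f k x = 0" if "x \<in> udom ?d - K i" for x
      proof -
        have "x \<in> points M - K i" using that udom_points by blast
        then show ?thesis using I(5)[OF i] by (simp add: h_def)
      qed
    qed
    have "weight x * J ?f x = eps ?d i * (if x \<in> udom ?d then weight x * (rho ?d (Y ?d x) * jac ?d ?f x) else 0)"
      if x: "x \<in> points M" for x
    proof (cases "x \<in> K i")
      case True
      then have "x \<in> Q i" using I(8)[OF i] by blast
      then show ?thesis using J_chart[where f="?f", OF d(1) _ openin_topspace x sf[OF i]] by (simp add: Q_def del: fun_upd_apply)
    next
      case False
      have W: "openin (mtop M) (points M - K i)" "x \<in> points M - K i" using I(4)[OF i] x False by auto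
      have c: "?f k y = 0" if "y \<in> points M - K i" for y using I(5)[OF i that] by (simp add: h_def)
      show ?thesis using J_const_row[where f="?f" and k=k, OF W c] jac_const_row[where f="?f" and k=k, OF d(1) W _ c] by simp
    qed
    then have "(\<integral>x. weight x * J ?f x \<partial>vol) = (\<integral>x. eps ?d i * (if x \<in> udom ?d then weight x * (rho ?d (Y ?d x) * jac ?d ?f x) else 0) \<partial>vol)"
      by (intro Bochner_Integration.integral_cong) auto
    then show ?thesis using 1 by simp
  qed
  have J: "J f x = (\<Sum>i\<in>I. J (f(k := h i)) x)" if x: "x \<in> points M" for x
  proof -
    have "J f x = J (f(k := \<lambda>x. \<Sum>i\<in>I. 1 * h i x)) x"
    proof -
      let ?d = "chart_at N (u x)" and ?g = "f(k := \<lambda>x. \<Sum>i\<in>I. 1 * h i x)"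
      have "D ?d a (f b) x = D ?d a (?g b) x" for a b
      proof (cases "b = k")
        case True
        have eq: "f k y = (\<Sum>i\<in>I. 1 * h i y)" if "y \<in> udom ?d" for y
          using I(6)[of y] that udom_points[of ?d] by (auto simp: h_def sum_distrib_right[symmetric])
        show ?thesis
          using D_cong[OF d(1)[OF x] openin_udom[OF d(1)[OF x]] subset_refl d(2)[OF x] smooth_fn_subset[OF f udom_points] eq] True by simp
      qed simp
      then show ?thesis by (simp add: J_def jac_def)
    qed
    also have "\<dots> = (\<Sum>i\<in>I. 1 * J (f(k := h i)) x)" by (rule J_sum_row[OF I(1) sh x])
    finally show ?thesis by simp
  qed
  have "(\<integral>x. weight x * J f x \<partial>vol) = (\<integral>x. (\<Sum>i\<in>I. weight x * J (f(k := h i)) x) \<partial>vol)"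
    by (rule Bochner_Integration.integral_cong) (auto simp: J sum_distrib_left)
  also have "\<dots> = (\<Sum>i\<in>I. \<integral>x. weight x * J (f(k := h i)) x \<partial>vol)"
    by (rule Bochner_Integration.integral_sum) (rule integrable_J[OF sf])
  also have "\<dots> = 0" using zero by simp
  finally show ?thesis .
qed

end

section \<open>Commuting horizontal derivatives\<close>

lemma frechet_derivative_cong_open:
  assumes "open S" "x \<in> S" "\<And>y. y \<in> S \<Longrightarrow> f y = g y" "f differentiable at x"
  shows "frechet_derivative g (at x) = frechet_derivative f (at x)"
proof -
  have "(f has_derivative frechet_derivative f (at x)) (at x)" using assms(4) frechet_derivative_works by blast
  then have "(g has_derivative frechet_derivative f (at x)) (at x)"
    by (rule has_derivative_transform_within_open[OF _ assms(1,2)]) (rule assms(3))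
  then show ?thesis by (rule frechet_derivative_at[symmetric])
qed

context manifold
begin

context
  fixes s :: "'k::euclidean_space \<Rightarrow> 'a" and S
  assumes S: "open S" and s: "smooth_map (open_mfd S) M s"
begin

private lemma chart_inv_id: "y \<in> S \<Longrightarrow> chart_inv (S, id) y = y"
  using inv_into_f_f[of id S y] by (simp add: chart_inv_def)

lemma leaf_point: "y \<in> S \<Longrightarrow> s y \<in> points M"
  using s by (auto simp: smooth_map_def continuous_map_def open_mfd_def)

lemma leaf_open:
  assumes "openin (mtop M) W" shows "open (S \<inter> s -` W)"
proof -
  have "openin (top_of_set S) {y \<in> topspace (top_of_set S). s y \<in> W}"
    using s assms by (intro openin_continuous_map_preimage) (auto simp: smooth_map_def open_mfd_def)
  moreover have "{y \<in> topspace (top_of_set S). s y \<in> W} = S \<inter> s -` W" by auto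
  ultimately show ?thesis using S openin_open_trans by auto
qed

private lemma leaf_chart:
  assumes c: "c \<in> charts M" shows "smooth_on (S \<inter> s -` fst c) (\<lambda>y. snd c (s y))"
proof (rule smooth_on_cong[OF leaf_open[OF chart_openin[OF c]]])
  show "smooth_on (S \<inter> s -` fst c) (snd c \<circ> s \<circ> chart_inv (S, id))"
    using s c by (simp add: smooth_map_def open_mfd_def)
qed (simp add: chart_inv_id)

lemma leaf_smooth:
  fixes f :: "'a \<Rightarrow> 'f::euclidean_space"
  assumes W: "openin (mtop M) W" and f: "smooth_fn M W f"
  shows "smooth_on (S \<inter> s -` W) (\<lambda>y. f (s y))"
proof (rule smooth_on_local)
  fix y assume y: "y \<in> S \<inter> s -` W"
  then obtain c where c: "c \<in> charts M" "s y \<in> fst c" using chart_cover leaf_point by blast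
  let ?T = "S \<inter> s -` (fst c \<inter> W)"
  have T: "open ?T" using leaf_open chart_openin c W by blast
  have "smooth_on ?T (\<lambda>y. f (chart_inv c (snd c (s y))))"
  proof (rule smooth_on_compose[OF T chart_image_openin[OF c(1) W]])
    show "smooth_on ?T (\<lambda>y. snd c (s y))" by (rule smooth_on_subset[OF leaf_chart[OF c(1)]]) auto
    show "smooth_on (snd c ` (fst c \<inter> W)) (\<lambda>z. f (chart_inv c z))" using f c by (auto simp: smooth_fn_def)
  qed auto
  then have "smooth_on ?T (\<lambda>y. f (s y))"
    by (rule smooth_on_cong[OF T, rotated]) (simp add: c)
  then show "\<exists>U. open U \<and> y \<in> U \<and> smooth_on U (\<lambda>y. f (s y))" using T y c by blast
qed

lemma leaf_deriv:
  fixes f :: "'a \<Rightarrow> 'f::euclidean_space"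
  assumes W: "openin (mtop M) W" and f: "smooth_fn M W f" and y: "y \<in> S" "s y \<in> W"
  shows "frechet_derivative (\<lambda>y. f (s y)) (at y) v = chart_deriv (chart_at M (s y)) f (s y) (mderiv (open_mfd S) M s y v)"
proof -
  let ?c = "chart_at M (s y)"
  note c = chart_at[OF leaf_point[OF y(1)]]
  have ca: "chart_at (open_mfd S) y = (S, id)"
    unfolding chart_at_def open_mfd_def by (rule some_equality) (use y in auto)
  have T: "open (S \<inter> s -` fst ?c)" "y \<in> S \<inter> s -` fst ?c" using leaf_open chart_openin c y by auto
  have d: "(\<lambda>y. snd ?c (s y)) differentiable at y" by (rule smooth_on_differentiable[OF leaf_chart[OF c(1)] T(2)])
  have "mderiv (open_mfd S) M s y = frechet_derivative (\<lambda>y. snd ?c (s y)) (at y)"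
    unfolding mderiv_def ca
    by simp (rule frechet_derivative_cong_open[OF T _ d], simp add: chart_inv_id)
  then have 1: "((\<lambda>y. snd ?c (s y)) has_derivative mderiv (open_mfd S) M s y) (at y)"
    using d frechet_derivative_works by metis
  have "((\<lambda>y. f (chart_inv ?c (snd ?c (s y)))) has_derivative
      (\<lambda>v. chart_deriv ?c f (s y) (mderiv (open_mfd S) M s y v))) (at y)"
    by (rule has_derivative_compose[OF 1 chart_deriv_has_derivative[OF f c y(2)]])
  then have "((\<lambda>y. f (s y)) has_derivative (\<lambda>v. chart_deriv ?c f (s y) (mderiv (open_mfd S) M s y v))) (at y)"
    by (rule has_derivative_transform_within_open[OF _ T]) (simp add: c)
  from frechet_derivative_at[OF this, symmetric] show ?thesis by simp
qed

end

lemma chart_deriv_chart: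
  assumes "c \<in> charts M" "x \<in> fst c" shows "chart_deriv c (snd c) x v = v"
proof -
  have "chart_deriv c (snd c) x = (\<lambda>v. v)"
  proof (rule chart_deriv_eqI)
    show "((\<lambda>z. snd c (chart_inv c z)) has_derivative (\<lambda>v. v)) (at (snd c x))"
      by (rule has_derivative_transform_within_open[OF has_derivative_ident chart_image_open[OF assms(1)]])
         (use assms in \<open>auto simp: chart_inv_right\<close>)
  qed
  then show ?thesis by simp
qed

end

lemma (in manifold_pair) mderiv_zero_iff:
  assumes "openin (mtop M) W" "d \<in> charts N" "\<And>y. y \<in> W \<Longrightarrow> u y \<in> fst d" "smooth_fn M W (\<lambda>y. snd d (u y))" "x \<in> W"
  shows "mderiv M N u x v = 0 \<longleftrightarrow> chart_deriv (chart_at M x) (\<lambda>y. snd d (u y)) x v = 0"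
proof -
  have "linear (coord_vec N d (u x))" "inj (coord_vec N d (u x))"
    using N.coord_vec_bij[OF assms(2) assms(3)[OF assms(5)]] bij_is_inj by blast+
  then have "coord_vec N d (u x) w = 0 \<longleftrightarrow> w = 0" for w
    using linear_injective_0[of "coord_vec N d (u x)"] linear_0[of "coord_vec N d (u x)"] by auto
  then show ?thesis using mderiv_chart[where u=u, OF assms] by simp
qed

context conformal_submersion
begin

section \<open>Horizontal lifts as vector fields on \<open>M\<close>, and their brackets\<close>

lemma D_compose_vec:
  fixes Z :: "'a \<Rightarrow> real^'k"
  assumes d: "d \<in> charts N" and W: "openin (mtop M) W" "W \<subseteq> udom d" "x \<in> W" and Z: "smooth_fn M W Z"
    and \<psi>: "smooth_on T \<psi>" "Z x \<in> T"
  shows "D d a (\<lambda>x. \<psi> (Z x)) x = (\<Sum>k\<in>UNIV. partial k \<psi> (Z x) * D d a (\<lambda>x. Z x $ k) x)"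
  unfolding D_def Gam_compose[OF W(1,3) Z \<psi>]
  by (simp add: sum_distrib_left sum_divide_distrib) (subst sum.swap, simp add: mult_ac)

text \<open>The components, in the chart \<open>c\<close>, of the vector field behind the derivation
  \<open>D d a\<close>, recovered from its action on the coordinate functions.\<close>

definition lift :: "('b, real^'n) chart \<Rightarrow> 'n \<Rightarrow> ('a, real^'m) chart \<Rightarrow> 'a \<Rightarrow> real^'m" where
  "lift d a c x = (\<chi> i. D d a (\<lambda>y. snd c y $ i) x)"

lemma D_lift:
  assumes d: "d \<in> charts N" and W: "openin (mtop M) W" "W \<subseteq> udom d" "x \<in> W" and f: "smooth_fn M W f"
    and c: "c \<in> charts M" "x \<in> fst c"
  shows "D d a f x = chart_deriv c f x (lift d a c x)"
proof -
  let ?W = "fst c \<inter> W" and ?\<psi> = "\<lambda>z. f (chart_inv c z)"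
  have W': "openin (mtop M) ?W" "?W \<subseteq> udom d" "x \<in> ?W" using W c chart_openin by blast+
  have \<psi>: "smooth_on (snd c ` ?W) ?\<psi>" using f c by (auto simp: smooth_fn_def)
  have sc: "smooth_fn M ?W (snd c)" by (rule smooth_fn_subset[OF smooth_fn_chart[OF c(1)]]) simp
  have x: "snd c x \<in> snd c ` ?W" using W' by blast
  have "D d a f x = D d a (\<lambda>y. ?\<psi> (snd c y)) x"
    by (rule D_cong[OF d W' smooth_fn_subset[OF f]]) (use c in auto)
  also have "\<dots> = (\<Sum>k\<in>UNIV. partial k ?\<psi> (snd c x) * D d a (\<lambda>y. snd c y $ k) x)"
    by (rule D_compose_vec[OF d W' sc \<psi> x])
  also have "\<dots> = chart_deriv c f x (lift d a c x)"
    unfolding chart_deriv_def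
    by (subst frechet_derivative_partial[OF smooth_on_differentiable[OF \<psi> x]]) (simp add: lift_def mult.commute)
  finally show ?thesis .
qed

lemma vertical_iff:
  assumes d: "d \<in> charts N" and x: "x \<in> udom d"
  shows "mderiv M N u x v = 0 \<longleftrightarrow> chart_deriv (chart_at M x) (Y d) x v = 0"
  unfolding Y_def[abs_def]
proof (rule mderiv_zero_iff[OF openin_udom[OF d] d _ _ x])
  show "u y \<in> fst d" if "y \<in> udom d" for y using that by (simp add: udom_def)
  show "smooth_fn M (udom d) (\<lambda>y. snd d (u y))" using smooth_Y[OF d] unfolding Y_def[abs_def] .
qed

text \<open>The lift is a combination of gradients of the coordinates of \<open>u\<close>, and these
  are orthogonal to the kernel of the differential of \<open>u\<close>.\<close>

lemma lift_horizontal: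
  assumes d: "d \<in> charts N" and x: "x \<in> udom d"
  shows "lift d a (chart_at M x) x \<in> horizontal_space M gM N u x"
proof -
  have xM: "x \<in> points M" using x udom_points by blast
  let ?c = "chart_at M x"
  note c = chart_at[OF xM]
  define G where "G = inner_matrix (gM x)"
  have G: "inner_product_form (gM x)" by (rule metric_inner[OF xM])
  have Gi: "invertible G" unfolding G_def by (rule invertible_inner_matrix[OF G])
  define g where "g b = grad_vec ?c (\<lambda>x. Y d x $ b) x" for b
  have ci: "smooth_fn M (fst ?c) (\<lambda>y. snd ?c y $ i)" for i
    using smooth_fn_chart[OF c(1)] unfolding smooth_fn_vec_iff[OF chart_openin[OF c(1)]] by blast
  have e: "grad_vec ?c (\<lambda>y. snd ?c y $ i) x = axis i 1" for i
    unfolding grad_vec_def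
    by (simp add: vec_eq_iff chart_deriv_nth[OF smooth_fn_chart[OF c(1)] c(1,2,2)] chart_deriv_chart[OF c] axis_def)
  have Gam: "Gam (\<lambda>x. Y d x $ b) (\<lambda>y. snd ?c y $ i) x = (matrix_inv G *v g b) $ i" for b i
    by (subst Gam_commute[OF xM]) (simp add: Gam_def dual_inner_def e g_def G_def inner_axis')
  have L: "lift d a ?c x = (\<Sum>b\<in>UNIV. (Hc d (Y d x) $ a $ b / (dil x)\<^sup>2) *\<^sub>R (matrix_inv G *v g b))"
    by (simp add: vec_eq_iff lift_def D_def Gam sum_divide_distrib)
  have "gM x v (lift d a ?c x) = 0" if v: "mderiv M N u x v = 0" for v
  proof -
    have "v \<bullet> g b = 0" for b
    proof -
      have s: "smooth_fn M (udom d) (\<lambda>x. Y d x $ b)" by (rule smooth_Y_nth[OF d])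
      have "g b \<bullet> v = chart_deriv ?c (\<lambda>x. Y d x $ b) x v"
        unfolding g_def grad_vec_def by (rule linear_eq_inner_axis[OF chart_deriv_linear[OF s c x], symmetric])
      also have "\<dots> = chart_deriv ?c (Y d) x v $ b" by (rule chart_deriv_nth[OF smooth_Y[OF d] c x])
      finally show ?thesis using v[unfolded vertical_iff[OF d x]] by (simp add: inner_commute)
    qed
    moreover have "G *v (matrix_inv G *v w) = w" for w
      by (simp add: matrix_vector_mul_assoc matrix_inv_right[OF Gi])
    moreover have "gM x v w = v \<bullet> (G *v w)" for w unfolding G_def by (rule inner_matrix_eq[OF G])
    ultimately show ?thesis
      unfolding L by (simp add: linear_sum[OF matrix_vector_mul_linear] matrix_vector_mult_scaleR inner_sum_right)
  qed
  then show ?thesis by (simp add: horizontal_space_def vertical_space_def)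
qed

lemma horizontal_vertical_zero:
  assumes x: "x \<in> points M" and v: "v \<in> horizontal_space M gM N u x" "mderiv M N u x v = 0"
  shows "v = 0"
  using v metric_inner[OF x] by (auto simp: horizontal_space_def vertical_space_def inner_product_form_def)

text \<open>The lifts send the coordinates of \<open>u\<close> to constants, so their bracket
  annihilates these coordinates and is vertical. If the bracket is also represented by a horizontal
  vector, it is 0.\<close>

lemma horizontal_commutingI:
  assumes Z: "\<And>d a b x. d \<in> charts N \<Longrightarrow> x \<in> udom d \<Longrightarrow> \<exists>Z \<in> horizontal_space M gM N u x.
     \<forall>W f. openin (mtop M) W \<longrightarrow> W \<subseteq> udom d \<longrightarrow> x \<in> W \<longrightarrow> smooth_fn M W f \<longrightarrow>
       D d a (D d b f) x - D d b (D d a f) x = chart_deriv (chart_at M x) f x Z"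
  shows horizontal_commuting
  unfolding horizontal_commuting_def
proof (intro ballI allI impI)
  fix d W and f :: "'a \<Rightarrow> real" and a b x assume d: "d \<in> charts N" and W: "openin (mtop M) W" "W \<subseteq> udom d" "x \<in> W" and f: "smooth_fn M W f"
  have x: "x \<in> udom d" "x \<in> points M" using W udom_points by blast+
  note U = openin_udom[OF d] subset_refl x(1)
  obtain Z where Z: "Z \<in> horizontal_space M gM N u x"
     "\<And>W f. openin (mtop M) W \<Longrightarrow> W \<subseteq> udom d \<Longrightarrow> x \<in> W \<Longrightarrow> smooth_fn M W f \<Longrightarrow>
       D d a (D d b f) x - D d b (D d a f) x = chart_deriv (chart_at M x) f x Z"
    using Z[OF d x(1), of a b] by blast
  have "chart_deriv (chart_at M x) (Y d) x Z $ k = 0" for k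
  proof -
    have "D d a (D d b (\<lambda>x. Y d x $ k)) x = 0" for a b
    proof -
      have "D d a (D d b (\<lambda>x. Y d x $ k)) x = D d a (\<lambda>x. if b = k then 1 else 0) x"
        by (rule D_cong[OF d U smooth_D[OF d U(1,2) smooth_Y_nth[OF d]] D_Y[OF d U(1,2)]])
      then show ?thesis using D_const[OF d U] by simp
    qed
    then have "chart_deriv (chart_at M x) (\<lambda>x. Y d x $ k) x Z = 0" using Z(2)[OF U smooth_Y_nth[OF d, of k]] by simp
    then show ?thesis using chart_deriv_nth[OF smooth_Y[OF d] chart_at[OF x(2)] x(1)] by simp
  qed
  then have "chart_deriv (chart_at M x) (Y d) x Z = 0" by (simp add: vec_eq_iff)
  then have "Z = 0" using horizontal_vertical_zero[OF x(2) Z(1)] vertical_iff[OF d x(1)] by blast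
  then have "D d a (D d b f) x - D d b (D d a f) x = 0"
    using Z(2)[OF W f] linear_0[OF chart_deriv_linear[OF f chart_at[OF x(2)] W(3)]] by simp
  then show "D d a (D d b f) x = D d b (D d a f) x" by simp
qed

text \<open>The bracket of fields tangent to a leaf is tangent to the leaf, hence horizontal. It is
  computed in the parameter domain, where the lifts become the fields \<open>A a\<close>.\<close>

lemma integrable_commuting:
  assumes "integrable_distribution TYPE(real^'n) M (horizontal_space M gM N u)"
  shows horizontal_commuting
proof (rule horizontal_commutingI)
  fix d a b x assume d: "d \<in> charts N" and x: "x \<in> udom d"
  have xM: "x \<in> points M" using x udom_points by blast
  from bspec[OF assms[unfolded integrable_distribution_def] xM]
  obtain S :: "(real^'n) set" and s where S: "open S" "x \<in> s ` S" "smooth_map (open_mfd S) M s"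
    and H: "\<forall>y\<in>S. inj (mderiv (open_mfd S) M s y) \<and> range (mderiv (open_mfd S) M s y) = horizontal_space M gM N u (s y)"
    by (elim exE conjE) (rule that)
  have H: "range (mderiv (open_mfd S) M s y) = horizontal_space M gM N u (s y)" if "y \<in> S" for y
    using bspec[OF H that] by simp
  obtain y0 where y0: "y0 \<in> S" "x = s y0" using S(2) by blast
  note leaf = leaf_open[OF S(1,3)] and leaf_smooth = leaf_smooth[OF S(1,3)] and leaf_deriv = leaf_deriv[OF S(1,3)]
  let ?T = "S \<inter> s -` udom d"
  have T: "open ?T" by (rule leaf[OF openin_udom[OF d]])
  let ?\<kappa> = "\<lambda>y. Y d (s y)"
  have \<kappa>: "smooth_on ?T ?\<kappa>" by (rule leaf_smooth[OF openin_udom[OF d] smooth_Y[OF d]])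
  define K where "K y = matrix (frechet_derivative ?\<kappa> (at y))" for y
  \<comment> \<open>On a leaf the coordinates of \<open>u\<close> are local coordinates, and the
    lifts are their coordinate fields, that is, the columns of the inverse Jacobian matrix. This
    formula shows that the pulled-back lifts are smooth.\<close>
  define A where "A a y = matrix_inv (K y) *v axis a 1" for a y
  have K: "K y *v v = frechet_derivative ?\<kappa> (at y) v" if "y \<in> ?T" for y v
    unfolding K_def using linear_frechet_derivative[OF smooth_on_differentiable[OF \<kappa> that]]
    by (intro matrix_works) (simp add: linear_matrix_vector_mul_eq)
  have ex: "\<exists>v. mderiv (open_mfd S) M s y v = lift d a (chart_at M (s y)) (s y) \<and> K y *v v = axis a 1" if y: "y \<in> ?T" for y a
  proof -
    have y': "y \<in> S" "s y \<in> udom d" "s y \<in> points M" using y udom_points by blast+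
    have "lift d a (chart_at M (s y)) (s y) \<in> range (mderiv (open_mfd S) M s y)"
      using lift_horizontal[OF d y'(2)] H[OF y'(1)] by simp
    then obtain v where v: "mderiv (open_mfd S) M s y v = lift d a (chart_at M (s y)) (s y)" by (metis rangeE)
    have "K y *v v = axis a 1"
    proof -
      have "K y *v v = chart_deriv (chart_at M (s y)) (Y d) (s y) (lift d a (chart_at M (s y)) (s y))"
        unfolding K[OF y] leaf_deriv[OF openin_udom[OF d] smooth_Y[OF d] y'(1,2)] v ..
      moreover have "chart_deriv (chart_at M (s y)) (Y d) (s y) (lift d a (chart_at M (s y)) (s y)) $ k = axis a 1 $ k" for k
      proof -
        note U = openin_udom[OF d] subset_refl y'(2)
        have "chart_deriv (chart_at M (s y)) (Y d) (s y) (lift d a (chart_at M (s y)) (s y)) $ k = D d a (\<lambda>x. Y d x $ k) (s y)"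
          unfolding D_lift[OF d U smooth_Y_nth[OF d] chart_at[OF y'(3)]]
          by (rule chart_deriv_nth[OF smooth_Y[OF d] chart_at[OF y'(3)] y'(2), symmetric])
        then show ?thesis using D_Y[OF d U, of a k] by (simp add: axis_def eq_commute[of k])
      qed
      ultimately show ?thesis by (simp add: vec_eq_iff)
    qed
    then show ?thesis using v by blast
  qed
  have inv: "invertible (K y)" if y: "y \<in> ?T" for y
  proof -
    have "\<forall>a. \<exists>v. K y *v v = axis a 1" using ex[OF y] by blast
    then obtain B where B: "\<And>a. K y *v B a = axis a 1" by metis
    have "K y ** (\<chi> i a. B a $ i) = mat 1"
      using B by (simp add: vec_eq_iff matrix_matrix_mult_def matrix_vector_mult_def axis_def mat_def)
    then show ?thesis by (simp add: invertible_right_inverse) blast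
  qed
  have A: "mderiv (open_mfd S) M s y (A a y) = lift d a (chart_at M (s y)) (s y)" if y: "y \<in> ?T" for y a
  proof -
    obtain v where v: "mderiv (open_mfd S) M s y v = lift d a (chart_at M (s y)) (s y)" "K y *v v = axis a 1"
      using ex[OF y] by blast
    have "A a y = matrix_inv (K y) *v (K y *v v)" by (simp add: A_def v)
    also have "\<dots> = v" by (simp add: matrix_vector_mul_assoc matrix_inv_left[OF inv[OF y]])
    finally show ?thesis using v by simp
  qed
  have sA: "smooth_on ?T (A a)" for a
  proof -
    have "smooth_on ?T (\<lambda>y. K y $ i $ j)" for i j
      using smooth_on_frechet_derivative[OF \<kappa>, of "axis j 1"] unfolding smooth_on_vec_iff[OF T] by (simp add: K_def matrix_def)
    from smooth_on_matrix_inv[OF T this inv] show ?thesis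
      unfolding smooth_on_vec_iff[OF T] by (simp add: A_def matrix_vector_mult_basis column_def)
  qed
  define Z where "Z = frechet_derivative (A b) (at y0) (A a y0) - frechet_derivative (A a) (at y0) (A b y0)"
  show "\<exists>Z \<in> horizontal_space M gM N u x. \<forall>W f. openin (mtop M) W \<longrightarrow> W \<subseteq> udom d \<longrightarrow> x \<in> W \<longrightarrow> smooth_fn M W f \<longrightarrow>
       D d a (D d b f) x - D d b (D d a f) x = chart_deriv (chart_at M x) f x Z"
  proof (intro bexI allI impI)
    show "mderiv (open_mfd S) M s y0 Z \<in> horizontal_space M gM N u x" using H[OF y0(1)] y0(2) by blast
    fix W and f :: "'a \<Rightarrow> real" assume W: "openin (mtop M) W" "W \<subseteq> udom d" "x \<in> W" and f: "smooth_fn M W f"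
    let ?R = "S \<inter> s -` W" and ?\<phi> = "\<lambda>y. f (s y)"
    have R: "open ?R" "y0 \<in> ?R" "?R \<subseteq> ?T" using leaf[OF W(1)] W y0 by auto
    have \<phi>: "smooth_on ?R ?\<phi>" by (rule leaf_smooth[OF W(1) f])
    have D: "D d a g (s y) = frechet_derivative (\<lambda>y. g (s y)) (at y) (A a y)" if g: "smooth_fn M W g" and y: "y \<in> ?R" for g y a
    proof -
      have y': "y \<in> S" "s y \<in> W" "y \<in> ?T" using y R by auto
      have "D d a g (s y) = chart_deriv (chart_at M (s y)) g (s y) (lift d a (chart_at M (s y)) (s y))"
        by (rule D_lift[OF d W(1,2) y'(2) g chart_at]) (use y' udom_points in blast)+
      then show ?thesis unfolding leaf_deriv[OF W(1) g y'(1,2)] A[OF y'(3)] .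
    qed
    have DD: "D d a (D d b f) x = frechet_derivative (\<lambda>y. frechet_derivative ?\<phi> (at y) (A b y)) (at y0) (A a y0)" for a b
    proof -
      have s: "smooth_fn M W (D d b f)" by (rule smooth_D[OF d W(1,2) f])
      have "frechet_derivative (\<lambda>y. frechet_derivative ?\<phi> (at y) (A b y)) (at y0) = frechet_derivative (\<lambda>y. D d b f (s y)) (at y0)"
        by (rule frechet_derivative_cong_open[OF R(1,2) _ smooth_on_differentiable[OF leaf_smooth[OF W(1) s] R(2)]]) (rule D[OF f])
      then show ?thesis unfolding y0(2) D[OF s R(2)] by simp
    qed
    show "D d a (D d b f) x - D d b (D d a f) x = chart_deriv (chart_at M x) f x (mderiv (open_mfd S) M s y0 Z)"
    proof -
      have "D d a (D d b f) x - D d b (D d a f) x = frechet_derivative ?\<phi> (at y0) Z"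
        unfolding DD Z_def
        by (rule commutator_first_order[OF R(1) \<phi> smooth_on_subset[OF sA R(3)] smooth_on_subset[OF sA R(3)] R(2)])
      also have "\<dots> = chart_deriv (chart_at M x) f x (mderiv (open_mfd S) M s y0 Z)"
        unfolding y0(2) by (rule leaf_deriv[OF W(1) f y0(1)]) (use W(3) y0 in simp)
      finally show ?thesis .
    qed
  qed
qed

text \<open>The lifts annihilate the components of \<open>r\<close>, hence so does their bracket,
  which therefore lies in the kernel of the differential of \<open>r\<close>. This kernel is the
  horizontal space.\<close>

lemma trivial_commuting:
  assumes "trivial_submersion M gM N u"
  shows horizontal_commuting
proof (rule horizontal_commutingI)
  fix d a b x assume d: "d \<in> charts N" and x: "x \<in> udom d"
  have xM: "x \<in> points M" using x udom_points by blast
  obtain r where r: "smooth_map M M r" and H: "\<And>x. x \<in> points M \<Longrightarrow> {v. mderiv M M r x v = 0} = horizontal_space M gM N u x"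
    using assms unfolding trivial_submersion_def by blast
  interpret R: manifold_pair M M by unfold_locales
  let ?c = "chart_at M x"
  note c = chart_at[OF xM]
  let ?V = "fst ?c \<inter> udom d"
  have V: "openin (mtop M) ?V" using chart_openin[OF c(1)] openin_udom[OF d] by blast
  define X where "X a z = lift d a ?c (chart_inv ?c z)" for a z
  have sX: "smooth_on (snd ?c ` ?V) (X a)" for a
  proof -
    have "smooth_fn M ?V (lift d a ?c)"
      unfolding smooth_fn_vec_iff[OF V] lift_def vec_lambda_beta
    proof
      fix i
      have "smooth_fn M ?V (\<lambda>y. snd ?c y $ i)"
        using smooth_fn_subset[OF smooth_fn_chart[OF c(1)], of ?V] unfolding smooth_fn_vec_iff[OF V] by blast
      then show "smooth_fn M ?V (D d a (\<lambda>y. snd ?c y $ i))" by (intro smooth_D d V) blast+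
    qed
    then have "smooth_on (snd ?c ` (fst ?c \<inter> ?V)) (\<lambda>z. lift d a ?c (chart_inv ?c z))" using c by (auto simp: smooth_fn_def)
    then show ?thesis by (simp add: X_def[abs_def] Int_absorb1 inf.assoc[symmetric])
  qed
  define Z where "Z = frechet_derivative (X b) (at (snd ?c x)) (X a (snd ?c x)) - frechet_derivative (X a) (at (snd ?c x)) (X b (snd ?c x))"
  have br: "D d a (D d b f) x - D d b (D d a f) x = chart_deriv ?c f x Z"
    if W: "openin (mtop M) W" "W \<subseteq> udom d" "x \<in> W" and f: "smooth_fn M W f" for W f
  proof -
    let ?S = "snd ?c ` (fst ?c \<inter> W)" and ?\<psi> = "\<lambda>z. f (chart_inv ?c z)"
    have S: "open ?S" "snd ?c x \<in> ?S" "?S \<subseteq> snd ?c ` ?V" using chart_image_openin[OF c(1) W(1)] W c by auto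
    have \<psi>: "smooth_on ?S ?\<psi>" using f c by (auto simp: smooth_fn_def)
    have D: "D d a g y = frechet_derivative (\<lambda>z. g (chart_inv ?c z)) (at (snd ?c y)) (X a (snd ?c y))"
      if g: "smooth_fn M W g" and y: "y \<in> fst ?c" "y \<in> W" for g y a
      using D_lift[OF d W(1,2) y(2) g c(1) y(1)] c(1) y(1) by (simp add: chart_deriv_def X_def)
    have DD: "D d a (D d b f) x = frechet_derivative (\<lambda>z. frechet_derivative ?\<psi> (at z) (X b z)) (at (snd ?c x)) (X a (snd ?c x))" for a b
    proof -
      have s: "smooth_fn M W (D d b f)" by (rule smooth_D[OF d W(1,2) f])
      then have s': "smooth_on ?S (\<lambda>z. D d b f (chart_inv ?c z))" using c by (auto simp: smooth_fn_def)
      have "frechet_derivative (\<lambda>z. frechet_derivative ?\<psi> (at z) (X b z)) (at (snd ?c x)) =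
          frechet_derivative (\<lambda>z. D d b f (chart_inv ?c z)) (at (snd ?c x))"
      proof (rule frechet_derivative_cong_open[OF S(1,2) _ smooth_on_differentiable[OF s' S(2)]])
        fix z assume "z \<in> ?S"
        then obtain y where y: "y \<in> fst ?c" "y \<in> W" "z = snd ?c y" by auto
        then show "D d b f (chart_inv ?c z) = frechet_derivative ?\<psi> (at z) (X b z)" using D[OF f y(1,2)] c(1) by simp
      qed
      then show ?thesis using D[OF s c(2) W(3)] by simp
    qed
    show ?thesis
      unfolding DD Z_def chart_deriv_def
      by (rule commutator_first_order[OF S(1) \<psi> smooth_on_subset[OF sX S(3)] smooth_on_subset[OF sX S(3)] S(2)])
  qed
  have "mderiv M M r x Z = 0"
  proof -
    define e where "e = chart_at M (r x)"
    have e: "e \<in> charts M" "r x \<in> fst e" unfolding e_def using chart_at[OF R.smooth_map_points[OF r xM]] by auto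
    let ?W = "{y \<in> points M. r y \<in> fst e} \<inter> udom d" and ?h = "\<lambda>y. snd e (r y)"
    have W: "openin (mtop M) ?W" "?W \<subseteq> udom d" "x \<in> ?W"
      using R.smooth_map_preimage_openin[OF r chart_openin[OF e(1)]] openin_udom[OF d] x xM e by auto
    have h: "smooth_fn M ?W ?h" by (rule smooth_fn_subset[OF R.smooth_map_fn[OF r e(1)]]) blast
    then have hi: "smooth_fn M ?W (\<lambda>y. ?h y $ i)" for i unfolding smooth_fn_vec_iff[OF W(1)] by blast
    have D0: "D d a (\<lambda>y. ?h y $ i) y = 0" if y: "y \<in> ?W" for y a i
    proof -
      have yM: "y \<in> points M" "y \<in> udom d" using y by auto
      have "mderiv M M r y (lift d a (chart_at M y) y) = 0" using H[OF yM(1)] lift_horizontal[OF d yM(2)] by blast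
      then have "chart_deriv (chart_at M y) ?h y (lift d a (chart_at M y) y) = 0"
        by (subst (asm) R.mderiv_zero_iff[OF W(1) e(1) _ h y]) auto
      then show ?thesis
        using D_lift[OF d W(1,2) y hi chart_at[OF yM(1)]] chart_deriv_nth[OF h chart_at[OF yM(1)] y] by simp
    qed
    have "chart_deriv ?c ?h x Z $ i = 0" for i
    proof -
      have "D d a (D d b (\<lambda>y. ?h y $ i)) x = 0" for a b
        using D_cong[OF d W smooth_D[OF d W(1,2) hi] D0] D_const[OF d W] by simp
      then have "chart_deriv ?c (\<lambda>y. ?h y $ i) x Z = 0" using br[OF W hi, of i] by simp
      then show ?thesis using chart_deriv_nth[OF h c W(3)] by simp
    qed
    then have "chart_deriv ?c ?h x Z = 0" by (simp add: vec_eq_iff)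
    moreover have "r y \<in> fst e" if "y \<in> ?W" for y using that by blast
    ultimately show ?thesis using R.mderiv_zero_iff[where u=r, OF W(1) e(1) _ h W(3)] by blast
  qed
  then have "Z \<in> horizontal_space M gM N u x" using H[OF xM] by blast
  then show "\<exists>Z \<in> horizontal_space M gM N u x. \<forall>W f. openin (mtop M) W \<longrightarrow> W \<subseteq> udom d \<longrightarrow> x \<in> W \<longrightarrow> smooth_fn M W f \<longrightarrow>
       D d a (D d b f) x - D d b (D d a f) x = chart_deriv (chart_at M x) f x Z"
    using br by (intro bexI[of _ Z] allI impI)
qed

end

section \<open>A cup product of step functions\<close>

text \<open>The inverse of splitting a tuple into its \<open>k\<close>-th face, given by
  \<open>skip k\<close>, and its \<open>k\<close>-th entry.\<close>

definition ins :: "nat \<Rightarrow> 'x \<Rightarrow> (nat \<Rightarrow> 'x) \<Rightarrow> nat \<Rightarrow> 'x" where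
  "ins k i J l = (if l < k then J l else if l = k then i else J (l - 1))"

lemma sum_PiE_ins:
  assumes k: "k \<le> Suc p"
  shows "(\<Sum>T\<in>PiE {..Suc p} (\<lambda>_. I). h T) = (\<Sum>J\<in>PiE {..p} (\<lambda>_. I). \<Sum>i\<in>I. h (ins k i J))"
proof -
  have "(\<Sum>T\<in>PiE {..Suc p} (\<lambda>_. I). h T) = (\<Sum>(J, i)\<in>PiE {..p} (\<lambda>_. I) \<times> I. h (ins k i J))"
  proof (rule sum.reindex_bij_witness[where i="\<lambda>(J, i). ins k i J" and j="\<lambda>T. (\<lambda>l. T (skip k l), T k)"])
    fix T assume T: "T \<in> PiE {..Suc p} (\<lambda>_. I)"
    show "(\<lambda>(J, i). ins k i J) (\<lambda>l. T (skip k l), T k) = T" by (auto simp: ins_def skip_def fun_eq_iff)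
    then show "(case (\<lambda>l. T (skip k l), T k) of (J, i) \<Rightarrow> h (ins k i J)) = h T" by simp
    show "(\<lambda>l. T (skip k l), T k) \<in> PiE {..p} (\<lambda>_. I) \<times> I"
      using T k by (auto simp: PiE_iff extensional_def skip_def)
  next
    fix Ji assume "Ji \<in> PiE {..p} (\<lambda>_. I) \<times> I"
    then obtain J i where Ji: "Ji = (J, i)" "J \<in> PiE {..p} (\<lambda>_. I)" "i \<in> I" by auto
    have 1: "(\<lambda>l. ins k i J (skip k l)) = J" "ins k i J k = i" by (auto simp: ins_def skip_def fun_eq_iff)
    then show "(\<lambda>l. (\<lambda>(J, i). ins k i J) Ji (skip k l), (\<lambda>(J, i). ins k i J) Ji k) = Ji" using Ji by simp
    show "(\<lambda>(J, i). ins k i J) Ji \<in> PiE {..Suc p} (\<lambda>_. I)"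
      using Ji k by (auto simp: PiE_iff extensional_def ins_def)
  qed
  then show ?thesis by (simp add: sum.cartesian_product)
qed

text \<open>The cocycle identity for a cup product of coboundaries of functions; \<open>b\<close>
  gives the order of the factors. The alternating sum telescopes.\<close>

lemma alternating_faces:
  fixes h :: "'n::finite \<Rightarrow> nat \<Rightarrow> real"
  assumes b: "bij_betw b UNIV {1..n}"
  shows "(\<Sum>k\<le>Suc n. (-1) ^ k * (\<Prod>r\<in>UNIV. h r (skip k (b r)) - h r (skip k (b r - 1)))) = 0"
proof -
  define L where "L r = h r (b r) - h r (b r - 1)" for r
  define R where "R r = h r (Suc (b r)) - h r (b r)" for r
  \<comment> \<open>The first \<open>k\<close> factors use the edge before their vertex, the others
    the edge after it. Omitting an inner vertex \<open>k\<close> merges two edges in the factor with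
    \<open>b r = k\<close>, so that face is \<open>X k + X (k - 1)\<close>; the outer faces are
    \<open>X 0\<close> and \<open>X n\<close>.\<close>
  define X where "X k = (\<Prod>r\<in>UNIV. if b r \<le> k then L r else R r)" for k
  define Fa where "Fa k = (\<Prod>r\<in>UNIV. h r (skip k (b r)) - h r (skip k (b r - 1)))" for k
  have b1: "1 \<le> b r" "b r \<le> n" for r using bij_betwE[OF b] by auto
  have F: "h r (skip k (b r)) - h r (skip k (b r - 1)) = (if b r < k then L r else if b r = k then L r + R r else R r)" for r k
    using b1[of r] by (auto simp: skip_def L_def R_def)
  have F0: "Fa 0 = X 0" unfolding Fa_def X_def F using b1(1) by (intro prod.cong refl) (metis One_nat_def le_zero_eq not_less0 not_less_eq_eq order.refl)
  have Fn: "Fa (Suc n) = X n" unfolding Fa_def X_def F using b1 by (intro prod.cong refl) (auto simp: le_imp_less_Suc)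
  have FS: "Fa (Suc k) = X (Suc k) + X k" if k: "Suc k \<le> n" for k
  proof -
    obtain r0 where r0: "b r0 = Suc k" using b k by (metis atLeastAtMost_iff bij_betw_imp_surj_on imageE le_add1 plus_1_eq_Suc)
    have r: "b r \<noteq> Suc k" if "r \<noteq> r0" for r using that r0 bij_betw_imp_inj_on[OF b] by (metis UNIV_I inj_onD)
    let ?P = "\<Prod>r\<in>UNIV - {r0}. if b r \<le> k then L r else R r"
    have "(\<Prod>r\<in>UNIV - {r0}. if b r < Suc k then L r else if b r = Suc k then L r + R r else R r) = ?P"
      "(\<Prod>r\<in>UNIV - {r0}. if b r \<le> Suc k then L r else R r) = ?P"
      by (intro prod.cong refl; use r in \<open>auto simp: less_Suc_eq_le le_Suc_eq\<close>)+
    then have "Fa (Suc k) = (L r0 + R r0) * ?P" "X (Suc k) = L r0 * ?P"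
      unfolding Fa_def F X_def by (subst prod.remove[of _ r0]; use r0 in simp)+
    moreover have "X k = R r0 * ?P"
      unfolding X_def by (subst prod.remove[of _ r0]) (use r0 in auto)
    ultimately show ?thesis by (simp add: distrib_right)
  qed
  have "(\<Sum>k\<le>m. (-1) ^ k * Fa k) = (-1) ^ m * X m" if "m \<le> n" for m
    using that by (induction m) (auto simp: F0 FS algebra_simps)
  from this[of n] have "(\<Sum>k\<le>Suc n. (-1) ^ k * Fa k) = 0" by (simp add: Fn)
  then show ?thesis by (simp add: Fa_def)
qed

text \<open>A coordinate cube of half-width \<open>2 * \<rho>\<close> around \<open>u x0\<close>,
  with constant orientation; \<open>\<rho>\<close> is a length, unrelated to the density
  \<open>rho\<close>. In units of \<open>\<rho>\<close> the step function varies between -1 and 1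
  only, and the room up to 2 lets the cube overlap the regions where a step is constant. The
  bijection \<open>b\<close> supplies an order of the factors, as the index type has none.\<close>

locale cube_setup = oriented_harmonic M gM N gN u dil F F' P
  for M :: "('a, real^'m) mfd" and gM and N :: "('b, real^'n) mfd" and gN u dil F F' P +
  fixes d0 :: "('b, real^'n) chart" and x0 :: 'a and \<rho> :: real and S S' :: "real \<Rightarrow> real" and b :: "'n \<Rightarrow> nat"
  assumes d0: "d0 \<in> charts N" and x0: "x0 \<in> udom d0" and \<rho>: "\<rho> > 0"
    and cube: "\<And>y. (\<And>r. \<bar>y $ r - Y d0 x0 $ r\<bar> \<le> 2 * \<rho>) \<Longrightarrow> y \<in> snd d0 ` fst d0"
    and cube_eps: "\<And>x. x \<in> udom d0 \<Longrightarrow> (\<And>r. \<bar>Y d0 x $ r - Y d0 x0 $ r\<bar> \<le> 2 * \<rho>) \<Longrightarrow> eps d0 x = eps d0 x0"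
    and S: "smooth_on UNIV S" "\<And>t. (S has_real_derivative S' t) (at t)" "\<And>t. S' t \<ge> 0" "S' 0 > 0"
      "\<And>t. t \<le> -1 \<Longrightarrow> S t = S (-1)" "\<And>t. t \<ge> 1 \<Longrightarrow> S t = S 1"
    and b: "bij_betw b UNIV {1..CARD('n)}"
begin

definition co :: "'n \<Rightarrow> 'b \<Rightarrow> real" where "co r q = (snd d0 q $ r - Y d0 x0 $ r) / \<rho>"
definition "QQ = {q \<in> fst d0. \<forall>r. \<bar>co r q\<bar> < 2}"
definition WW :: "'n \<Rightarrow> real \<Rightarrow> 'b set" where "WW r s = {q \<in> fst d0. s * co r q > 1}"
definition "CC = {q \<in> points N. \<not> (q \<in> fst d0 \<and> (\<forall>r. \<bar>co r q\<bar> \<le> 2))}"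
definition pre :: "'b set \<Rightarrow> 'a set" where "pre V = {x \<in> points M. u x \<in> V}"
text \<open>Each kind of member makes \<open>Psi\<close> closed for a reason of its own: in the cube
  it is a cup product, in \<open>WW r s\<close> the step function of the coordinate \<open>r\<close>
  is constant, and \<open>CC\<close> is disjoint from the cube.\<close>

definition "cover = {pre QQ, pre CC} \<union> {pre (WW r s) | r s. s \<in> {1, -1}}"

text \<open>The cup product of the coboundaries of the step functions in the order given by
  \<open>b\<close>, cut off outside the cube.\<close>

definition Psi :: "(nat \<Rightarrow> 'b) \<Rightarrow> real" where
  "Psi q = (if \<forall>j\<le>CARD('n). q j \<in> QQ then \<Prod>r\<in>UNIV. S (co r (q (b r))) - S (co r (q (b r - 1))) else 0)"

lemma b_bounds: "1 \<le> b r" "b r \<le> CARD('n)"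
  using bij_betwE[OF b] by auto

lemma S_const: "s \<in> {1, -1} \<Longrightarrow> s * t > 1 \<Longrightarrow> S t = S s"
  using S(5,6)[of t] by auto

lemma Psi_WW: "s \<in> {1, -1} \<Longrightarrow> (\<And>j. j \<le> CARD('n) \<Longrightarrow> q j \<in> WW r s) \<Longrightarrow> Psi q = 0"
proof -
  assume s: "s \<in> {1, -1}" and q: "\<And>j. j \<le> CARD('n) \<Longrightarrow> q j \<in> WW r s"
  have "S (co r (q j)) = S s" if "j \<le> CARD('n)" for j using S_const[OF s] q[OF that] by (simp add: WW_def)
  then have "S (co r (q (b r))) - S (co r (q (b r - 1))) = 0" using b_bounds[of r] by simp
  then have "(\<Prod>r\<in>UNIV. S (co r (q (b r))) - S (co r (q (b r - 1)))) = 0" by (intro prod_zero) auto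
  then show "Psi q = 0" by (simp add: Psi_def)
qed

lemma QQ_CC: "QQ \<inter> CC = {}" by (auto simp: QQ_def CC_def less_imp_le)

lemma Psi_CC: "q 0 \<in> CC \<Longrightarrow> Psi q = 0"
  using QQ_CC by (auto simp: Psi_def)

lemma Psi_cocycle:
  assumes V: "V \<in> cover" and q: "\<And>j. j \<le> Suc CARD('n) \<Longrightarrow> q j \<in> u ` V"
  shows "(\<Sum>k\<le>Suc CARD('n). (-1) ^ k * Psi (\<lambda>j. q (skip k j))) = 0"
proof -
  have sk: "q (skip k j) \<in> u ` V" if "j \<le> CARD('n)" for k j using q[of "skip k j"] that by (auto simp: skip_def)
  have sub: "u ` pre V \<subseteq> V" for V by (auto simp: pre_def)
  consider "V = pre QQ" | "V = pre CC" | r s where "V = pre (WW r s)" "s \<in> {1, -1}" using V by (auto simp: cover_def)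
  then show ?thesis
  proof cases
    case 1
    then have "\<forall>j\<le>CARD('n). q (skip k j) \<in> QQ" for k using sk sub by blast
    then show ?thesis using alternating_faces[OF b, of "\<lambda>r j. S (co r (q j))"] by (simp add: Psi_def)
  next
    case 2
    then have "Psi (\<lambda>j. q (skip k j)) = 0" for k using sk[of 0 k] 2 sub[of CC] by (intro Psi_CC) blast
    then show ?thesis by simp
  next
    case 3
    then have "Psi (\<lambda>j. q (skip k j)) = 0" for k using sk 3(1) sub[of "WW r s"] by (intro Psi_WW[OF 3(2), of _ r]) blast
    then show ?thesis by simp
  qed
qed

lemma pre_openin: "openin (mtop N) V \<Longrightarrow> openin (mtop M) (pre V)"
  unfolding pre_def by (rule smooth_map_preimage_openin[OF smooth_u])

lemma chart_set_openin: "open T \<Longrightarrow> openin (mtop N) {q \<in> fst d0. (\<chi> r. co r q) \<in> T}"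
proof -
  assume T: "open T"
  have "continuous_on UNIV (\<lambda>y::real^'n. \<chi> r. (y $ r - Y d0 x0 $ r) / \<rho>)" using \<rho> by (intro continuous_intros) auto
  then have "open ((\<lambda>y. \<chi> r. (y $ r - Y d0 x0 $ r) / \<rho>) -` T)" using T by (simp add: open_vimage)
  from N.chart_preimage_openin[OF d0 this] show ?thesis by (simp add: co_def)
qed

lemma cover_openin: "V \<in> cover \<Longrightarrow> openin (mtop M) V"
proof -
  have Q: "openin (mtop N) QQ"
  proof -
    have "open {t::real^'n. \<forall>r. \<bar>t $ r\<bar> < 2}"
      by (simp add: Collect_all_eq) (intro open_INT ballI open_Collect_less continuous_intros; simp)
    from chart_set_openin[OF this] show ?thesis by (simp add: QQ_def)
  qed
  have W: "openin (mtop N) (WW r s)" for r s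
  proof -
    have "open {t::real^'n. s * t $ r > 1}" by (intro open_Collect_less continuous_intros)
    from chart_set_openin[OF this] show ?thesis by (simp add: WW_def)
  qed
  have C: "openin (mtop N) CC"
  proof -
    define B where "B = {y::real^'n. \<forall>r. \<bar>y $ r - Y d0 x0 $ r\<bar> \<le> 2 * \<rho>}"
    have "B = cbox (Y d0 x0 - (\<chi> r. 2 * \<rho>)) (Y d0 x0 + (\<chi> r. 2 * \<rho>))"
      by (auto simp: B_def mem_box_cart abs_le_iff algebra_simps)
    then have "compact B" by (simp add: compact_cbox)
    moreover have sub: "B \<subseteq> snd d0 ` fst d0" using cube by (auto simp: B_def simp del: image_iff)
    ultimately have "compactin (top_of_set (snd d0 ` fst d0)) B" by (simp add: compactin_subtopology)
    from image_compactin[OF this N.chart_inv_continuous[OF d0]] have "closedin (mtop N) (chart_inv d0 ` B)"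
      using N.M compactin_imp_closedin unfolding smooth_manifold_def by blast
    moreover have "chart_inv d0 ` B = {q \<in> fst d0. \<forall>r. \<bar>co r q\<bar> \<le> 2}"
    proof -
      have "\<bar>co r q\<bar> \<le> 2 \<longleftrightarrow> \<bar>snd d0 q $ r - Y d0 x0 $ r\<bar> \<le> 2 * \<rho>" for r q
        using \<rho> by (simp add: co_def abs_divide pos_divide_le_eq)
      then have "{q \<in> fst d0. \<forall>r. \<bar>co r q\<bar> \<le> 2} = {q \<in> fst d0. snd d0 q \<in> B}" by (simp add: B_def)
      also have "\<dots> = chart_inv d0 ` B"
      proof (rule Set.set_eqI, rule iffI)
        fix q assume "q \<in> {q \<in> fst d0. snd d0 q \<in> B}"
        then have q: "q \<in> fst d0" "snd d0 q \<in> B" by blast+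
        then show "q \<in> chart_inv d0 ` B" using N.chart_inv_left[OF d0 q(1)] by (metis image_eqI)
      next
        fix q assume "q \<in> chart_inv d0 ` B"
        then obtain y where y: "y \<in> B" "q = chart_inv d0 y" by blast
        then have "y \<in> snd d0 ` fst d0" using sub by blast
        then show "q \<in> {q \<in> fst d0. snd d0 q \<in> B}" using y N.chart_inv_mem[of y d0] N.chart_inv_right[of y d0] by simp
      qed
      finally show ?thesis by simp
    qed
    ultimately have "openin (mtop N) (points N - {q \<in> fst d0. \<forall>r. \<bar>co r q\<bar> \<le> 2})" by auto
    moreover have "points N - {q \<in> fst d0. \<forall>r. \<bar>co r q\<bar> \<le> 2} = CC" by (auto simp: CC_def)
    ultimately show ?thesis by simp
  qed
  show "V \<in> cover \<Longrightarrow> openin (mtop M) V" using pre_openin Q W C by (auto simp: cover_def)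
qed

lemma cover_points: "points M \<subseteq> \<Union>cover"
proof
  fix x assume x: "x \<in> points M"
  then have ux: "u x \<in> points N" by (rule smooth_map_points[OF smooth_u])
  consider "u x \<in> CC" | r where "u x \<in> fst d0" "\<bar>co r (u x)\<bar> > 1" | "u x \<in> fst d0" "\<And>r. \<bar>co r (u x)\<bar> \<le> 1"
    using ux by (auto simp: CC_def) (meson linorder_not_le)
  then show "x \<in> \<Union>cover"
  proof cases
    case 1 then show ?thesis using x by (auto simp: cover_def pre_def)
  next
    case 2
    then have "u x \<in> WW r 1 \<or> u x \<in> WW r (-1)" by (auto simp: WW_def abs_if split: if_splits)
    then show ?thesis using x by (auto simp: cover_def pre_def)
  next
    case 3
    then have "\<bar>co r (u x)\<bar> < 2" for r using 3(2)[of r] by linarith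
    then have "u x \<in> QQ" using 3(1) by (simp add: QQ_def)
    then show ?thesis using x by (auto simp: cover_def pre_def)
  qed
qed

end

locale star_cover = cube_setup M gM N gN u dil F F' P d0 x0 \<rho> S S' b
  for M :: "('a, real^'m) mfd" and gM and N :: "('b, real^'n) mfd" and gN u dil F F' P d0 x0 \<rho> S S' b +
  fixes I :: "'a set" and \<phi> :: "'a \<Rightarrow> 'a \<Rightarrow> real" and K :: "'a \<Rightarrow> 'a set"
  assumes I: "finite I" "I \<subseteq> points M" and \<phi>: "\<And>i. i \<in> I \<Longrightarrow> smooth_fn M (points M) (\<phi> i)"
    and K: "\<And>i. i \<in> I \<Longrightarrow> closedin (mtop M) (K i)" and \<phi>K: "\<And>i y. i \<in> I \<Longrightarrow> y \<in> points M - K i \<Longrightarrow> \<phi> i y = 0"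
    and \<phi>_sum: "\<And>y. y \<in> points M \<Longrightarrow> (\<Sum>i\<in>I. \<phi> i y) = 1"
    and star: "\<And>y. y \<in> points M \<Longrightarrow> \<exists>V\<in>cover. insert y {i \<in> I. y \<in> K i} \<subseteq> V"
begin

abbreviation tuples :: "nat \<Rightarrow> (nat \<Rightarrow> 'a) set" where "tuples n \<equiv> PiE {..n} (\<lambda>_. I)"

lemma tuplesD: "T \<in> tuples n \<Longrightarrow> j \<le> n \<Longrightarrow> T j \<in> I" by auto

lemma J_row_\<phi>:
  assumes x: "x \<in> points M" shows "(\<Sum>i\<in>I. J (f(k := \<phi> i)) x) = 0"
proof -
  have "(\<Sum>i\<in>I. 1 * J (f(k := \<phi> i)) x) = J (f(k := \<lambda>x. \<Sum>i\<in>I. 1 * \<phi> i x)) x"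
    by (rule J_sum_row[OF I(1) \<phi> x, symmetric])
  also have "\<dots> = 0" by (rule J_const_row[OF openin_topspace x, of _ k 1]) (simp add: \<phi>_sum)
  finally show ?thesis by simp
qed

definition Jt :: "(nat \<Rightarrow> 'a) \<Rightarrow> 'a \<Rightarrow> real" where "Jt T = J (\<lambda>r. \<phi> (T (b r)))"

text \<open>The Whitney form of the cochain \<open>Psi\<close>, evaluated on the horizontal distribution.\<close>

definition Om :: "'a \<Rightarrow> real" where
  "Om x = (\<Sum>T\<in>tuples CARD('n). Psi (\<lambda>j. u (T j)) * (\<phi> (T 0) x * Jt T x))"

text \<open>As \<open>K (T j)\<close> is closed, \<open>\<phi> (T j)\<close> vanishes near a point
  outside it, together with its differential.\<close>

lemma Jt_zero:
  assumes T: "T \<in> tuples CARD('n)" and x: "x \<in> points M" and j: "j \<le> CARD('n)" "x \<notin> K (T j)"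
  shows "\<phi> (T 0) x * Jt T x = 0"
proof (cases "j = 0")
  case True
  then show ?thesis using \<phi>K[OF tuplesD[OF T j(1)], of x] x j by simp
next
  case False
  then obtain r where r: "b r = j" using b j(1) by (metis One_nat_def Suc_leI atLeastAtMost_iff bij_betw_imp_surj_on gr0I imageE)
  have Tj: "T j \<in> I" by (rule tuplesD[OF T j(1)])
  have "Jt T x = 0"
    unfolding Jt_def
    by (rule J_const_row[of "points M - K (T j)" _ _ r 0]) (use K[OF Tj] \<phi>K[OF Tj] x j r in auto)
  then show ?thesis by simp
qed

text \<open>With \<open>Psi\<close> written as the coboundary of \<open>C\<close>, each face term is
  first summed over the omitted vertex. For \<open>k > 0\<close> this adds up the differentials of
  the partition of unity and gives 0; for \<open>k = 0\<close> it adds up the functions and gives 1.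
  What remains is a combination of terms to which \<open>integral_J\<close> applies.\<close>

lemma integral_Om_zero:
  assumes p: "CARD('n) = Suc p"
    and C: "\<And>T x. T \<in> tuples (Suc p) \<Longrightarrow> x \<in> points M \<Longrightarrow> (\<And>j. j \<le> Suc p \<Longrightarrow> x \<in> K (T j)) \<Longrightarrow>
      Psi (\<lambda>j. u (T j)) = (\<Sum>k\<le>Suc p. (-1) ^ k * C (\<lambda>l. T (skip k l)))"
  shows "(\<integral>x. weight x * Om x \<partial>vol) = 0"
proof -
  define Jd where "Jd T = J (\<lambda>r. \<phi> (T (b r - 1)))" for T
  have sJ: "smooth_fn M (points M) (\<phi> (T (b r - 1)))" if "T \<in> tuples p" for T r
    by (rule \<phi>[OF tuplesD[OF that]]) (use b_bounds[of r] p in simp)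
  have Om: "Om x = (\<Sum>T\<in>tuples p. C T * Jd T x)" if x: "x \<in> points M" for x
  proof -
    have "Om x = (\<Sum>T\<in>tuples (Suc p). \<Sum>k\<le>Suc p. (-1) ^ k * (C (\<lambda>l. T (skip k l)) * (\<phi> (T 0) x * Jt T x)))"
      unfolding Om_def p
    proof (intro sum.cong refl)
      fix T assume T: "T \<in> tuples (Suc p)"
      show "Psi (\<lambda>j. u (T j)) * (\<phi> (T 0) x * Jt T x) = (\<Sum>k\<le>Suc p. (-1) ^ k * (C (\<lambda>l. T (skip k l)) * (\<phi> (T 0) x * Jt T x)))"
      proof (cases "\<forall>j\<le>Suc p. x \<in> K (T j)")
        case True
        then show ?thesis using C[OF T x] by (simp add: sum_distrib_right mult.assoc del: sum.atMost_Suc)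
      next
        case False
        then obtain j where "j \<le> Suc p" "x \<notin> K (T j)" by blast
        then have "\<phi> (T 0) x * Jt T x = 0" using Jt_zero[of T x j] T p x by simp
        then show ?thesis by (simp only: mult_zero_right sum.neutral_const)
      qed
    qed
    also have "\<dots> = (\<Sum>k\<le>Suc p. (-1) ^ k * (\<Sum>T\<in>tuples (Suc p). C (\<lambda>l. T (skip k l)) * (\<phi> (T 0) x * Jt T x)))"
      unfolding sum_distrib_left by (rule sum.swap)
    also have "\<dots> = (\<Sum>k\<le>Suc p. if k = 0 then \<Sum>T\<in>tuples p. C T * Jd T x else 0)"
    proof (intro sum.cong refl)
      fix k assume k: "k \<in> {..Suc p}"
      have ins: "(\<lambda>l. ins k i T (skip k l)) = T" for i T by (auto simp: ins_def skip_def fun_eq_iff)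
      have "(\<Sum>T\<in>tuples (Suc p). C (\<lambda>l. T (skip k l)) * (\<phi> (T 0) x * Jt T x))
          = (\<Sum>T\<in>tuples p. C T * (\<Sum>i\<in>I. \<phi> (ins k i T 0) x * Jt (ins k i T) x))"
        using sum_PiE_ins[of k p "\<lambda>T. C (\<lambda>l. T (skip k l)) * (\<phi> (T 0) x * Jt T x)" I] k
        by (simp add: ins sum_distrib_left)
      also have "\<dots> = (if k = 0 then \<Sum>T\<in>tuples p. C T * Jd T x else 0)"
      proof (cases "k = 0")
        case True
        have "Jt (ins k i T) x = Jd T x" for i T
        proof -
          have "ins k i T (b r) = T (b r - 1)" for r using b_bounds[of r] True by (simp add: ins_def)
          then show ?thesis by (simp add: Jt_def Jd_def)
        qed
        moreover have "ins k i T 0 = i" for i :: 'a and T using True by (simp add: ins_def)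
        ultimately have "(\<Sum>i\<in>I. \<phi> (ins k i T 0) x * Jt (ins k i T) x) = (\<Sum>i\<in>I. \<phi> i x) * Jd T x" for T
          by (simp only: sum_distrib_right)
        then have "(\<Sum>i\<in>I. \<phi> (ins k i T 0) x * Jt (ins k i T) x) = Jd T x" for T
          using \<phi>_sum[OF x] by simp
        then show ?thesis using True by simp
      next
        case False
        then obtain r0 where r0: "b r0 = k"
          using b k p by (metis One_nat_def Suc_leI atLeastAtMost_iff atMost_iff bij_betw_imp_surj_on gr0I imageE)
        have "(\<Sum>i\<in>I. \<phi> (ins k i T 0) x * Jt (ins k i T) x) = 0" for T
        proof -
          let ?f = "\<lambda>r. \<phi> (if b r < k then T (b r) else T (b r - 1))"
          have "Jt (ins k i T) x = J (?f(r0 := \<phi> i)) x" for i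
          proof -
            have "(\<lambda>r. \<phi> (ins k i T (b r))) = ?f(r0 := \<phi> i)"
            proof
              fix r
              have "b r = k \<longleftrightarrow> r = r0" using r0 bij_betw_imp_inj_on[OF b] by (metis UNIV_I inj_onD)
              then show "\<phi> (ins k i T (b r)) = (?f(r0 := \<phi> i)) r" by (auto simp: ins_def)
            qed
            then show ?thesis by (simp only: Jt_def)
          qed
          moreover have "ins k i T 0 = T 0" for i :: 'a using False by (simp add: ins_def)
          ultimately have "(\<Sum>i\<in>I. \<phi> (ins k i T 0) x * Jt (ins k i T) x) = (\<Sum>i\<in>I. \<phi> (T 0) x * J (?f(r0 := \<phi> i)) x)"
            by (simp only:)
          then show ?thesis using J_row_\<phi>[OF x, of ?f r0] by (simp only: sum_distrib_left[symmetric] mult_zero_right)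
        qed
        then show ?thesis using False by simp
      qed
      finally show "(-1) ^ k * (\<Sum>T\<in>tuples (Suc p). C (\<lambda>l. T (skip k l)) * (\<phi> (T 0) x * Jt T x))
          = (if k = 0 then \<Sum>T\<in>tuples p. C T * Jd T x else 0)" by simp
    qed
    finally show ?thesis by simp
  qed
  have z: "(\<integral>x. weight x * Jd T x \<partial>vol) = 0" if "T \<in> tuples p" for T
    unfolding Jd_def by (rule integral_J[OF sJ[OF that]])
  have "(\<integral>x. weight x * Om x \<partial>vol) = (\<integral>x. (\<Sum>T\<in>tuples p. C T * (weight x * Jd T x)) \<partial>vol)"
    by (rule Bochner_Integration.integral_cong) (auto simp: Om sum_distrib_left mult_ac)
  also have "\<dots> = (\<Sum>T\<in>tuples p. \<integral>x. C T * (weight x * Jd T x) \<partial>vol)"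
    by (rule Bochner_Integration.integral_sum) (rule integrable_mult_right, unfold Jd_def, rule integrable_J[OF sJ])
  also have "\<dots> = 0" using z by simp
  finally show ?thesis .
qed

end

lemma sum_PiE_0: "(\<Sum>T\<in>PiE {..0::nat} (\<lambda>_. I). h (T 0)) = (\<Sum>i\<in>I. h i)"
  by (rule sum.reindex_bij_witness[where i="\<lambda>i l. if l = 0 then i else undefined" and j="\<lambda>T. T 0"])
     (auto simp: PiE_iff extensional_def fun_eq_iff)

section \<open>Comparison of the Whitney form with the bump form pulled back from
  \<open>N\<close>\<close>

context star_cover
begin

text \<open>At such points every term of the Whitney form that can be nonzero has all its vertices
  in \<open>V\<close>. These sets are open and still cover, so what is known of \<open>Psi\<close>
  on a member of the cover becomes a local formula for \<open>Om\<close>.\<close>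

definition PV :: "'a set \<Rightarrow> 'a set" where "PV V = {x \<in> V. {i \<in> I. x \<in> K i} \<subseteq> V}"

lemma PV_openin:
  assumes "V \<in> cover" shows "openin (mtop M) (PV V)"
proof -
  have V: "openin (mtop M) V" by (rule cover_openin[OF assms])
  then have "PV V = V - (\<Union>i\<in>I - V. K i)" using openin_subset[OF V] by (auto simp: PV_def)
  then show ?thesis using V I(1) K by (auto intro!: openin_diff closedin_Union)
qed

lemma PV_cover: "x \<in> points M \<Longrightarrow> \<exists>V\<in>cover. x \<in> PV V"
  using star[of x] by (auto simp: PV_def)

lemma WW_cover: "s \<in> {1, -1} \<Longrightarrow> pre (WW r s) \<in> cover" by (auto simp: cover_def)

lemma PV_WW_udom: "x \<in> PV (pre (WW r s)) \<Longrightarrow> x \<in> udom d0"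
  by (auto simp: PV_def pre_def WW_def udom_def)

text \<open>The step function seen through the partition of unity: its values at the index points,
  interpolated. It is to be compared with the step function \<open>g\<close> itself.\<close>

definition G :: "'n \<Rightarrow> 'a \<Rightarrow> real" where "G r x = (\<Sum>i\<in>I. S (co r (u i)) * \<phi> i x)"
definition g :: "'n \<Rightarrow> 'a \<Rightarrow> real" where "g r x = S (co r (u x))"

lemma smooth_G: "smooth_fn M (points M) (G r)"
  unfolding G_def[abs_def] by (intro smooth_fn_sum smooth_fn_mult smooth_fn_const openin_topspace \<phi>)

definition psi :: "'n \<Rightarrow> real^'n \<Rightarrow> real" where "psi r y = S ((y $ r - Y d0 x0 $ r) / \<rho>)"

lemma g_psi: "g r x = psi r (Y d0 x)" by (simp add: g_def psi_def co_def Y_def)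

lemma smooth_psi: "smooth_on UNIV (psi r)"
proof -
  have "smooth_on UNIV (\<lambda>y::real^'n. (y $ r - Y d0 x0 $ r) / \<rho>)"
    by (intro smooth_on_divide smooth_on_diff smooth_on_const smooth_on_compose_linear[OF bounded_linear_vec_nth] smooth_on_id)
       (use \<rho> in auto)
  from smooth_on_compose[OF open_UNIV open_UNIV this S(1)] show ?thesis by (simp add: psi_def[abs_def])
qed

lemma partial_psi: "partial a (psi r) y = (if a = r then S' ((y $ r - Y d0 x0 $ r) / \<rho>) / \<rho> else 0)"
proof -
  have 1: "((\<lambda>y::real^'n. (y $ r - Y d0 x0 $ r) / \<rho>) has_derivative (\<lambda>v. v $ r / \<rho>)) (at y)"
    using \<rho> by (auto intro!: derivative_eq_intros bounded_linear_imp_has_derivative bounded_linear_vec_nth)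
  have "(psi r has_derivative (\<lambda>v. S' ((y $ r - Y d0 x0 $ r) / \<rho>) * (v $ r / \<rho>))) (at y)"
    unfolding psi_def[abs_def] by (rule has_derivative_compose[OF 1 S(2)[unfolded has_field_derivative_def]])
  then show ?thesis by (simp add: partial_def frechet_derivative_at[symmetric] axis_def)
qed

lemma smooth_g: "smooth_fn M (udom d0) (g r)"
  unfolding g_psi[abs_def]
  by (rule smooth_fn_compose[OF openin_udom[OF d0] smooth_Y[OF d0] open_UNIV smooth_psi]) simp

lemma g_WW: "s \<in> {1, -1} \<Longrightarrow> x \<in> PV (pre (WW r s)) \<Longrightarrow> g r x = S s"
  unfolding g_def by (rule S_const) (auto simp: PV_def pre_def WW_def)

lemma G_WW:
  assumes s: "s \<in> {1, -1}" and x: "x \<in> PV (pre (WW r s))" shows "G r x = S s"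
proof -
  have xM: "x \<in> points M" using x by (auto simp: PV_def pre_def)
  have "S (co r (u i)) * \<phi> i x = S s * \<phi> i x" if i: "i \<in> I" for i
  proof (cases "x \<in> K i")
    case True
    then have "s * co r (u i) > 1" using x i by (auto simp: PV_def pre_def WW_def)
    then show ?thesis using S_const[OF s] by simp
  next
    case False
    then show ?thesis using \<phi>K[OF i, of x] xM by simp
  qed
  then have "G r x = (\<Sum>i\<in>I. S s * \<phi> i x)" unfolding G_def by (intro sum.cong refl)
  then show ?thesis using \<phi>_sum[OF xM] by (simp add: sum_distrib_left[symmetric])
qed

lemma Om_terms_zero:
  assumes x: "x \<in> PV V" and V: "V \<subseteq> points M" and 0: "\<And>T. (\<And>j. j \<le> CARD('n) \<Longrightarrow> T j \<in> V) \<Longrightarrow> Psi (\<lambda>j. u (T j)) = 0"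
  shows "Om x = 0"
  unfolding Om_def
proof (intro sum.neutral ballI)
  fix T assume T: "T \<in> tuples CARD('n)"
  have xM: "x \<in> points M" using x V by (auto simp: PV_def)
  show "Psi (\<lambda>j. u (T j)) * (\<phi> (T 0) x * Jt T x) = 0"
  proof (cases "\<forall>j\<le>CARD('n). x \<in> K (T j)")
    case True
    have "T j \<in> V" if "j \<le> CARD('n)" for j
      using True tuplesD[OF T that] that x by (auto simp: PV_def)
    then show ?thesis using 0 by simp
  next
    case False
    then obtain j where "j \<le> CARD('n)" "x \<notin> K (T j)" by blast
    then show ?thesis using Jt_zero[OF T xM] by simp
  qed
qed

lemma Om_WW: "s \<in> {1, -1} \<Longrightarrow> x \<in> PV (pre (WW r s)) \<Longrightarrow> Om x = 0"
  by (rule Om_terms_zero) (auto simp: pre_def intro!: Psi_WW[where r=r and s=s])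

lemma Om_CC: "x \<in> PV (pre CC) \<Longrightarrow> Om x = 0"
  by (rule Om_terms_zero) (auto simp: pre_def intro!: Psi_CC)

text \<open>The vertices are summed out one after the other, beginning with the last. In the
  difference of step values at two consecutive vertices, the first value turns the row into
  \<open>G r\<close>, while the second is multiplied by the sum of the differentials of the
  partition of unity, which is 0.\<close>

lemma Om_QQ:
  assumes x: "x \<in> PV (pre QQ)" shows "Om x = J G x"
proof -
  have xM: "x \<in> points M" using x by (auto simp: PV_def pre_def)
  define a where "a r i = S (co r (u i))" for r i
  define P' where "P' k T = (\<Prod>r | b r \<le> k. a r (T (b r)) - a r (T (b r - 1)))" for k T
  define f where "f k T r = (if b r \<le> k then \<phi> (T (b r)) else G r)" for k T r
  \<comment> \<open>The Whitney sum after the vertices beyond \<open>k\<close> have been summed out: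
    it leads from \<open>Om x\<close> at \<open>k = CARD('n)\<close> to \<open>J G x\<close> at
    \<open>k = 0\<close>.\<close>
  define H where "H k = (\<Sum>T\<in>tuples k. \<phi> (T 0) x * P' k T * J (f k T) x)" for k
  have "H (Suc k) = H k" if k: "Suc k \<le> CARD('n)" for k
  proof -
    obtain r0 where r0: "b r0 = Suc k" using b k by (metis atLeastAtMost_iff bij_betw_imp_surj_on imageE le_add1 plus_1_eq_Suc)
    have ne: "b r \<noteq> Suc k" if "r \<noteq> r0" for r using that r0 bij_betw_imp_inj_on[OF b] by (metis UNIV_I inj_onD)
    have "H (Suc k) = (\<Sum>T\<in>tuples k. \<Sum>i\<in>I. \<phi> (ins (Suc k) i T 0) x * P' (Suc k) (ins (Suc k) i T) * J (f (Suc k) (ins (Suc k) i T)) x)"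
      unfolding H_def by (rule sum_PiE_ins) simp
    also have "\<dots> = H k"
      unfolding H_def
    proof (intro sum.cong refl)
      fix T assume T: "T \<in> tuples k"
      have P': "P' (Suc k) (ins (Suc k) i T) = (a r0 i - a r0 (T k)) * P' k T" for i
      proof -
        have "{r. b r \<le> Suc k} = insert r0 {r. b r \<le> k}" using r0 ne by (auto simp: le_Suc_eq)
        moreover have "r0 \<notin> {r. b r \<le> k}" using r0 by simp
        moreover have "(\<Prod>r | b r \<le> k. a r (ins (Suc k) i T (b r)) - a r (ins (Suc k) i T (b r - 1))) = P' k T"
          unfolding P'_def by (intro prod.cong refl) (auto simp: ins_def)
        ultimately show ?thesis unfolding P'_def using r0 by (simp add: ins_def)
      qed
      have f': "f (Suc k) (ins (Suc k) i T) = (f k T)(r0 := \<phi> i)" for i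
        using r0 ne by (auto simp: f_def ins_def fun_eq_iff le_Suc_eq)
      have fG: "(f k T)(r0 := G r0) = f k T" using r0 by (auto simp: f_def fun_eq_iff)
      have 1: "(\<Sum>i\<in>I. a r0 i * J ((f k T)(r0 := \<phi> i)) x) = J (f k T) x"
        using J_sum_row[where f="f k T" and k=r0 and r="a r0" and g=\<phi>, OF I(1) \<phi> xM] fG by (simp add: G_def[abs_def] a_def del: fun_upd_apply)
      have "(\<Sum>i\<in>I. \<phi> (ins (Suc k) i T 0) x * P' (Suc k) (ins (Suc k) i T) * J (f (Suc k) (ins (Suc k) i T)) x)
        = (\<Sum>i\<in>I. \<phi> (T 0) x * P' k T * (a r0 i * J ((f k T)(r0 := \<phi> i)) x) - \<phi> (T 0) x * P' k T * a r0 (T k) * J ((f k T)(r0 := \<phi> i)) x)"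
        unfolding P' f' by (intro sum.cong refl) (simp add: ins_def algebra_simps del: fun_upd_apply)
      also have "\<dots> = \<phi> (T 0) x * P' k T * (\<Sum>i\<in>I. a r0 i * J ((f k T)(r0 := \<phi> i)) x) - \<phi> (T 0) x * P' k T * a r0 (T k) * (\<Sum>i\<in>I. J ((f k T)(r0 := \<phi> i)) x)"
        by (simp only: sum_subtractf sum_distrib_left)
      also have "\<dots> = \<phi> (T 0) x * P' k T * J (f k T) x"
        unfolding 1 J_row_\<phi>[OF xM] by simp
      finally show "(\<Sum>i\<in>I. \<phi> (ins (Suc k) i T 0) x * P' (Suc k) (ins (Suc k) i T) * J (f (Suc k) (ins (Suc k) i T)) x)
        = \<phi> (T 0) x * P' k T * J (f k T) x" .
    qed
    finally show ?thesis .
  qed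
  then have "H k = H 0" if "k \<le> CARD('n)" for k using that by (induction k) auto
  from this[OF order.refl] have "H CARD('n) = H 0" .
  also have "H 0 = J G x"
  proof -
    have "b r = 0 \<longleftrightarrow> False" for r using b_bounds(1)[of r] by simp
    then have "P' 0 T = 1" "f 0 T = G" for T by (simp_all only: P'_def f_def fun_eq_iff le_zero_eq if_False prod.empty empty_def[symmetric] simp_thms)
    then have "H 0 = (\<Sum>i\<in>I. \<phi> i x * J G x)" unfolding H_def using sum_PiE_0[of "\<lambda>i. \<phi> i x * J G x"] by simp
    then show ?thesis using \<phi>_sum[OF xM] by (simp add: sum_distrib_right[symmetric])
  qed
  also have "H CARD('n) = Om x"
    unfolding H_def Om_def
  proof (intro sum.cong refl)
    fix T assume T: "T \<in> tuples CARD('n)"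
    have f: "f CARD('n) T = (\<lambda>r. \<phi> (T (b r)))" using b_bounds by (simp add: f_def fun_eq_iff)
    show "\<phi> (T 0) x * P' CARD('n) T * J (f CARD('n) T) x = Psi (\<lambda>j. u (T j)) * (\<phi> (T 0) x * Jt T x)"
    proof (cases "\<forall>j\<le>CARD('n). x \<in> K (T j)")
      case True
      have "u (T j) \<in> QQ" if "j \<le> CARD('n)" for j
        using True tuplesD[OF T that] that x by (auto simp: PV_def pre_def)
      then have "Psi (\<lambda>j. u (T j)) = P' CARD('n) T"
        unfolding Psi_def P'_def a_def using b_bounds by simp
      then show ?thesis by (simp add: f Jt_def)
    next
      case False
      then obtain j where "j \<le> CARD('n)" "x \<notin> K (T j)" by blast
      then have "\<phi> (T 0) x * Jt T x = 0" using Jt_zero[OF T xM] by simp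
      then show ?thesis by (auto simp: f Jt_def)
    qed
  qed
  finally show ?thesis by simp
qed

definition FF :: "('n \<Rightarrow> 'a \<Rightarrow> real) \<Rightarrow> 'a \<Rightarrow> real" where
  "FF f x = (if x \<in> pre QQ then weight x * (rho d0 (Y d0 x) * jac d0 f x) else 0)"

text \<open>The row \<open>r\<close> is constant on the slabs where its own step is constant. So the
  Jacobian vanishes before the boundary of the cube is reached, and the cut-off integrand
  \<open>FF f\<close> is continuous.\<close>

definition adm :: "('n \<Rightarrow> 'a \<Rightarrow> real) \<Rightarrow> bool" where
  "adm f \<longleftrightarrow> (\<forall>r. smooth_fn M (udom d0) (f r)) \<and>
     (\<forall>r. \<forall>s\<in>{1, -1}. \<exists>c. \<forall>x\<in>PV (pre (WW r s)). f r x = c)"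

text \<open>The closed region, inside the preimage of the cube, where no row is forced to be
  constant.\<close>

definition "K0 = points M - PV (pre CC) - (\<Union>r. PV (pre (WW r 1)) \<union> PV (pre (WW r (-1))))"

lemma pre_QQ_udom: "pre QQ \<subseteq> udom d0" by (auto simp: pre_def QQ_def udom_def)

lemma closed_K0: "closedin (mtop M) K0"
proof -
  have "pre CC \<in> cover" by (simp add: cover_def)
  then have "openin (mtop M) (PV (pre CC) \<union> (\<Union>r. PV (pre (WW r 1)) \<union> PV (pre (WW r (-1)))))"
    by (intro openin_Un openin_Union PV_openin) (auto intro!: openin_Un PV_openin WW_cover)
  moreover have "K0 = points M - (PV (pre CC) \<union> (\<Union>r. PV (pre (WW r 1)) \<union> PV (pre (WW r (-1)))))"
    by (auto simp: K0_def)
  ultimately show ?thesis by (simp only: closedin_diff[OF closedin_topspace])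
qed

lemma K0_QQ: "x \<in> K0 \<Longrightarrow> x \<in> PV (pre QQ)"
proof -
  assume x: "x \<in> K0"
  then obtain V where "V \<in> cover" "x \<in> PV V" using PV_cover[of x] by (auto simp: K0_def)
  then show ?thesis using x by (auto simp: cover_def K0_def)
qed

lemma K0_cases:
  assumes "x \<in> points M"
  obtains "x \<in> K0" | "x \<in> PV (pre CC)" | r s where "s \<in> {1, -1}" "x \<in> PV (pre (WW r s))"
  using assms unfolding K0_def by blast

lemma PV_CC_QQ: "x \<in> PV (pre CC) \<Longrightarrow> x \<notin> pre QQ"
  using QQ_CC by (auto simp: PV_def pre_def)

lemma jac_adm_zero:
  assumes f: "adm f" and s: "s \<in> {1, -1}" and x: "x \<in> PV (pre (WW r s))" shows "jac d0 f x = 0"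
proof -
  obtain c where c: "\<And>y. y \<in> PV (pre (WW r s)) \<Longrightarrow> f r y = c" using f s unfolding adm_def by meson
  show ?thesis by (rule jac_const_row[where f=f and k=r, OF d0 PV_openin[OF WW_cover[OF s]] x PV_WW_udom[OF x] c])
qed

lemma FF_off_K0:
  assumes f: "adm f" and x: "x \<in> points M - K0" shows "FF f x = 0"
proof -
  have "x \<in> points M" using x by simp
  then show ?thesis
    by (cases rule: K0_cases) (use x jac_adm_zero[OF f] PV_CC_QQ in \<open>auto simp: FF_def\<close>)
qed

lemma adm_smooth: "adm f \<Longrightarrow> smooth_fn M (udom d0) (f r)"
  by (simp add: adm_def)

lemma FF_continuous:
  assumes f: "adm f" shows "continuous_map (mtop M) euclideanreal (FF f)"
proof (rule pasting_lemma[where I="{pre QQ, points M - K0}" and T="\<lambda>W. W" and f="\<lambda>_. FF f"])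
  have B: "openin (mtop M) (pre QQ)" by (rule cover_openin) (simp add: cover_def)
  have C: "openin (mtop M) (points M - K0)" using closed_K0 by blast
  fix W assume W: "W \<in> {pre QQ, points M - K0}"
  then show "openin (mtop M) W" using B C by blast
  have "smooth_fn M (pre QQ) (\<lambda>x. rho d0 (Y d0 x) * jac d0 f x)"
  proof (intro smooth_fn_mult B)
    show "smooth_fn M (pre QQ) (\<lambda>x. rho d0 (Y d0 x))"
      by (rule smooth_fn_compose[OF B smooth_fn_subset[OF smooth_Y[OF d0] pre_QQ_udom] N.chart_image_open[OF d0] smooth_rho[OF d0]])
         (use Y_image pre_QQ_udom in blast)
    show "smooth_fn M (pre QQ) (jac d0 f)"
      by (rule smooth_fn_subset[OF smooth_jac[OF d0 openin_udom[OF d0] subset_refl adm_smooth[OF f]] pre_QQ_udom])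
  qed
  from continuous_map_real_mult[OF continuous_map_from_subtopology[OF weight_continuous] smooth_fn_continuous[OF B this]]
  have 1: "continuous_map (subtopology (mtop M) (pre QQ)) euclideanreal (FF f)"
    by (rule continuous_map_eq) (simp add: FF_def)
  have "continuous_map (subtopology (mtop M) (points M - K0)) euclideanreal (\<lambda>x. 0)" by simp
  then have 2: "continuous_map (subtopology (mtop M) (points M - K0)) euclideanreal (FF f)"
    by (rule continuous_map_eq) (use FF_off_K0[OF f] in simp)
  show "continuous_map (subtopology (mtop M) W) euclideanreal (FF f)" using W 1 2 by blast
next
  fix x assume "x \<in> topspace (mtop M)"
  moreover have "K0 \<subseteq> pre QQ" using K0_QQ by (auto simp: PV_def)
  ultimately show "\<exists>W. W \<in> {pre QQ, points M - K0} \<and> x \<in> W \<and> FF f x = FF f x" by blast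
qed auto

lemma FF_integrable: "adm f \<Longrightarrow> integrable vol (FF f)"
  by (rule continuous_integrable_vol[OF FF_continuous])

lemma adm_upd:
  assumes f: "adm f" and h: "smooth_fn M (udom d0) h" "\<And>s. s \<in> {1, -1} \<Longrightarrow> \<exists>c. \<forall>x\<in>PV (pre (WW k s)). h x = c"
  shows "adm (f(k := h))"
  using f h unfolding adm_def by simp

text \<open>A cutoff function that is 1 near \<open>K0\<close> makes the row \<open>k\<close> compactly supported over the chart. Off \<open>K0\<close>,
  some row is locally constant or the cutoff function is 0.\<close>

lemma integral_FF_zero:
  assumes f: "adm f" and fk: "\<And>s x. s \<in> {1, -1} \<Longrightarrow> x \<in> PV (pre (WW k s)) \<Longrightarrow> f k x = 0"
  shows "(\<integral>x. FF f x \<partial>vol) = 0"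
proof -
  have B: "openin (mtop M) (pre QQ)" by (rule cover_openin) (simp add: cover_def)
  have KB: "K0 \<subseteq> pre QQ" using K0_QQ by (auto simp: PV_def)
  define Q where "Q x = (if x \<in> K0 then pre QQ else points M - K0)" for x
  have Q: "openin (mtop M) (Q x) \<and> x \<in> Q x" if "x \<in> points M" for x
    using B KB closed_K0 that by (auto simp: Q_def)
  obtain I' and \<phi>' :: "'a \<Rightarrow> 'a \<Rightarrow> real" and K' where I': "finite I'" "I' \<subseteq> points M"
    "\<And>i. i \<in> I' \<Longrightarrow> smooth_fn M (points M) (\<phi>' i)" "\<And>i. i \<in> I' \<Longrightarrow> closedin (mtop M) (K' i)"
    "\<And>i y. i \<in> I' \<Longrightarrow> y \<in> points M - K' i \<Longrightarrow> \<phi>' i y = 0"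
    "\<And>y. y \<in> points M \<Longrightarrow> (\<Sum>i\<in>I'. \<phi>' i y) = 1"
    "\<And>y. y \<in> points M \<Longrightarrow> \<exists>x\<in>points M. insert y {i \<in> I'. y \<in> K' i} \<subseteq> Q x"
    "\<And>i. i \<in> I' \<Longrightarrow> K' i \<subseteq> Q i"
  proof (rule star_partition_of_unity[OF compact])
    show "openin (mtop M) (Q x) \<and> x \<in> Q x" if "x \<in> points M" for x using Q[OF that] by simp
  qed (rule that)
  \<comment> \<open>Members with index in \<open>K0\<close> vanish off a closed subset of
    \<open>pre QQ\<close>, and the other members vanish near \<open>K0\<close>; this yields both
    properties of the cutoff function.\<close>
  define \<kappa> where "\<kappa> x = (\<Sum>i\<in>I' \<inter> K0. \<phi>' i x)" for x
  define C where "C = (\<Union>i\<in>I' \<inter> K0. K' i)"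
  define W where "W = points M - (\<Union>i\<in>I' - K0. K' i)"
  have "K' i \<subseteq> pre QQ" if "i \<in> I' \<inter> K0" for i using I'(8)[of i] that by (simp add: Q_def)
  then have C: "closedin (mtop M) C" "C \<subseteq> pre QQ"
    unfolding C_def using I'(1,4) by (auto intro!: closedin_Union)
  have W: "openin (mtop M) W" using I'(1,4) by (auto simp: W_def intro!: openin_diff closedin_Union)
  have "K' i \<inter> K0 = {}" if "i \<in> I' - K0" for i using I'(8)[of i] that by (auto simp: Q_def)
  then have K0W: "K0 \<subseteq> W" using closedin_subset[OF closed_K0] unfolding W_def by blast
  have \<kappa>1: "\<kappa> x = 1" if "x \<in> W" for x
  proof -
    have "(\<Sum>i\<in>I'. \<phi>' i x) = (\<Sum>i\<in>I' \<inter> K0. \<phi>' i x)"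
      by (rule sum.mono_neutral_right) (use I'(1,5) that in \<open>auto simp: W_def\<close>)
    then show ?thesis using I'(6)[of x] that by (simp add: \<kappa>_def W_def)
  qed
  have \<kappa>0: "\<kappa> x = 0" if "x \<in> points M - C" for x
    unfolding \<kappa>_def by (rule sum.neutral) (use that I'(5) in \<open>auto simp: C_def\<close>)
  have s\<kappa>: "smooth_fn M (points M) \<kappa>" unfolding \<kappa>_def[abs_def] by (intro smooth_fn_sum openin_topspace I'(3)) blast
  define h where "h x = \<kappa> x * f k x" for x
  let ?f = "f(k := h)"
  have sh: "smooth_fn M (udom d0) h"
    unfolding h_def[abs_def] by (intro smooth_fn_mult openin_udom d0 smooth_fn_subset[OF s\<kappa> udom_points] adm_smooth f)
  have f': "adm ?f" by (rule adm_upd[OF f sh]) (use fk in \<open>auto simp: h_def\<close>)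
  have CU: "C \<subseteq> udom d0" using C(2) pre_QQ_udom by blast
  have "(\<integral>x. (if x \<in> udom d0 then weight x * (rho d0 (Y d0 x) * jac d0 ?f x) else 0) \<partial>vol) = 0"
  proof (rule integral_jac_chart[OF d0 adm_smooth[OF f'] C(1) CU])
    fix x assume "x \<in> udom d0 - C"
    then have "x \<in> points M - C" using udom_points by blast
    then show "?f k x = 0" using \<kappa>0 by (simp add: h_def)
  qed
  moreover have "FF f x = (if x \<in> udom d0 then weight x * (rho d0 (Y d0 x) * jac d0 ?f x) else 0)" if x: "x \<in> points M" for x
    using x
  proof (cases rule: K0_cases)
    case 1
    let ?W = "W \<inter> udom d0"
    have xU: "x \<in> pre QQ" "x \<in> udom d0" using 1 KB pre_QQ_udom by blast+
    have W': "openin (mtop M) ?W" "?W \<subseteq> udom d0" "x \<in> ?W" using W openin_udom[OF d0] 1 K0W xU by blast+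
    have "D d0 a (?f r) x = D d0 a (f r) x" for a r
    proof (cases "r = k")
      case True
      have "D d0 a (f k) x = D d0 a h x"
        by (rule D_cong[OF d0 W' smooth_fn_subset[OF adm_smooth[OF f] W'(2)]]) (use \<kappa>1 in \<open>auto simp: h_def\<close>)
      then show ?thesis using True by simp
    qed simp
    then have "jac d0 ?f x = jac d0 f x" by (simp add: jac_def del: fun_upd_apply)
    then show ?thesis using xU by (simp add: FF_def del: fun_upd_apply)
  next
    case 2
    have c: "?f k y = 0" if "y \<in> PV (pre CC)" for y
    proof -
      have "y \<in> points M" "y \<notin> pre QQ" using that PV_CC_QQ by (auto simp: PV_def pre_def)
      then show ?thesis using \<kappa>0[of y] C(2) by (auto simp: h_def)
    qed
    have o: "openin (mtop M) (PV (pre CC))" by (rule PV_openin) (simp add: cover_def)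
    have "jac d0 ?f x = 0" if "x \<in> udom d0" by (rule jac_const_row[where f="?f" and k=k, OF d0 o 2 that c])
    then show ?thesis using PV_CC_QQ[OF 2] by (simp add: FF_def del: fun_upd_apply)
  next
    case (3 r s)
    then show ?thesis using jac_adm_zero[OF f 3] jac_adm_zero[OF f' 3] by (simp add: FF_def del: fun_upd_apply)
  qed
  ultimately show ?thesis by (subst Bochner_Integration.integral_cong[OF refl]) (simp_all del: fun_upd_apply)
qed

lemma g_const: "s \<in> {1, -1} \<Longrightarrow> \<exists>c. \<forall>x\<in>PV (pre (WW r s)). g r x = c"
  and G_const: "s \<in> {1, -1} \<Longrightarrow> \<exists>c. \<forall>x\<in>PV (pre (WW r s)). G r x = c"
  using g_WW G_WW by blast+

lemma smooth_G': "smooth_fn M (udom d0) (G r)" by (rule smooth_fn_subset[OF smooth_G udom_points])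

text \<open>On the slabs of the row \<open>k\<close> the functions \<open>g k\<close> and
  \<open>G k\<close> take the same constant values, so their difference is an admissible row to
  which \<open>integral_FF_zero\<close> applies.\<close>

lemma integral_FF_replace:
  assumes f: "adm f" shows "(\<integral>x. FF (f(k := g k)) x \<partial>vol) = (\<integral>x. FF (f(k := G k)) x \<partial>vol)"
proof -
  let ?h = "\<lambda>x. -1 * g k x + G k x"
  let ?fg = "f(k := g k)" and ?fG = "f(k := G k)" and ?fh = "f(k := ?h)"
  have sh: "smooth_fn M (udom d0) ?h"
    by (intro smooth_fn_add smooth_fn_mult smooth_fn_const smooth_g smooth_G' openin_udom d0)
  have h0: "?h x = 0" if "s \<in> {1, -1}" "x \<in> PV (pre (WW k s))" for s x using g_WW[OF that] G_WW[OF that] by simp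
  have ah: "adm ?fh" by (rule adm_upd[OF f sh]) (use h0 in blast)
  have ag: "adm ?fg" by (rule adm_upd[OF f smooth_g g_const])
  have aG: "adm ?fG" by (rule adm_upd[OF f smooth_G' G_const])
  have 0: "(\<integral>x. FF ?fh x \<partial>vol) = 0" by (rule integral_FF_zero[OF ah, of k]) (use h0 in simp)
  have "FF ?fh x = FF ?fG x - FF ?fg x" for x
  proof (cases "x \<in> pre QQ")
    case True
    then have x: "x \<in> udom d0" using pre_QQ_udom by blast
    have j: "jac d0 ?fh x = -1 * jac d0 ?fg x + jac d0 ?fG x"
      by (rule jac_add_row[OF d0 openin_udom[OF d0] x subset_refl smooth_g smooth_G'])
    show ?thesis unfolding FF_def j using True by (simp add: algebra_simps del: fun_upd_apply)
  qed (simp add: FF_def)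
  then have "(\<integral>x. FF ?fh x \<partial>vol) = (\<integral>x. FF ?fG x \<partial>vol) - (\<integral>x. FF ?fg x \<partial>vol)"
    using Bochner_Integration.integral_diff[OF FF_integrable[OF aG] FF_integrable[OF ag]] by (simp del: fun_upd_apply)
  then show ?thesis using 0 by simp
qed

lemma integral_FF_mixed:
  assumes "finite T" shows "(\<integral>x. FF (\<lambda>r. if r \<in> T then g r else G r) x \<partial>vol) = (\<integral>x. FF G x \<partial>vol)"
  using assms
proof (induction T rule: finite_induct)
  case (insert k T)
  let ?f = "\<lambda>r. if r \<in> T then g r else G r"
  have f: "adm ?f" unfolding adm_def using smooth_g smooth_G' g_const G_const by auto
  have 1: "(\<lambda>r. if r \<in> insert k T then g r else G r) = ?f(k := g k)" by (auto simp: fun_eq_iff)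
  have 2: "?f(k := G k) = ?f" using insert by (auto simp: fun_eq_iff)
  show ?case unfolding 1 integral_FF_replace[OF f] 2 by (rule insert.IH)
qed simp

lemma adm_g: "adm g" unfolding adm_def using smooth_g g_const by auto

lemma adm_G: "adm G" unfolding adm_def using smooth_G' G_const by auto

text \<open>On \<open>K0\<close> both sides come from the Jacobian of \<open>G\<close>; near
  \<open>CC\<close> and on the slabs both are 0.\<close>

lemma weight_Om:
  assumes "x \<in> points M" shows "weight x * Om x = eps d0 x0 * FF G x"
  using assms
proof (cases rule: K0_cases)
  case 1
  note xQ = K0_QQ[OF 1]
  then have "x \<in> pre QQ" by (simp add: PV_def)
  with xQ have x: "x \<in> PV (pre QQ)" "x \<in> pre QQ" "x \<in> udom d0" "x \<in> points M" using pre_QQ_udom udom_points by blast+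
  have "eps d0 x = eps d0 x0"
  proof (rule cube_eps[OF x(3)])
    fix r
    have "\<bar>co r (u x)\<bar> < 2" using x(2) by (auto simp: pre_def QQ_def)
    then show "\<bar>Y d0 x $ r - Y d0 x0 $ r\<bar> \<le> 2 * \<rho>" using \<rho> by (simp add: co_def Y_def abs_divide pos_divide_less_eq)
  qed
  then show ?thesis
    using Om_QQ[OF x(1)] J_chart[where f=G, OF d0 x(3) openin_topspace x(4) smooth_G] x(2) by (simp add: FF_def)
next
  case 2
  then show ?thesis using Om_CC PV_CC_QQ by (simp add: FF_def)
next
  case (3 r s)
  then show ?thesis using Om_WW[OF 3] jac_adm_zero[OF adm_G 3] by (simp add: FF_def)
qed

lemma FF_g: "x \<in> pre QQ \<Longrightarrow> FF g x = weight x * (rho d0 (Y d0 x) * (\<Prod>r\<in>UNIV. S' (co r (u x)) / \<rho>))"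
proof -
  assume x: "x \<in> pre QQ"
  then have xU: "x \<in> udom d0" using pre_QQ_udom by blast
  have "D d0 a (g r) x = (if r = a then S' (co r (u x)) / \<rho> else 0)" for a r
    unfolding g_psi[abs_def] D_compose[OF d0 openin_udom[OF d0] subset_refl xU smooth_psi UNIV_I] partial_psi
    by (simp add: co_def Y_def)
  then have "jac d0 g x = (\<Prod>r\<in>UNIV. S' (co r (u x)) / \<rho>)"
    unfolding jac_def by (subst det_diagonal) auto
  then show ?thesis using x by (simp add: FF_def)
qed

text \<open>Once every row is replaced by \<open>g\<close>, the Jacobian matrix is diagonal. Its
  entries are derivatives of the step functions, nonnegative everywhere and positive at
  \<open>x0\<close>.\<close>

lemma integral_Om_nonzero: "(\<integral>x. weight x * Om x \<partial>vol) \<noteq> 0"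
proof -
  have x0M: "x0 \<in> points M" using x0 udom_points by blast
  have rw: "weight x * rho d0 (Y d0 x) > 0" if "x \<in> pre QQ" for x
  proof -
    have "x \<in> points M" "Y d0 x \<in> snd d0 ` fst d0" using that pre_QQ_udom udom_points Y_image by blast+
    then show ?thesis using weight_pos rho_pos[OF d0] by (intro mult_pos_pos)
  qed
  have co0: "co r (u x0) = 0" for r by (simp add: co_def Y_def)
  have x0Q: "x0 \<in> pre QQ" using x0 by (simp add: pre_def QQ_def co0 udom_def)
  have "(\<integral>x. FF g x \<partial>vol) > 0"
  proof (rule continuous_integral_pos[OF FF_continuous[OF adm_g] _ x0M])
    show "FF g x \<ge> 0" for x
    proof (cases "x \<in> pre QQ")
      case True
      have "(\<Prod>r\<in>UNIV. S' (co r (u x)) / \<rho>) \<ge> 0" using S(3) \<rho> by (intro prod_nonneg) auto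
      then show ?thesis using FF_g[OF True] rw[OF True] by (simp add: mult.assoc[symmetric])
    qed (simp add: FF_def)
    have "(\<Prod>r\<in>(UNIV::'n set). S' (co r (u x0)) / \<rho>) > 0" using S(4) \<rho> by (intro prod_pos) (simp add: co0)
    then show "FF g x0 > 0" using FF_g[OF x0Q] rw[OF x0Q] by (simp add: mult.assoc[symmetric])
  qed
  then have "(\<integral>x. FF G x \<partial>vol) \<noteq> 0" using integral_FF_mixed[of UNIV] by simp
  moreover have "(\<integral>x. weight x * Om x \<partial>vol) = eps d0 x0 * (\<integral>x. FF G x \<partial>vol)"
    by (subst Bochner_Integration.integral_cong[OF refl weight_Om]) simp_all
  moreover have "eps d0 x0 \<noteq> 0" by (simp add: eps_def)
  ultimately show ?thesis by simp
qed

end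

lemma vertex_face: "simplical_face k (\<lambda>j. if j = l then 1 else 0) = (\<lambda>j. if j = skip k l then 1 else (0::real))"
  by (auto simp: simplical_face_def skip_def fun_eq_iff)

section \<open>The contradiction with a trivial cohomology group\<close>

context cube_setup
begin

lemma Psi_cong:
  assumes "\<And>j. j \<le> CARD('n) \<Longrightarrow> q j = q' j" shows "Psi q = Psi q'"
proof -
  have "q (b r) = q' (b r)" "q (b r - 1) = q' (b r - 1)" for r using assms b_bounds[of r] by simp_all
  moreover have "(\<forall>j\<le>CARD('n). q j \<in> QQ) \<longleftrightarrow> (\<forall>j\<le>CARD('n). q' j \<in> QQ)" using assms by simp
  ultimately show ?thesis by (cases "\<forall>j\<le>CARD('n). q' j \<in> QQ") (simp_all only: Psi_def if_True if_False)
qed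

lemma cube_cohomology_nontrivial: "\<not> trivial_group (real_cohomology_group CARD('n) (mtop M))"
proof
  assume triv: "trivial_group (real_cohomology_group CARD('n) (mtop M))"
  obtain p where p: "CARD('n) = Suc p" using zero_less_card_finite not0_implies_Suc by (metis less_numeral_extra(3))
  define vert where "vert l = (\<lambda>j. if j = l then 1 else (0::real))" for l :: nat
  \<comment> \<open>The value depends on the vertices only, so on a straightened simplex it is
    \<open>Psi\<close> of the images of the index points.\<close>
  define \<theta> where "\<theta> \<sigma> = Psi (\<lambda>j. u (\<sigma> (vert j)))" for \<sigma> :: "(nat \<Rightarrow> real) \<Rightarrow> 'a"
  have vert: "vert l \<in> standard_simplex n" if "l \<le> n" for l n using that by (simp add: vert_def)
  have cocycle: "(\<Sum>k\<le>Suc (Suc p). (-1) ^ k * \<theta> (singular_face (Suc (Suc p)) k \<tau>)) = 0"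
    if \<tau>: "small_simplex cover (Suc (Suc p)) (mtop M) \<tau>" for \<tau>
  proof -
    obtain V where V: "V \<in> cover" "singular_simplex (Suc (Suc p)) (subtopology (mtop M) V) \<tau>"
      using \<tau> unfolding small_simplex_def by blast
    have q: "u (\<tau> (vert j)) \<in> u ` V" if "j \<le> Suc CARD('n)" for j
      using V(2) vert[of j "Suc (Suc p)"] that p by (auto simp: singular_simplex_def continuous_map_def Pi_iff)
    have "\<theta> (singular_face (Suc (Suc p)) k \<tau>) = Psi (\<lambda>j. u (\<tau> (vert (skip k j))))" for k
    proof -
      have "singular_face (Suc (Suc p)) k \<tau> (vert j) = \<tau> (vert (skip k j))" if "j \<le> CARD('n)" for j
        using vert[OF that] p by (simp add: singular_face_def vert_def vertex_face)
      then show ?thesis unfolding \<theta>_def by (intro Psi_cong) simp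
    qed
    then show ?thesis using Psi_cocycle[OF V(1), of "\<lambda>j. u (\<tau> (vert j))"] q p by simp
  qed
  obtain \<theta>' where \<theta>': "\<theta>' \<in> cochains (Suc p) (mtop M)" "coboundary (Suc p) (mtop M) \<theta>' = (\<lambda>\<sigma>. 0)"
    "\<And>\<sigma>. small_simplex cover (Suc p) (mtop M) \<sigma> \<Longrightarrow> \<theta>' \<sigma> = \<theta> \<sigma>"
    using small_cocycle_extension[OF cover_openin cover_points cocycle] by blast
  obtain c where c: "\<And>\<sigma>. singular_simplex (Suc p) (mtop M) \<sigma> \<Longrightarrow> \<theta>' \<sigma> = (\<Sum>k\<le>Suc p. (-1) ^ k * c (singular_face (Suc p) k \<sigma>))"
    using trivial_cohomology_primitive[OF triv[unfolded p] \<theta>'(1,2)] by blast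
  obtain I and \<phi> :: "'a \<Rightarrow> 'a \<Rightarrow> real" and K and A :: "nat \<Rightarrow> (nat \<Rightarrow> 'a) \<Rightarrow> (nat \<Rightarrow> real) \<Rightarrow> 'a"
    where st: "finite I" "I \<subseteq> points M"
    "\<And>i. i \<in> I \<Longrightarrow> smooth_fn M (points M) (\<phi> i)" "\<And>i. i \<in> I \<Longrightarrow> closedin (mtop M) (K i)"
    "\<And>i y. i \<in> I \<Longrightarrow> y \<in> points M - K i \<Longrightarrow> \<phi> i y = 0"
    "\<And>y. y \<in> points M \<Longrightarrow> (\<Sum>i\<in>I. \<phi> i y) = 1"
    "\<And>y. y \<in> points M \<Longrightarrow> \<exists>V\<in>cover. insert y {i \<in> I. y \<in> K i} \<subseteq> V"
    and A: "\<And>y n J. y \<in> points M \<Longrightarrow> J ` {..n} \<subseteq> {i \<in> I. y \<in> K i} \<Longrightarrow> small_simplex cover n (mtop M) (A n J)"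
    "\<And>y n J k. y \<in> points M \<Longrightarrow> J ` {..n} \<subseteq> {i \<in> I. y \<in> K i} \<Longrightarrow> k \<le> n \<Longrightarrow> A n J (\<lambda>j. if j = k then 1 else 0) = J k"
    "\<And>y n J k. y \<in> points M \<Longrightarrow> J ` {..Suc n} \<subseteq> {i \<in> I. y \<in> K i} \<Longrightarrow> k \<le> Suc n \<Longrightarrow>
       singular_face (Suc n) k (A (Suc n) J) = A n (\<lambda>l. J (skip k l))"
  proof (rule straightening[OF compact])
    show "openin (mtop M) V" if "V \<in> cover" for V by (rule cover_openin[OF that])
    show "points M \<subseteq> \<Union>cover" by (rule cover_points)
  qed (rule that)
  interpret star_cover M gM N gN u dil F F' P d0 x0 \<rho> S S' b I \<phi> K
    by unfold_locales (fact st)+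
  have "(\<integral>x. weight x * Om x \<partial>vol) = 0"
  \<comment> \<open>Since the faces of straightened simplices are straightened simplices, the
    singular primitive \<open>c\<close> becomes a primitive of \<open>Psi\<close> on tuples of index
    points.\<close>
  proof (rule integral_Om_zero[OF p, where C="\<lambda>T. c (A p T)"])
    fix T x assume T: "T \<in> tuples (Suc p)" and x: "x \<in> points M" and xK: "\<And>j. j \<le> Suc p \<Longrightarrow> x \<in> K (T j)"
    have sub: "T ` {..Suc p} \<subseteq> {i \<in> I. x \<in> K i}" using xK tuplesD[OF T] by auto
    note sm = A(1)[OF x sub]
    have v: "A (Suc p) T (vert j) = T j" if "j \<le> Suc p" for j using A(2)[OF x sub that] by (simp add: vert_def)
    have "Psi (\<lambda>j. u (T j)) = \<theta> (A (Suc p) T)"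
      unfolding \<theta>_def by (rule Psi_cong) (simp add: v p)
    also have "\<dots> = \<theta>' (A (Suc p) T)" using \<theta>'(3)[OF sm] by simp
    also have "\<dots> = (\<Sum>k\<le>Suc p. (-1) ^ k * c (singular_face (Suc p) k (A (Suc p) T)))"
      by (rule c[OF small_simplex_imp_singular[OF sm]])
    also have "\<dots> = (\<Sum>k\<le>Suc p. (-1) ^ k * c (A p (\<lambda>l. T (skip k l))))"
      by (intro sum.cong refl) (simp add: A(3)[OF x sub])
    finally show "Psi (\<lambda>j. u (T j)) = (\<Sum>k\<le>Suc p. (-1) ^ k * c (A p (\<lambda>l. T (skip k l))))" .
  qed
  then show False using integral_Om_nonzero by simp
qed

end

lemma (in oriented_harmonic) cohomology_nontrivial:
  assumes ne: "points M \<noteq> {}"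
  shows "\<not> trivial_group (real_cohomology_group CARD('n) (mtop M))"
proof -
  obtain x0 where x0M: "x0 \<in> points M" using ne by blast
  define d0 where "d0 = chart_at N (u x0)"
  have d0: "d0 \<in> charts N" "u x0 \<in> fst d0" unfolding d0_def using N.chart_at[OF smooth_map_points[OF smooth_u x0M]] by auto
  then have x0: "x0 \<in> udom d0" using x0M by (simp add: udom_def)
  \<comment> \<open>The part of the chart domain with the same orientation as at
    \<open>u x0\<close>; the cube is placed inside it to keep \<open>eps\<close> constant.\<close>
  define Z where "Z = {q \<in> fst d0. q \<in> P d0 \<longleftrightarrow> u x0 \<in> P d0}"
  have "Z = (if u x0 \<in> P d0 then P d0 else fst d0 - P d0)" using P_subset[OF d0(1)] by (auto simp: Z_def)
  then have "openin (mtop N) Z" using P_openin[OF d0(1)] by simp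
  then have "open (snd d0 ` (fst d0 \<inter> Z))" by (rule N.chart_image_openin[OF d0(1)])
  moreover have "Y d0 x0 \<in> snd d0 ` (fst d0 \<inter> Z)" using d0 by (auto simp: Y_def Z_def)
  ultimately obtain e where e: "e > 0" "ball (Y d0 x0) e \<subseteq> snd d0 ` (fst d0 \<inter> Z)" by (meson openE)
  \<comment> \<open>The l1 norm bounds the distance within the cube by \<open>CARD('n)\<close> times
    \<open>2 * \<rho>\<close>, which is \<open>e / 2\<close>.\<close>
  define \<rho> where "\<rho> = e / (4 * real CARD('n))"
  have \<rho>: "\<rho> > 0" using e by (simp add: \<rho>_def)
  have ball: "y \<in> ball (Y d0 x0) e" if "\<And>r. \<bar>y $ r - Y d0 x0 $ r\<bar> \<le> 2 * \<rho>" for y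
  proof -
    have "norm (y - Y d0 x0) \<le> (\<Sum>r\<in>UNIV. \<bar>(y - Y d0 x0) $ r\<bar>)" by (rule norm_le_l1_cart)
    also have "\<dots> \<le> (\<Sum>r\<in>(UNIV::'n set). 2 * \<rho>)" by (rule sum_mono) (use that in simp)
    also have "\<dots> < e" using e by (simp add: \<rho>_def)
    finally show ?thesis by (simp add: dist_norm norm_minus_commute)
  qed
  obtain S S' :: "real \<Rightarrow> real" where S: "smooth_on UNIV S" "\<And>t. (S has_real_derivative S' t) (at t)"
    "\<And>t. S' t \<ge> 0" "S' 0 > 0" "\<And>t. \<bar>t\<bar> \<ge> 1 \<Longrightarrow> S' t = 0"
    "\<And>t. t \<le> -1 \<Longrightarrow> S t = S (-1)" "\<And>t. t \<ge> 1 \<Longrightarrow> S t = S 1" "smooth_on UNIV S'"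
    by (rule smooth_step_exists) (rule that)
  obtain b :: "'n \<Rightarrow> nat" where b: "bij_betw b UNIV {1..CARD('n)}"
    using finite_same_card_bij[of "UNIV::'n set" "{1..CARD('n)}"] by auto
  interpret cube_setup M gM N gN u dil F F' P d0 x0 \<rho> S S' b
  proof
    show "y \<in> snd d0 ` fst d0" if "\<And>r. \<bar>y $ r - Y d0 x0 $ r\<bar> \<le> 2 * \<rho>" for y using ball[OF that] e(2) by blast
    show "eps d0 x = eps d0 x0" if x: "x \<in> udom d0" and y: "\<And>r. \<bar>Y d0 x $ r - Y d0 x0 $ r\<bar> \<le> 2 * \<rho>" for x
    proof -
      have "Y d0 x \<in> snd d0 ` (fst d0 \<inter> Z)" using ball[OF y] e(2) by blast
      then obtain q where q: "q \<in> fst d0" "q \<in> Z" "snd d0 q = snd d0 (u x)" by (auto simp: Y_def)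
      have "u x \<in> fst d0" using x by (simp add: udom_def)
      from inj_onD[OF N.chart_inj[OF d0(1)] q(3,1) this] have "q = u x" .
      then show ?thesis using q(2) by (simp add: Z_def eps_def)
    qed
  qed (fact d0 x0 \<rho> S b)+
  show ?thesis by (rule cube_cohomology_nontrivial)
qed

theorem theorem1:
  fixes M :: "('a, real^'m) mfd" and gM :: "'a \<Rightarrow> real^'m \<Rightarrow> real^'m \<Rightarrow> real"
    and N :: "('b, real^'n) mfd" and gN :: "'b \<Rightarrow> real^'n \<Rightarrow> real^'n \<Rightarrow> real"
    and F F' F'' :: "real \<Rightarrow> real" and u :: "'a \<Rightarrow> 'b" and dil :: "'a \<Rightarrow> real"
  assumes "smooth_manifold M" "compact_space (mtop M)" "points M \<noteq> {}" "riemannian_metric M gM"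
    and "smooth_manifold N" "compact_space (mtop N)" "orientable N" "riemannian_metric N gN"
    and "CARD('m) > CARD('n)"
    and "\<And>t. t \<ge> 0 \<Longrightarrow> F t \<ge> 0" "F 0 = 0" "strict_mono_on {0..} F"
    and "\<And>t. t \<ge> 0 \<Longrightarrow> (F has_real_derivative F' t) (at t within {0..})"
    and "\<And>t. t \<ge> 0 \<Longrightarrow> (F' has_real_derivative F'' t) (at t within {0..})"
    and "continuous_on {0..} F''"
    and "\<And>t. t > 0 \<Longrightarrow> F' t > 0"
    and "F_harmonic F M gM N gN u"
    and "horizontally_conformal_submersion M gM N gN u dil"
    and "vertical_field M N u (gradient M gM (\<lambda>x. (dil x)\<^sup>2))"
    and "discrete {t. t \<ge> 0 \<and> (real CARD('n) - 2) * F' t - 2 * t * F'' t = 0}"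
    and "trivial_group (real_cohomology_group CARD('n) (mtop M))"
  shows "\<not> integrable_distribution TYPE(real^'n) M (horizontal_space M gM N u) \<and>
         \<not> trivial_submersion M gM N u"
proof -
  interpret CS: conformal_submersion M gM N gN u dil
    by unfold_locales (use assms in auto)
  have False if comm: CS.horizontal_commuting
  proof -
    obtain P where P: "\<And>d. d \<in> charts N \<Longrightarrow> openin (mtop N) (P d)" "\<And>d. d \<in> charts N \<Longrightarrow> P d \<subseteq> fst d"
      "\<And>d. d \<in> charts N \<Longrightarrow> openin (mtop N) (fst d - P d)"
      "\<And>d d' x. d \<in> charts N \<Longrightarrow> d' \<in> charts N \<Longrightarrow> x \<in> fst d \<Longrightarrow> x \<in> fst d' \<Longrightarrow> (x \<in> P d \<longleftrightarrow> x \<in> P d') \<longleftrightarrow> tdet d d' x > 0"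
      by (rule CS.N.orientation_sets[OF assms(7)]) (rule that)
    interpret oriented_harmonic M gM N gN u dil F F' P
    proof
      show "continuous_on {0..} F'" by (rule DERIV_continuous_on) (use assms(14) in auto)
    qed (fact assms comm P)+
    show False using cohomology_nontrivial[OF assms(3)] assms(21) by simp
  qed
  then show ?thesis using CS.integrable_commuting CS.trivial_commuting by blast
qed

end
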